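(* Let $K_0$ be an infinite field, $K \supseteq K_0$ a field, $\mathcal{C}$ a $K_0$-linear abelian category, and $F : K\mathrm{Vect}^f \to \mathcal{C}$ a $K_0$-linear functor such that $F(K)$ is non-zero and cube-bounded. Let $d = \operatorname{rk}_0(F(K))$ be the reduced rank of $F(K)$ in $\mathcal{C}$, and let $A \in \operatorname{Sub}_{\mathcal{C}}(F(K))$ be a pedestal. Then the following composition is a $d$-inflator on $K$: $$\operatorname{Dir}_K(K) \to \operatorname{Dir}_{\mathcal{C}}(F(K)) \to \operatorname{Dir}_{\mathcal{C}}(F(K)/A) \to \operatorname{Dir}_{\mathcal{C}}(F(K)/A)^\flat,$$ where the first map is induced by the (automatically exact) functor $F$ (sending a subspace $V \subseteq K^n$ to $F(V) \subseteq F(K)^n$), the second map is pushforward along $F(K) \twoheadrightarrow F(K)/A$ (sending $X \subseteq F(K)^n$ to $(X + A^n)/A^n$), and the last map is the flattening map of directories.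
   Context: Fix an infinite field $K_0$. For an object $A$ of a $K_0$-linear abelian category $\mathcal{C}$, $\operatorname{Sub}_{\mathcal{C}}(A^n)$ is the modular lattice of subobjects of $A^n$. The directory $\operatorname{Dir}_{\mathcal{C}}(A)$ is the multi-sorted structure $(\operatorname{Sub}_{\mathcal{C}}(A^n))_{n\ge1}$ with the lattice structure on each sort, the maps $\oplus: \operatorname{Sub}(A^n)\times\operatorname{Sub}(A^m)\to\operatorname{Sub}(A^{n+m})$, and the action of $GL_n(K_0)$ on $\operatorname{Sub}(A^n)$. A directory is any structure isomorphic to one of this form. If $\mathcal{C}$ is the category of left modules over a $K_0$-algebra $R$, one writes $\operatorname{Sub}_R$, $\operatorname{Dir}_R$. A morphism of directories $f:D_\bullet\to D'_\bullet$ is a family of maps $f_n:D_n\to D'_n$, each order-preserving and $GL_n(K_0)$-equivariant, with $f_{n+m}(x\oplus y)=f_n(x)\oplus f_m(y)$ (the lattice operations need not be preserved). "Semisimple" means semisimple of finite length. A directory $\operatorname{Dir}_{\mathcal{C}}(B)$ is semisimple of length $d$ if $B$ is semisimple of length $d$. For a field $K\supseteq K_0$, a $d$-inflator on $K$ is a morphism of directories $\varsigma:\operatorname{Dir}_K(K)\to D_\bullet$, where $D_\bullet$ is semisimple of length $d$, such that $\ell(\varsigma_n(V))=d\cdot\dim_K(V)$ for all $n$ and all $V\in\operatorname{Sub}_K(K^n)$; here $\ell$ denotes length. $K\mathrm{Vect}^f$ is the category of finite-dimensional $K$-vector spaces. Cubes and ranks. In a modular lattice $M$, a strict $n$-cube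 is an injective map from the power set of $\{1,\dots,n\}$ to $M$ preserving binary joins and meets; its base is the image of $\emptyset$. $\operatorname{rk}_0(M)\in\mathbb{N}\cup\{\infty\}$ (reduced rank) is the supremum of $n$ such that $M$ has a strict $n$-cube; if $M$ has a least element $\bot$, $\operatorname{rk}_\bot(M)$ is the supremum of $n$ such that $M$ has a strict $n$-cube with base $\bot$. For an object $X$ of an abelian category, $\operatorname{rk}_0(X)=\operatorname{rk}_0(\operatorname{Sub}(X))$ and $\operatorname{rk}_\bot(X)=\operatorname{rk}_\bot(\operatorname{Sub}(X))$; $X$ is cube-bounded if $\operatorname{rk}_0(X)<\infty$. With $d=\operatorname{rk}_0(F(K))$, a pedestal is a $\mathcal{C}$-subobject $A\subseteq F(K)$ with $\operatorname{rk}_\bot(F(K)/A)=d$. Flattening. Let $M$ be a bounded modular lattice with $\operatorname{rk}_\bot(M)<\infty$. A quasi-atom is an element $q>\bot$ such that $(\bot,q]$ is closed under $\wedge$. There is a modular pregeometry on the set of quasi-atoms in which a finite set $\{q_1,\dots,q_n\}$ (distinct) is independent iff $(q_1\vee\dots\vee q_{i-1})\wedge q_i=\bot$ for $2\le i\le n$. $M^\flat$ is the lattice of closed sets of this pregeometry, and $V:M\to M^\flat$ sends $x$ to the closed set $V(x)=\{q \text{ quasi-atom}: q\wedge x>\bot\}$. A map $f:M\to P$ to a poset is a flattening map if $f=g\circ V$ for some poset isomorphism $g:M^\flat\to P$. For a directory $D_\bullet$ with $D_1$ cube-bounded (equivalently all $D_n$ cube-bounded), there is a directory $D^\flat_\bullet$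 with a directory morphism $D_\bullet\to D_\bullet^\flat$ such that each $D_n\to D_n^\flat$ is a flattening map; it is unique up to isomorphism, and is called the flattening map of $D_\bullet$. *)

theory Defs
  imports
    "HOL-Algebra.Lattice"
    "HOL-Library.Extended_Nat"
    "HOL-Library.FuncSet"
    "Jordan_Normal_Form.VS_Connect"
begin

section \<open>Posets, lengths and cube ranks\<close>

definition poset_iso :: "'a gorder \<Rightarrow> 'b gorder \<Rightarrow> ('a \<Rightarrow> 'b) \<Rightarrow> bool" where
  "poset_iso L M f \<longleftrightarrow> bij_betw f (carrier L) (carrier M) \<and> order_emb L M f"

definition poset_length :: "'a gorder \<Rightarrow> enat" where
  "poset_length L = Sup {enat k | k. \<exists>c :: nat \<Rightarrow> 'a.
     (\<forall>i\<le>k. c i \<in> carrier L) \<and> (\<forall>i<k. c i \<sqsubset>\<^bsub>L\<^esub> c (Suc i))}"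

text \<open>The length of an element of a lattice with least element is the length of the interval
  below it; in the lattice of subobjects this is the length of the subobject.\<close>

definition elt_length :: "'a gorder \<Rightarrow> 'a \<Rightarrow> enat" where
  "elt_length L x = poset_length (L\<lparr>carrier := {y \<in> carrier L. y \<sqsubseteq>\<^bsub>L\<^esub> x}\<rparr>)"

definition strict_cube :: "'a gorder \<Rightarrow> nat \<Rightarrow> (nat set \<Rightarrow> 'a) \<Rightarrow> bool" where
  "strict_cube L n f \<longleftrightarrow>
     f \<in> Pow {1..n} \<rightarrow> carrier L \<and> inj_on f (Pow {1..n}) \<and>
     (\<forall>S\<in>Pow {1..n}. \<forall>T\<in>Pow {1..n}.
        f (S \<union> T) = f S \<squnion>\<^bsub>L\<^esub> f T \<and> f (S \<inter> T) = f S \<sqinter>\<^bsub>L\<^esub> f T)"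

definition rk0 :: "'a gorder \<Rightarrow> enat" where
  "rk0 L = Sup {enat n | n. \<exists>f. strict_cube L n f}"

definition rk_bot :: "'a gorder \<Rightarrow> enat" where
  "rk_bot L = Sup {enat n | n. \<exists>f. strict_cube L n f \<and> f {} = \<bottom>\<^bsub>L\<^esub>}"


section \<open>Flattening of lattices\<close>

definition quasi_atoms :: "'a gorder \<Rightarrow> 'a set" where
  "quasi_atoms L = {q \<in> carrier L. q \<noteq> \<bottom>\<^bsub>L\<^esub> \<and>
     (\<forall>x\<in>carrier L. \<forall>y\<in>carrier L.
        x \<noteq> \<bottom>\<^bsub>L\<^esub> \<and> x \<sqsubseteq>\<^bsub>L\<^esub> q \<and> y \<noteq> \<bottom>\<^bsub>L\<^esub> \<and> y \<sqsubseteq>\<^bsub>L\<^esub> q \<longrightarrow> x \<sqinter>\<^bsub>L\<^esub> y \<noteq> \<bottom>\<^bsub>L\<^esub>)}"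

text \<open>In a modular lattice the condition on the list does not depend on the enumeration.\<close>

definition qa_indep :: "'a gorder \<Rightarrow> 'a set \<Rightarrow> bool" where
  "qa_indep L T \<longleftrightarrow> (\<exists>qs. distinct qs \<and> set qs = T \<and> T \<subseteq> quasi_atoms L \<and>
     (\<forall>i. 0 < i \<and> i < length qs \<longrightarrow> (\<Squnion>\<^bsub>L\<^esub> (set (take i qs))) \<sqinter>\<^bsub>L\<^esub> (qs ! i) = \<bottom>\<^bsub>L\<^esub>))"

text \<open>The closure operator of the pregeometry on the quasi-atoms whose finite independent sets
  are those given by \<open>qa_indep\<close>.\<close>

definition qa_closure :: "'a gorder \<Rightarrow> 'a set \<Rightarrow> 'a set" where
  "qa_closure L S = {q \<in> quasi_atoms L. \<exists>T. finite T \<and> T \<subseteq> S \<and> qa_indep L T \<and>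
     (q \<in> T \<or> \<not> qa_indep L (insert q T))}"

definition flat_lattice :: "'a gorder \<Rightarrow> 'a set gorder" where
  "flat_lattice L = \<lparr> carrier = {S. S \<subseteq> quasi_atoms L \<and> qa_closure L S = S},
     eq = (=), le = (\<subseteq>) \<rparr>"

definition flat_V :: "'a gorder \<Rightarrow> 'a \<Rightarrow> 'a set" where
  "flat_V L x = {q \<in> quasi_atoms L. q \<sqinter>\<^bsub>L\<^esub> x \<noteq> \<bottom>\<^bsub>L\<^esub>}"

definition flattening_map :: "'a gorder \<Rightarrow> 'b gorder \<Rightarrow> ('a \<Rightarrow> 'b) \<Rightarrow> bool" where
  "flattening_map L P f \<longleftrightarrow>
     (\<exists>g. poset_iso (flat_lattice L) P g \<and> (\<forall>x\<in>carrier L. f x = g (flat_V L x)))"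


section \<open>Linear and abelian categories\<close>

text \<open>\<open>Cmp C g f\<close> is the composite of \<open>f\<close> followed by \<open>g\<close>. \<open>Zer\<close>, \<open>Add\<close> and \<open>Scl\<close> are the
  vector space operations on the sets of morphisms.\<close>

record ('o, 'm, 'k) lincat =
  Obj :: "'o set"
  Arr :: "'m set"
  Dom :: "'m \<Rightarrow> 'o"
  Cod :: "'m \<Rightarrow> 'o"
  Ide :: "'o \<Rightarrow> 'm"
  Cmp :: "'m \<Rightarrow> 'm \<Rightarrow> 'm"
  Zer :: "'o \<Rightarrow> 'o \<Rightarrow> 'm"
  Add :: "'m \<Rightarrow> 'm \<Rightarrow> 'm"
  Scl :: "'k \<Rightarrow> 'm \<Rightarrow> 'm"

definition Hom :: "('o, 'm, 'k) lincat \<Rightarrow> 'o \<Rightarrow> 'o \<Rightarrow> 'm set" where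
  "Hom C X Y = {f \<in> Arr C. Dom C f = X \<and> Cod C f = Y}"

definition hom_space :: "('o, 'm, 'k) lincat \<Rightarrow> 'o \<Rightarrow> 'o \<Rightarrow> ('k, 'm) module" where
  "hom_space C X Y = \<lparr> carrier = Hom C X Y, mult = undefined, one = undefined,
     zero = Zer C X Y, add = Add C, smult = Scl C \<rparr>"

locale linear_category =
  fixes C :: "('o, 'm, 'k::field) lincat"
  assumes Dom_Obj: "f \<in> Arr C \<Longrightarrow> Dom C f \<in> Obj C"
    and Cod_Obj: "f \<in> Arr C \<Longrightarrow> Cod C f \<in> Obj C"
    and Ide_Hom: "X \<in> Obj C \<Longrightarrow> Ide C X \<in> Hom C X X"
    and Cmp_Hom: "f \<in> Hom C X Y \<Longrightarrow> g \<in> Hom C Y Z \<Longrightarrow> Cmp C g f \<in> Hom C X Z"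
    and Cmp_Ide_left: "f \<in> Hom C X Y \<Longrightarrow> Cmp C (Ide C Y) f = f"
    and Cmp_Ide_right: "f \<in> Hom C X Y \<Longrightarrow> Cmp C f (Ide C X) = f"
    and Cmp_assoc: "f \<in> Hom C W X \<Longrightarrow> g \<in> Hom C X Y \<Longrightarrow> h \<in> Hom C Y Z \<Longrightarrow>
      Cmp C h (Cmp C g f) = Cmp C (Cmp C h g) f"
    and hom_vectorspace: "X \<in> Obj C \<Longrightarrow> Y \<in> Obj C \<Longrightarrow> vectorspace class_ring (hom_space C X Y)"
    and Cmp_Add_left: "f \<in> Hom C X Y \<Longrightarrow> g \<in> Hom C Y Z \<Longrightarrow> g' \<in> Hom C Y Z \<Longrightarrow>
      Cmp C (Add C g g') f = Add C (Cmp C g f) (Cmp C g' f)"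
    and Cmp_Add_right: "f \<in> Hom C X Y \<Longrightarrow> f' \<in> Hom C X Y \<Longrightarrow> g \<in> Hom C Y Z \<Longrightarrow>
      Cmp C g (Add C f f') = Add C (Cmp C g f) (Cmp C g f')"
    and Cmp_Scl_left: "f \<in> Hom C X Y \<Longrightarrow> g \<in> Hom C Y Z \<Longrightarrow>
      Cmp C (Scl C c g) f = Scl C c (Cmp C g f)"
    and Cmp_Scl_right: "f \<in> Hom C X Y \<Longrightarrow> g \<in> Hom C Y Z \<Longrightarrow>
      Cmp C g (Scl C c f) = Scl C c (Cmp C g f)"

definition mono_arr :: "('o, 'm, 'k) lincat \<Rightarrow> 'm \<Rightarrow> bool" where
  "mono_arr C m \<longleftrightarrow> m \<in> Arr C \<and>
     (\<forall>X. \<forall>f\<in>Hom C X (Dom C m). \<forall>g\<in>Hom C X (Dom C m). Cmp C m f = Cmp C m g \<longrightarrow> f = g)"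

definition epi_arr :: "('o, 'm, 'k) lincat \<Rightarrow> 'm \<Rightarrow> bool" where
  "epi_arr C e \<longleftrightarrow> e \<in> Arr C \<and>
     (\<forall>X. \<forall>f\<in>Hom C (Cod C e) X. \<forall>g\<in>Hom C (Cod C e) X. Cmp C f e = Cmp C g e \<longrightarrow> f = g)"

definition iso_arr :: "('o, 'm, 'k) lincat \<Rightarrow> 'm \<Rightarrow> bool" where
  "iso_arr C u \<longleftrightarrow> u \<in> Arr C \<and> (\<exists>v\<in>Hom C (Cod C u) (Dom C u).
     Cmp C v u = Ide C (Dom C u) \<and> Cmp C u v = Ide C (Cod C u))"

definition zero_obj :: "('o, 'm, 'k) lincat \<Rightarrow> 'o \<Rightarrow> bool" where
  "zero_obj C Z \<longleftrightarrow> Z \<in> Obj C \<and>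
     (\<forall>X\<in>Obj C. (\<exists>!f. f \<in> Hom C Z X) \<and> (\<exists>!f. f \<in> Hom C X Z))"

definition is_kernel :: "('o, 'm, 'k) lincat \<Rightarrow> 'm \<Rightarrow> 'm \<Rightarrow> bool" where
  "is_kernel C k f \<longleftrightarrow> f \<in> Arr C \<and> k \<in> Arr C \<and> Cod C k = Dom C f \<and>
     Cmp C f k = Zer C (Dom C k) (Cod C f) \<and>
     (\<forall>X. \<forall>h\<in>Hom C X (Dom C f). Cmp C f h = Zer C X (Cod C f) \<longrightarrow>
        (\<exists>!u. u \<in> Hom C X (Dom C k) \<and> Cmp C k u = h))"

definition is_cokernel :: "('o, 'm, 'k) lincat \<Rightarrow> 'm \<Rightarrow> 'm \<Rightarrow> bool" where
  "is_cokernel C q f \<longleftrightarrow> f \<in> Arr C \<and> q \<in> Arr C \<and> Dom C q = Cod C f \<and>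
     Cmp C q f = Zer C (Dom C f) (Cod C q) \<and>
     (\<forall>X. \<forall>h\<in>Hom C (Cod C f) X. Cmp C h f = Zer C (Dom C f) X \<longrightarrow>
        (\<exists>!u. u \<in> Hom C (Cod C q) X \<and> Cmp C u q = h))"

text \<open>\<open>P\<close> is the direct sum of the objects \<open>S 0, \<dots>, S (n - 1)\<close>, with injections \<open>j i\<close> and
  projections \<open>p i\<close>.\<close>

definition is_biproduct ::
  "('o, 'm, 'k) lincat \<Rightarrow> nat \<Rightarrow> (nat \<Rightarrow> 'o) \<Rightarrow> 'o \<Rightarrow> (nat \<Rightarrow> 'm) \<Rightarrow> (nat \<Rightarrow> 'm) \<Rightarrow> bool" where
  "is_biproduct C n S P j p \<longleftrightarrow> P \<in> Obj C \<and>
     (\<forall>i<n. S i \<in> Obj C \<and> j i \<in> Hom C (S i) P \<and> p i \<in> Hom C P (S i)) \<and>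
     (\<forall>i<n. \<forall>l<n. Cmp C (p i) (j l) = (if i = l then Ide C (S i) else Zer C (S l) (S i))) \<and>
     finsum (hom_space C P P) (\<lambda>i. Cmp C (j i) (p i)) {..<n} = Ide C P"

locale abelian_category = linear_category C for C :: "('o, 'm, 'k::field) lincat" +
  assumes has_zero: "\<exists>Z. zero_obj C Z"
    and has_biproducts: "X \<in> Obj C \<Longrightarrow> Y \<in> Obj C \<Longrightarrow>
      \<exists>P j p. is_biproduct C 2 (\<lambda>i. if i = 0 then X else Y) P j p"
    and has_kernels: "f \<in> Arr C \<Longrightarrow> \<exists>k. is_kernel C k f"
    and has_cokernels: "f \<in> Arr C \<Longrightarrow> \<exists>q. is_cokernel C q f"
    and mono_normal: "mono_arr C m \<Longrightarrow> \<exists>f. is_kernel C m f"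
    and epi_normal: "epi_arr C e \<Longrightarrow> \<exists>f. is_cokernel C e f"

text \<open>A functor consists of an object map \<open>FO\<close> and a morphism map \<open>FA\<close>.\<close>

locale linear_functor =
  fixes S :: "('o, 'm, 'k) lincat" and T :: "('p, 'q, 'k) lincat"
    and FO :: "'o \<Rightarrow> 'p" and FA :: "'m \<Rightarrow> 'q"
  assumes FO_Obj: "X \<in> Obj S \<Longrightarrow> FO X \<in> Obj T"
    and FA_Hom: "f \<in> Hom S X Y \<Longrightarrow> FA f \<in> Hom T (FO X) (FO Y)"
    and FA_Ide: "X \<in> Obj S \<Longrightarrow> FA (Ide S X) = Ide T (FO X)"
    and FA_Cmp: "f \<in> Hom S X Y \<Longrightarrow> g \<in> Hom S Y Z \<Longrightarrow> FA (Cmp S g f) = Cmp T (FA g) (FA f)"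
    and FA_Add: "f \<in> Hom S X Y \<Longrightarrow> g \<in> Hom S X Y \<Longrightarrow> FA (Add S f g) = Add T (FA f) (FA g)"
    and FA_Scl: "f \<in> Hom S X Y \<Longrightarrow> FA (Scl S c f) = Scl T c (FA f)"


section \<open>Subobjects and quotients\<close>

definition factors_through :: "('o, 'm, 'k) lincat \<Rightarrow> 'm \<Rightarrow> 'm \<Rightarrow> bool" where
  "factors_through C f m \<longleftrightarrow> (\<exists>u\<in>Hom C (Dom C f) (Dom C m). Cmp C m u = f)"

text \<open>A subobject of \<open>X\<close> is an equivalence class of monomorphisms into \<open>X\<close>.\<close>

definition sub_class :: "('o, 'm, 'k) lincat \<Rightarrow> 'm \<Rightarrow> 'm set" where
  "sub_class C m = {m'. mono_arr C m' \<and> Cod C m' = Cod C m \<and>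
     factors_through C m m' \<and> factors_through C m' m}"

definition Sub :: "('o, 'm, 'k) lincat \<Rightarrow> 'o \<Rightarrow> 'm set gorder" where
  "Sub C X = \<lparr> carrier = {sub_class C m | m. mono_arr C m \<and> Cod C m = X}, eq = (=),
     le = (\<lambda>S T. \<exists>s\<in>S. \<exists>t\<in>T. factors_through C s t) \<rparr>"

definition quot_map :: "('o, 'm, 'k) lincat \<Rightarrow> 'm set \<Rightarrow> 'm" where
  "quot_map C A = (SOME q. \<exists>a\<in>A. is_cokernel C q a)"

definition quot_obj :: "('o, 'm, 'k) lincat \<Rightarrow> 'm set \<Rightarrow> 'o" where
  "quot_obj C A = Cod C (quot_map C A)"

text \<open>The image of a morphism is the least subobject of its codomain through which it factors.\<close>

definition image_sub :: "('o, 'm, 'k) lincat \<Rightarrow> 'm \<Rightarrow> 'm set" where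
  "image_sub C f = {m. mono_arr C m \<and> Cod C m = Cod C f \<and> factors_through C f m \<and>
     (\<forall>m'. mono_arr C m' \<and> Cod C m' = Cod C f \<and> factors_through C f m' \<longrightarrow>
        factors_through C m m')}"

definition simple_obj :: "('o, 'm, 'k) lincat \<Rightarrow> 'o \<Rightarrow> bool" where
  "simple_obj C S \<longleftrightarrow> S \<in> Obj C \<and> \<not> zero_obj C S \<and>
     (\<forall>m. mono_arr C m \<and> Cod C m = S \<longrightarrow> zero_obj C (Dom C m) \<or> iso_arr C m)"

definition semisimple_obj :: "('o, 'm, 'k) lincat \<Rightarrow> 'o \<Rightarrow> bool" where
  "semisimple_obj C B \<longleftrightarrow>
     (\<exists>n S j p. (\<forall>i<n. simple_obj C (S i)) \<and> is_biproduct C n S B j p)"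

definition obj_length :: "('o, 'm, 'k) lincat \<Rightarrow> 'o \<Rightarrow> enat" where
  "obj_length C B = poset_length (Sub C B)"

definition cube_bounded :: "('o, 'm, 'k) lincat \<Rightarrow> 'o \<Rightarrow> bool" where
  "cube_bounded C X \<longleftrightarrow> rk0 (Sub C X) < \<infinity>"

definition pedestal :: "('o, 'm, 'k) lincat \<Rightarrow> 'o \<Rightarrow> 'm set \<Rightarrow> bool" where
  "pedestal C X A \<longleftrightarrow> A \<in> carrier (Sub C X) \<and> rk_bot (Sub C (quot_obj C A)) = rk0 (Sub C X)"


section \<open>Finite powers of an object\<close>

definition pow_diagram ::
  "('o, 'm, 'k) lincat \<Rightarrow> 'o \<Rightarrow> nat \<Rightarrow> 'o \<times> (nat \<Rightarrow> 'm) \<times> (nat \<Rightarrow> 'm)" where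
  "pow_diagram C X n =
     (SOME t. is_biproduct C n (\<lambda>_. X) (fst t) (fst (snd t)) (snd (snd t)))"

definition pow_obj :: "('o, 'm, 'k) lincat \<Rightarrow> 'o \<Rightarrow> nat \<Rightarrow> 'o" where
  "pow_obj C X n = fst (pow_diagram C X n)"

definition pow_inj :: "('o, 'm, 'k) lincat \<Rightarrow> 'o \<Rightarrow> nat \<Rightarrow> nat \<Rightarrow> 'm" where
  "pow_inj C X n = fst (snd (pow_diagram C X n))"

definition pow_proj :: "('o, 'm, 'k) lincat \<Rightarrow> 'o \<Rightarrow> nat \<Rightarrow> nat \<Rightarrow> 'm" where
  "pow_proj C X n = snd (snd (pow_diagram C X n))"

text \<open>The morphism \<open>f\<^sup>n : X\<^sup>n \<rightarrow> Y\<^sup>n\<close> induced by \<open>f : X \<rightarrow> Y\<close>.\<close>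

definition pow_arr :: "('o, 'm, 'k) lincat \<Rightarrow> 'm \<Rightarrow> nat \<Rightarrow> 'm" where
  "pow_arr C f n =
     finsum (hom_space C (pow_obj C (Dom C f) n) (pow_obj C (Cod C f) n))
       (\<lambda>i. Cmp C (pow_inj C (Cod C f) n i) (Cmp C f (pow_proj C (Dom C f) n i))) {..<n}"

text \<open>The embedding \<open>X\<^sup>n \<rightarrow> X\<^sup>N\<close> onto the coordinates \<open>s, \<dots>, s + n - 1\<close>.\<close>

definition pow_shift :: "('o, 'm, 'k) lincat \<Rightarrow> 'o \<Rightarrow> nat \<Rightarrow> nat \<Rightarrow> nat \<Rightarrow> 'm" where
  "pow_shift C X n N s =
     finsum (hom_space C (pow_obj C X n) (pow_obj C X N))
       (\<lambda>i. Cmp C (pow_inj C X N (s + i)) (pow_proj C X n i)) {..<n}"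

definition pow_mat :: "('o, 'm, 'k) lincat \<Rightarrow> 'o \<Rightarrow> nat \<Rightarrow> 'k mat \<Rightarrow> 'm" where
  "pow_mat C X n g =
     finsum (hom_space C (pow_obj C X n) (pow_obj C X n))
       (\<lambda>(i, l). Scl C (g $$ (i, l)) (Cmp C (pow_inj C X n i) (pow_proj C X n l)))
       ({..<n} \<times> {..<n})"


section \<open>Directories\<close>

text \<open>Only the sorts \<open>Srt D n\<close> with \<open>n \<ge> 1\<close> belong to the structure. The lattice operations of a
  sort are determined by its order.\<close>

record ('s, 'k) dir =
  Srt :: "nat \<Rightarrow> 's gorder"
  Dsum :: "nat \<Rightarrow> nat \<Rightarrow> 's \<Rightarrow> 's \<Rightarrow> 's"
  Act :: "nat \<Rightarrow> 'k mat \<Rightarrow> 's \<Rightarrow> 's"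

definition GL :: "nat \<Rightarrow> 'k::field mat set" where
  "GL n = {g \<in> carrier_mat n n. invertible_mat g}"

text \<open>For subobjects \<open>x : U \<rightarrow> X\<^sup>n\<close> and \<open>y : W \<rightarrow> X\<^sup>m\<close>, their sum is represented by
  \<open>x \<oplus> y : U \<oplus> W \<rightarrow> X\<^sup>n\<^sup>+\<^sup>m\<close>, for any choice of the direct sum \<open>U \<oplus> W\<close>.\<close>

definition sub_dsum ::
  "('o, 'm, 'k) lincat \<Rightarrow> 'o \<Rightarrow> nat \<Rightarrow> nat \<Rightarrow> 'm set \<Rightarrow> 'm set \<Rightarrow> 'm set" where
  "sub_dsum C X n m U W = {z. mono_arr C z \<and> (\<exists>x\<in>U. \<exists>y\<in>W. \<exists>j p.
     is_biproduct C 2 (\<lambda>i. if i = 0 then Dom C x else Dom C y) (Dom C z) j p \<and>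
     z = Add C (Cmp C (pow_shift C X n (n + m) 0) (Cmp C x (p 0)))
               (Cmp C (pow_shift C X m (n + m) n) (Cmp C y (p 1))))}"

definition Dir :: "('o, 'm, 'k) lincat \<Rightarrow> 'o \<Rightarrow> ('m set, 'k) dir" where
  "Dir C X = \<lparr> Srt = (\<lambda>n. Sub C (pow_obj C X n)), Dsum = sub_dsum C X,
     Act = (\<lambda>n g U. (\<lambda>x. Cmp C (pow_mat C X n g) x) ` U) \<rparr>"

definition dir_morphism ::
  "('s, 'k::field) dir \<Rightarrow> ('t, 'k) dir \<Rightarrow> (nat \<Rightarrow> 's \<Rightarrow> 't) \<Rightarrow> bool" where
  "dir_morphism D E f \<longleftrightarrow>
     (\<forall>n\<ge>1. f n \<in> carrier (Srt D n) \<rightarrow> carrier (Srt E n) \<and> isotone (Srt D n) (Srt E n) (f n)) \<and>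
     (\<forall>n\<ge>1. \<forall>g\<in>GL n. \<forall>x\<in>carrier (Srt D n). f n (Act D n g x) = Act E n g (f n x)) \<and>
     (\<forall>n\<ge>1. \<forall>m\<ge>1. \<forall>x\<in>carrier (Srt D n). \<forall>y\<in>carrier (Srt D m).
        f (n + m) (Dsum D n m x y) = Dsum E n m (f n x) (f m y))"

definition dir_iso ::
  "('s, 'k::field) dir \<Rightarrow> ('t, 'k) dir \<Rightarrow> (nat \<Rightarrow> 's \<Rightarrow> 't) \<Rightarrow> bool" where
  "dir_iso D E f \<longleftrightarrow> dir_morphism D E f \<and> (\<forall>n\<ge>1. poset_iso (Srt D n) (Srt E n) (f n))"

text \<open>The type argument names the types of objects and morphisms of the category in which the
  directory is realised, since types cannot be quantified existentially.\<close>

definition directory :: "('o \<times> 'm) itself \<Rightarrow> ('s, 'k::field) dir \<Rightarrow> bool" where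
  "directory _ D \<longleftrightarrow> (\<exists>(C :: ('o, 'm, 'k) lincat) B f.
     abelian_category C \<and> B \<in> Obj C \<and> dir_iso D (Dir C B) f)"

definition semisimple_directory ::
  "('o \<times> 'm) itself \<Rightarrow> nat \<Rightarrow> ('s, 'k::field) dir \<Rightarrow> bool" where
  "semisimple_directory _ d D \<longleftrightarrow> (\<exists>(C :: ('o, 'm, 'k) lincat) B f.
     abelian_category C \<and> B \<in> Obj C \<and> semisimple_obj C B \<and> obj_length C B = enat d \<and>
     dir_iso D (Dir C B) f)"

definition dir_flattening ::
  "('s, 'k::field) dir \<Rightarrow> ('t, 'k) dir \<Rightarrow> (nat \<Rightarrow> 's \<Rightarrow> 't) \<Rightarrow> bool" where
  "dir_flattening D E f \<longleftrightarrow>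
     dir_morphism D E f \<and> (\<forall>n\<ge>1. flattening_map (Srt D n) (Srt E n) (f n))"

definition dir_comp ::
  "(nat \<Rightarrow> 't \<Rightarrow> 'u) \<Rightarrow> (nat \<Rightarrow> 's \<Rightarrow> 't) \<Rightarrow> nat \<Rightarrow> 's \<Rightarrow> 'u" where
  "dir_comp g f = (\<lambda>n. g n \<circ> f n)"

definition pushforward :: "('o, 'm, 'k) lincat \<Rightarrow> 'm \<Rightarrow> nat \<Rightarrow> 'm set \<Rightarrow> 'm set" where
  "pushforward C f n U = \<Union> ((\<lambda>x. image_sub C (Cmp C (pow_arr C f n) x)) ` U)"


section \<open>Finite-dimensional vector spaces\<close>

text \<open>The extension of the base field is given by an embedding \<open>\<iota>\<close> of \<open>'k\<close> into \<open>'K\<close>. The objects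
  are all finite-dimensional vector spaces over \<open>'K\<close> with underlying set contained in the
  type \<open>'K vec\<close>; up to isomorphism these are all finite-dimensional vector spaces.\<close>

type_synonym 'K vspace = "('K, 'K vec) module"
type_synonym 'K vmap = "'K vspace \<times> 'K vspace \<times> ('K vec \<Rightarrow> 'K vec)"

definition KVectf :: "('k::field \<Rightarrow> 'K::field) \<Rightarrow> ('K vspace, 'K vmap, 'k) lincat" where
  "KVectf \<iota> = \<lparr>
     Obj = {V. vectorspace class_ring V \<and> vectorspace.fin_dim class_ring V},
     Arr = {(V, W, f). vectorspace class_ring V \<and> vectorspace.fin_dim class_ring V \<and>
                       vectorspace class_ring W \<and> vectorspace.fin_dim class_ring W \<and>
                       f \<in> module_hom class_ring V W \<and> f \<in> extensional (carrier V)},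
     Dom = (\<lambda>(V, W, f). V),
     Cod = (\<lambda>(V, W, f). W),
     Ide = (\<lambda>V. (V, V, \<lambda>v\<in>carrier V. v)),
     Cmp = (\<lambda>(W', Z, g) (V, W, f). (V, Z, compose (carrier V) g f)),
     Zer = (\<lambda>V W. (V, W, \<lambda>v\<in>carrier V. \<zero>\<^bsub>W\<^esub>)),
     Add = (\<lambda>(V, W, f) (V', W', g). (V, W, \<lambda>v\<in>carrier V. f v \<oplus>\<^bsub>W\<^esub> g v)),
     Scl = (\<lambda>c (V, W, f). (V, W, \<lambda>v\<in>carrier V. \<iota> c \<odot>\<^bsub>W\<^esub> f v)) \<rparr>"

abbreviation Kn :: "nat \<Rightarrow> 'K::field vspace" where
  "Kn n \<equiv> module_vec TYPE('K) n"

text \<open>The space \<open>V \<subseteq> K\<^sup>n\<close> with the induced operations, and its inclusion.\<close>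

definition Ksub :: "nat \<Rightarrow> 'K::field vec set \<Rightarrow> 'K vspace" where
  "Ksub n V = Kn n\<lparr>carrier := V\<rparr>"

definition Kincl :: "nat \<Rightarrow> 'K::field vec set \<Rightarrow> 'K vmap" where
  "Kincl n V = (Ksub n V, Kn n, \<lambda>v\<in>V. v)"

definition Kproj :: "nat \<Rightarrow> nat \<Rightarrow> 'K::field vmap" where
  "Kproj n i = (Kn n, Kn 1, \<lambda>v\<in>carrier_vec n. vec 1 (\<lambda>_. v $ i))"

text \<open>The directory \<open>Dir\<^sub>K(K)\<close>, in which \<open>Sub\<^sub>K(K\<^sup>n)\<close> is the lattice of linear subspaces of \<open>K\<^sup>n\<close>.\<close>

definition DirK :: "('k::field \<Rightarrow> 'K::field) \<Rightarrow> ('K vec set, 'k) dir" where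
  "DirK \<iota> = \<lparr>
     Srt = (\<lambda>n. \<lparr> carrier = {V. subspace class_ring V (Kn n)}, eq = (=), le = (\<subseteq>) \<rparr>),
     Dsum = (\<lambda>n m V W. {v @\<^sub>v w | v w. v \<in> V \<and> w \<in> W}),
     Act = (\<lambda>n g V. (\<lambda>v. map_mat \<iota> g *\<^sub>v v) ` V) \<rparr>"

text \<open>The map induced by a functor \<open>F\<close>: the composite of \<open>F(V) \<rightarrow> F(K\<^sup>n)\<close> with the canonical
  isomorphism \<open>F(K\<^sup>n) \<rightarrow> F(K)\<^sup>n\<close>, whose \<open>i\<close>-th coordinate is \<open>F\<close> applied to the \<open>i\<close>-th
  coordinate projection.\<close>

definition functor_pow_iso :: "('o, 'm, 'k) lincat \<Rightarrow> ('K::field vspace \<Rightarrow> 'o) \<Rightarrow>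
    ('K vmap \<Rightarrow> 'm) \<Rightarrow> nat \<Rightarrow> 'm" where
  "functor_pow_iso C FO FA n =
     finsum (hom_space C (FO (Kn n)) (pow_obj C (FO (Kn 1)) n))
       (\<lambda>i. Cmp C (pow_inj C (FO (Kn 1)) n i) (FA (Kproj n i))) {..<n}"

definition functor_dir_map :: "('o, 'm, 'k) lincat \<Rightarrow> ('K::field vspace \<Rightarrow> 'o) \<Rightarrow>
    ('K vmap \<Rightarrow> 'm) \<Rightarrow> nat \<Rightarrow> 'K vec set \<Rightarrow> 'm set" where
  "functor_dir_map C FO FA n V =
     sub_class C (Cmp C (functor_pow_iso C FO FA n) (FA (Kincl n V)))"


section \<open>Inflators\<close>

text \<open>The type argument has the same role as in \<open>semisimple_directory\<close>.\<close>

definition inflator :: "('o \<times> 'm) itself \<Rightarrow> ('k::field \<Rightarrow> 'K::field) \<Rightarrow> nat \<Rightarrow> ('s, 'k) dir \<Rightarrow>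
    (nat \<Rightarrow> 'K vec set \<Rightarrow> 's) \<Rightarrow> bool" where
  "inflator ty \<iota> d D \<sigma> \<longleftrightarrow>
     semisimple_directory ty d D \<and> dir_morphism (DirK \<iota>) D \<sigma> \<and>
     (\<forall>n\<ge>1. \<forall>V\<in>carrier (Srt (DirK \<iota>) n).
        elt_length (Srt D n) (\<sigma> n V) = enat (d * vectorspace.dim class_ring (Ksub n V)))"

end

theory Submission
  imports Defs
begin

text \<open>The functor \<open>F\<close> is additive. Hence for \<open>V \<subseteq> K\<^sup>n\<close> of dimension \<open>k\<close>, with a complement \<open>V'\<close>,
  the objects \<open>F(V)\<close> and \<open>F(V')\<close> are sums of \<open>k\<close> and \<open>n - k\<close> copies of \<open>F(K)\<close>. Reduced rank is
  subadditive in short exact sequences and cannot increase under quotients, so the image \<open>y\<close> of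
  \<open>F(V)\<close> in \<open>(F(K)/A)\<^sup>n\<close> has rank at most \<open>k d\<close>, and the cokernel of \<open>y\<close>, being a quotient of
  \<open>F(V')\<close>, has rank at most \<open>(n - k) d\<close>. On the other hand \<open>A\<close> is a pedestal, so
  \<open>(F(K)/A)\<^sup>n\<close> has a strict cube of dimension \<open>n d\<close> with base \<open>\<bottom>\<close>. This forces exactly \<open>k d\<close>
  independent subobjects below \<open>y\<close>, and that number is the length of \<open>y\<close> after flattening. For
  \<open>V = K\<close> the flattened lattice has length \<open>d\<close> and \<open>d\<close> independent atoms, which makes the object
  realising it semisimple.\<close>

section \<open>Chains\<close>

text \<open>Cubes are awkward to cut and to recombine. The counting therefore uses independent lists
  over a base \<open>b\<close>, which can be permuted, shrunk, concatenated and pushed above an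
  element; \<open>ind_cube\<close> and \<open>cube_ind\<close> translate between the two. The
  forcing step rests on a modular-lattice fact. Relative to an element \<open>y\<close>, every
  strict cube splits into directions that stay independent above \<open>y\<close> and directions
  that give independent elements below \<open>y\<close>, with no dimension lost. Flattened length
  equals the largest number of independent elements because an independent list of maximal length
  below \<open>y\<close> consists of quasi-atoms. In the category the obstacle is the absence of
  elements. Lifting through epimorphisms replaces choosing preimages. The flattening is determined
  only up to isomorphism, so \<open>D\<close> is an arbitrary directory with a flattening map.
  Semisimplicity has to be read off the subobject lattice of whichever object realises it: in a
  lattice of length \<open>d\<close>, any \<open>d\<close> independent elements are atoms with join
  \<open>\<top>\<close>.\<close>

definition chain_to :: "'a gorder \<Rightarrow> nat \<Rightarrow> 'a \<Rightarrow> bool" where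
  "chain_to L k v \<longleftrightarrow> (\<exists>c :: nat \<Rightarrow> 'a.
     (\<forall>i\<le>k. c i \<in> carrier L) \<and> (\<forall>i<k. c i \<sqsubset>\<^bsub>L\<^esub> c (Suc i)) \<and> c k = v)"

lemma chain_to_0: "v \<in> carrier L \<Longrightarrow> chain_to L 0 v"
  unfolding chain_to_def by (rule exI[of _ "\<lambda>_. v"]) simp

lemma chain_to_Suc:
  assumes "chain_to L k u" "u \<sqsubset>\<^bsub>L\<^esub> v" "v \<in> carrier L"
  shows "chain_to L (Suc k) v"
proof -
  obtain c where c: "\<forall>i\<le>k. c i \<in> carrier L" "\<forall>i<k. c i \<sqsubset>\<^bsub>L\<^esub> c (Suc i)" "c k = u"
    using assms(1) unfolding chain_to_def by blast
  show ?thesis unfolding chain_to_def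
    by (rule exI[of _ "c(Suc k := v)"]) (use c assms in \<open>auto simp: le_Suc_eq less_Suc_eq\<close>)
qed

lemma chain_to_poset_length: "chain_to L k v \<Longrightarrow> enat k \<le> poset_length L"
  unfolding poset_length_def chain_to_def by (intro Sup_upper) blast

lemma poset_length_le:
  assumes "\<And>k c. \<forall>i\<le>k. c i \<in> carrier L \<Longrightarrow> \<forall>i<k. c i \<sqsubset>\<^bsub>L\<^esub> c (Suc i) \<Longrightarrow> k \<le> r"
  shows "poset_length L \<le> enat r"
  unfolding poset_length_def by (intro Sup_least) (use assms in auto)

text \<open>The strict order refers to the equivalence relation of the structure. This form uses
  only \<open>\<sqsubseteq>\<close>, which is all that an order embedding has to respect.\<close>

lemma weak_lless_iff:
  assumes "weak_partial_order L" "x \<in> carrier L" "y \<in> carrier L"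
  shows "x \<sqsubset>\<^bsub>L\<^esub> y \<longleftrightarrow> x \<sqsubseteq>\<^bsub>L\<^esub> y \<and> \<not> y \<sqsubseteq>\<^bsub>L\<^esub> x"
proof -
  interpret weak_partial_order L by fact
  show ?thesis unfolding lless_def using assms(2,3)
    by (meson local.sym weak_le_antisym weak_refl)
qed

lemma lless_order_emb:
  assumes "order_emb L M f" "f \<in> carrier L \<rightarrow> carrier M" "x \<in> carrier L" "y \<in> carrier L"
  shows "f x \<sqsubset>\<^bsub>M\<^esub> f y \<longleftrightarrow> x \<sqsubset>\<^bsub>L\<^esub> y"
proof -
  have "weak_partial_order L" "weak_partial_order M"
    using assms(1) by (auto simp: order_emb_def)
  then show ?thesis
    using assms by (auto simp: weak_lless_iff order_emb_def Pi_iff)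
qed

lemma poset_length_order_emb:
  assumes "order_emb L M f" "f \<in> carrier L \<rightarrow> carrier M"
  shows "poset_length L \<le> poset_length M"
  unfolding poset_length_def
proof (intro Sup_subset_mono subsetI, clarify)
  fix k c assume c: "\<forall>i\<le>k. c i \<in> carrier L" "\<forall>i<k. c i \<sqsubset>\<^bsub>L\<^esub> c (Suc i)"
  have "\<forall>i\<le>k. (f \<circ> c) i \<in> carrier M" using c assms by auto
  moreover have "\<forall>i<k. (f \<circ> c) i \<sqsubset>\<^bsub>M\<^esub> (f \<circ> c) (Suc i)"
    using c lless_order_emb[OF assms] by simp
  ultimately show "\<exists>ka. enat k = enat ka \<and> (\<exists>c. (\<forall>i\<le>ka. c i \<in> carrier M) \<and> (\<forall>i<ka. c i \<sqsubset>\<^bsub>M\<^esub> c (Suc i)))"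
    by blast
qed

lemma poset_iso_inv:
  assumes "poset_iso L M f"
  shows "poset_iso M L (inv_into (carrier L) f)"
proof -
  have b: "bij_betw f (carrier L) (carrier M)" and e: "order_emb L M f"
    using assms by (auto simp: poset_iso_def)
  have b': "bij_betw (inv_into (carrier L) f) (carrier M) (carrier L)"
    by (rule bij_betw_inv_into[OF b])
  show ?thesis unfolding poset_iso_def order_emb_def
  proof (intro conjI ballI b')
    show "weak_partial_order M" "weak_partial_order L" using e by (auto simp: order_emb_def)
    fix x y assume xy: "x \<in> carrier M" "y \<in> carrier M"
    let ?i = "inv_into (carrier L) f"
    have "?i x \<in> carrier L" "?i y \<in> carrier L" "f (?i x) = x" "f (?i y) = y"
      using xy b b' by (auto simp: bij_betw_def f_inv_into_f inv_into_into)
    then show "?i x \<sqsubseteq>\<^bsub>L\<^esub> ?i y \<longleftrightarrow> x \<sqsubseteq>\<^bsub>M\<^esub> y"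
      using e unfolding order_emb_def by metis
  qed
qed

lemma poset_iso_comp:
  assumes "poset_iso L M f" "poset_iso M N g"
  shows "poset_iso L N (g \<circ> f)"
proof -
  have "bij_betw (g \<circ> f) (carrier L) (carrier N)"
    using assms unfolding poset_iso_def by (meson bij_betw_trans)
  moreover have "x \<in> carrier L \<Longrightarrow> f x \<in> carrier M" for x
    using assms(1) unfolding poset_iso_def by (meson bij_betw_apply)
  ultimately show ?thesis
    using assms unfolding poset_iso_def order_emb_def by simp
qed

lemma poset_iso_closed: "poset_iso L M f \<Longrightarrow> x \<in> carrier L \<Longrightarrow> f x \<in> carrier M"
  by (auto simp: poset_iso_def bij_betw_apply)

lemma poset_iso_le: "poset_iso L M f \<Longrightarrow> x \<in> carrier L \<Longrightarrow> y \<in> carrier L \<Longrightarrow> f x \<sqsubseteq>\<^bsub>M\<^esub> f y \<longleftrightarrow> x \<sqsubseteq>\<^bsub>L\<^esub> y"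
  by (auto simp: poset_iso_def order_emb_def)

lemma poset_iso_inj: "poset_iso L M f \<Longrightarrow> x \<in> carrier L \<Longrightarrow> y \<in> carrier L \<Longrightarrow> f x = f y \<longleftrightarrow> x = y"
  by (auto simp: poset_iso_def bij_betw_def inj_on_def)

lemma poset_iso_length:
  assumes "poset_iso L M f"
  shows "poset_length L = poset_length M"
proof (rule antisym)
  show "poset_length L \<le> poset_length M"
    by (rule poset_length_order_emb[of _ _ f]) (use assms in \<open>auto simp: poset_iso_def bij_betw_def\<close>)
  show "poset_length M \<le> poset_length L"
    by (rule poset_length_order_emb[of _ _ "inv_into (carrier L) f"])
      (use poset_iso_inv[OF assms] in \<open>auto simp: poset_iso_def bij_betw_def\<close>)
qed

lemma poset_iso_elt_length:
  assumes "poset_iso L M f" "x \<in> carrier L"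
  shows "elt_length M (f x) = elt_length L x"
proof -
  have b: "bij_betw f (carrier L) (carrier M)" and e: "order_emb L M f"
    using assms by (auto simp: poset_iso_def)
  have w: "weak_partial_order L" "weak_partial_order M" using e by (auto simp: order_emb_def)
  have "poset_iso (L\<lparr>carrier := {y \<in> carrier L. y \<sqsubseteq>\<^bsub>L\<^esub> x}\<rparr>) (M\<lparr>carrier := {y \<in> carrier M. y \<sqsubseteq>\<^bsub>M\<^esub> f x}\<rparr>) f"
    unfolding poset_iso_def
  proof
    have "f ` {y \<in> carrier L. y \<sqsubseteq>\<^bsub>L\<^esub> x} = {y \<in> carrier M. y \<sqsubseteq>\<^bsub>M\<^esub> f x}"
    proof (intro equalityI subsetI)
      fix z assume "z \<in> f ` {y \<in> carrier L. y \<sqsubseteq>\<^bsub>L\<^esub> x}"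
      then show "z \<in> {y \<in> carrier M. y \<sqsubseteq>\<^bsub>M\<^esub> f x}"
        using assms(2) poset_iso_le[OF assms(1)] poset_iso_closed[OF assms(1)] by auto
    next
      fix z assume z: "z \<in> {y \<in> carrier M. y \<sqsubseteq>\<^bsub>M\<^esub> f x}"
      then obtain y where "y \<in> carrier L" "z = f y"
        using b unfolding bij_betw_def by blast
      then show "z \<in> f ` {y \<in> carrier L. y \<sqsubseteq>\<^bsub>L\<^esub> x}"
        using z poset_iso_le[OF assms(1)] assms(2) by auto
    qed
    then show "bij_betw f (carrier (L\<lparr>carrier := {y \<in> carrier L. y \<sqsubseteq>\<^bsub>L\<^esub> x}\<rparr>)) (carrier (M\<lparr>carrier := {y \<in> carrier M. y \<sqsubseteq>\<^bsub>M\<^esub> f x}\<rparr>))"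
      using b by (auto simp: bij_betw_def inj_on_def)
    show "order_emb (L\<lparr>carrier := {y \<in> carrier L. y \<sqsubseteq>\<^bsub>L\<^esub> x}\<rparr>) (M\<lparr>carrier := {y \<in> carrier M. y \<sqsubseteq>\<^bsub>M\<^esub> f x}\<rparr>) f"
      unfolding order_emb_def using w e
      by (auto intro!: weak_partial_order_subset simp: order_emb_def)
  qed
  then show ?thesis unfolding elt_length_def by (rule poset_iso_length[symmetric])
qed

section \<open>Independent lists in modular lattices\<close>

text \<open>The empty list joins to \<open>b\<close> rather than to \<open>\<bottom>\<close>, so
  that lists are read in the interval above \<open>b\<close>. Cubes with an arbitrary base require
  this.\<close>

primrec list_join :: "'a gorder \<Rightarrow> 'a \<Rightarrow> 'a list \<Rightarrow> 'a" where
  "list_join L b [] = b"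
| "list_join L b (a # as) = a \<squnion>\<^bsub>L\<^esub> list_join L b as"

text \<open>Each entry is compared only with the entries after it, which suits induction. That the
  order of the entries is irrelevant is a consequence of modularity, proved in
  \<open>ind_perm\<close>.\<close>

primrec indep_list :: "'a gorder \<Rightarrow> 'a \<Rightarrow> 'a list \<Rightarrow> bool" where
  "indep_list L b [] \<longleftrightarrow> b \<in> carrier L"
| "indep_list L b (a # as) \<longleftrightarrow> a \<in> carrier L \<and> b \<sqsubseteq>\<^bsub>L\<^esub> a \<and> a \<noteq> b \<and>
     a \<sqinter>\<^bsub>L\<^esub> list_join L b as = b \<and> indep_list L b as"

text \<open>Only one half of the modular law is assumed because the other inequality holds in every
  lattice; \<open>modular\<close> combines the two.\<close>

locale modular_lattice = bounded_lattice L for L :: "'a gorder" (structure) +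
  assumes modular_le: "x \<in> carrier L \<Longrightarrow> y \<in> carrier L \<Longrightarrow> z \<in> carrier L \<Longrightarrow> x \<sqsubseteq> z \<Longrightarrow>
    (x \<squnion> y) \<sqinter> z \<sqsubseteq> x \<squnion> (y \<sqinter> z)"
begin

declare le_antisym [rule del] le_trans [rule del] least_closed [rule del]

lemma join_assoc: "x \<in> carrier L \<Longrightarrow> y \<in> carrier L \<Longrightarrow> z \<in> carrier L \<Longrightarrow> (x \<squnion> y) \<squnion> z = x \<squnion> (y \<squnion> z)"
  using weak_join_assoc by (simp add: eq_is_equal)

lemma join_lcomm: "x \<in> carrier L \<Longrightarrow> y \<in> carrier L \<Longrightarrow> z \<in> carrier L \<Longrightarrow> x \<squnion> (y \<squnion> z) = y \<squnion> (x \<squnion> z)"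
  by (metis join_assoc join_comm)

lemma le_joinI1: "x \<sqsubseteq> y \<Longrightarrow> x \<in> carrier L \<Longrightarrow> y \<in> carrier L \<Longrightarrow> z \<in> carrier L \<Longrightarrow> x \<sqsubseteq> y \<squnion> z"
  by (meson join_closed join_left le_trans)

lemma le_joinI2: "x \<sqsubseteq> z \<Longrightarrow> x \<in> carrier L \<Longrightarrow> y \<in> carrier L \<Longrightarrow> z \<in> carrier L \<Longrightarrow> x \<sqsubseteq> y \<squnion> z"
  by (meson join_closed join_right le_trans)

lemma meet_leI1: "x \<sqsubseteq> z \<Longrightarrow> x \<in> carrier L \<Longrightarrow> y \<in> carrier L \<Longrightarrow> z \<in> carrier L \<Longrightarrow> x \<sqinter> y \<sqsubseteq> z"
  by (meson meet_closed meet_left le_trans)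

lemma meet_leI2: "y \<sqsubseteq> z \<Longrightarrow> x \<in> carrier L \<Longrightarrow> y \<in> carrier L \<Longrightarrow> z \<in> carrier L \<Longrightarrow> x \<sqinter> y \<sqsubseteq> z"
  by (meson meet_closed meet_right le_trans)

lemma join_mono: "x \<sqsubseteq> x' \<Longrightarrow> y \<sqsubseteq> y' \<Longrightarrow> x \<in> carrier L \<Longrightarrow> x' \<in> carrier L \<Longrightarrow> y \<in> carrier L \<Longrightarrow> y' \<in> carrier L \<Longrightarrow>
   x \<squnion> y \<sqsubseteq> x' \<squnion> y'"
  by (simp add: join_le le_joinI1 le_joinI2)

lemma meet_mono: "x \<sqsubseteq> x' \<Longrightarrow> y \<sqsubseteq> y' \<Longrightarrow> x \<in> carrier L \<Longrightarrow> x' \<in> carrier L \<Longrightarrow> y \<in> carrier L \<Longrightarrow> y' \<in> carrier L \<Longrightarrow>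
   x \<sqinter> y \<sqsubseteq> x' \<sqinter> y'"
  by (simp add: meet_le meet_leI1 meet_leI2)

lemma meet_absorb1: "x \<sqsubseteq> y \<Longrightarrow> x \<in> carrier L \<Longrightarrow> y \<in> carrier L \<Longrightarrow> x \<sqinter> y = x"
  using le_iff_join by metis

lemma meet_absorb2: "x \<sqsubseteq> y \<Longrightarrow> x \<in> carrier L \<Longrightarrow> y \<in> carrier L \<Longrightarrow> y \<sqinter> x = x"
  using meet_absorb1 meet_comm by metis

lemma join_absorb2: "x \<sqsubseteq> y \<Longrightarrow> x \<in> carrier L \<Longrightarrow> y \<in> carrier L \<Longrightarrow> x \<squnion> y = y"
  using le_iff_meet by metis

lemma join_absorb1: "x \<sqsubseteq> y \<Longrightarrow> x \<in> carrier L \<Longrightarrow> y \<in> carrier L \<Longrightarrow> y \<squnion> x = y"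
  using join_absorb2 join_comm by metis

lemma le_bot_eq: "x \<sqsubseteq> \<bottom> \<Longrightarrow> x \<in> carrier L \<Longrightarrow> x = \<bottom>"
  by (simp add: le_antisym)

lemma modular: "x \<in> carrier L \<Longrightarrow> y \<in> carrier L \<Longrightarrow> z \<in> carrier L \<Longrightarrow> x \<sqsubseteq> z \<Longrightarrow>
    (x \<squnion> y) \<sqinter> z = x \<squnion> (y \<sqinter> z)"
  by (rule le_antisym, simp add: modular_le, rule meet_le, rule join_mono)
    (simp_all add: meet_left meet_leI2 join_le)

text \<open>This is the rebracketing rule behind all manipulations of independence. By modularity
  the part of \<open>y \<squnion> z\<close> inside \<open>x \<squnion> y\<close> is just
  \<open>y\<close>, so anything common to \<open>x\<close> and \<open>y \<squnion> z\<close> already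
  lies in \<open>x \<sqinter> y\<close>.\<close>

lemma meet_join_shift:
  assumes "x \<in> carrier L" "y \<in> carrier L" "z \<in> carrier L" "b \<in> carrier L"
    and "x \<sqinter> y = b" "(x \<squnion> y) \<sqinter> z = b" "b \<sqsubseteq> z"
  shows "x \<sqinter> (y \<squnion> z) = b"
proof -
  have b: "b \<sqsubseteq> x" "b \<sqsubseteq> y" using assms meet_left meet_right by metis+
  have "(y \<squnion> z) \<sqinter> (x \<squnion> y) = y \<squnion> (z \<sqinter> (x \<squnion> y))"
    by (rule modular) (use assms in \<open>auto intro: join_right\<close>)
  also have "\<dots> = y" using assms b by (simp add: meet_comm[of _ z] join_absorb1)
  finally have e: "(y \<squnion> z) \<sqinter> (x \<squnion> y) = y" .
  have "x \<sqinter> (y \<squnion> z) \<sqsubseteq> (y \<squnion> z) \<sqinter> (x \<squnion> y)"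
    using assms by (intro meet_le meet_leI1 meet_leI2 join_left) auto
  then have "x \<sqinter> (y \<squnion> z) \<sqsubseteq> x \<sqinter> y" unfolding e
    using assms by (intro meet_le meet_left) auto
  then have "x \<sqinter> (y \<squnion> z) \<sqsubseteq> b" using assms by simp
  moreover have "b \<sqsubseteq> x \<sqinter> (y \<squnion> z)"
    by (rule meet_le) (use assms b in \<open>auto intro: le_joinI1\<close>)
  ultimately show ?thesis using assms by (simp add: le_antisym)
qed

abbreviation jn where "jn \<equiv> list_join L"
abbreviation ind where "ind \<equiv> indep_list L"

lemma jn_closed [simp]: "b \<in> carrier L \<Longrightarrow> set as \<subseteq> carrier L \<Longrightarrow> jn b as \<in> carrier L"
  by (induction as) auto

lemma jn_ge_base: "b \<in> carrier L \<Longrightarrow> set as \<subseteq> carrier L \<Longrightarrow> b \<sqsubseteq> jn b as"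
  by (induction as) (auto intro: le_joinI2)

lemma jn_ge_mem: "b \<in> carrier L \<Longrightarrow> set as \<subseteq> carrier L \<Longrightarrow> a \<in> set as \<Longrightarrow> a \<sqsubseteq> jn b as"
  by (induction as) (auto intro: le_joinI2 join_left)

lemma jn_le: "b \<in> carrier L \<Longrightarrow> set as \<subseteq> carrier L \<Longrightarrow> z \<in> carrier L \<Longrightarrow> b \<sqsubseteq> z \<Longrightarrow> (\<And>a. a \<in> set as \<Longrightarrow> a \<sqsubseteq> z) \<Longrightarrow> jn b as \<sqsubseteq> z"
  by (induction as) (auto intro: join_le)

lemma jn_append: "b \<in> carrier L \<Longrightarrow> set as \<subseteq> carrier L \<Longrightarrow> set bs \<subseteq> carrier L \<Longrightarrow> jn b (as @ bs) = jn b as \<squnion> jn b bs"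
  by (induction as) (auto simp: join_assoc join_absorb2 jn_ge_base)

lemma indD:
  assumes "ind b as"
  shows "b \<in> carrier L" "set as \<subseteq> carrier L" "\<And>a. a \<in> set as \<Longrightarrow> b \<sqsubseteq> a" "\<And>a. a \<in> set as \<Longrightarrow> a \<noteq> b"
  using assms by (induction as) auto

lemma ind_jn_closed [simp]: "ind b as \<Longrightarrow> jn b as \<in> carrier L"
  using indD(1,2) by simp

lemma ind_jn_ge_base: "ind b as \<Longrightarrow> b \<sqsubseteq> jn b as"
  by (rule jn_ge_base[OF indD(1) indD(2)])

text \<open>Shrinking the entries shrinks the meets in the definition, and these cannot fall below
  \<open>b\<close>.\<close>

lemma ind_shrink:
  assumes "list_all2 (\<lambda>a' a. a' \<in> carrier L \<and> b \<sqsubseteq> a' \<and> a' \<noteq> b \<and> a' \<sqsubseteq> a) as' as" "ind b as"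
  shows "ind b as' \<and> jn b as' \<sqsubseteq> jn b as"
  using assms
proof (induction rule: list_all2_induct)
  case Nil
  then show ?case by simp
next
  case (Cons a' as' a as)
  then have *: "ind b as'" "jn b as' \<sqsubseteq> jn b as" "ind b as" "b \<in> carrier L" using indD(1) by auto
  have "a' \<sqinter> jn b as' \<sqsubseteq> a \<sqinter> jn b as" using * Cons by (intro meet_mono) auto
  then have "a' \<sqinter> jn b as' = b"
    using Cons * by (intro le_antisym meet_le ind_jn_ge_base) auto
  then show ?case using * Cons by (auto intro: join_mono)
qed

text \<open>Blocks with trivially meeting joins can be put together: \<open>meet_join_shift\<close>
  moves the join of the second block across each head of the first.\<close>

lemma ind_append:
  assumes "ind b as" "ind b bs" "jn b as \<sqinter> jn b bs = b"
  shows "ind b (as @ bs)"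
  using assms
proof (induction as)
  case (Cons a as)
  have c: "b \<in> carrier L" "set as \<subseteq> carrier L" "set bs \<subseteq> carrier L" "a \<in> carrier L"
    using Cons.prems indD(1,2)[of b as] indD(2)[of b bs] by auto
  have "jn b as \<sqinter> jn b bs \<sqsubseteq> (a \<squnion> jn b as) \<sqinter> jn b bs"
    using c by (intro meet_mono join_right) auto
  then have i: "jn b as \<sqinter> jn b bs = b"
    using Cons.prems c by (intro le_antisym meet_le jn_ge_base) auto
  have "a \<sqinter> (jn b as \<squnion> jn b bs) = b"
    by (rule meet_join_shift) (use Cons.prems c jn_ge_base in auto)
  then show ?case using Cons i c by (simp add: jn_append)
qed simp

lemma jn_middle: "b \<in> carrier L \<Longrightarrow> set xs \<subseteq> carrier L \<Longrightarrow> set ys \<subseteq> carrier L \<Longrightarrow> a \<in> carrier L \<Longrightarrow>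
   jn b (xs @ a # ys) = jn b (a # xs @ ys)"
  by (induction xs) (auto simp: join_lcomm)

text \<open>Exchanging two neighbours is an instance of \<open>meet_join_shift\<close>, with the
  join of the tail in the middle. Such exchanges generate all permutations.\<close>

lemma ind_swap: "ind b (x # a # zs) \<Longrightarrow> ind b (a # x # zs)"
proof -
  assume *: "ind b (x # a # zs)"
  then have c: "b \<in> carrier L" "set zs \<subseteq> carrier L" "a \<in> carrier L" "x \<in> carrier L"
    using indD(1,2)[of b zs] by auto
  have "b \<sqsubseteq> x \<sqinter> jn b zs" using * c by (intro meet_le jn_ge_base) auto
  moreover have "x \<sqinter> jn b zs \<sqsubseteq> x \<sqinter> (a \<squnion> jn b zs)" using c by (intro meet_mono join_right) auto
  ultimately have i: "x \<sqinter> jn b zs = b" using * c by (intro le_antisym) auto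
  have "a \<sqinter> (jn b zs \<squnion> x) = b"
    by (rule meet_join_shift) (use * c in \<open>auto simp: meet_comm[of _ _ x]\<close>)
  then show ?thesis using * i by (simp add: join_comm[of _ x])
qed

lemma ind_Cons_cong:
  "ind b as = ind b bs \<Longrightarrow> (ind b (x # as) \<or> ind b (x # bs) \<Longrightarrow> jn b as = jn b bs) \<Longrightarrow>
     ind b (x # as) = ind b (x # bs)"
  by auto

lemma ind_middle: "ind b (xs @ a # ys) \<longleftrightarrow> ind b (a # xs @ ys)"
proof (induction xs)
  case (Cons x xs)
  have "ind b (x # xs @ a # ys) \<longleftrightarrow> ind b (x # a # xs @ ys)"
  proof -
    have "jn b (xs @ a # ys) = jn b (a # xs @ ys)" if "ind b (x # xs @ a # ys) \<or> ind b (x # a # xs @ ys)"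
    proof -
      have "b \<in> carrier L" "set (xs @ a # ys) \<subseteq> carrier L"
        using that indD(1)[of b "x # xs @ a # ys"] indD(1)[of b "x # a # xs @ ys"]
          indD(2)[of b "x # xs @ a # ys"] indD(2)[of b "x # a # xs @ ys"] by auto
      then show ?thesis by (intro jn_middle) auto
    qed
    then show ?thesis by (rule ind_Cons_cong[OF Cons.IH])
  qed
  moreover have "ind b (x # a # xs @ ys) = ind b (a # x # xs @ ys)" using ind_swap by blast
  ultimately show ?case by (simp only: append_Cons)
qed simp

text \<open>Needed because \<open>qa_indep\<close> speaks of sets and asks only for some enumeration
  of them.\<close>

lemma ind_perm: "mset as = mset as' \<Longrightarrow> ind b as \<Longrightarrow> ind b as'"
proof (induction as arbitrary: as')
  case (Cons a as)
  then have "a \<in> set as'" by (metis list.set_intros(1) mset_eq_setD)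
  then obtain xs ys where as': "as' = xs @ a # ys" by (meson split_list)
  then have m: "mset as = mset (xs @ ys)" using Cons.prems by simp
  then have "ind b (xs @ ys)" using Cons by auto
  have "jn b as = jn b (xs @ ys)"
  proof -
    have "mset as = mset bs \<Longrightarrow> b \<in> carrier L \<Longrightarrow> set as \<subseteq> carrier L \<Longrightarrow> jn b as = jn b bs" for bs
    proof (rule le_antisym)
      assume *: "mset as = mset bs" "b \<in> carrier L" "set as \<subseteq> carrier L"
      then have s: "set as = set bs" by (metis mset_eq_setD)
      show "jn b as \<sqsubseteq> jn b bs" using * s by (intro jn_le jn_closed jn_ge_base jn_ge_mem) auto
      show "jn b bs \<sqsubseteq> jn b as" using * s by (intro jn_le jn_closed jn_ge_base jn_ge_mem) auto
      show "jn b as \<in> carrier L" "jn b bs \<in> carrier L" using * s by auto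
    qed
    then show ?thesis using m Cons.prems(2) indD by auto
  qed
  then show ?case unfolding as' ind_middle using Cons.prems \<open>ind b (xs @ ys)\<close> by auto
qed simp

lemma ind_distinct: "ind b as \<Longrightarrow> distinct as"
proof (induction as)
  case (Cons a as)
  have "a \<notin> set as"
  proof
    assume "a \<in> set as"
    then have "a \<sqsubseteq> jn b as" using Cons.prems indD(1,2)[of b as] by (intro jn_ge_mem) auto
    then have "a \<sqinter> jn b as = a" using Cons.prems by (intro meet_absorb1) auto
    then show False using Cons.prems by auto
  qed
  then show ?case using Cons by auto
qed simp

section \<open>Cubes and independent lists\<close>

lemma meet_assoc: "x \<in> carrier L \<Longrightarrow> y \<in> carrier L \<Longrightarrow> z \<in> carrier L \<Longrightarrow> (x \<sqinter> y) \<sqinter> z = x \<sqinter> (y \<sqinter> z)"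
  using weak_meet_assoc by (simp add: eq_is_equal)

lemma meet_idem: "x \<in> carrier L \<Longrightarrow> x \<sqinter> x = x"
  by (simp add: meet_absorb1)

lemma join_idem: "x \<in> carrier L \<Longrightarrow> x \<squnion> x = x"
  by (simp add: join_absorb1)

text \<open>Modularity gives \<open>(x \<squnion> a) \<sqinter> J = x\<close>: an element
  \<open>a\<close> independent of \<open>J\<close> leaves no trace inside \<open>J\<close>. This and
  the next lemma are the two meet identities for adding a direction \<open>a\<close> to a cube lying
  below \<open>J\<close>.\<close>

lemma join_indep_meet:
  assumes "x \<in> carrier L" "y \<in> carrier L" "J \<in> carrier L" "a \<in> carrier L"
    and "x \<sqsubseteq> J" "y \<sqsubseteq> J" "a \<sqinter> J = b" "b \<sqsubseteq> x"
  shows "(x \<squnion> a) \<sqinter> y = x \<sqinter> y"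
proof -
  have b: "b \<in> carrier L" using assms by auto
  have "(x \<squnion> a) \<sqinter> J = x" using assms b by (simp add: modular join_absorb1)
  then have "((x \<squnion> a) \<sqinter> J) \<sqinter> y = x \<sqinter> y" by simp
  then show ?thesis using assms by (simp add: meet_assoc meet_absorb2)
qed

lemma join_indep_meet_both:
  assumes "x \<in> carrier L" "y \<in> carrier L" "J \<in> carrier L" "a \<in> carrier L"
    and "x \<sqsubseteq> J" "y \<sqsubseteq> J" "a \<sqinter> J = b" "b \<sqsubseteq> x"
  shows "(x \<squnion> a) \<sqinter> (y \<squnion> a) = (x \<sqinter> y) \<squnion> a"
proof -
  have "(a \<squnion> y) \<sqinter> (x \<squnion> a) = a \<squnion> (y \<sqinter> (x \<squnion> a))"
    using assms by (intro modular) (auto intro: join_right)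
  also have "y \<sqinter> (x \<squnion> a) = x \<sqinter> y"
    using join_indep_meet[OF assms] meet_comm by metis
  finally show ?thesis by (metis join_comm meet_comm)
qed

text \<open>A cube for the tail is doubled in a new direction: a vertex either stays or is joined
  with the head \<open>a\<close>. The bound by the join of the list drives the induction, and it
  later allows the cube to be restricted to a subobject.\<close>

lemma ind_cube:
  assumes "ind b as"
  shows "\<exists>f. strict_cube L (length as) f \<and> f {} = b \<and> (\<forall>S\<in>Pow {1..length as}. f S \<sqsubseteq> jn b as)"
  using assms
proof (induction as)
  case Nil
  then show ?case
    by (intro exI[of _ "\<lambda>_. b"]) (auto simp: strict_cube_def join_idem meet_idem)
next
  case (Cons a as)
  let ?n = "length as"
  define I where "I = {1..?n}"
  define J where "J = jn b as"
  obtain f where f: "strict_cube L ?n f" "f {} = b" and fJ: "\<And>S. S \<subseteq> I \<Longrightarrow> f S \<sqsubseteq> J"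
    using Cons by (auto simp: I_def J_def)
  have J: "J \<in> carrier L" "a \<in> carrier L" "a \<sqinter> J = b" "a \<noteq> b" "b \<in> carrier L" "b \<sqsubseteq> a"
    using Cons.prems indD(1)[of b as] by (auto simp: J_def)
  have fc: "f S \<in> carrier L" if "S \<subseteq> I" for S
    using f(1) that unfolding strict_cube_def I_def Pi_iff by blast
  have fUI: "f (S \<union> T) = f S \<squnion> f T" "f (S \<inter> T) = f S \<sqinter> f T" if "S \<subseteq> I" "T \<subseteq> I" for S T
    using f(1) that unfolding strict_cube_def I_def by blast+
  have finj: "S = T" if "f S = f T" "S \<subseteq> I" "T \<subseteq> I" for S T
    using f(1) that unfolding strict_cube_def I_def inj_on_def by blast
  have bf: "b \<sqsubseteq> f S" if "S \<subseteq> I" for S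
    using fUI(2)[of "{}" S] f(2) that fc[of S] fc[of "{}"] meet_right[of "f {}" "f S"] by simp
  define g where "g S = (if Suc ?n \<in> S then f (S \<inter> I) \<squnion> a else f (S \<inter> I))" for S
  have gc: "g S \<in> carrier L" for S using fc[of "S \<inter> I"] J by (auto simp: g_def)
  have top: "{1..Suc ?n} = insert (Suc ?n) I" by (auto simp: I_def)
  have nI: "Suc ?n \<notin> I" by (auto simp: I_def)
  \<comment> \<open>Meeting with \<open>J\<close> forgets the new direction, and \<open>an\<close>
    below detects it by asking whether \<open>a\<close> lies under the vertex. Together they give
    injectivity of \<open>g\<close>.\<close>
  have gJ: "g S \<sqinter> J = f (S \<inter> I)" for S
  proof -
    have "(f (S \<inter> I) \<squnion> a) \<sqinter> J = f (S \<inter> I) \<sqinter> J"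
      by (rule join_indep_meet[of _ _ J _ b]) (use J fc fJ bf in auto)
    then show ?thesis using fc[of "S \<inter> I"] fJ[of "S \<inter> I"] J by (auto simp: g_def meet_absorb1)
  qed
  have an: "Suc ?n \<in> S \<longleftrightarrow> a \<sqsubseteq> g S" for S
  proof
    show "a \<sqsubseteq> g S" if "Suc ?n \<in> S" using that fc[of "S \<inter> I"] J by (auto simp: g_def intro: join_right)
    show "Suc ?n \<in> S" if "a \<sqsubseteq> g S"
    proof (rule ccontr)
      assume "Suc ?n \<notin> S"
      then have "a \<sqsubseteq> f (S \<inter> I)" using that by (simp add: g_def)
      then have "a \<sqsubseteq> J" using fJ[of "S \<inter> I"] fc[of "S \<inter> I"] J by (meson inf_le2 le_trans)
      then show False using J by (simp add: meet_absorb1)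
    qed
  qed
  have "strict_cube L (Suc ?n) g"
    unfolding strict_cube_def
  proof (intro conjI ballI)
    show "g \<in> Pow {1..Suc ?n} \<rightarrow> carrier L" using gc by auto
    show "inj_on g (Pow {1..Suc ?n})"
    proof (rule inj_onI)
      fix S T assume S: "S \<in> Pow {1..Suc ?n}" "T \<in> Pow {1..Suc ?n}" and e: "g S = g T"
      have "S \<inter> I = T \<inter> I" using gJ[of S] gJ[of T] e finj by auto
      moreover have "Suc ?n \<in> S \<longleftrightarrow> Suc ?n \<in> T" using an e by metis
      ultimately show "S = T" using S unfolding top by blast
    qed
    fix S T assume "S \<in> Pow {1..Suc ?n}" "T \<in> Pow {1..Suc ?n}"
    define x where "x = f (S \<inter> I)" define y where "y = f (T \<inter> I)"
    have xy: "x \<in> carrier L" "y \<in> carrier L" "x \<sqsubseteq> J" "y \<sqsubseteq> J" "b \<sqsubseteq> x" "b \<sqsubseteq> y"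
      using fc fJ bf by (auto simp: x_def y_def)
    have "f ((S \<union> T) \<inter> I) = x \<squnion> y" "f ((S \<inter> T) \<inter> I) = x \<sqinter> y"
      using fUI[of "S \<inter> I" "T \<inter> I"] unfolding x_def y_def
      by (simp_all add: Int_Un_distrib2 Int_left_commute Int_assoc)
    then have gUn: "g (S \<union> T) = (if Suc ?n \<in> S \<union> T then (x \<squnion> y) \<squnion> a else x \<squnion> y)"
      and gIn: "g (S \<inter> T) = (if Suc ?n \<in> S \<inter> T then (x \<sqinter> y) \<squnion> a else x \<sqinter> y)"
      by (simp_all add: g_def)
    have gS: "g S = (if Suc ?n \<in> S then x \<squnion> a else x)" and gT: "g T = (if Suc ?n \<in> T then y \<squnion> a else y)"
      by (simp_all add: g_def x_def y_def)
    show "g (S \<union> T) = g S \<squnion> g T"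
    proof -
      have "(x \<squnion> a) \<squnion> (y \<squnion> a) = (x \<squnion> y) \<squnion> a"
        using xy J by (metis join_assoc join_closed join_comm join_idem)
      moreover have "(x \<squnion> a) \<squnion> y = (x \<squnion> y) \<squnion> a" using xy J by (metis join_assoc join_comm)
      moreover have "x \<squnion> (y \<squnion> a) = (x \<squnion> y) \<squnion> a" using xy J by (simp add: join_assoc)
      ultimately show ?thesis unfolding gUn gS gT by simp
    qed
    show "g (S \<inter> T) = g S \<sqinter> g T"
    proof -
      have "(x \<squnion> a) \<sqinter> (y \<squnion> a) = (x \<sqinter> y) \<squnion> a" by (rule join_indep_meet_both) (use xy J in auto)
      moreover have "(x \<squnion> a) \<sqinter> y = x \<sqinter> y" by (rule join_indep_meet) (use xy J in auto)
      moreover have "x \<sqinter> (y \<squnion> a) = x \<sqinter> y"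
        using join_indep_meet[of y x J a b] xy J by (simp add: meet_comm)
      ultimately show ?thesis unfolding gIn gS gT by simp
    qed
  qed
  moreover have "g {} = b" by (simp add: g_def f(2))
  moreover have "g S \<sqsubseteq> jn b (a # as)" for S
  proof -
    have "f (S \<inter> I) \<sqsubseteq> a \<squnion> J" using fc[of "S \<inter> I"] fJ[of "S \<inter> I"] J by (auto intro: le_joinI2)
    then show ?thesis using J fc[of "S \<inter> I"] by (auto simp: g_def J_def[symmetric] intro: join_le join_left)
  qed
  ultimately show ?case by auto
qed

lemma cubeD:
  assumes "strict_cube L n f" "S \<subseteq> {1..n}"
  shows "f S \<in> carrier L"
    and "T \<subseteq> {1..n} \<Longrightarrow> f (S \<union> T) = f S \<squnion> f T"
    and "T \<subseteq> {1..n} \<Longrightarrow> f (S \<inter> T) = f S \<sqinter> f T"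
    and "T \<subseteq> {1..n} \<Longrightarrow> f S = f T \<longleftrightarrow> S = T"
  using assms unfolding strict_cube_def inj_on_def by blast+

lemma cube_mono:
  assumes "strict_cube L n f" "S \<subseteq> T" "T \<subseteq> {1..n}"
  shows "f S \<sqsubseteq> f T"
proof -
  have "f S \<in> carrier L" "f T \<in> carrier L" using assms by (auto intro!: cubeD(1)[OF assms(1)])
  moreover have "f T = f S \<squnion> f T" using cubeD(2)[OF assms(1), of S T] assms by (simp add: Un_absorb1)
  ultimately show ?thesis using join_left by metis
qed

text \<open>The vertices \<open>insert i S\<close> and \<open>S \<union> T\<close> intersect in
  \<open>S\<close> when \<open>i\<close> lies outside \<open>S \<union> T\<close>, so their images
  meet in \<open>f S\<close>. Cutting everything with \<open>y\<close> preserves this, and an entry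
  is lost only if the cut collapses it to the base.\<close>

lemma cube_ind_meet:
  assumes f: "strict_cube L n f" and S: "S \<subseteq> {1..n}" and y: "y \<in> carrier L"
  shows "distinct is \<Longrightarrow> set is \<subseteq> {1..n} - S \<Longrightarrow> \<forall>i\<in>set is. f (insert i S) \<sqinter> y \<noteq> f S \<sqinter> y \<Longrightarrow>
     ind (f S \<sqinter> y) (map (\<lambda>i. f (insert i S) \<sqinter> y) is) \<and>
     jn (f S \<sqinter> y) (map (\<lambda>i. f (insert i S) \<sqinter> y) is) \<sqsubseteq> f (S \<union> set is) \<sqinter> y"
proof (induction "is")
  case Nil
  then show ?case using cubeD(1)[OF f S] y by simp
next
  case (Cons i "is")
  define J where "J = jn (f S \<sqinter> y) (map (\<lambda>i. f (insert i S) \<sqinter> y) is)"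
  have IH: "ind (f S \<sqinter> y) (map (\<lambda>i. f (insert i S) \<sqinter> y) is)" "J \<sqsubseteq> f (S \<union> set is) \<sqinter> y"
    using Cons by (auto simp: J_def)
  then have J: "J \<in> carrier L" "f S \<sqinter> y \<sqsubseteq> J" by (auto simp: J_def intro: ind_jn_ge_base)
  have sub: "insert i S \<subseteq> {1..n}" "S \<union> set is \<subseteq> {1..n}" "S \<union> set (i # is) \<subseteq> {1..n}" using Cons.prems S by auto
  note c = cubeD(1)[OF f S] cubeD(1)[OF f sub(1)] cubeD(1)[OF f sub(2)] cubeD(1)[OF f sub(3)]
  have le: "f S \<sqinter> y \<sqsubseteq> f (insert i S) \<sqinter> y"
    using c y cube_mono[OF f _ sub(1), of S] by (intro meet_mono) auto
  have "insert i S \<inter> (S \<union> set is) = S" using Cons.prems by auto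
  then have e: "f (insert i S) \<sqinter> f (S \<union> set is) = f S" using cubeD(3)[OF f sub(1) sub(2)] by simp
  have "(f (insert i S) \<sqinter> y) \<sqinter> J \<sqsubseteq> f S \<sqinter> y"
  proof (rule meet_le)
    have "J \<sqsubseteq> f (S \<union> set is)" using IH(2) c y J by (meson le_trans meet_closed meet_left)
    then have "(f (insert i S) \<sqinter> y) \<sqinter> J \<sqsubseteq> f (insert i S) \<sqinter> f (S \<union> set is)"
      using c y J by (intro meet_mono meet_left) auto
    then show "(f (insert i S) \<sqinter> y) \<sqinter> J \<sqsubseteq> f S" unfolding e .
    show "(f (insert i S) \<sqinter> y) \<sqinter> J \<sqsubseteq> y" using c y J by (intro meet_leI1 meet_right) auto
  qed (use c y J in auto)
  moreover have "f S \<sqinter> y \<sqsubseteq> (f (insert i S) \<sqinter> y) \<sqinter> J" by (rule meet_le) (use J le c y in auto)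
  ultimately have "(f (insert i S) \<sqinter> y) \<sqinter> J = f S \<sqinter> y" using c y J by (intro le_antisym) auto
  moreover have "(f (insert i S) \<sqinter> y) \<squnion> J \<sqsubseteq> f (S \<union> set (i # is)) \<sqinter> y"
  proof (rule join_le)
    show "f (insert i S) \<sqinter> y \<sqsubseteq> f (S \<union> set (i # is)) \<sqinter> y"
      using c y cube_mono[OF f _ sub(3), of "insert i S"] by (intro meet_mono) auto
    have "f (S \<union> set is) \<sqinter> y \<sqsubseteq> f (S \<union> set (i # is)) \<sqinter> y"
      using c y cube_mono[OF f _ sub(3), of "S \<union> set is"] by (intro meet_mono) auto
    then show "J \<sqsubseteq> f (S \<union> set (i # is)) \<sqinter> y" using IH(2) c y J by (meson le_trans meet_closed)
  qed (use c y J in auto)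
  ultimately show ?case using IH(1) Cons.prems c y le unfolding J_def by auto
qed

lemma cube_ind:
  assumes f: "strict_cube L n f"
  shows "distinct is \<Longrightarrow> set is \<subseteq> {1..n} \<Longrightarrow>
     ind (f {}) (map (\<lambda>i. f {i}) is) \<and> jn (f {}) (map (\<lambda>i. f {i}) is) \<sqsubseteq> f (set is)"
proof -
  assume i: "distinct is" "set is \<subseteq> {1..n}"
  have m: "f (insert i {}) \<sqinter> \<top> = f {i}" "f {} \<sqinter> \<top> = f {}" "f (set is) \<sqinter> \<top> = f (set is)" if "i \<in> set is" for i
    using that i cubeD(1)[OF f, of "{i}"] cubeD(1)[OF f, of "{}"]  cubeD(1)[OF f, of "set is"]
    by (auto intro!: meet_absorb1)
  have m0: "f {} \<sqinter> \<top> = f {}" "f (set is) \<sqinter> \<top> = f (set is)"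
    using cubeD(1)[OF f, of "{}"]  cubeD(1)[OF f, of "set is"] i by (auto intro!: meet_absorb1)
  have e: "map (\<lambda>i. f (insert i {}) \<sqinter> \<top>) is = map (\<lambda>i. f {i}) is" using m by auto
  have ne: "\<forall>i\<in>set is. f (insert i {}) \<sqinter> \<top> \<noteq> f {} \<sqinter> \<top>"
  proof
    fix i assume "i \<in> set is"
    then show "f (insert i {}) \<sqinter> \<top> \<noteq> f {} \<sqinter> \<top>"
      using m[of i] m0 cubeD(4)[OF f, of "{i}" "{}"] i by auto
  qed
  have "ind (f {}) (map (\<lambda>i. f {i}) is)" "jn (f {}) (map (\<lambda>i. f {i}) is) \<sqsubseteq> f ({} \<union> set is) \<sqinter> \<top>"
    using cube_ind_meet[OF f empty_subsetI top_closed i(1) _ ne] i unfolding e m0 by auto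
  then show ?thesis using m0 by simp
qed

text \<open>The list is carried to the interval above \<open>b \<squnion> y\<close>. Since its join
  meets \<open>y\<close> only inside \<open>b\<close>, joining with \<open>y\<close> identifies
  nothing, and \<open>meet_join_shift\<close> followed by modularity preserves the meets.\<close>

lemma ind_join_lift:
  assumes "ind b cs" "y \<in> carrier L" "jn b cs \<sqinter> y \<sqsubseteq> b"
  shows "ind (b \<squnion> y) (map (\<lambda>c. c \<squnion> y) cs) \<and> jn (b \<squnion> y) (map (\<lambda>c. c \<squnion> y) cs) = jn b cs \<squnion> y"
  using assms
proof (induction cs)
  case (Cons c cs)
  define J where "J = jn b cs"
  have c: "b \<in> carrier L" "c \<in> carrier L" "J \<in> carrier L" "b \<sqsubseteq> J" "b \<sqsubseteq> c" "y \<in> carrier L" "c \<noteq> b"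
    "c \<sqinter> J = b" "(c \<squnion> J) \<sqinter> y \<sqsubseteq> b"
    using Cons.prems indD(1)[of b cs] by (auto simp: J_def intro: ind_jn_ge_base)
  have "J \<sqinter> y \<sqsubseteq> (c \<squnion> J) \<sqinter> y" using c by (intro meet_mono join_right) auto
  then have "J \<sqinter> y \<sqsubseteq> b" using c by (meson le_trans meet_closed join_closed)
  then have IH: "ind (b \<squnion> y) (map (\<lambda>c. c \<squnion> y) cs)" "jn (b \<squnion> y) (map (\<lambda>c. c \<squnion> y) cs) = J \<squnion> y"
    using Cons by (auto simp: J_def)
  have e: "c \<sqinter> (J \<squnion> (b \<squnion> y)) = b"
  proof (rule meet_join_shift)
    have "(b \<squnion> y) \<sqinter> (c \<squnion> J) = b \<squnion> (y \<sqinter> (c \<squnion> J))" using c by (intro modular) (auto intro: le_joinI2)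
    also have "\<dots> = b" using c by (intro join_absorb1) (auto simp: meet_comm)
    finally show "(c \<squnion> J) \<sqinter> (b \<squnion> y) = b" by (simp add: meet_comm)
  qed (use c in \<open>auto intro: join_left\<close>)
  have Jb: "J \<squnion> (b \<squnion> y) = J \<squnion> y" using c by (simp add: join_assoc[symmetric] join_absorb1)
  have "(y \<squnion> c) \<sqinter> (J \<squnion> y) = y \<squnion> (c \<sqinter> (J \<squnion> y))" using c by (intro modular) (auto intro: join_right)
  then have m: "(c \<squnion> y) \<sqinter> (J \<squnion> y) = b \<squnion> y" using e Jb by (simp add: join_comm)
  have "c \<squnion> y \<noteq> b \<squnion> y"
  proof
    assume "c \<squnion> y = b \<squnion> y"
    then have "c \<sqsubseteq> b \<squnion> y" using join_left[of c y] c(2,6) by simp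
    then have "c \<sqsubseteq> J \<squnion> (b \<squnion> y)" by (rule le_joinI2) (use c(1-3,6) in auto)
    then have "c \<sqinter> (J \<squnion> (b \<squnion> y)) = c" using c(1-3,6) by (intro meet_absorb1) auto
    then show False using e c(7) by metis
  qed
  moreover have "(c \<squnion> y) \<squnion> (J \<squnion> y) = (c \<squnion> J) \<squnion> y"
    using c by (metis join_assoc join_closed join_comm join_idem)
  moreover have "b \<squnion> y \<sqsubseteq> c \<squnion> y" using c by (intro join_mono) auto
  ultimately show ?case using IH m c by (simp add: J_def[symmetric])
qed simp

text \<open>With \<open>S\<close> maximal such that \<open>f S \<sqinter> y = f {} \<sqinter> y\<close>, the directions in \<open>S\<close> remain independent
  after joining with \<open>y\<close>, and the other directions give independent elements below \<open>y\<close>.\<close>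

lemma cube_split:
  assumes f: "strict_cube L n f" and y: "y \<in> carrier L"
  shows "\<exists>as bs. ind (f {} \<sqinter> y) as \<and> jn (f {} \<sqinter> y) as \<sqsubseteq> y \<and> ind (f {} \<squnion> y) bs \<and> length as + length bs = n"
proof -
  define \<S> where "\<S> = {S. S \<subseteq> {1..n} \<and> f S \<sqinter> y = f {} \<sqinter> y}"
  have "finite \<S>" "{} \<in> \<S>" by (auto simp: \<S>_def)
  then obtain S where "S \<in> \<S>" and max: "\<And>T. T \<in> \<S> \<Longrightarrow> S \<subseteq> T \<Longrightarrow> S = T"
    using finite_has_maximal[of \<S>] by (metis empty_iff)
  then have S: "S \<subseteq> {1..n}" "f S \<sqinter> y = f {} \<sqinter> y" by (auto simp: \<S>_def)
  have finS: "finite S" using S(1) finite_subset by blast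
  obtain ss where ss: "distinct ss" "set ss = S" using finite_distinct_list[OF finS] by blast
  obtain ts where ts: "distinct ts" "set ts = {1..n} - S" using finite_distinct_list[of "{1..n} - S"] by auto
  have len: "length ts + length ss = n"
    using distinct_card[OF ts(1)] distinct_card[OF ss(1)] ss ts S card_mono[OF _ S(1)]
    by (simp add: card_Diff_subset finS)
  \<comment> \<open>By maximality of \<open>S\<close>, adjoining any further direction changes the
    meet with \<open>y\<close>. This is the nondegeneracy condition of
    \<open>cube_ind_meet\<close>.\<close>
  have ne: "\<forall>i\<in>set ts. f (insert i S) \<sqinter> y \<noteq> f S \<sqinter> y"
  proof (intro ballI notI)
    fix i assume i: "i \<in> set ts" "f (insert i S) \<sqinter> y = f S \<sqinter> y"
    then have "insert i S \<in> \<S>" using S ts by (auto simp: \<S>_def)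
    then show False using max[of "insert i S"] i ts by auto
  qed
  note A = cube_ind_meet[OF f S(1) y ts(1) _ ne, unfolded S(2)]
  have "f (S \<union> set ts) \<in> carrier L" using cubeD(1)[OF f] ts S by auto
  then have "jn (f {} \<sqinter> y) (map (\<lambda>i. f (insert i S) \<sqinter> y) ts) \<sqsubseteq> y"
    using A ts(2) y le_trans[OF _ meet_right[OF \<open>f (S \<union> set ts) \<in> carrier L\<close> y]]
    by (simp add: ind_jn_closed)
  moreover
  have B: "ind (f {}) (map (\<lambda>i. f {i}) ss)" "jn (f {}) (map (\<lambda>i. f {i}) ss) \<sqsubseteq> f S"
    using cube_ind[OF f ss(1)] ss S by auto
  have c: "f S \<in> carrier L" "f {} \<in> carrier L" using cubeD(1)[OF f] S by auto
  have "jn (f {}) (map (\<lambda>i. f {i}) ss) \<sqinter> y \<sqsubseteq> f S \<sqinter> y" using B c y by (intro meet_mono) auto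
  then have "jn (f {}) (map (\<lambda>i. f {i}) ss) \<sqinter> y \<sqsubseteq> f {}"
    unfolding S(2) using B(1) c y by (meson ind_jn_closed le_trans meet_closed meet_left)
  note C = ind_join_lift[OF B(1) y this]
  ultimately show ?thesis using A C len ts
    by (intro exI[of _ "map (\<lambda>i. f (insert i S) \<sqinter> y) ts"] exI[of _ "map (\<lambda>c. c \<squnion> y) (map (\<lambda>i. f {i}) ss)"]) auto
qed

end

lemma strict_cube_map:
  assumes "strict_cube L n f"
    and "\<And>S. S \<subseteq> {1..n} \<Longrightarrow> h (f S) \<in> carrier M"
    and "\<And>S T. S \<subseteq> {1..n} \<Longrightarrow> T \<subseteq> {1..n} \<Longrightarrow> h (f S) = h (f T) \<Longrightarrow> f S = f T"
    and "\<And>S T. S \<subseteq> {1..n} \<Longrightarrow> T \<subseteq> {1..n} \<Longrightarrow> h (f S \<squnion>\<^bsub>L\<^esub> f T) = h (f S) \<squnion>\<^bsub>M\<^esub> h (f T)"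
    and "\<And>S T. S \<subseteq> {1..n} \<Longrightarrow> T \<subseteq> {1..n} \<Longrightarrow> h (f S \<sqinter>\<^bsub>L\<^esub> f T) = h (f S) \<sqinter>\<^bsub>M\<^esub> h (f T)"
  shows "strict_cube M n (h \<circ> f)"
proof -
  have i: "inj_on f (Pow {1..n})" and u: "\<And>S T. S \<subseteq> {1..n} \<Longrightarrow> T \<subseteq> {1..n} \<Longrightarrow>
     f (S \<union> T) = f S \<squnion>\<^bsub>L\<^esub> f T \<and> f (S \<inter> T) = f S \<sqinter>\<^bsub>L\<^esub> f T"
    using assms(1) unfolding strict_cube_def by auto
  have "inj_on (h \<circ> f) (Pow {1..n})"
  proof (rule inj_onI)
    fix S T assume "S \<in> Pow {1..n}" "T \<in> Pow {1..n}" "(h \<circ> f) S = (h \<circ> f) T"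
    then show "S = T" using assms(3)[of S T] inj_onD[OF i, of S T] by simp
  qed
  moreover have "h \<circ> f \<in> Pow {1..n} \<rightarrow> carrier M" using assms(2) by auto
  ultimately show ?thesis unfolding strict_cube_def using u assms(4,5) by simp
qed

lemma rk0_ge: "strict_cube L n f \<Longrightarrow> enat n \<le> rk0 L"
  unfolding rk0_def by (intro Sup_upper) blast

lemma (in modular_lattice) rk_bot_attained:
  assumes "rk_bot L = enat d"
  obtains as where "ind \<bottom> as" "length as = d"
proof -
  let ?A = "{enat n | n. \<exists>f. strict_cube L n f \<and> f {} = \<bottom>}"
  \<comment> \<open>The zero-dimensional cube makes \<open>?A\<close> nonempty, so that its finite
    supremum is a maximum and is attained; the supremum of the empty set would be 0 by
    default.\<close>
  have "\<exists>f. strict_cube L 0 f \<and> f {} = \<bottom>" using ind_cube[of "\<bottom>" "[]"] by auto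
  then have "?A \<noteq> {}" by blast
  then have "enat d \<in> ?A"
    using assms Max_in[of ?A] unfolding rk_bot_def Sup_enat_def by (simp split: if_splits)
  then obtain f where f: "strict_cube L d f" "f {} = \<bottom>" by auto
  have "set [1..<Suc d] \<subseteq> {1..d}" by auto
  then have "ind \<bottom> (map (\<lambda>i. f {i}) [1..<Suc d])" using cube_ind[OF f(1), of "[1..<Suc d]"] f(2) by simp
  then show ?thesis by (rule that) simp
qed

section \<open>The flattened lattice\<close>

context modular_lattice
begin

lemma bottom_meet_eq [simp]: "x \<in> carrier L \<Longrightarrow> \<bottom> \<sqinter> x = \<bottom>" "x \<in> carrier L \<Longrightarrow> x \<sqinter> \<bottom> = \<bottom>"
  by (simp_all add: meet_absorb1 meet_absorb2)

lemma bottom_join_eq [simp]: "x \<in> carrier L \<Longrightarrow> \<bottom> \<squnion> x = x" "x \<in> carrier L \<Longrightarrow> x \<squnion> \<bottom> = x"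
  by (simp_all add: join_absorb1 join_absorb2)

lemma ind_bottom_Cons: "ind \<bottom> (a # as) \<longleftrightarrow> a \<in> carrier L \<and> a \<noteq> \<bottom> \<and> a \<sqinter> jn \<bottom> as = \<bottom> \<and> ind \<bottom> as"
  by auto

text \<open>The lattice form of an essential submodule. The condition
  \<open>a' \<sqsubseteq> a\<close> is not built in and is supplied where it is used.\<close>

definition essential :: "'a \<Rightarrow> 'a \<Rightarrow> bool" where
  "essential a' a \<longleftrightarrow> (\<forall>z\<in>carrier L. z \<sqsubseteq> a \<and> z \<noteq> \<bottom> \<longrightarrow> z \<sqinter> a' \<noteq> \<bottom>)"

text \<open>If \<open>z\<close> met \<open>a' \<squnion> b\<close> trivially, its projection to
  \<open>a\<close> along \<open>b\<close> would either vanish, forcing \<open>z\<close> below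
  \<open>b\<close>, or meet \<open>a'\<close>, against
  \<open>a' \<sqinter> (b \<squnion> z) = \<bottom>\<close>.\<close>

lemma essential_join:
  assumes c: "a' \<in> carrier L" "a \<in> carrier L" "b \<in> carrier L"
    and "a' \<sqsubseteq> a" "essential a' a" "a \<sqinter> b = \<bottom>"
  shows "essential (a' \<squnion> b) (a \<squnion> b)"
  unfolding essential_def
proof (intro ballI impI notI, elim conjE)
  fix z assume z: "z \<in> carrier L" "z \<sqsubseteq> a \<squnion> b" "z \<noteq> \<bottom>" and m: "z \<sqinter> (a' \<squnion> b) = \<bottom>"
  \<comment> \<open>The projection of \<open>z\<close> to \<open>a\<close> along
    \<open>b\<close>.\<close>
  define w where "w = a \<sqinter> (z \<squnion> b)"
  have w: "w \<in> carrier L" "w \<sqsubseteq> a" "w \<sqsubseteq> z \<squnion> b" using c z(1) by (auto simp: w_def intro: meet_left meet_right)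
  have "w \<noteq> \<bottom>"
  proof
    assume "w = \<bottom>"
    have "(b \<squnion> a) \<sqinter> (z \<squnion> b) = b \<squnion> w" unfolding w_def using c z(1) by (intro modular) (auto intro: join_right)
    also have "\<dots> = b" using \<open>w = \<bottom>\<close> c by simp
    finally have "z \<squnion> b = b"
      using meet_absorb2[of "z \<squnion> b" "b \<squnion> a"] join_le[of z "b \<squnion> a" b] join_left[of b a] z c by (simp add: join_comm)
    then have "z \<sqsubseteq> b" using join_left[of z b] z c by simp
    then have "z \<sqsubseteq> a' \<squnion> b" using c z by (intro le_joinI2) auto
    then show False using m z c by (simp add: meet_absorb1)
  qed
  then have ne: "w \<sqinter> a' \<noteq> \<bottom>" using assms(5) w unfolding essential_def by blast
  have "a' \<sqinter> b \<sqsubseteq> a \<sqinter> b" using c assms(4) by (intro meet_mono) auto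
  then have ab: "a' \<sqinter> b = \<bottom>" using assms(6) c le_bot_eq by simp
  have "a' \<sqinter> (b \<squnion> z) = \<bottom>"
    by (rule meet_join_shift) (use c z(1) m ab in \<open>auto simp: meet_comm\<close>)
  moreover have "w \<sqinter> a' \<sqsubseteq> a' \<sqinter> (b \<squnion> z)"
    using w c z(1) by (intro meet_le meet_right meet_leI1) (auto simp: join_comm)
  ultimately show False using ne le_bot_eq[of "w \<sqinter> a'"] w c by simp
qed

lemma essential_trans:
  assumes "a'' \<in> carrier L" "a' \<in> carrier L" "a \<in> carrier L" "a'' \<sqsubseteq> a'" "a' \<sqsubseteq> a" "essential a'' a'" "essential a' a"
  shows "essential a'' a"
  unfolding essential_def
proof (intro ballI impI notI, elim conjE)
  fix z assume z: "z \<in> carrier L" "z \<sqsubseteq> a" "z \<noteq> \<bottom>" "z \<sqinter> a'' = \<bottom>"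
  then have "z \<sqinter> a' \<noteq> \<bottom>" using assms(7) by (auto simp: essential_def)
  then have "(z \<sqinter> a') \<sqinter> a'' \<noteq> \<bottom>" using assms z(1) meet_right[of z a'] by (auto simp: essential_def)
  moreover have "(z \<sqinter> a') \<sqinter> a'' \<sqsubseteq> z \<sqinter> a''" using assms z(1) by (intro meet_mono meet_left) auto
  ultimately show False using z assms le_bot_eq by simp
qed

lemma quasi_atomD:
  assumes "q \<in> quasi_atoms L"
  shows "q \<in> carrier L" "q \<noteq> \<bottom>"
    and "x \<in> carrier L \<Longrightarrow> y \<in> carrier L \<Longrightarrow> x \<noteq> \<bottom> \<Longrightarrow> x \<sqsubseteq> q \<Longrightarrow> y \<noteq> \<bottom> \<Longrightarrow> y \<sqsubseteq> q \<Longrightarrow> x \<sqinter> y \<noteq> \<bottom>"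
  using assms unfolding quasi_atoms_def by blast+

text \<open>Inside a quasi-atom every nonzero element is essential, in particular
  \<open>q \<sqinter> x\<close>. Essentiality passes to independent joins, so \<open>x\<close> meets
  every nonzero element below the join of the quasi-atoms.\<close>

lemma essential_quasi_atoms:
  assumes "ind \<bottom> qs" "set qs \<subseteq> flat_V L x" "x \<in> carrier L"
  shows "essential (jn \<bottom> qs \<sqinter> x) (jn \<bottom> qs)"
  using assms(1,2)
proof (induction qs)
  case Nil
  then show ?case by (auto simp: essential_def dest: le_bot_eq)
next
  case (Cons q qs)
  define J where "J = jn \<bottom> qs"
  have IH: "essential (J \<sqinter> x) J" using Cons by (simp add: J_def)
  have q: "q \<in> quasi_atoms L" "q \<sqinter> x \<noteq> \<bottom>" using Cons.prems by (auto simp: flat_V_def)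
  note qc = quasi_atomD[OF q(1)]
  have J: "J \<in> carrier L" "q \<sqinter> J = \<bottom>" using Cons.prems by (auto simp: J_def)
  note c = qc(1) J(1) assms(3)
  have "essential (q \<sqinter> x) q"
    unfolding essential_def using qc(3)[of _ "q \<sqinter> x"] q c meet_left by auto
  \<comment> \<open>The two summands are shrunk one after the other, since
    \<open>essential_join\<close> varies only one side; \<open>3\<close> composes the two
    steps.\<close>
  then have 1: "essential ((q \<sqinter> x) \<squnion> J) (q \<squnion> J)"
    using c J by (intro essential_join) (auto intro: meet_left)
  have "(q \<sqinter> x) \<sqinter> J \<sqsubseteq> q \<sqinter> J" using c by (intro meet_mono meet_left) auto
  then have "J \<sqinter> (q \<sqinter> x) = \<bottom>" using J c le_bot_eq by (simp add: meet_comm)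
  then have 2: "essential ((J \<sqinter> x) \<squnion> (q \<sqinter> x)) (J \<squnion> (q \<sqinter> x))"
    using c IH by (intro essential_join) (auto intro: meet_left)
  have 3: "essential ((J \<sqinter> x) \<squnion> (q \<sqinter> x)) (q \<squnion> J)"
  proof (rule essential_trans[OF _ _ _ _ _ 2])
    show "(J \<sqinter> x) \<squnion> (q \<sqinter> x) \<sqsubseteq> J \<squnion> (q \<sqinter> x)" using c by (intro join_mono meet_left) auto
    show "J \<squnion> (q \<sqinter> x) \<sqsubseteq> q \<squnion> J" unfolding join_comm[of _ q] using c by (intro join_mono meet_left) auto
    show "essential (J \<squnion> (q \<sqinter> x)) (q \<squnion> J)" using 1 by (simp add: join_comm)
  qed (use c in auto)
  have "(J \<sqinter> x) \<squnion> (q \<sqinter> x) \<sqsubseteq> (q \<squnion> J) \<sqinter> x"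
    using c by (intro join_le meet_mono join_left join_right meet_closed join_closed) auto
  then have "z \<sqinter> ((J \<sqinter> x) \<squnion> (q \<sqinter> x)) \<sqsubseteq> z \<sqinter> ((q \<squnion> J) \<sqinter> x)" if "z \<in> carrier L" for z
    using c that by (intro meet_mono) auto
  then have "essential ((q \<squnion> J) \<sqinter> x) (q \<squnion> J)"
    using 3 c unfolding essential_def by (metis le_bot_eq join_closed meet_closed)
  then show ?case by (simp add: J_def)
qed

lemma Sup_list_join: "as \<noteq> [] \<Longrightarrow> set as \<subseteq> carrier L \<Longrightarrow> \<Squnion>\<^bsub>L\<^esub> (set as) = jn \<bottom> as"
proof (rule least_unique)
  assume a: "as \<noteq> []" "set as \<subseteq> carrier L"
  show "least L (\<Squnion>\<^bsub>L\<^esub> (set as)) (Upper L (set as))" by (rule finite_sup_least) (use a in auto)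
  show "least L (jn \<bottom> as) (Upper L (set as))"
  proof (rule least_UpperI)
    fix y assume "y \<in> Upper L (set as)"
    then have "y \<in> carrier L" "\<And>x. x \<in> set as \<Longrightarrow> x \<sqsubseteq> y" using a unfolding Upper_def by auto
    then show "jn \<bottom> as \<sqsubseteq> y" using a by (intro jn_le) auto
  qed (use a jn_ge_mem[OF bottom_closed] in auto)
qed

text \<open>The defining condition of \<open>qa_indep\<close> tests each member against the
  preceding ones, while \<open>indep_list\<close> tests it against the later ones; hence the
  reversal.\<close>

lemma ind_rev_iff:
  "set qs \<subseteq> quasi_atoms L \<Longrightarrow> ind \<bottom> (rev qs) \<longleftrightarrow>
     (\<forall>i. 0 < i \<and> i < length qs \<longrightarrow> (\<Squnion>\<^bsub>L\<^esub> (set (take i qs))) \<sqinter> (qs ! i) = \<bottom>)"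
proof (induction qs rule: rev_induct)
  case (snoc q qs)
  have q: "q \<in> carrier L" "q \<noteq> \<bottom>" "set qs \<subseteq> carrier L" using snoc.prems quasi_atomD by auto
  have jr: "jn \<bottom> (rev qs) = (if qs = [] then \<bottom> else \<Squnion>\<^bsub>L\<^esub> (set qs))"
    using Sup_list_join[of "rev qs"] q by simp
  have "(\<forall>i. 0 < i \<and> i < length (qs @ [q]) \<longrightarrow> (\<Squnion>\<^bsub>L\<^esub> (set (take i (qs @ [q])))) \<sqinter> ((qs @ [q]) ! i) = \<bottom>)
      \<longleftrightarrow> (\<forall>i. 0 < i \<and> i < length qs \<longrightarrow> (\<Squnion>\<^bsub>L\<^esub> (set (take i qs))) \<sqinter> (qs ! i) = \<bottom>)
        \<and> (qs \<noteq> [] \<longrightarrow> (\<Squnion>\<^bsub>L\<^esub> (set qs)) \<sqinter> q = \<bottom>)"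
    by (auto simp: nth_append less_Suc_eq)
  then show ?case using snoc q jr by (auto simp: meet_comm[of _ q])
qed simp

lemma qa_indep_iff:
  "qa_indep L T \<longleftrightarrow> (\<exists>qs. set qs = T \<and> T \<subseteq> quasi_atoms L \<and> ind \<bottom> qs)"
proof
  assume "qa_indep L T"
  then obtain qs where "distinct qs" "set qs = T" "T \<subseteq> quasi_atoms L"
     "\<forall>i. 0 < i \<and> i < length qs \<longrightarrow> (\<Squnion>\<^bsub>L\<^esub> (set (take i qs))) \<sqinter> (qs ! i) = \<bottom>"
    unfolding qa_indep_def by blast
  then show "\<exists>qs. set qs = T \<and> T \<subseteq> quasi_atoms L \<and> ind \<bottom> qs"
    using ind_rev_iff[of qs] by (intro exI[of _ "rev qs"]) auto
next
  assume "\<exists>qs. set qs = T \<and> T \<subseteq> quasi_atoms L \<and> ind \<bottom> qs"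
  then obtain qs where qs: "set qs = T" "T \<subseteq> quasi_atoms L" "ind \<bottom> qs" by blast
  then show "qa_indep L T"
    unfolding qa_indep_def using ind_rev_iff[of "rev qs"] ind_distinct[OF qs(3)]
    by (intro exI[of _ "rev qs"]) auto
qed

text \<open>Permutation invariance turns the existential choice of an enumeration into a test on any
  given distinct one.\<close>

lemma qa_indep_set: "set qs \<subseteq> quasi_atoms L \<Longrightarrow> distinct qs \<Longrightarrow> qa_indep L (set qs) \<longleftrightarrow> ind \<bottom> qs"
proof -
  assume q: "set qs \<subseteq> quasi_atoms L" "distinct qs"
  show ?thesis
  proof
    assume "qa_indep L (set qs)"
    then obtain ps where ps: "set ps = set qs" "ind \<bottom> ps" unfolding qa_indep_iff by blast
    then have "mset ps = mset qs" using q ind_distinct[OF ps(2)] by (simp add: set_eq_iff_mset_eq_distinct)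
    then show "ind \<bottom> qs" using ps(2) ind_perm by blast
  qed (use q qa_indep_iff in blast)
qed

text \<open>If \<open>q\<close> depends on an independent set \<open>T\<close> inside
  \<open>V(x)\<close>, then \<open>q\<close> meets the join of \<open>T\<close>. Since
  \<open>x\<close> meets every nonzero element below that join, \<open>q\<close> meets
  \<open>x\<close> as well.\<close>

lemma flat_V_closed:
  assumes x: "x \<in> carrier L"
  shows "flat_V L x \<in> carrier (flat_lattice L)"
proof -
  have "qa_closure L (flat_V L x) = flat_V L x"
  proof (intro equalityI subsetI)
    fix q assume q: "q \<in> flat_V L x"
    then have "q \<in> quasi_atoms L" by (simp add: flat_V_def)
    then have "qa_indep L {q}" using qa_indep_set[of "[q]"] quasi_atomD[of q] by (simp add: ind_bottom_Cons)
    then show "q \<in> qa_closure L (flat_V L x)" unfolding qa_closure_def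
      using q \<open>q \<in> quasi_atoms L\<close> by (intro CollectI conjI exI[of _ "{q}"]) auto
  next
    fix q assume "q \<in> qa_closure L (flat_V L x)"
    then obtain T where q: "q \<in> quasi_atoms L" and T: "finite T" "T \<subseteq> flat_V L x" "qa_indep L T"
      "q \<in> T \<or> \<not> qa_indep L (insert q T)" unfolding qa_closure_def by blast
    note qc = quasi_atomD[OF q]
    obtain ts where ts: "set ts = T" "T \<subseteq> quasi_atoms L" "ind \<bottom> ts" using T(3) unfolding qa_indep_iff by blast
    show "q \<in> flat_V L x"
    proof (cases "q \<in> T")
      case False
      then have "\<not> ind \<bottom> (q # ts)" using T(4) qa_indep_set[of "q # ts"] ts q ind_distinct[OF ts(3)] by auto
      then have ne: "q \<sqinter> jn \<bottom> ts \<noteq> \<bottom>" using ts qc by (auto simp: ind_bottom_Cons)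
      have J: "jn \<bottom> ts \<in> carrier L" using ts by simp
      have "essential (jn \<bottom> ts \<sqinter> x) (jn \<bottom> ts)" by (rule essential_quasi_atoms) (use ts T x in auto)
      then have "(q \<sqinter> jn \<bottom> ts) \<sqinter> (jn \<bottom> ts \<sqinter> x) \<noteq> \<bottom>"
        using ne qc J unfolding essential_def by (simp add: meet_right)
      moreover have "(q \<sqinter> jn \<bottom> ts) \<sqinter> (jn \<bottom> ts \<sqinter> x) \<sqsubseteq> q \<sqinter> x"
        using qc J x by (intro meet_mono meet_left meet_right) auto
      ultimately have "q \<sqinter> x \<noteq> \<bottom>" using qc J x le_bot_eq by auto
      then show ?thesis using q by (simp add: flat_V_def)
    qed (use T in auto)
  qed
  then show ?thesis by (auto simp: flat_lattice_def flat_V_def)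
qed

text \<open>The nonzero elements below a quasi-atom are closed under meets, so
  \<open>q \<sqinter> x\<close> and \<open>q \<sqinter> y\<close> cannot be disjoint once both are
  nonzero.\<close>

lemma flat_V_meet:
  assumes "x \<in> carrier L" "y \<in> carrier L"
  shows "flat_V L x \<inter> flat_V L y = flat_V L (x \<sqinter> y)"
proof (intro equalityI subsetI)
  fix q assume "q \<in> flat_V L x \<inter> flat_V L y"
  then have q: "q \<in> quasi_atoms L" "q \<sqinter> x \<noteq> \<bottom>" "q \<sqinter> y \<noteq> \<bottom>" by (auto simp: flat_V_def)
  note qc = quasi_atomD[OF q(1)]
  have "(q \<sqinter> x) \<sqinter> (q \<sqinter> y) \<noteq> \<bottom>" by (rule qc(3)) (use q qc assms in \<open>auto intro: meet_left\<close>)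
  moreover have "(q \<sqinter> x) \<sqinter> (q \<sqinter> y) \<sqsubseteq> q \<sqinter> (x \<sqinter> y)"
    using qc assms by (intro meet_le meet_leI1[OF meet_left] meet_mono meet_right) auto
  ultimately have "q \<sqinter> (x \<sqinter> y) \<noteq> \<bottom>" using qc assms le_bot_eq by auto
  then show "q \<in> flat_V L (x \<sqinter> y)" using q by (simp add: flat_V_def)
next
  fix q assume "q \<in> flat_V L (x \<sqinter> y)"
  then have q: "q \<in> quasi_atoms L" "q \<sqinter> (x \<sqinter> y) \<noteq> \<bottom>" by (auto simp: flat_V_def)
  note qc = quasi_atomD[OF q(1)]
  have "q \<sqinter> (x \<sqinter> y) \<sqsubseteq> q \<sqinter> x" "q \<sqinter> (x \<sqinter> y) \<sqsubseteq> q \<sqinter> y"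
    using qc assms by (auto intro!: meet_mono meet_left meet_right)
  then have "q \<sqinter> x \<noteq> \<bottom>" "q \<sqinter> y \<noteq> \<bottom>" using q qc assms le_bot_eq by auto
  then show "q \<in> flat_V L x \<inter> flat_V L y" using q by (simp add: flat_V_def)
qed

lemma flat_V_mono:
  assumes "x \<in> carrier L" "y \<in> carrier L" "x \<sqsubseteq> y"
  shows "flat_V L x \<subseteq> flat_V L y"
  using flat_V_meet[of x y] meet_absorb1[of x y] assms by auto

lemma flat_V_bottom: "flat_V L \<bottom> = {}"
  by (auto simp: flat_V_def quasi_atoms_def)

text \<open>An entry that is not a quasi-atom contains two nonzero elements with meet
  \<open>\<bottom>\<close>. Replacing it by these two would give a longer independent list below
  \<open>y\<close>.\<close>

lemma maximal_ind_quasi_atoms: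
  assumes "ind \<bottom> as" "jn \<bottom> as \<sqsubseteq> y" "y \<in> carrier L"
    and max: "\<And>bs. ind \<bottom> bs \<Longrightarrow> jn \<bottom> bs \<sqsubseteq> y \<Longrightarrow> length bs \<le> length as"
  shows "set as \<subseteq> quasi_atoms L"
proof
  fix a assume a: "a \<in> set as"
  then obtain xs ys where as: "as = xs @ a # ys" by (meson split_list)
  define J where "J = jn \<bottom> (xs @ ys)"
  have i: "ind \<bottom> (a # xs @ ys)" using assms(1) unfolding as ind_middle .
  then have J: "J \<in> carrier L" "a \<sqinter> J = \<bottom>" "a \<in> carrier L" "a \<noteq> \<bottom>" "ind \<bottom> (xs @ ys)" by (auto simp: J_def)
  have "set xs \<subseteq> carrier L" "set ys \<subseteq> carrier L" using indD(2)[OF assms(1)] as by auto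
  then have le: "a \<squnion> J \<sqsubseteq> y" using assms(2) J unfolding as by (simp add: jn_middle J_def)
  show "a \<in> quasi_atoms L"
  proof (rule ccontr)
    assume "a \<notin> quasi_atoms L"
    then obtain u v where uv: "u \<in> carrier L" "v \<in> carrier L" "u \<noteq> \<bottom>" "u \<sqsubseteq> a" "v \<noteq> \<bottom>" "v \<sqsubseteq> a" "u \<sqinter> v = \<bottom>"
      using J unfolding quasi_atoms_def by blast
    have "v \<sqinter> J \<sqsubseteq> a \<sqinter> J" using uv J by (intro meet_mono) auto
    then have v: "v \<sqinter> J = \<bottom>" using J uv le_bot_eq by simp
    have "(u \<squnion> v) \<sqinter> J \<sqsubseteq> a \<sqinter> J" using uv J by (intro meet_mono join_le) auto
    then have "(u \<squnion> v) \<sqinter> J = \<bottom>" using J uv le_bot_eq by simp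
    then have "u \<sqinter> (v \<squnion> J) = \<bottom>" using uv J by (intro meet_join_shift) auto
    then have "ind \<bottom> (u # v # xs @ ys)" using v uv J by (simp add: J_def)
    moreover have "jn \<bottom> (u # v # xs @ ys) \<sqsubseteq> y"
    proof -
      have "u \<squnion> (v \<squnion> J) \<sqsubseteq> a \<squnion> J" using uv J by (intro join_le le_joinI1 join_right) auto
      then show ?thesis using le uv J assms(3) le_trans[of "u \<squnion> (v \<squnion> J)" "a \<squnion> J" y] by (simp add: J_def[symmetric])
    qed
    ultimately have "length (u # v # xs @ ys) \<le> length as" by (rule max)
    then show False unfolding as by simp
  qed
qed

text \<open>Every strict step of closed sets offers a quasi-atom outside the closure of the smaller
  set, which extends the independent list found so far. A chain with \<open>k\<close> steps thus
  yields \<open>k\<close> independent quasi-atoms in \<open>V(y)\<close>.\<close>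

lemma flat_chain_le:
  assumes y: "y \<in> carrier L"
    and max: "\<And>bs. ind \<bottom> bs \<Longrightarrow> jn \<bottom> bs \<sqsubseteq> y \<Longrightarrow> length bs \<le> r"
    and c: "\<forall>i\<le>k. c i \<in> carrier (flat_lattice L) \<and> c i \<subseteq> flat_V L y" "\<forall>i<k. c i \<subset> c (Suc i)"
  shows "k \<le> r"
proof -
  have "\<exists>qs. length qs = i \<and> ind \<bottom> qs \<and> set qs \<subseteq> c i" if "i \<le> k" for i
    using that
  proof (induction i)
    case 0
    then show ?case by simp
  next
    case (Suc i)
    then obtain qs where qs: "length qs = i" "ind \<bottom> qs" "set qs \<subseteq> c i" by auto
    obtain q where q: "q \<in> c (Suc i)" "q \<notin> c i" using c(2) Suc.prems by (meson Suc_le_eq psubsetE subsetI)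
    have cl: "c i \<subseteq> quasi_atoms L" "qa_closure L (c i) = c i" "c (Suc i) \<subseteq> quasi_atoms L"
      using c(1) Suc.prems by (auto simp: flat_lattice_def)
    have "q \<notin> qa_closure L (c i)" using q cl by simp
    moreover have "qa_indep L (set qs)" using qs cl unfolding qa_indep_iff by blast
    ultimately have "q \<notin> set qs \<and> qa_indep L (insert q (set qs))"
      using q cl qs unfolding qa_closure_def by blast
    then have "ind \<bottom> (q # qs)" using qa_indep_set[of "q # qs"] q cl qs ind_distinct[OF qs(2)] by auto
    moreover have "c i \<subseteq> c (Suc i)" using c(2) Suc.prems by (simp add: less_imp_le)
    ultimately show ?case using qs q by (intro exI[of _ "q # qs"]) auto
  qed
  then obtain qs where qs: "length qs = k" "ind \<bottom> qs" "set qs \<subseteq> c k" by blast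
  have V: "set qs \<subseteq> flat_V L y" using qs c(1) by blast
  \<comment> \<open>A member of \<open>V(y)\<close> meets \<open>y\<close> but need not lie below
    it. Cutting with \<open>y\<close> repairs this, keeps the entries nonzero and preserves
    independence by \<open>ind_shrink\<close>.\<close>
  define ps where "ps = map (\<lambda>q. q \<sqinter> y) qs"
  have "list_all2 (\<lambda>a' a. a' \<in> carrier L \<and> \<bottom> \<sqsubseteq> a' \<and> a' \<noteq> \<bottom> \<and> a' \<sqsubseteq> a) ps qs"
    unfolding ps_def list_all2_map1
    by (rule list.rel_refl_strong) (use V y indD(2)[OF qs(2)] in \<open>auto simp: flat_V_def intro: meet_left\<close>)
  then have "ind \<bottom> ps" using ind_shrink qs(2) by blast
  moreover have "jn \<bottom> ps \<sqsubseteq> y" unfolding ps_def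
    by (rule jn_le) (use y indD(2)[OF qs(2)] in \<open>auto intro: meet_right\<close>)
  ultimately have "length ps \<le> r" by (rule max)
  then show ?thesis by (simp add: ps_def qs(1))
qed

text \<open>Adding a quasi-atom \<open>q\<close> independent of \<open>J\<close> enlarges
  \<open>V(J)\<close> strictly, because \<open>q\<close> belongs to \<open>V(q \<squnion> J)\<close>
  but not to \<open>V(J)\<close>.\<close>

lemma flat_chain_to:
  assumes "ind \<bottom> qs" "set qs \<subseteq> quasi_atoms L" "jn \<bottom> qs \<sqsubseteq> y" "y \<in> carrier L"
  shows "chain_to ((flat_lattice L)\<lparr>carrier := {z \<in> carrier (flat_lattice L). z \<sqsubseteq>\<^bsub>flat_lattice L\<^esub> flat_V L y}\<rparr>)
    (length qs) (flat_V L (jn \<bottom> qs))"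
  using assms(1-3)
proof (induction qs)
  case Nil
  then show ?case
    using flat_V_closed[OF bottom_closed] by (auto intro!: chain_to_0 simp: flat_lattice_def flat_V_bottom)
next
  case (Cons q qs)
  have c: "q \<in> carrier L" "jn \<bottom> qs \<in> carrier L" "q \<sqinter> jn \<bottom> qs = \<bottom>" "q \<noteq> \<bottom>" using Cons.prems by auto
  have le: "jn \<bottom> qs \<sqsubseteq> q \<squnion> jn \<bottom> qs" "q \<sqsubseteq> q \<squnion> jn \<bottom> qs" using c by (auto intro: join_left join_right)
  have V: "flat_V L (jn \<bottom> qs) \<subseteq> flat_V L (q \<squnion> jn \<bottom> qs)" "flat_V L (q \<squnion> jn \<bottom> qs) \<subseteq> flat_V L y"
    using flat_V_mono[OF c(2) _ le(1)] flat_V_mono[of "q \<squnion> jn \<bottom> qs" y] c(1,2) Cons.prems assms(4) by auto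
  have "q \<in> flat_V L (q \<squnion> jn \<bottom> qs)" "q \<notin> flat_V L (jn \<bottom> qs)"
    using c le Cons.prems meet_absorb1[of q "q \<squnion> jn \<bottom> qs"] by (auto simp: flat_V_def)
  then have ne: "flat_V L (jn \<bottom> qs) \<noteq> flat_V L (q \<squnion> jn \<bottom> qs)" by blast
  have "jn \<bottom> qs \<sqsubseteq> y" using c Cons.prems assms(4) le le_trans[of "jn \<bottom> qs" "q \<squnion> jn \<bottom> qs" y] by simp
  then have "chain_to ((flat_lattice L)\<lparr>carrier := {z \<in> carrier (flat_lattice L). z \<sqsubseteq>\<^bsub>flat_lattice L\<^esub> flat_V L y}\<rparr>)
    (length qs) (flat_V L (jn \<bottom> qs))" using Cons by auto
  then show ?case
    unfolding list.size list_join.simps add_Suc_right add_0_right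
    by (rule chain_to_Suc) (use ne V flat_V_closed[of "q \<squnion> jn \<bottom> qs"] c in \<open>auto simp: lless_def flat_lattice_def\<close>)
qed

text \<open>The bridge from lattice rank to flattened length: a longest independent list consists of
  quasi-atoms and hence gives a chain of closed sets, while any chain gives back an independent list
  below \<open>y\<close>.\<close>

lemma flat_elt_length:
  assumes y: "y \<in> carrier L"
    and as: "ind \<bottom> as" "jn \<bottom> as \<sqsubseteq> y" "length as = r"
    and max: "\<And>bs. ind \<bottom> bs \<Longrightarrow> jn \<bottom> bs \<sqsubseteq> y \<Longrightarrow> length bs \<le> r"
  shows "elt_length (flat_lattice L) (flat_V L y) = enat r"
  unfolding elt_length_def
proof (rule antisym)
  have "set as \<subseteq> quasi_atoms L" by (rule maximal_ind_quasi_atoms[OF as(1,2) y]) (use max as in auto)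
  from chain_to_poset_length[OF flat_chain_to[OF as(1) this as(2) y]]
  show "enat r \<le> poset_length (flat_lattice L\<lparr>carrier := {z \<in> carrier (flat_lattice L). z \<sqsubseteq>\<^bsub>flat_lattice L\<^esub> flat_V L y}\<rparr>)"
    using as(3) by simp
  show "poset_length (flat_lattice L\<lparr>carrier := {z \<in> carrier (flat_lattice L). z \<sqsubseteq>\<^bsub>flat_lattice L\<^esub> flat_V L y}\<rparr>) \<le> enat r"
  proof (rule poset_length_le)
    fix k c assume c: "\<forall>i\<le>k. c i \<in> carrier (flat_lattice L\<lparr>carrier := {z \<in> carrier (flat_lattice L). z \<sqsubseteq>\<^bsub>flat_lattice L\<^esub> flat_V L y}\<rparr>)"
      "\<forall>i<k. c i \<sqsubset>\<^bsub>flat_lattice L\<lparr>carrier := {z \<in> carrier (flat_lattice L). z \<sqsubseteq>\<^bsub>flat_lattice L\<^esub> flat_V L y}\<rparr>\<^esub> c (Suc i)"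
    show "k \<le> r"
      by (rule flat_chain_le[OF y max, where c = c]) (use c in \<open>auto simp: lless_def flat_lattice_def\<close>)
  qed
qed

lemma flat_V_top: "flat_V L \<top> = quasi_atoms L"
proof -
  have "q \<sqinter> \<top> = q" if "q \<in> quasi_atoms L" for q
    using quasi_atomD(1)[OF that] by (simp add: meet_absorb1)
  then show ?thesis using quasi_atomD(2) by (auto simp: flat_V_def)
qed

lemma flat_length:
  assumes "ind \<bottom> as" and "\<And>bs. ind \<bottom> bs \<Longrightarrow> length bs \<le> length as"
  shows "poset_length (flat_lattice L) = enat (length as)"
proof -
  have "elt_length (flat_lattice L) (flat_V L \<top>) = enat (length as)"
    by (rule flat_elt_length[OF top_closed assms(1)]) (use assms in auto)
  moreover have "{z \<in> carrier (flat_lattice L). z \<sqsubseteq>\<^bsub>flat_lattice L\<^esub> flat_V L \<top>} = carrier (flat_lattice L)"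
    unfolding flat_V_top by (auto simp: flat_lattice_def)
  ultimately show ?thesis by (simp add: elt_length_def)
qed

lemma chain_to_jn: "ind b as \<Longrightarrow> chain_to L (length as) (jn b as)"
proof (induction as)
  case (Cons a as)
  then have c: "a \<in> carrier L" "jn b as \<in> carrier L" "a \<sqinter> jn b as = b" "a \<noteq> b" by auto
  have "jn b as \<noteq> a \<squnion> jn b as"
    using join_left[of a "jn b as"] meet_absorb1[of a "jn b as"] c by auto
  then have "jn b as \<sqsubset> a \<squnion> jn b as" using c by (simp add: lless_eq join_right)
  then show ?case using Cons c by (auto intro: chain_to_Suc)
qed (simp add: chain_to_0)

text \<open>The joins of the tails already form a chain with \<open>d\<close> steps; if it stopped
  short of \<open>\<top>\<close>, one further step would exceed the length.\<close>

lemma ind_length_top: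
  assumes "poset_length L = enat d" "ind \<bottom> ss" "length ss = d"
  shows "jn \<bottom> ss = \<top>"
proof (rule ccontr)
  assume "jn \<bottom> ss \<noteq> \<top>"
  then have "jn \<bottom> ss \<sqsubset> \<top>" using assms(2) by (simp add: lless_eq)
  then have "chain_to L (Suc d) \<top>" using chain_to_jn[OF assms(2)] assms(3) by (auto intro: chain_to_Suc)
  then show False using chain_to_poset_length assms(1) by fastforce
qed

text \<open>An element strictly between \<open>\<bottom>\<close> and \<open>s\<close> could replace
  \<open>s\<close> in the list. The chain of the new list would end strictly below
  \<open>s \<squnion> J\<close>, leaving room for a step number \<open>d + 1\<close>.\<close>

lemma ind_length_atom:
  assumes "poset_length L = enat d" "ind \<bottom> ss" "length ss = d" "s \<in> set ss"
    and t: "t \<in> carrier L" "t \<sqsubseteq> s"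
  shows "t = \<bottom> \<or> t = s"
proof (rule ccontr)
  assume n: "\<not> (t = \<bottom> \<or> t = s)"
  obtain xs ys where ss: "ss = xs @ s # ys" using assms(4) by (meson split_list)
  define J where "J = jn \<bottom> (xs @ ys)"
  have i: "ind \<bottom> (s # xs @ ys)" using assms(2) unfolding ss ind_middle .
  then have J: "J \<in> carrier L" "s \<sqinter> J = \<bottom>" "s \<in> carrier L" "ind \<bottom> (xs @ ys)" by (auto simp: J_def)
  have "t \<sqinter> J \<sqsubseteq> s \<sqinter> J" using t J by (intro meet_mono) auto
  then have tJ: "t \<sqinter> J = \<bottom>" using t J le_bot_eq by simp
  have it: "ind \<bottom> (t # xs @ ys)" using tJ n t J by (simp add: J_def)
  have ne: "t \<squnion> J \<noteq> s \<squnion> J"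
  proof
    assume e: "t \<squnion> J = s \<squnion> J"
    have "(t \<squnion> J) \<sqinter> s = t \<squnion> (J \<sqinter> s)" using t J by (intro modular) auto
    then have "(s \<squnion> J) \<sqinter> s = t" using t J e by (simp add: meet_comm)
    then show False using n J meet_absorb2[of s "s \<squnion> J"] by (simp add: join_left)
  qed
  have "t \<squnion> J \<sqsubset> s \<squnion> J" using ne t J by (simp add: lless_eq join_mono)
  then have "chain_to L (Suc (length (t # xs @ ys))) (s \<squnion> J)"
    by (intro chain_to_Suc[OF chain_to_jn[OF it]]) (use J in \<open>auto simp: J_def\<close>)
  moreover have "length (t # xs @ ys) = d" using assms(3) ss by simp
  ultimately show False using chain_to_poset_length[of L "Suc d"] assms(1) by simp
qed

end

text \<open>Independent quasi-atoms stay independent in the flattening because \<open>V\<close>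
  preserves meets and \<open>V(\<bottom>)\<close> is empty. Only an upper bound for the join of the
  images is carried through the induction; this is enough to keep the next meet trivial.\<close>

lemma flat_ind_image:
  assumes "modular_lattice L" "modular_lattice M" and h: "poset_iso (flat_lattice L) M h"
  shows "indep_list L \<bottom>\<^bsub>L\<^esub> qs \<Longrightarrow> set qs \<subseteq> quasi_atoms L \<Longrightarrow>
    indep_list M \<bottom>\<^bsub>M\<^esub> (map (\<lambda>q. h (flat_V L q)) qs) \<and>
    list_join M \<bottom>\<^bsub>M\<^esub> (map (\<lambda>q. h (flat_V L q)) qs) \<sqsubseteq>\<^bsub>M\<^esub> h (flat_V L (list_join L \<bottom>\<^bsub>L\<^esub> qs))"
proof (induction qs)
  interpret L: modular_lattice L by fact
  interpret M: modular_lattice M by fact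
  note hc = poset_iso_closed[OF h L.flat_V_closed]
  {
    case Nil
    then show ?case using hc by simp
  next
    case (Cons q qs)
    define J where "J = list_join L \<bottom>\<^bsub>L\<^esub> qs"
    define K where "K = list_join M \<bottom>\<^bsub>M\<^esub> (map (\<lambda>q. h (flat_V L q)) qs)"
    have IH: "indep_list M \<bottom>\<^bsub>M\<^esub> (map (\<lambda>q. h (flat_V L q)) qs)" "K \<sqsubseteq>\<^bsub>M\<^esub> h (flat_V L J)"
      using Cons by (auto simp: J_def K_def)
    have q: "q \<in> carrier L" "J \<in> carrier L" "q \<sqinter>\<^bsub>L\<^esub> J = \<bottom>\<^bsub>L\<^esub>" "q \<noteq> \<bottom>\<^bsub>L\<^esub>" "q \<in> quasi_atoms L"
      using Cons.prems by (auto simp: J_def)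
    have K: "K \<in> carrier M" using IH by (simp add: K_def)
    have VV: "flat_V L q \<inter> flat_V L J = {}" using L.flat_V_meet[OF q(1,2)] q(3) L.flat_V_bottom by simp
    obtain e where e: "e \<in> carrier (flat_lattice L)" "h e = \<bottom>\<^bsub>M\<^esub>"
      using h M.bottom_closed unfolding poset_iso_def bij_betw_def by (metis imageE)
    \<comment> \<open>The bottom of \<open>M\<close> comes from some closed set \<open>e\<close>,
      and the empty closed set lies below \<open>e\<close>.\<close>
    have hb: "h {} = \<bottom>\<^bsub>M\<^esub>"
    proof -
      have c: "{} \<in> carrier (flat_lattice L)" using L.flat_V_closed[OF L.bottom_closed] L.flat_V_bottom by simp
      have "h {} \<sqsubseteq>\<^bsub>M\<^esub> h e" using poset_iso_le[OF h c e(1)] by (simp add: flat_lattice_def)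
      then show ?thesis using M.le_bot_eq e poset_iso_closed[OF h c] by simp
    qed
    have ne: "h (flat_V L q) \<noteq> \<bottom>\<^bsub>M\<^esub>"
    proof -
      have "q \<in> flat_V L q" using q by (simp add: flat_V_def L.meet_absorb1)
      moreover have "{} \<in> carrier (flat_lattice L)" using L.flat_V_closed[OF L.bottom_closed] L.flat_V_bottom by simp
      ultimately show ?thesis using poset_iso_inj[OF h L.flat_V_closed[OF q(1)], of "{}"] hb by auto
    qed
    have mt: "h (flat_V L q) \<sqinter>\<^bsub>M\<^esub> K = \<bottom>\<^bsub>M\<^esub>"
    proof -
      let ?m = "h (flat_V L q) \<sqinter>\<^bsub>M\<^esub> K"
      have mc: "?m \<in> carrier M" using hc q K by simp
      then obtain S where S: "S \<in> carrier (flat_lattice L)" "h S = ?m"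
        using h unfolding poset_iso_def bij_betw_def by (metis imageE)
      have "h S \<sqsubseteq>\<^bsub>M\<^esub> h (flat_V L q)" unfolding S using hc q K by (intro M.meet_left) auto
      then have 1: "S \<subseteq> flat_V L q" using poset_iso_le[OF h S(1) L.flat_V_closed[OF q(1)]] by (simp add: flat_lattice_def)
      have "h S \<sqsubseteq>\<^bsub>M\<^esub> h (flat_V L J)" unfolding S
        by (rule M.meet_leI2[OF IH(2)]) (use hc q K in auto)
      then have "S \<subseteq> flat_V L J" using poset_iso_le[OF h S(1) L.flat_V_closed[OF q(2)]] by (simp add: flat_lattice_def)
      then have "S = {}" using 1 VV by blast
      then show ?thesis using S hb by simp
    qed
    have lq: "h (flat_V L q) \<sqsubseteq>\<^bsub>M\<^esub> h (flat_V L (q \<squnion>\<^bsub>L\<^esub> J))" "h (flat_V L J) \<sqsubseteq>\<^bsub>M\<^esub> h (flat_V L (q \<squnion>\<^bsub>L\<^esub> J))"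
      using poset_iso_le[OF h L.flat_V_closed L.flat_V_closed] q L.flat_V_mono[OF _ _ L.join_left] L.flat_V_mono[OF _ _ L.join_right]
      by (simp_all add: flat_lattice_def)
    have "K \<sqsubseteq>\<^bsub>M\<^esub> h (flat_V L (q \<squnion>\<^bsub>L\<^esub> J))"
      by (rule M.le_trans[OF IH(2) lq(2)]) (use hc q K in auto)
    then have "h (flat_V L q) \<squnion>\<^bsub>M\<^esub> K \<sqsubseteq>\<^bsub>M\<^esub> h (flat_V L (q \<squnion>\<^bsub>L\<^esub> J))"
      using lq hc q K by (intro M.join_le) auto
    then show ?case using IH(1) ne mt hc q by (simp add: J_def[symmetric] K_def[symmetric])
  }
qed

section \<open>Linear categories\<close>

context linear_category
begin

abbreviation comp_arr (infixr "\<cdot>" 75) where "g \<cdot> f \<equiv> Cmp C g f"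
abbreviation add_arr (infixl "\<boxplus>" 65) where "f \<boxplus> g \<equiv> Add C f g"
abbreviation zr where "zr \<equiv> Zer C"
text \<open>As a scalar multiple, negation inherits its compatibility with composition from the
  linearity axioms.\<close>

definition neg where "neg f = Scl C (-1) f"

lemma Hom_iff [simp]: "f \<in> Hom C X Y \<longleftrightarrow> f \<in> Arr C \<and> Dom C f = X \<and> Cod C f = Y"
  by (simp add: Hom_def)

lemma Dom_in [simp]: "f \<in> Arr C \<Longrightarrow> Dom C f \<in> Obj C" and Cod_in [simp]: "f \<in> Arr C \<Longrightarrow> Cod C f \<in> Obj C"
  by (simp_all add: Dom_Obj Cod_Obj)

lemma ide_simps [simp]:
  "X \<in> Obj C \<Longrightarrow> Ide C X \<in> Arr C" "X \<in> Obj C \<Longrightarrow> Dom C (Ide C X) = X" "X \<in> Obj C \<Longrightarrow> Cod C (Ide C X) = X"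
  using Ide_Hom[of X] by auto

lemma cmp_simps [simp]:
  assumes "g \<in> Arr C" "f \<in> Arr C" "Dom C g = Cod C f"
  shows "g \<cdot> f \<in> Arr C" "Dom C (g \<cdot> f) = Dom C f" "Cod C (g \<cdot> f) = Cod C g"
  using Cmp_Hom[of f "Dom C f" "Cod C f" g "Cod C g"] assms by auto

lemma cmp_ide [simp]:
  "f \<in> Arr C \<Longrightarrow> Cod C f = Y \<Longrightarrow> Ide C Y \<cdot> f = f"
  "f \<in> Arr C \<Longrightarrow> Dom C f = X \<Longrightarrow> f \<cdot> Ide C X = f"
  using Cmp_Ide_left[of f "Dom C f" Y] Cmp_Ide_right[of f X "Cod C f"] by auto

lemma cmp_assoc:
  "h \<in> Arr C \<Longrightarrow> g \<in> Arr C \<Longrightarrow> f \<in> Arr C \<Longrightarrow> Dom C h = Cod C g \<Longrightarrow> Dom C g = Cod C f \<Longrightarrow>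
     (h \<cdot> g) \<cdot> f = h \<cdot> (g \<cdot> f)"
  using Cmp_assoc[of f "Dom C f" "Cod C f" g "Cod C g" h "Cod C h"] by auto

lemma hom_abelian_group: "X \<in> Obj C \<Longrightarrow> Y \<in> Obj C \<Longrightarrow> abelian_group (hom_space C X Y)"
  using hom_vectorspace[of X Y] by (simp add: vectorspace_def module_def)

lemma hom_module: "X \<in> Obj C \<Longrightarrow> Y \<in> Obj C \<Longrightarrow> module class_ring (hom_space C X Y)"
  using hom_vectorspace[of X Y] by (simp add: vectorspace_def)

lemma hom_space_simps [simp]:
  "carrier (hom_space C X Y) = Hom C X Y" "add (hom_space C X Y) = Add C" "zero (hom_space C X Y) = Zer C X Y"
  "smult (hom_space C X Y) = Scl C"
  by (simp_all add: hom_space_def)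

lemma zr_simps [simp]:
  assumes "X \<in> Obj C" "Y \<in> Obj C"
  shows "zr X Y \<in> Arr C" "Dom C (zr X Y) = X" "Cod C (zr X Y) = Y"
proof -
  interpret abelian_group "hom_space C X Y" by (rule hom_abelian_group[OF assms])
  show "zr X Y \<in> Arr C" "Dom C (zr X Y) = X" "Cod C (zr X Y) = Y" using zero_closed by auto
qed

lemma add_simps [simp]:
  assumes "f \<in> Arr C" "g \<in> Arr C" "Dom C f = Dom C g" "Cod C f = Cod C g"
  shows "f \<boxplus> g \<in> Arr C" "Dom C (f \<boxplus> g) = Dom C g" "Cod C (f \<boxplus> g) = Cod C g"
proof -
  interpret abelian_group "hom_space C (Dom C g) (Cod C g)" by (rule hom_abelian_group) (use assms in auto)
  show "f \<boxplus> g \<in> Arr C" "Dom C (f \<boxplus> g) = Dom C g" "Cod C (f \<boxplus> g) = Cod C g" using a_closed[of f g] assms by auto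
qed

lemma scl_simps [simp]:
  assumes "f \<in> Arr C"
  shows "Scl C c f \<in> Arr C" "Dom C (Scl C c f) = Dom C f" "Cod C (Scl C c f) = Cod C f"
proof -
  interpret module class_ring "hom_space C (Dom C f) (Cod C f)" by (rule hom_module) (use assms in auto)
  show "Scl C c f \<in> Arr C" "Dom C (Scl C c f) = Dom C f" "Cod C (Scl C c f) = Cod C f"
    using smult_closed[of c f] assms by (auto simp: class_ring_simps)
qed

lemma scl_arith:
  assumes "f \<in> Arr C"
  shows "Scl C 1 f = f" "Scl C (a * b) f = Scl C a (Scl C b f)" "Scl C (a + b) f = Scl C a f \<boxplus> Scl C b f"
    "Scl C 0 f = zr (Dom C f) (Cod C f)"
proof -
  interpret module class_ring "hom_space C (Dom C f) (Cod C f)" by (rule hom_module) (use assms in auto)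
  show "Scl C 1 f = f" "Scl C (a * b) f = Scl C a (Scl C b f)" "Scl C (a + b) f = Scl C a f \<boxplus> Scl C b f"
    "Scl C 0 f = zr (Dom C f) (Cod C f)"
    using smult_one[of f] smult_assoc1[of a b f] smult_l_distr[of a b f] smult_l_null[of f] assms
    by (auto simp: class_ring_simps)
qed

lemma neg_simps [simp]:
  assumes "f \<in> Arr C"
  shows "neg f \<in> Arr C" "Dom C (neg f) = Dom C f" "Cod C (neg f) = Cod C f"
  using assms by (simp_all add: neg_def)

lemma
  assumes "f \<in> Arr C" "g \<in> Arr C" "Dom C f = Dom C g" "Cod C f = Cod C g"
  shows add_comm: "f \<boxplus> g = g \<boxplus> f"
    and add_assoc: "h \<in> Arr C \<Longrightarrow> Dom C h = Dom C g \<Longrightarrow> Cod C h = Cod C g \<Longrightarrow> (f \<boxplus> g) \<boxplus> h = f \<boxplus> (g \<boxplus> h)"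
proof -
  interpret abelian_group "hom_space C (Dom C g) (Cod C g)" by (rule hom_abelian_group) (use assms in auto)
  show "f \<boxplus> g = g \<boxplus> f" using a_comm[of f g] assms by auto
  show "h \<in> Arr C \<Longrightarrow> Dom C h = Dom C g \<Longrightarrow> Cod C h = Cod C g \<Longrightarrow> (f \<boxplus> g) \<boxplus> h = f \<boxplus> (g \<boxplus> h)"
    using a_assoc[of f g h] assms by auto
qed

lemma add_zr [simp]:
  assumes "f \<in> Arr C" "Dom C f = X" "Cod C f = Y"
  shows "f \<boxplus> zr X Y = f" "zr X Y \<boxplus> f = f"
proof -
  interpret abelian_group "hom_space C X Y" by (rule hom_abelian_group) (use assms in auto)
  show "f \<boxplus> zr X Y = f" "zr X Y \<boxplus> f = f" using r_zero[of f] l_zero[of f] assms by auto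
qed

lemma add_neg [simp]:
  assumes "f \<in> Arr C"
  shows "f \<boxplus> neg f = zr (Dom C f) (Cod C f)" "neg f \<boxplus> f = zr (Dom C f) (Cod C f)"
proof -
  show 1: "f \<boxplus> neg f = zr (Dom C f) (Cod C f)"
    using scl_arith(3)[OF assms, of 1 "-1"] scl_arith(1,4)[OF assms] by (simp add: neg_def)
  show "neg f \<boxplus> f = zr (Dom C f) (Cod C f)"
    using 1 add_comm[of f "neg f"] assms by simp
qed

lemma add_neg_cancel:
  assumes "f \<in> Arr C" "g \<in> Arr C" "Dom C f = Dom C g" "Cod C f = Cod C g"
  shows "(f \<boxplus> g) \<boxplus> neg g = f" "(f \<boxplus> neg g) \<boxplus> g = f"
  using assms by (simp_all add: add_assoc)

lemma add_neg_zr_iff: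
  assumes "f \<in> Arr C" "g \<in> Arr C" "Dom C f = Dom C g" "Cod C f = Cod C g"
  shows "f \<boxplus> neg g = zr (Dom C g) (Cod C g) \<longleftrightarrow> f = g"
  using add_neg_cancel(2)[OF assms] assms by auto

lemma cmp_add [simp]:
  assumes "f \<in> Arr C" "g \<in> Arr C" "Dom C f = Dom C g" "Cod C f = Cod C g"
  shows "h \<in> Arr C \<Longrightarrow> Dom C h = Cod C g \<Longrightarrow> h \<cdot> (f \<boxplus> g) = h \<cdot> f \<boxplus> h \<cdot> g"
    and "h \<in> Arr C \<Longrightarrow> Cod C h = Dom C g \<Longrightarrow> (f \<boxplus> g) \<cdot> h = f \<cdot> h \<boxplus> g \<cdot> h"
  using Cmp_Add_right[of f "Dom C g" "Cod C g" g h "Cod C h"] Cmp_Add_left[of h "Dom C h" "Cod C h" f "Cod C f" g] assms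
  by auto

lemma cmp_scl [simp]:
  assumes "f \<in> Arr C" "g \<in> Arr C" "Dom C g = Cod C f"
  shows "g \<cdot> Scl C c f = Scl C c (g \<cdot> f)" "Scl C c g \<cdot> f = Scl C c (g \<cdot> f)"
  using Cmp_Scl_left[of f "Dom C f" "Cod C f" g "Cod C g" c] Cmp_Scl_right[of f "Dom C f" "Cod C f" g "Cod C g" c] assms
  by auto

lemma cmp_neg [simp]:
  assumes "f \<in> Arr C" "g \<in> Arr C" "Dom C g = Cod C f"
  shows "g \<cdot> neg f = neg (g \<cdot> f)" "neg g \<cdot> f = neg (g \<cdot> f)"
  using assms by (simp_all add: neg_def)

text \<open>The zero morphism is its own multiple by the scalar 0, and scalars can be pulled out of
  composites.\<close>

lemma cmp_zr [simp]:
  assumes "f \<in> Arr C"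
  shows "X \<in> Obj C \<Longrightarrow> Y = Dom C f \<Longrightarrow> f \<cdot> zr X Y = zr X (Cod C f)" "Z \<in> Obj C \<Longrightarrow> Y = Cod C f \<Longrightarrow> zr Y Z \<cdot> f = zr (Dom C f) Z"
proof -
  assume X: "X \<in> Obj C" "Y = Dom C f"
  have "f \<cdot> Scl C 0 (zr X (Dom C f)) = Scl C 0 (f \<cdot> zr X (Dom C f))" using X assms by (intro cmp_scl) auto
  then show "f \<cdot> zr X Y = zr X (Cod C f)" using X assms by (simp add: scl_arith)
next
  assume X: "Z \<in> Obj C" "Y = Cod C f"
  have "Scl C 0 (zr (Cod C f) Z) \<cdot> f = Scl C 0 (zr (Cod C f) Z \<cdot> f)" using X assms by (intro cmp_scl) auto
  then show "zr Y Z \<cdot> f = zr (Dom C f) Z" using X assms by (simp add: scl_arith)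
qed

lemma neg_zr [simp]: "X \<in> Obj C \<Longrightarrow> Y \<in> Obj C \<Longrightarrow> neg (zr X Y) = zr X Y"
  using add_zr(2)[of "neg (zr X Y)" X Y] add_neg(1)[of "zr X Y"] by simp

section \<open>Finite sums of morphisms\<close>

abbreviation hsum where "hsum X Y \<equiv> finsum (hom_space C X Y)"

lemma hsum_empty [simp]: "X \<in> Obj C \<Longrightarrow> Y \<in> Obj C \<Longrightarrow> hsum X Y F {} = zr X Y"
proof -
  assume "X \<in> Obj C" "Y \<in> Obj C"
  then interpret abelian_group "hom_space C X Y" by (rule hom_abelian_group)
  show ?thesis by simp
qed

lemma hsum_insert:
  assumes "finite A" "a \<notin> A" "\<And>x. x \<in> insert a A \<Longrightarrow> F x \<in> Hom C X Y"
  shows "hsum X Y F (insert a A) = F a \<boxplus> hsum X Y F A"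
proof -
  have "X \<in> Obj C" "Y \<in> Obj C" using assms(3)[of a] by auto
  then interpret abelian_group "hom_space C X Y" by (rule hom_abelian_group)
  show ?thesis using finsum_insert[of A a F] assms by (simp add: Pi_iff)
qed

lemma hsum_cong:
  assumes "X \<in> Obj C" "Y \<in> Obj C" "\<And>a. a \<in> A \<Longrightarrow> F a = G a" "\<And>a. a \<in> A \<Longrightarrow> G a \<in> Hom C X Y"
  shows "hsum X Y F A = hsum X Y G A"
proof -
  interpret abelian_group "hom_space C X Y" using assms by (intro hom_abelian_group)
  show ?thesis by (rule finsum_cong') (use assms in auto)
qed

lemma hsum_Hom [simp]:
  assumes "X \<in> Obj C" "Y \<in> Obj C" "\<And>a. a \<in> A \<Longrightarrow> F a \<in> Hom C X Y"
  shows "hsum X Y F A \<in> Arr C" "Dom C (hsum X Y F A) = X" "Cod C (hsum X Y F A) = Y"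
proof -
  interpret abelian_group "hom_space C X Y" using assms by (intro hom_abelian_group)
  have "hsum X Y F A \<in> carrier (hom_space C X Y)" by (rule finsum_closed) (use assms in auto)
  then show "hsum X Y F A \<in> Arr C" "Dom C (hsum X Y F A) = X" "Cod C (hsum X Y F A) = Y" by auto
qed

lemma hsum_lessThan_Hom [simp]:
  assumes "X \<in> Obj C" "Y \<in> Obj C" "\<And>i. i < n \<Longrightarrow> F i \<in> Hom C X Y"
  shows "hsum X Y F {..<n} \<in> Arr C" "Dom C (hsum X Y F {..<n}) = X" "Cod C (hsum X Y F {..<n}) = Y"
  using hsum_Hom[of X Y "{..<n}" F] assms by auto

lemma cmp_hsum:
  assumes "finite A" "X \<in> Obj C" "Y \<in> Obj C" "\<And>a. a \<in> A \<Longrightarrow> F a \<in> Hom C X Y" "g \<in> Hom C Y Z"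
  shows "g \<cdot> hsum X Y F A = hsum X Z (\<lambda>a. g \<cdot> F a) A"
  using assms(1,4)
proof (induction A rule: finite_induct)
  case (insert a A)
  have Z: "Z \<in> Obj C" using assms(5) by auto
  have "g \<cdot> hsum X Y F (insert a A) = g \<cdot> (F a \<boxplus> hsum X Y F A)" using insert by (subst hsum_insert) auto
  also have "\<dots> = g \<cdot> F a \<boxplus> g \<cdot> hsum X Y F A" using insert assms by (intro cmp_add) auto
  also have "\<dots> = hsum X Z (\<lambda>a. g \<cdot> F a) (insert a A)" using insert assms Z by (subst hsum_insert) auto
  finally show ?case .
qed (use assms in auto)

lemma hsum_cmp:
  assumes "finite A" "X \<in> Obj C" "Y \<in> Obj C" "\<And>a. a \<in> A \<Longrightarrow> F a \<in> Hom C X Y" "g \<in> Hom C W X"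
  shows "hsum X Y F A \<cdot> g = hsum W Y (\<lambda>a. F a \<cdot> g) A"
  using assms(1,4)
proof (induction A rule: finite_induct)
  case (insert a A)
  have W: "W \<in> Obj C" using assms(5) by auto
  have "hsum X Y F (insert a A) \<cdot> g = (F a \<boxplus> hsum X Y F A) \<cdot> g" using insert by (subst hsum_insert) auto
  also have "\<dots> = F a \<cdot> g \<boxplus> hsum X Y F A \<cdot> g" using insert assms by (intro cmp_add) auto
  also have "\<dots> = hsum W Y (\<lambda>a. F a \<cdot> g) (insert a A)" using insert assms W by (subst hsum_insert) auto
  finally show ?case .
qed (use assms in auto)

lemma hsum_zr:
  assumes "finite A" "X \<in> Obj C" "Y \<in> Obj C" "\<And>a. a \<in> A \<Longrightarrow> F a = zr X Y"
  shows "hsum X Y F A = zr X Y"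
  using assms(1,4)
proof (induction A rule: finite_induct)
  case (insert a A)
  then show ?case using assms(2,3) by (subst hsum_insert) auto
qed (use assms in auto)

lemma hsum_single:
  assumes "finite A" "i \<in> A" "F i \<in> Hom C X Y" "\<And>a. a \<in> A \<Longrightarrow> a \<noteq> i \<Longrightarrow> F a = zr X Y"
  shows "hsum X Y F A = F i"
proof -
  have XY: "X \<in> Obj C" "Y \<in> Obj C" using assms(3) by auto
  have A: "A = insert i (A - {i})" using assms by auto
  have z: "hsum X Y F (A - {i}) = zr X Y" using assms XY by (intro hsum_zr) auto
  have h: "F x \<in> Hom C X Y" if "x \<in> A" for x using assms(3,4) XY that by (cases "x = i") auto
  have "hsum X Y F (insert i (A - {i})) = F i \<boxplus> hsum X Y F (A - {i})"
    by (rule hsum_insert) (use assms h in auto)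
  then have "hsum X Y F A = F i \<boxplus> zr X Y" unfolding z A[symmetric] .
  then show ?thesis using assms by simp
qed

lemma hsum_lessThan_Suc:
  assumes "\<And>i. i < Suc n \<Longrightarrow> F i \<in> Hom C X Y"
  shows "hsum X Y F {..<Suc n} = F n \<boxplus> hsum X Y F {..<n}"
  unfolding lessThan_Suc by (rule hsum_insert) (use assms in auto)

lemma hsum_2:
  fixes F :: "nat \<Rightarrow> _"
  assumes "F 0 \<in> Hom C X Y" "F 1 \<in> Hom C X Y"
  shows "hsum X Y F {..<2} = F 1 \<boxplus> F 0"
proof -
  have "hsum X Y F {..<Suc (Suc 0)} = F (Suc 0) \<boxplus> hsum X Y F {..<Suc 0}"
    by (rule hsum_lessThan_Suc) (use assms in \<open>auto simp: less_Suc_eq\<close>)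
  moreover have "hsum X Y F {..<Suc 0} = F 0 \<boxplus> hsum X Y F {..<0}"
    by (rule hsum_lessThan_Suc) (use assms in auto)
  moreover have "hsum X Y F {..<0} = zr X Y" using assms by auto
  ultimately show ?thesis using assms by (simp add: numeral_2_eq_2)
qed

text \<open>Composites are kept nested to the right, so a known value of \<open>g \<cdot> f\<close>
  must be applied in front of a further factor \<open>h\<close>.\<close>

lemma cmp_reduce:
  "g \<cdot> f = k \<Longrightarrow> g \<in> Arr C \<Longrightarrow> f \<in> Arr C \<Longrightarrow> h \<in> Arr C \<Longrightarrow> Dom C g = Cod C f \<Longrightarrow> Dom C f = Cod C h \<Longrightarrow> g \<cdot> (f \<cdot> h) = k \<cdot> h"
  using cmp_assoc[of g f h] by simp

section \<open>Biproducts\<close>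

lemma biproductD:
  assumes "is_biproduct C n S P j p"
  shows "P \<in> Obj C"
    and "i < n \<Longrightarrow> S i \<in> Obj C" "i < n \<Longrightarrow> j i \<in> Arr C" "i < n \<Longrightarrow> Dom C (j i) = S i" "i < n \<Longrightarrow> Cod C (j i) = P"
    and "i < n \<Longrightarrow> p i \<in> Arr C" "i < n \<Longrightarrow> Dom C (p i) = P" "i < n \<Longrightarrow> Cod C (p i) = S i"
    and "i < n \<Longrightarrow> p i \<cdot> j i = Ide C (S i)"
    and "i < n \<Longrightarrow> l < n \<Longrightarrow> i \<noteq> l \<Longrightarrow> p i \<cdot> j l = zr (S l) (S i)"
    and "hsum P P (\<lambda>i. j i \<cdot> p i) {..<n} = Ide C P"
  using assms unfolding is_biproduct_def by auto

lemma biproductI: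
  assumes "P \<in> Obj C"
    and "\<And>i. i < n \<Longrightarrow> S i \<in> Obj C"
    and "\<And>i. i < n \<Longrightarrow> j i \<in> Hom C (S i) P" and "\<And>i. i < n \<Longrightarrow> p i \<in> Hom C P (S i)"
    and "\<And>i l. i < n \<Longrightarrow> l < n \<Longrightarrow> p i \<cdot> j l = (if i = l then Ide C (S i) else zr (S l) (S i))"
    and "hsum P P (\<lambda>i. j i \<cdot> p i) {..<n} = Ide C P"
  shows "is_biproduct C n S P j p"
  unfolding is_biproduct_def using assms by auto

lemma biproduct_decomp:
  assumes "is_biproduct C n S P j p" "f \<in> Arr C" "Cod C f = P"
  shows "f = hsum (Dom C f) P (\<lambda>i. j i \<cdot> (p i \<cdot> f)) {..<n}"
proof -
  note b = biproductD[OF assms(1)]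
  have "f = hsum P P (\<lambda>i. j i \<cdot> p i) {..<n} \<cdot> f" using b(11) assms by simp
  also have "\<dots> = hsum (Dom C f) P (\<lambda>i. (j i \<cdot> p i) \<cdot> f) {..<n}" using b assms by (intro hsum_cmp) auto
  also have "\<dots> = hsum (Dom C f) P (\<lambda>i. j i \<cdot> (p i \<cdot> f)) {..<n}" using b assms by (intro hsum_cong) (auto simp: cmp_assoc)
  finally show ?thesis .
qed

lemma biproduct_decomp':
  assumes "is_biproduct C n S P j p" "f \<in> Arr C" "Dom C f = P"
  shows "f = hsum P (Cod C f) (\<lambda>i. (f \<cdot> j i) \<cdot> p i) {..<n}"
proof -
  note b = biproductD[OF assms(1)]
  have "f = f \<cdot> hsum P P (\<lambda>i. j i \<cdot> p i) {..<n}" using b(11) assms by simp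
  also have "\<dots> = hsum P (Cod C f) (\<lambda>i. f \<cdot> (j i \<cdot> p i)) {..<n}" using b assms by (intro cmp_hsum) auto
  also have "\<dots> = hsum P (Cod C f) (\<lambda>i. (f \<cdot> j i) \<cdot> p i) {..<n}" using b assms by (intro hsum_cong) (auto simp: cmp_assoc)
  finally show ?thesis .
qed

lemma biproduct_ext:
  assumes "is_biproduct C n S P j p" "f \<in> Arr C" "g \<in> Arr C" "Cod C f = P" "Cod C g = P" "Dom C f = Dom C g"
    and "\<And>i. i < n \<Longrightarrow> p i \<cdot> f = p i \<cdot> g"
  shows "f = g"
proof -
  note b = biproductD[OF assms(1)]
  have "hsum (Dom C f) P (\<lambda>i. j i \<cdot> (p i \<cdot> f)) {..<n} = hsum (Dom C f) P (\<lambda>i. j i \<cdot> (p i \<cdot> g)) {..<n}"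
    using b assms by (intro hsum_cong) auto
  then show ?thesis using biproduct_decomp[OF assms(1), of f] biproduct_decomp[OF assms(1), of g] assms by simp
qed

lemma biproduct_ext':
  assumes "is_biproduct C n S P j p" "f \<in> Arr C" "g \<in> Arr C" "Dom C f = P" "Dom C g = P" "Cod C f = Cod C g"
    and "\<And>i. i < n \<Longrightarrow> f \<cdot> j i = g \<cdot> j i"
  shows "f = g"
proof -
  note b = biproductD[OF assms(1)]
  have "hsum P (Cod C f) (\<lambda>i. (f \<cdot> j i) \<cdot> p i) {..<n} = hsum P (Cod C f) (\<lambda>i. (g \<cdot> j i) \<cdot> p i) {..<n}"
    using b assms by (intro hsum_cong) auto
  then show ?thesis using biproduct_decomp'[OF assms(1), of f] biproduct_decomp'[OF assms(1), of g] assms by simp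
qed

lemma biproduct_tuple:
  assumes "is_biproduct C n S P j p" "X \<in> Obj C" "\<And>i. i < n \<Longrightarrow> h i \<in> Hom C X (S i)"
  shows "hsum X P (\<lambda>i. j i \<cdot> h i) {..<n} \<in> Hom C X P"
    and "l < n \<Longrightarrow> p l \<cdot> hsum X P (\<lambda>i. j i \<cdot> h i) {..<n} = h l"
proof -
  note b = biproductD[OF assms(1)]
  show "hsum X P (\<lambda>i. j i \<cdot> h i) {..<n} \<in> Hom C X P" using b assms by auto
  assume l: "l < n"
  have "p l \<cdot> hsum X P (\<lambda>i. j i \<cdot> h i) {..<n} = hsum X (S l) (\<lambda>i. p l \<cdot> (j i \<cdot> h i)) {..<n}"
    using b assms l by (intro cmp_hsum) auto
  also have "\<dots> = p l \<cdot> (j l \<cdot> h l)"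
    using b assms l by (intro hsum_single) (auto simp: cmp_assoc[symmetric])
  also have "\<dots> = h l" using b assms l by (simp add: cmp_assoc[symmetric])
  finally show "p l \<cdot> hsum X P (\<lambda>i. j i \<cdot> h i) {..<n} = h l" .
qed

text \<open>The decomposition of the identity is traded for joint injectivity of the projections on
  endomorphisms: the sum and the identity have the same components. Separation is usually the easier
  condition to verify.\<close>

lemma biproduct_extI:
  assumes "P \<in> Obj C" "\<And>i. i < n \<Longrightarrow> S i \<in> Obj C"
    and "\<And>i. i < n \<Longrightarrow> j i \<in> Hom C (S i) P" and "\<And>i. i < n \<Longrightarrow> p i \<in> Hom C P (S i)"
    and pj: "\<And>i l. i < n \<Longrightarrow> l < n \<Longrightarrow> p i \<cdot> j l = (if i = l then Ide C (S i) else zr (S l) (S i))"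
    and ext: "\<And>f g. f \<in> Hom C P P \<Longrightarrow> g \<in> Hom C P P \<Longrightarrow> (\<And>i. i < n \<Longrightarrow> p i \<cdot> f = p i \<cdot> g) \<Longrightarrow> f = g"
  shows "is_biproduct C n S P j p"
proof (rule biproductI[OF assms(1-5)])
  show "hsum P P (\<lambda>i. j i \<cdot> p i) {..<n} = Ide C P"
  proof (rule ext)
    fix l assume l: "l < n"
    have "p l \<cdot> hsum P P (\<lambda>i. j i \<cdot> p i) {..<n} = hsum P (S l) (\<lambda>i. p l \<cdot> (j i \<cdot> p i)) {..<n}"
      using assms(1-5) l by (intro cmp_hsum) auto
    also have "\<dots> = p l \<cdot> (j l \<cdot> p l)"
      using assms(1-5) l by (intro hsum_single) (auto simp: cmp_assoc[symmetric])
    also have "\<dots> = p l \<cdot> Ide C P" using assms(1-5) l by (simp add: cmp_assoc[symmetric])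
    finally show "p l \<cdot> hsum P P (\<lambda>i. j i \<cdot> p i) {..<n} = p l \<cdot> Ide C P" .
  qed (use assms(1-5) in auto)
qed auto

lemma biproduct2D:
  assumes "is_biproduct C 2 (\<lambda>i. if i = 0 then X else Y) P j p"
  shows "P \<in> Obj C" "X \<in> Obj C" "Y \<in> Obj C"
    "j 0 \<in> Arr C" "Dom C (j 0) = X" "Cod C (j 0) = P" "j 1 \<in> Arr C" "Dom C (j 1) = Y" "Cod C (j 1) = P"
    "p 0 \<in> Arr C" "Dom C (p 0) = P" "Cod C (p 0) = X" "p 1 \<in> Arr C" "Dom C (p 1) = P" "Cod C (p 1) = Y"
    "p 0 \<cdot> j 0 = Ide C X" "p 1 \<cdot> j 1 = Ide C Y" "p 0 \<cdot> j 1 = zr Y X" "p 1 \<cdot> j 0 = zr X Y"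
    "j 0 \<cdot> p 0 \<boxplus> j 1 \<cdot> p 1 = Ide C P"
proof -
  note b = biproductD[OF assms]
  show "P \<in> Obj C" "X \<in> Obj C" "Y \<in> Obj C"
    "j 0 \<in> Arr C" "Dom C (j 0) = X" "Cod C (j 0) = P" "j 1 \<in> Arr C" "Dom C (j 1) = Y" "Cod C (j 1) = P"
    "p 0 \<in> Arr C" "Dom C (p 0) = P" "Cod C (p 0) = X" "p 1 \<in> Arr C" "Dom C (p 1) = P" "Cod C (p 1) = Y"
    "p 0 \<cdot> j 0 = Ide C X" "p 1 \<cdot> j 1 = Ide C Y" "p 0 \<cdot> j 1 = zr Y X" "p 1 \<cdot> j 0 = zr X Y"
    using b(1) b(2-9)[of 0] b(2-9)[of 1] b(10)[of 0 1] b(10)[of 1 0] by auto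
  have "hsum P P (\<lambda>i. j i \<cdot> p i) {..<2} = j 1 \<cdot> p 1 \<boxplus> j 0 \<cdot> p 0"
    using b(1) b(2-9)[of 0] b(2-9)[of 1] by (intro hsum_2) auto
  then show "j 0 \<cdot> p 0 \<boxplus> j 1 \<cdot> p 1 = Ide C P"
    using b(11) b(1) b(2-9)[of 0] b(2-9)[of 1] add_comm[of "j 0 \<cdot> p 0" "j 1 \<cdot> p 1"] by simp
qed

lemma biproduct_2_ext:
  assumes b: "is_biproduct C 2 (\<lambda>i. if i = 0 then X else Y) P j p"
    and "f \<in> Arr C" "g \<in> Arr C" "Cod C f = P" "Cod C g = P" "Dom C f = Dom C g" "p 0 \<cdot> f = p 0 \<cdot> g" "p 1 \<cdot> f = p 1 \<cdot> g"
  shows "f = g"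
  by (rule biproduct_ext[OF b]) (use assms in \<open>auto simp: less_2_cases_iff\<close>)

lemma biproduct_Suc:
  assumes n: "is_biproduct C n S P j p" and b: "is_biproduct C 2 (\<lambda>i. if i = 0 then P else S n) Q a b"
  shows "is_biproduct C (Suc n) S Q (\<lambda>i. if i < n then a 0 \<cdot> j i else a 1) (\<lambda>i. if i < n then p i \<cdot> b 0 else b 1)"
proof (rule biproduct_extI)
  note n' = biproductD[OF n] and b' = biproduct2D[OF b]
  have S: "i < Suc n \<longleftrightarrow> i < n \<or> i = n" for i by auto
  show "Q \<in> Obj C" by (rule b')
  show "S i \<in> Obj C" if "i < Suc n" for i using that n'(2)[of i] b'(3) less_SucE by blast
  show "(if i < n then a 0 \<cdot> j i else a 1) \<in> Hom C (S i) Q" if "i < Suc n" for i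
    using that n'(2-8)[of i] b'(1-15) by (cases "i = n") auto
  show "(if i < n then p i \<cdot> b 0 else b 1) \<in> Hom C Q (S i)" if "i < Suc n" for i
    using that n'(2-8)[of i] b'(1-15) by (cases "i = n") auto
  show "(if i < n then p i \<cdot> b 0 else b 1) \<cdot> (if l < n then a 0 \<cdot> j l else a 1) =
     (if i = l then Ide C (S i) else zr (S l) (S i))" if il: "i < Suc n" "l < Suc n" for i l
  proof -
    consider "i < n" "l < n" | "i < n" "l = n" | "i = n" "l < n" | "i = n" "l = n" using il by (auto simp: less_Suc_eq)
    then show ?thesis
    proof cases
      case 1
      have "(p i \<cdot> b 0) \<cdot> (a 0 \<cdot> j l) = p i \<cdot> (b 0 \<cdot> (a 0 \<cdot> j l))"
        by (rule cmp_assoc) (use 1 n'(2-8)[of l] n'(2-8)[of i] b'(1-15) in simp_all)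
      also have "b 0 \<cdot> (a 0 \<cdot> j l) = Ide C P \<cdot> j l"
        by (rule cmp_reduce[OF b'(16)]) (use 1 n'(2-8)[of l] b'(1-15) in simp_all)
      also have "\<dots> = j l" using 1 n'(2-8)[of l] by simp
      also have "p i \<cdot> j l = (if i = l then Ide C (S i) else zr (S l) (S i))" using 1 n'(9,10) by simp
      finally show ?thesis using 1 by simp
    next
      case 2
      have "(p i \<cdot> b 0) \<cdot> a 1 = p i \<cdot> zr (S n) P" unfolding b'(18)[symmetric]
        by (rule cmp_assoc) (use 2 n'(2-8)[of i] b'(1-15) in simp_all)
      also have "\<dots> = zr (S n) (S i)" using 2 n'(2-8)[of i] b'(1-15) by simp
      finally show ?thesis using 2 by simp
    next
      case 3
      have "b 1 \<cdot> (a 0 \<cdot> j l) = zr P (S n) \<cdot> j l"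
        by (rule cmp_reduce[OF b'(19)]) (use 3 n'(2-8)[of l] b'(1-15) in simp_all)
      also have "\<dots> = zr (S l) (S n)" using 3 n'(2-8)[of l] b'(1-15) by simp
      finally show ?thesis using 3 by simp
    next
      case 4
      then show ?thesis using b'(17) by simp
    qed
  qed
  fix f g assume fg: "f \<in> Hom C Q Q" "g \<in> Hom C Q Q"
    and e: "\<And>i. i < Suc n \<Longrightarrow> (if i < n then p i \<cdot> b 0 else b 1) \<cdot> f = (if i < n then p i \<cdot> b 0 else b 1) \<cdot> g"
  have "p i \<cdot> (b 0 \<cdot> f) = p i \<cdot> (b 0 \<cdot> g)" if "i < n" for i
    using e[of i] that n'(2-8)[of i] b'(1-15) fg cmp_assoc[of "p i" "b 0" f] cmp_assoc[of "p i" "b 0" g] by simp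
  then have "b 0 \<cdot> f = b 0 \<cdot> g" using fg b'(1-15) by - (rule biproduct_ext[OF n], simp_all)
  moreover have "b 1 \<cdot> f = b 1 \<cdot> g" using e[of n] by simp
  ultimately show "f = g" using fg by - (rule biproduct_2_ext[OF b], simp_all)
qed

end

section \<open>Monomorphisms and epimorphisms in abelian categories\<close>

context abelian_category
begin

abbreviation mono where "mono \<equiv> mono_arr C"
abbreviation epi where "epi \<equiv> epi_arr C"

lemma mono_Arr [simp]: "mono m \<Longrightarrow> m \<in> Arr C" and epi_Arr [simp]: "epi m \<Longrightarrow> m \<in> Arr C"
  by (simp_all add: mono_arr_def epi_arr_def)

lemma mono_cancel:
  "mono m \<Longrightarrow> f \<in> Arr C \<Longrightarrow> g \<in> Arr C \<Longrightarrow> Cod C f = Dom C m \<Longrightarrow> Cod C g = Dom C m \<Longrightarrow>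
     Dom C f = Dom C g \<Longrightarrow> m \<cdot> f = m \<cdot> g \<Longrightarrow> f = g"
  unfolding mono_arr_def by simp

lemma epi_cancel:
  "epi m \<Longrightarrow> f \<in> Arr C \<Longrightarrow> g \<in> Arr C \<Longrightarrow> Dom C f = Cod C m \<Longrightarrow> Dom C g = Cod C m \<Longrightarrow>
     Cod C f = Cod C g \<Longrightarrow> f \<cdot> m = g \<cdot> m \<Longrightarrow> f = g"
  unfolding epi_arr_def by simp

lemma monoI:
  assumes "m \<in> Arr C"
    and "\<And>f. f \<in> Arr C \<Longrightarrow> Cod C f = Dom C m \<Longrightarrow> m \<cdot> f = zr (Dom C f) (Cod C m) \<Longrightarrow> f = zr (Dom C f) (Cod C f)"
  shows "mono m"
  unfolding mono_arr_def
proof (intro conjI allI ballI impI assms(1))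
  fix X f g assume fg: "f \<in> Hom C X (Dom C m)" "g \<in> Hom C X (Dom C m)" "m \<cdot> f = m \<cdot> g"
  have "m \<cdot> (f \<boxplus> neg g) = m \<cdot> f \<boxplus> neg (m \<cdot> g)" using fg assms(1) by simp
  also have "\<dots> = zr X (Cod C m)" unfolding fg(3) using fg(1,2) assms(1) by simp
  finally have "f \<boxplus> neg g = zr X (Dom C m)" using assms(2)[of "f \<boxplus> neg g"] fg(1,2) by simp
  then show "f = g" using add_neg_zr_iff[of f g] fg(1,2) by simp
qed

lemma epiI:
  assumes "m \<in> Arr C"
    and "\<And>f. f \<in> Arr C \<Longrightarrow> Dom C f = Cod C m \<Longrightarrow> f \<cdot> m = zr (Dom C m) (Cod C f) \<Longrightarrow> f = zr (Dom C f) (Cod C f)"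
  shows "epi m"
  unfolding epi_arr_def
proof (intro conjI allI ballI impI assms(1))
  fix X f g assume fg: "f \<in> Hom C (Cod C m) X" "g \<in> Hom C (Cod C m) X" "f \<cdot> m = g \<cdot> m"
  have "(f \<boxplus> neg g) \<cdot> m = f \<cdot> m \<boxplus> neg (g \<cdot> m)" using fg assms(1) by simp
  also have "\<dots> = zr (Dom C m) X" unfolding fg(3) using fg(1,2) assms(1) by simp
  finally have "f \<boxplus> neg g = zr (Cod C m) X" using assms(2)[of "f \<boxplus> neg g"] fg(1,2) by simp
  then show "f = g" using add_neg_zr_iff[of f g] fg(1,2) by simp
qed

lemma mono_zr:
  "mono m \<Longrightarrow> f \<in> Arr C \<Longrightarrow> Cod C f = Dom C m \<Longrightarrow> m \<cdot> f = zr (Dom C f) (Cod C m) \<Longrightarrow> f = zr (Dom C f) (Dom C m)"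
  by (rule mono_cancel[of m]) simp_all

lemma epi_zr:
  "epi m \<Longrightarrow> f \<in> Arr C \<Longrightarrow> Dom C f = Cod C m \<Longrightarrow> f \<cdot> m = zr (Dom C m) (Cod C f) \<Longrightarrow> f = zr (Cod C m) (Cod C f)"
  by (rule epi_cancel[of m]) simp_all

lemma mono_comp: "mono m \<Longrightarrow> mono n \<Longrightarrow> Dom C m = Cod C n \<Longrightarrow> mono (m \<cdot> n)"
proof (rule monoI)
  fix f assume *: "mono m" "mono n" "Dom C m = Cod C n" "f \<in> Arr C" "Cod C f = Dom C (m \<cdot> n)"
    "(m \<cdot> n) \<cdot> f = zr (Dom C f) (Cod C (m \<cdot> n))"
  then have "m \<cdot> (n \<cdot> f) = zr (Dom C f) (Cod C m)" by (simp add: cmp_assoc)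
  then have "n \<cdot> f = zr (Dom C f) (Cod C n)" using mono_zr[of m "n \<cdot> f"] * by simp
  then show "f = zr (Dom C f) (Cod C f)" using mono_zr[of n f] * by simp
qed simp

lemma epi_comp: "epi m \<Longrightarrow> epi n \<Longrightarrow> Dom C m = Cod C n \<Longrightarrow> epi (m \<cdot> n)"
proof (rule epiI)
  fix f assume *: "epi m" "epi n" "Dom C m = Cod C n" "f \<in> Arr C" "Dom C f = Cod C (m \<cdot> n)"
    "f \<cdot> (m \<cdot> n) = zr (Dom C (m \<cdot> n)) (Cod C f)"
  then have "(f \<cdot> m) \<cdot> n = zr (Dom C n) (Cod C f)" by (simp add: cmp_assoc)
  then have "f \<cdot> m = zr (Dom C m) (Cod C f)" using epi_zr[of n "f \<cdot> m"] * by simp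
  then show "f = zr (Dom C f) (Cod C f)" using epi_zr[of m f] * by simp
qed simp

lemma split_mono: "m \<in> Arr C \<Longrightarrow> r \<in> Arr C \<Longrightarrow> Dom C r = Cod C m \<Longrightarrow> r \<cdot> m = Ide C (Dom C m) \<Longrightarrow> mono m"
proof (rule monoI)
  fix f assume *: "m \<in> Arr C" "r \<in> Arr C" "Dom C r = Cod C m" "r \<cdot> m = Ide C (Dom C m)"
    "f \<in> Arr C" "Cod C f = Dom C m" "m \<cdot> f = zr (Dom C f) (Cod C m)"
  have cr: "Cod C r = Dom C m" using *(4) cmp_simps(3)[of r m] * by simp
  have "r \<cdot> (m \<cdot> f) = Ide C (Dom C m) \<cdot> f" by (rule cmp_reduce[OF *(4)]) (use * in simp_all)
  then show "f = zr (Dom C f) (Cod C f)" unfolding *(7) using *(1,2,3,5,6) cr by simp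
qed

lemma split_epi: "e \<in> Arr C \<Longrightarrow> s \<in> Arr C \<Longrightarrow> Dom C e = Cod C s \<Longrightarrow> e \<cdot> s = Ide C (Cod C e) \<Longrightarrow> epi e"
proof (rule epiI)
  fix f assume *: "e \<in> Arr C" "s \<in> Arr C" "Dom C e = Cod C s" "e \<cdot> s = Ide C (Cod C e)"
    "f \<in> Arr C" "Dom C f = Cod C e" "f \<cdot> e = zr (Dom C e) (Cod C f)"
  have ds: "Dom C s = Cod C e" using *(4) cmp_simps(2)[of e s] * by simp
  have "(f \<cdot> e) \<cdot> s = f \<cdot> (e \<cdot> s)" by (rule cmp_assoc) (use * in simp_all)
  also have "\<dots> = f" unfolding *(4) using *(5,6) by simp
  finally have "zr (Dom C e) (Cod C f) \<cdot> s = f" unfolding *(7) .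
  moreover have "zr (Dom C e) (Cod C f) \<cdot> s = zr (Dom C s) (Cod C f)" using * by simp
  ultimately show "f = zr (Dom C f) (Cod C f)" using *(6) ds by simp
qed

lemma ide_mono [simp]: "X \<in> Obj C \<Longrightarrow> mono (Ide C X)"
  by (rule split_mono[of _ "Ide C X"]) simp_all

lemma ide_epi [simp]: "X \<in> Obj C \<Longrightarrow> epi (Ide C X)"
  by (rule split_epi[of _ "Ide C X"]) simp_all

lemma kernel_exists:
  assumes "f \<in> Arr C"
  obtains k where "mono k" "Cod C k = Dom C f" "f \<cdot> k = zr (Dom C k) (Cod C f)"
    "\<And>h. h \<in> Arr C \<Longrightarrow> Cod C h = Dom C f \<Longrightarrow> f \<cdot> h = zr (Dom C h) (Cod C f) \<Longrightarrow> factors_through C h k"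
proof -
  obtain k where "is_kernel C k f" using has_kernels[OF assms] by blast
  then have k: "k \<in> Arr C" "Cod C k = Dom C f" "f \<cdot> k = zr (Dom C k) (Cod C f)"
    and u: "\<And>X h. h \<in> Hom C X (Dom C f) \<Longrightarrow> f \<cdot> h = zr X (Cod C f) \<Longrightarrow> \<exists>!u. u \<in> Hom C X (Dom C k) \<and> k \<cdot> u = h"
    unfolding is_kernel_def by blast+
  have "mono k" unfolding mono_arr_def
  proof (intro conjI allI ballI impI k(1))
    fix X a b assume *: "a \<in> Hom C X (Dom C k)" "b \<in> Hom C X (Dom C k)" "k \<cdot> a = k \<cdot> b"
    have "f \<cdot> (k \<cdot> b) = zr (Dom C k) (Cod C f) \<cdot> b"
      by (rule cmp_reduce[OF k(3)]) (use * assms k in simp_all)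
    then have "f \<cdot> (k \<cdot> b) = zr X (Cod C f)" using * assms by simp
    then have "\<exists>!u. u \<in> Hom C X (Dom C k) \<and> k \<cdot> u = k \<cdot> b" using * k by (intro u) auto
    then show "a = b" using * by blast
  qed
  moreover have "factors_through C h k" if "h \<in> Arr C" "Cod C h = Dom C f" "f \<cdot> h = zr (Dom C h) (Cod C f)" for h
  proof -
    have "\<exists>!u. u \<in> Hom C (Dom C h) (Dom C k) \<and> k \<cdot> u = h" using u[of h "Dom C h"] that by simp
    then show ?thesis unfolding factors_through_def by blast
  qed
  ultimately show ?thesis using that k by blast
qed

lemma cokernelD:
  assumes "is_cokernel C q f"
  shows "f \<in> Arr C" "epi q" "Dom C q = Cod C f" "q \<cdot> f = zr (Dom C f) (Cod C q)"
    and "h \<in> Arr C \<Longrightarrow> Dom C h = Cod C f \<Longrightarrow> h \<cdot> f = zr (Dom C f) (Cod C h) \<Longrightarrow> \<exists>u\<in>Hom C (Cod C q) (Cod C h). u \<cdot> q = h"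
proof -
  have k: "f \<in> Arr C" "q \<in> Arr C" "Dom C q = Cod C f" "q \<cdot> f = zr (Dom C f) (Cod C q)"
    and u: "\<And>X h. h \<in> Hom C (Cod C f) X \<Longrightarrow> h \<cdot> f = zr (Dom C f) X \<Longrightarrow> \<exists>!u. u \<in> Hom C (Cod C q) X \<and> u \<cdot> q = h"
    using assms unfolding is_cokernel_def by blast+
  show "f \<in> Arr C" "Dom C q = Cod C f" "q \<cdot> f = zr (Dom C f) (Cod C q)" by (fact k)+
  show "epi q" unfolding epi_arr_def
  proof (intro conjI allI ballI impI k(2))
    fix X a b assume *: "a \<in> Hom C (Cod C q) X" "b \<in> Hom C (Cod C q) X" "a \<cdot> q = b \<cdot> q"
    have "(b \<cdot> q) \<cdot> f = zr (Dom C f) X" using * k by (simp add: cmp_assoc)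
    then have "\<exists>!u. u \<in> Hom C (Cod C q) X \<and> u \<cdot> q = b \<cdot> q" using * k by (intro u) auto
    then show "a = b" using * by blast
  qed
  show "h \<in> Arr C \<Longrightarrow> Dom C h = Cod C f \<Longrightarrow> h \<cdot> f = zr (Dom C f) (Cod C h) \<Longrightarrow> \<exists>u\<in>Hom C (Cod C q) (Cod C h). u \<cdot> q = h"
  proof -
    assume "h \<in> Arr C" "Dom C h = Cod C f" "h \<cdot> f = zr (Dom C f) (Cod C h)"
    then have "\<exists>!u. u \<in> Hom C (Cod C q) (Cod C h) \<and> u \<cdot> q = h" using u[of h "Cod C h"] by simp
    then show ?thesis by blast
  qed
qed

text \<open>An epimorphism is a cokernel of some \<open>f\<close>, and this \<open>f\<close> is
  itself one of the test maps \<open>k\<close>.\<close>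

lemma epi_factor:
  assumes "epi e" "h \<in> Arr C" "Dom C h = Dom C e"
    and k: "\<And>k. k \<in> Arr C \<Longrightarrow> Cod C k = Dom C e \<Longrightarrow> e \<cdot> k = zr (Dom C k) (Cod C e) \<Longrightarrow> h \<cdot> k = zr (Dom C k) (Cod C h)"
  shows "\<exists>u\<in>Hom C (Cod C e) (Cod C h). u \<cdot> e = h"
proof -
  obtain f where f: "is_cokernel C e f" using epi_normal[OF assms(1)] by blast
  note c = cokernelD[OF f]
  have "h \<cdot> f = zr (Dom C f) (Cod C h)" using k[of f] c by simp
  then show ?thesis using c(5)[of h] assms c by simp
qed

text \<open>A monomorphism is a kernel of some \<open>f\<close>, and this \<open>f\<close> is itself
  one of the test maps \<open>q\<close>.\<close>

lemma mono_factor: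
  assumes "mono m" "h \<in> Arr C" "Cod C h = Cod C m"
    and k: "\<And>q. q \<in> Arr C \<Longrightarrow> Dom C q = Cod C m \<Longrightarrow> q \<cdot> m = zr (Dom C m) (Cod C q) \<Longrightarrow> q \<cdot> h = zr (Dom C h) (Cod C q)"
  shows "factors_through C h m"
proof -
  obtain f where "is_kernel C m f" using mono_normal[OF assms(1)] by blast
  then have f: "f \<in> Arr C" "Cod C m = Dom C f" "f \<cdot> m = zr (Dom C m) (Cod C f)"
    and u: "\<And>X h. h \<in> Hom C X (Dom C f) \<Longrightarrow> f \<cdot> h = zr X (Cod C f) \<Longrightarrow> \<exists>!u. u \<in> Hom C X (Dom C m) \<and> m \<cdot> u = h"
    unfolding is_kernel_def by blast+
  have "f \<cdot> h = zr (Dom C h) (Cod C f)" using k[of f] f by simp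
  then have "\<exists>!u. u \<in> Hom C (Dom C h) (Dom C m) \<and> m \<cdot> u = h" using u[of h "Dom C h"] assms f by simp
  then show ?thesis unfolding factors_through_def by blast
qed

lemma factors_throughE:
  assumes "factors_through C f m"
  obtains u where "u \<in> Arr C" "Dom C u = Dom C f" "Cod C u = Dom C m" "m \<cdot> u = f"
  using assms unfolding factors_through_def by auto

lemma factors_throughI: "u \<in> Arr C \<Longrightarrow> Dom C u = Dom C f \<Longrightarrow> Cod C u = Dom C m \<Longrightarrow> m \<cdot> u = f \<Longrightarrow> factors_through C f m"
  unfolding factors_through_def by auto

text \<open>Membership in a subobject may be tested after a cover. If
  \<open>m \<cdot> u = f \<cdot> e\<close>, then whatever \<open>e\<close> kills is killed by
  \<open>u\<close> because \<open>m\<close> is mono; hence \<open>u\<close> descends along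
  \<open>e\<close>.\<close>

lemma factors_through_descent:
  assumes "epi e" "mono m" "f \<in> Arr C" "Dom C f = Cod C e" "Cod C f = Cod C m" "factors_through C (f \<cdot> e) m"
  shows "factors_through C f m"
proof -
  obtain u where u: "u \<in> Arr C" "Dom C u = Dom C e" "Cod C u = Dom C m" "m \<cdot> u = f \<cdot> e"
    using assms by (auto elim!: factors_throughE)
  have "\<exists>v\<in>Hom C (Cod C e) (Cod C u). v \<cdot> e = u"
  proof (rule epi_factor[OF assms(1) u(1,2)])
    fix k assume k: "k \<in> Arr C" "Cod C k = Dom C e" "e \<cdot> k = zr (Dom C k) (Cod C e)"
    have "m \<cdot> (u \<cdot> k) = (f \<cdot> e) \<cdot> k" by (rule cmp_reduce[OF u(4)]) (use k u assms(1,2) in simp_all)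
    also have "\<dots> = f \<cdot> (e \<cdot> k)" using k assms by (simp add: cmp_assoc)
    also have "\<dots> = zr (Dom C k) (Cod C m)" unfolding k(3) using k(1) assms by simp
    finally show "u \<cdot> k = zr (Dom C k) (Cod C u)" using mono_zr[of m "u \<cdot> k"] k u assms(1,2) by simp
  qed
  then obtain v where v: "v \<in> Arr C" "Dom C v = Cod C e" "Cod C v = Dom C m" "v \<cdot> e = u" using u by auto
  have "(m \<cdot> v) \<cdot> e = f \<cdot> e" using v u(4) assms(1,2) by (simp add: cmp_assoc)
  then have "m \<cdot> v = f" using epi_cancel[OF assms(1), of "m \<cdot> v" f] v assms(2-5) by simp
  then show ?thesis using v assms(4) by (intro factors_throughI) auto
qed

text \<open>The mono part is a kernel of a cokernel of \<open>f\<close>. The other part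
  \<open>e\<close> is epi because, if \<open>u\<close> kills \<open>e\<close>, then \<open>e\<close>
  factors through the kernel \<open>k\<close> of \<open>u\<close>, and minimality of the image makes
  \<open>k\<close> split epi, so \<open>u\<close> vanishes.\<close>

lemma image_factorisation:
  assumes f: "f \<in> Arr C"
  obtains m e where "mono m" "epi e" "Dom C e = Dom C f" "Cod C m = Cod C f" "Cod C e = Dom C m" "m \<cdot> e = f"
proof -
  obtain q where q: "is_cokernel C q f" using has_cokernels[OF f] by blast
  note c = cokernelD[OF q]
  obtain m where m: "mono m" "Cod C m = Dom C q" "q \<cdot> m = zr (Dom C m) (Cod C q)"
    "\<And>h. h \<in> Arr C \<Longrightarrow> Cod C h = Dom C q \<Longrightarrow> q \<cdot> h = zr (Dom C h) (Cod C q) \<Longrightarrow> factors_through C h m"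
    using kernel_exists[of q] c by auto
  obtain e where e: "e \<in> Arr C" "Dom C e = Dom C f" "Cod C e = Dom C m" "m \<cdot> e = f"
    using m(4)[of f] c by (auto elim!: factors_throughE)
  have "epi e"
  proof (rule epiI[OF e(1)])
    fix u assume u: "u \<in> Arr C" "Dom C u = Cod C e" "u \<cdot> e = zr (Dom C e) (Cod C u)"
    obtain k where k: "mono k" "Cod C k = Dom C u" "u \<cdot> k = zr (Dom C k) (Cod C u)"
      "\<And>h. h \<in> Arr C \<Longrightarrow> Cod C h = Dom C u \<Longrightarrow> u \<cdot> h = zr (Dom C h) (Cod C u) \<Longrightarrow> factors_through C h k"
      using kernel_exists[OF u(1)] by auto
    obtain e' where e': "e' \<in> Arr C" "Dom C e' = Dom C e" "Cod C e' = Dom C k" "k \<cdot> e' = e"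
      using k(4)[of e] u e by (auto elim!: factors_throughE)
    have mk: "mono (m \<cdot> k)" using m k u e by (intro mono_comp) auto
    \<comment> \<open>Minimality of the image: a map that kills \<open>m \<cdot> k\<close> kills
      \<open>f\<close>, hence factors through the cokernel \<open>q\<close>, and \<open>q\<close>
      kills \<open>m\<close>.\<close>
    have "factors_through C m (m \<cdot> k)"
    proof (rule mono_factor[OF mk])
      fix g assume g: "g \<in> Arr C" "Dom C g = Cod C (m \<cdot> k)" "g \<cdot> (m \<cdot> k) = zr (Dom C (m \<cdot> k)) (Cod C g)"
      have tk: "Cod C k = Dom C m" using k u e by simp
      have "g \<cdot> f = (g \<cdot> (m \<cdot> k)) \<cdot> e'"
        using g(1,2) e'(1-3) m(1) k(1) tk e(4) e'(4) by (simp add: cmp_assoc)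
      also have "\<dots> = zr (Dom C f) (Cod C g)" unfolding g(3) using g(1) e'(1-3) m(1) k(1) tk e(2) by simp
      finally obtain g' where g': "g' \<in> Arr C" "Dom C g' = Cod C q" "Cod C g' = Cod C g" "g' \<cdot> q = g"
        using c(5)[of g] g m(1,2) c(3) k(1) tk by auto
      have "g \<cdot> m = g' \<cdot> (q \<cdot> m)" using g' m(1,2) c(2) by (simp add: cmp_assoc[symmetric])
      then show "g \<cdot> m = zr (Dom C m) (Cod C g)" unfolding m(3) using g' m(1) c(2) by simp
    qed (use m k u e in auto)
    then obtain s where s0: "s \<in> Arr C" "Dom C s = Dom C m" "Cod C s = Dom C (m \<cdot> k)" "(m \<cdot> k) \<cdot> s = m"
      by (rule factors_throughE)
    then have s: "s \<in> Arr C" "Dom C s = Dom C m" "Cod C s = Dom C k" "(m \<cdot> k) \<cdot> s = m"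
      using m(1) k(1,2) u(2) e(3) by simp_all
    have "m \<cdot> (k \<cdot> s) = m \<cdot> Ide C (Dom C m)" using s m(1) k(1,2) u e by (simp add: cmp_assoc)
    then have ks: "k \<cdot> s = Ide C (Dom C m)"
      using mono_cancel[OF m(1), of "k \<cdot> s" "Ide C (Dom C m)"] s(1-3) m(1) k(1,2) u(1,2) e by simp
    have "u = u \<cdot> (k \<cdot> s)" unfolding ks using u e by simp
    also have "\<dots> = (u \<cdot> k) \<cdot> s" using u(1,2) k(1,2) s(1-3) by (simp add: cmp_assoc)
    also have "\<dots> = zr (Dom C u) (Cod C u)" unfolding k(3) using u(1,2) e(3) k(1,2) s(1-3) by simp
    finally show "u = zr (Dom C u) (Cod C u)" .
  qed
  then show ?thesis using that m e c by metis
qed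

lemma binary_biproduct:
  assumes "X \<in> Obj C" "Y \<in> Obj C"
  obtains P j p where "is_biproduct C 2 (\<lambda>i. if i = 0 then X else Y) P j p"
  using has_biproducts[OF assms] by blast

text \<open>Epimorphisms are stable under pullback. This is the substitute for choosing a preimage:
  a generalised element of the target of \<open>e\<close> lifts after passing to a cover of its
  domain.\<close>

lemma epi_lift:
  assumes e: "epi e" and f: "f \<in> Arr C" "Cod C f = Cod C e"
  obtains e' f' where "epi e'" "Cod C e' = Dom C f" "f' \<in> Arr C" "Dom C f' = Dom C e'" "Cod C f' = Dom C e"
    "e \<cdot> f' = f \<cdot> e'"
proof -
  have eA: "e \<in> Arr C" using e by simp
  obtain P j p where P: "is_biproduct C 2 (\<lambda>i. if i = 0 then Dom C e else Dom C f) P j p"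
    using binary_biproduct[of "Dom C e" "Dom C f"] eA f by auto
  note b = biproduct2D[OF P]
  \<comment> \<open>The difference of the two maps on the biproduct of their domains; its kernel is
    the pullback of \<open>e\<close> and \<open>f\<close>.\<close>
  define t where "t = e \<cdot> p 0 \<boxplus> neg (f \<cdot> p 1)"
  have t: "t \<in> Arr C" "Dom C t = P" "Cod C t = Cod C e" using b(1-15) eA f by (simp_all add: t_def)
  have tj0: "t \<cdot> j 0 = e"
  proof -
    have "t \<cdot> j 0 = (e \<cdot> p 0) \<cdot> j 0 \<boxplus> neg ((f \<cdot> p 1) \<cdot> j 0)" unfolding t_def using b(1-15) eA f by simp
    also have "(e \<cdot> p 0) \<cdot> j 0 = e" using b(1-16) eA by (simp add: cmp_assoc)
    also have "(f \<cdot> p 1) \<cdot> j 0 = f \<cdot> (p 1 \<cdot> j 0)" by (rule cmp_assoc) (use b(1-15) f in simp_all)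
    also have "\<dots> = zr (Dom C e) (Cod C e)" unfolding b(19) using b(1-3) f by simp
    finally show ?thesis using eA by simp
  qed
  have "epi t"
  proof (rule epiI[OF t(1)])
    fix u assume u: "u \<in> Arr C" "Dom C u = Cod C t" "u \<cdot> t = zr (Dom C t) (Cod C u)"
    have "u \<cdot> e = (u \<cdot> t) \<cdot> j 0" using tj0 u(1,2) t b(1-15) by (simp add: cmp_assoc)
    also have "\<dots> = zr (Dom C e) (Cod C u)" unfolding u(3) using t b(1-15) u(1) by simp
    finally show "u = zr (Dom C u) (Cod C u)" using epi_zr[OF e u(1)] u t by simp
  qed
  obtain k where k: "mono k" "Cod C k = Dom C t" "t \<cdot> k = zr (Dom C k) (Cod C t)"
    "\<And>h. h \<in> Arr C \<Longrightarrow> Cod C h = Dom C t \<Longrightarrow> t \<cdot> h = zr (Dom C h) (Cod C t) \<Longrightarrow> factors_through C h k"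
    using kernel_exists[OF t(1)] by auto
  have kA: "k \<in> Arr C" "Cod C k = P" using k t by auto
  have "epi (p 1 \<cdot> k)"
  proof (rule epiI)
    fix h assume h: "h \<in> Arr C" "Dom C h = Cod C (p 1 \<cdot> k)" "h \<cdot> (p 1 \<cdot> k) = zr (Dom C (p 1 \<cdot> k)) (Cod C h)"
    have h1: "Dom C h = Dom C f" "(h \<cdot> p 1) \<cdot> k = zr (Dom C k) (Cod C h)" using h b(1-15) kA by (simp_all add: cmp_assoc)
    \<comment> \<open>As \<open>h \<cdot> p 1\<close> kills the kernel of the epimorphism
      \<open>t\<close>, it has the form \<open>u \<cdot> t\<close>. Restriction to the first summand
      then gives \<open>u \<cdot> e = 0\<close>, hence \<open>u = 0\<close> and finally
      \<open>h = 0\<close>.\<close>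
    have "\<exists>u\<in>Hom C (Cod C t) (Cod C (h \<cdot> p 1)). u \<cdot> t = h \<cdot> p 1"
    proof (rule epi_factor[OF \<open>epi t\<close>])
      fix x assume x: "x \<in> Arr C" "Cod C x = Dom C t" "t \<cdot> x = zr (Dom C x) (Cod C t)"
      obtain y where y: "y \<in> Arr C" "Dom C y = Dom C x" "Cod C y = Dom C k" "k \<cdot> y = x"
        using k(4)[OF x] by (auto elim: factors_throughE)
      have "((h \<cdot> p 1) \<cdot> k) \<cdot> y = (h \<cdot> p 1) \<cdot> (k \<cdot> y)"
        by (rule cmp_assoc) (use y(1-3) h(1) h1(1) b(1-15) kA in simp_all)
      then have "(h \<cdot> p 1) \<cdot> x = ((h \<cdot> p 1) \<cdot> k) \<cdot> y" unfolding y(4) by simp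
      also have "\<dots> = zr (Dom C x) (Cod C h)" unfolding h1(2) using y h(1) kA by simp
      finally show "(h \<cdot> p 1) \<cdot> x = zr (Dom C x) (Cod C (h \<cdot> p 1))" using h(1) h1(1) b(1-15) by simp
    qed (use h(1) h1(1) b(1-15) t in simp_all)
    then obtain u where u: "u \<in> Arr C" "Dom C u = Cod C t" "Cod C u = Cod C h" "u \<cdot> t = h \<cdot> p 1"
      using h(1) h1(1) b(1-15) by auto
    have "u \<cdot> e = (u \<cdot> t) \<cdot> j 0" using tj0 u(1,2) t b(1-15) by (simp add: cmp_assoc)
    also have "\<dots> = h \<cdot> (p 1 \<cdot> j 0)" unfolding u(4) by (rule cmp_assoc) (use h(1) h1(1) b(1-15) in simp_all)
    also have "\<dots> = zr (Dom C e) (Cod C u)" unfolding b(19) using h(1) h1(1) b(1-3) u(3) by simp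
    finally have "u = zr (Cod C e) (Cod C u)" using epi_zr[OF e u(1)] u t by simp
    then have "h \<cdot> p 1 = zr (Cod C e) (Cod C h) \<cdot> t" using u by metis
    then have z: "h \<cdot> p 1 = zr P (Cod C h)" using t h(1) by simp
    have "h = (h \<cdot> p 1) \<cdot> j 1" using h(1) h1(1) b(1-15) b(17) by (simp add: cmp_assoc)
    also have "\<dots> = zr (Dom C h) (Cod C h)" unfolding z using h(1) h1(1) b(1-15) by simp
    finally show "h = zr (Dom C h) (Cod C h)" .
  qed (use b(1-15) kA in simp)
  moreover have "e \<cdot> (p 0 \<cdot> k) = f \<cdot> (p 1 \<cdot> k)"
  proof -
    have "t \<cdot> k = e \<cdot> (p 0 \<cdot> k) \<boxplus> neg (f \<cdot> (p 1 \<cdot> k))"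
      unfolding t_def using b(1-15) eA f kA by (simp add: cmp_assoc)
    then have "e \<cdot> (p 0 \<cdot> k) \<boxplus> neg (f \<cdot> (p 1 \<cdot> k)) = zr (Dom C k) (Cod C e)" using k(3) t by simp
    then show ?thesis using add_neg_zr_iff[of "e \<cdot> (p 0 \<cdot> k)" "f \<cdot> (p 1 \<cdot> k)"] b(1-15) eA f kA by simp
  qed
  ultimately show ?thesis by (intro that[of "p 1 \<cdot> k" "p 0 \<cdot> k"]) (use b(1-15) kA in simp_all)
qed

text \<open>A common cover of two covers, needed when two generalised elements with one domain have
  been lifted separately.\<close>

lemma epi_refine2:
  assumes "epi e" "epi f" "Cod C e = Cod C f"
  obtains a b where "a \<in> Arr C" "b \<in> Arr C" "Cod C a = Dom C e" "Cod C b = Dom C f" "Dom C a = Dom C b"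
    "epi (e \<cdot> a)" "e \<cdot> a = f \<cdot> b"
proof -
  obtain b a where *: "epi b" "Cod C b = Dom C f" "a \<in> Arr C" "Dom C a = Dom C b" "Cod C a = Dom C e" "e \<cdot> a = f \<cdot> b"
    using epi_lift[OF assms(1), of f] assms by auto
  have "epi (f \<cdot> b)" using * assms by (intro epi_comp) auto
  then show ?thesis using * by (intro that[of a b]) auto
qed

end

section \<open>The lattice of subobjects\<close>

context abelian_category
begin

abbreviation ft where "ft \<equiv> factors_through C"

lemma ft_refl: "m \<in> Arr C \<Longrightarrow> ft m m"
  by (rule factors_throughI[of "Ide C (Dom C m)"]) simp_all

lemma ft_Arr: "ft f m \<Longrightarrow> m \<in> Arr C \<Longrightarrow> f \<in> Arr C" and ft_Cod: "ft f m \<Longrightarrow> m \<in> Arr C \<Longrightarrow> Cod C f = Cod C m"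
  by (erule factors_throughE; force)+

lemma ft_trans: "ft f m \<Longrightarrow> ft m n \<Longrightarrow> n \<in> Arr C \<Longrightarrow> ft f n"
proof -
  assume *: "ft f m" "ft m n" "n \<in> Arr C"
  obtain u where u: "u \<in> Arr C" "Dom C u = Dom C f" "Cod C u = Dom C m" "m \<cdot> u = f" using *(1) by (rule factors_throughE)
  obtain v where v: "v \<in> Arr C" "Dom C v = Dom C m" "Cod C v = Dom C n" "n \<cdot> v = m" using *(2) by (rule factors_throughE)
  have "n \<cdot> (v \<cdot> u) = m \<cdot> u" by (rule cmp_reduce[OF v(4)]) (use u v *(3) in simp_all)
  then show ?thesis using u v by (intro factors_throughI[of "v \<cdot> u"]) simp_all
qed

lemma ft_comp: "ft f m \<Longrightarrow> m \<in> Arr C \<Longrightarrow> h \<in> Arr C \<Longrightarrow> Cod C h = Dom C f \<Longrightarrow> ft (f \<cdot> h) m"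
proof -
  assume *: "ft f m" "m \<in> Arr C" "h \<in> Arr C" "Cod C h = Dom C f"
  obtain u where u: "u \<in> Arr C" "Dom C u = Dom C f" "Cod C u = Dom C m" "m \<cdot> u = f" using *(1) by (rule factors_throughE)
  have "m \<cdot> (u \<cdot> h) = f \<cdot> h" by (rule cmp_reduce[OF u(4)]) (use u * in simp_all)
  then show ?thesis using u * ft_Arr[OF *(1,2)] by (intro factors_throughI[of "u \<cdot> h"]) simp_all
qed

text \<open>A subobject is determined by the generalised elements of the ambient object that belong to
  it. Up to precomposition with an epimorphism they can be handled like elements of modules.\<close>

definition gel :: "'m set \<Rightarrow> 'm set" where
  "gel S = {f. \<exists>s\<in>S. ft f s}"

lemma sub_class_self: "mono m \<Longrightarrow> m \<in> sub_class C m"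
  by (simp add: sub_class_def ft_refl)

lemma gel_sub_class: "mono m \<Longrightarrow> gel (sub_class C m) = {f. ft f m}"
proof (intro equalityI subsetI)
  assume m: "mono m"
  show "f \<in> {f. ft f m}" if f: "f \<in> gel (sub_class C m)" for f
  proof -
    obtain s where "ft f s" "ft s m" using f by (auto simp: gel_def sub_class_def)
    then show ?thesis using ft_trans m by auto
  qed
  show "f \<in> gel (sub_class C m)" if "f \<in> {f. ft f m}" for f
    using that sub_class_self[OF m] by (auto simp: gel_def)
qed

lemma sub_class_eqI: "mono m \<Longrightarrow> mono n \<Longrightarrow> Cod C m = Cod C n \<Longrightarrow> ft m n \<Longrightarrow> ft n m \<Longrightarrow> sub_class C m = sub_class C n"
proof -
  assume *: "mono m" "mono n" "Cod C m = Cod C n" "ft m n" "ft n m"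
  have "ft m x \<and> ft x m \<longleftrightarrow> ft n x \<and> ft x n" if "mono x" for x
    using ft_trans[of m n x] ft_trans[of n m x] ft_trans[of x m n] ft_trans[of x n m] * that by auto
  then show ?thesis unfolding sub_class_def using *(3) by auto
qed

lemma sub_class_Sub: "mono m \<Longrightarrow> sub_class C m \<in> carrier (Sub C (Cod C m))"
  by (auto simp: Sub_def)

lemma SubE:
  assumes "S \<in> carrier (Sub C X)"
  obtains m where "mono m" "m \<in> Arr C" "Cod C m = X" "S = sub_class C m" "m \<in> S" "\<And>f. f \<in> gel S \<longleftrightarrow> ft f m"
  using assms gel_sub_class sub_class_self unfolding Sub_def by auto

lemma SubE_mono:
  assumes "S \<in> carrier (Sub C X)"
  obtains m where "mono m" "m \<in> Arr C" "Cod C m = X" "\<And>f. f \<in> gel S \<longleftrightarrow> ft f m"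
  using SubE[OF assms] by metis

lemma SubE_Arr:
  assumes "S \<in> carrier (Sub C X)"
  obtains m where "m \<in> Arr C" "Cod C m = X" "\<And>f. f \<in> gel S \<longleftrightarrow> ft f m"
  using SubE[OF assms] by metis

lemma Sub_mem:
  assumes "S \<in> carrier (Sub C X)" "x \<in> S"
  shows "mono x" "x \<in> Arr C" "Cod C x = X" "S = sub_class C x" "\<And>f. f \<in> gel S \<longleftrightarrow> ft f x"
proof -
  obtain m where m: "mono m" "Cod C m = X" "S = sub_class C m" using SubE[OF assms(1)] by metis
  then have x: "mono x" "Cod C x = Cod C m" "ft m x" "ft x m" using assms(2) by (auto simp: sub_class_def)
  then show "mono x" "x \<in> Arr C" "Cod C x = X" "S = sub_class C x" using m sub_class_eqI[of x m] by auto
  then show "\<And>f. f \<in> gel S \<longleftrightarrow> ft f x" using gel_sub_class by auto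
qed

lemma gelD:
  assumes "f \<in> gel S" "S \<in> carrier (Sub C X)"
  shows "f \<in> Arr C" "Cod C f = X"
  using SubE_Arr[OF assms(2)] assms(1) ft_Arr ft_Cod by metis+

lemma gel_comp: "S \<in> carrier (Sub C X) \<Longrightarrow> f \<in> gel S \<Longrightarrow> h \<in> Arr C \<Longrightarrow> Cod C h = Dom C f \<Longrightarrow> f \<cdot> h \<in> gel S"
  using SubE_Arr[of S X] ft_comp by metis

lemma gel_add:
  assumes S: "S \<in> carrier (Sub C X)" and "f \<in> gel S" "g \<in> gel S" "Dom C f = Dom C g"
  shows "f \<boxplus> g \<in> gel S"
proof -
  obtain m where m: "m \<in> Arr C" "Cod C m = X" "\<And>f. f \<in> gel S \<longleftrightarrow> ft f m" using SubE_Arr[OF S] by metis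
  obtain u where u: "u \<in> Arr C" "Dom C u = Dom C f" "Cod C u = Dom C m" "m \<cdot> u = f"
    using assms(2) unfolding m(3) by (rule factors_throughE)
  obtain v where v: "v \<in> Arr C" "Dom C v = Dom C g" "Cod C v = Dom C m" "m \<cdot> v = g"
    using assms(3) unfolding m(3) by (rule factors_throughE)
  have "m \<cdot> (u \<boxplus> v) = f \<boxplus> g" using u v m(1) assms(4) by simp
  moreover have "Dom C (f \<boxplus> g) = Dom C g" using assms gelD[OF _ S] by simp
  ultimately show ?thesis unfolding m(3) using u v assms(4) by (intro factors_throughI[of "u \<boxplus> v"]) simp_all
qed

lemma gel_neg: "S \<in> carrier (Sub C X) \<Longrightarrow> f \<in> gel S \<Longrightarrow> neg f \<in> gel S"
proof -
  assume *: "S \<in> carrier (Sub C X)" "f \<in> gel S"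
  obtain m where m: "m \<in> Arr C" "Cod C m = X" "\<And>f. f \<in> gel S \<longleftrightarrow> ft f m" using SubE_Arr[OF *(1)] by metis
  obtain u where u: "u \<in> Arr C" "Dom C u = Dom C f" "Cod C u = Dom C m" "m \<cdot> u = f"
    using *(2) unfolding m(3) by (rule factors_throughE)
  have "m \<cdot> neg u = neg f" using u m(1) by simp
  then show ?thesis unfolding m(3) using u gelD[OF *(2,1)] by (intro factors_throughI[of "neg u"]) simp_all
qed

lemma gel_diff: "S \<in> carrier (Sub C X) \<Longrightarrow> f \<in> gel S \<Longrightarrow> g \<in> gel S \<Longrightarrow> Dom C f = Dom C g \<Longrightarrow> f \<boxplus> neg g \<in> gel S"
  by (rule gel_add) (auto intro: gel_neg simp: gelD)

lemma gel_zr: "S \<in> carrier (Sub C X) \<Longrightarrow> Y \<in> Obj C \<Longrightarrow> zr Y X \<in> gel S"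
proof -
  assume *: "S \<in> carrier (Sub C X)" "Y \<in> Obj C"
  obtain m where m: "m \<in> Arr C" "Cod C m = X" "\<And>f. f \<in> gel S \<longleftrightarrow> ft f m" using SubE_Arr[OF *(1)] by metis
  then show ?thesis using * by (auto intro!: factors_throughI[of "zr Y (Dom C m)"])
qed

lemma gel_descent:
  "S \<in> carrier (Sub C X) \<Longrightarrow> f \<cdot> e \<in> gel S \<Longrightarrow> epi e \<Longrightarrow> f \<in> Arr C \<Longrightarrow> Cod C f = X \<Longrightarrow> Dom C f = Cod C e \<Longrightarrow> f \<in> gel S"
  using SubE_mono[of S X] factors_through_descent[of e _ f] by metis

lemma Sub_le: "S \<in> carrier (Sub C X) \<Longrightarrow> T \<in> carrier (Sub C X) \<Longrightarrow> S \<sqsubseteq>\<^bsub>Sub C X\<^esub> T \<longleftrightarrow> gel S \<subseteq> gel T"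
proof -
  assume *: "S \<in> carrier (Sub C X)" "T \<in> carrier (Sub C X)"
  obtain m where m: "m \<in> Arr C" "m \<in> S" "\<And>f. f \<in> gel S \<longleftrightarrow> ft f m" using SubE[OF *(1)] by metis
  show ?thesis
  proof
    assume "S \<sqsubseteq>\<^bsub>Sub C X\<^esub> T"
    then obtain s t where st: "s \<in> S" "t \<in> T" "ft s t" by (auto simp: Sub_def)
    then show "gel S \<subseteq> gel T" using Sub_mem[OF *(1) st(1)] Sub_mem[OF *(2) st(2)] ft_trans by blast
  next
    assume "gel S \<subseteq> gel T"
    then have "m \<in> gel T" using m ft_refl by blast
    then show "S \<sqsubseteq>\<^bsub>Sub C X\<^esub> T" using m(2) by (auto simp: Sub_def gel_def)
  qed
qed

lemma Sub_eqI: "S \<in> carrier (Sub C X) \<Longrightarrow> T \<in> carrier (Sub C X) \<Longrightarrow> gel S = gel T \<Longrightarrow> S = T"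
proof -
  assume *: "S \<in> carrier (Sub C X)" "T \<in> carrier (Sub C X)" "gel S = gel T"
  obtain m where m: "mono m" "Cod C m = X" "S = sub_class C m" "\<And>f. f \<in> gel S \<longleftrightarrow> ft f m" using SubE[OF *(1)] by metis
  obtain n where n: "mono n" "Cod C n = X" "T = sub_class C n" "\<And>f. f \<in> gel T \<longleftrightarrow> ft f n" using SubE[OF *(2)] by metis
  show ?thesis unfolding m(3) n(3) using m n *(3) ft_refl[of m] ft_refl[of n] by (intro sub_class_eqI) auto
qed

lemma eq_Sub [simp]: "eq (Sub C X) = (=)"
  by (simp add: Sub_def)

lemma partial_order_Sub: "partial_order (Sub C X)"
proof
  show "S .=\<^bsub>Sub C X\<^esub> T" if "S \<sqsubseteq>\<^bsub>Sub C X\<^esub> T" "T \<sqsubseteq>\<^bsub>Sub C X\<^esub> S" "S \<in> carrier (Sub C X)" "T \<in> carrier (Sub C X)" for S T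
    unfolding eq_Sub
    using that by - (rule Sub_eqI, auto simp: Sub_le)
qed (auto simp: Sub_le)

lemma sub_kernel:
  assumes f: "f \<in> Arr C"
  obtains S where "S \<in> carrier (Sub C (Dom C f))"
    "gel S = {g \<in> Arr C. Cod C g = Dom C f \<and> f \<cdot> g = zr (Dom C g) (Cod C f)}"
proof -
  obtain k where k: "mono k" "Cod C k = Dom C f" "f \<cdot> k = zr (Dom C k) (Cod C f)"
    "\<And>h. h \<in> Arr C \<Longrightarrow> Cod C h = Dom C f \<Longrightarrow> f \<cdot> h = zr (Dom C h) (Cod C f) \<Longrightarrow> ft h k"
    using kernel_exists[OF f] by auto
  have kA: "k \<in> Arr C" using k by simp
  have "f \<cdot> h = zr (Dom C h) (Cod C f)" if "ft h k" for h
  proof -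
    obtain u where u: "u \<in> Arr C" "Dom C u = Dom C h" "Cod C u = Dom C k" "k \<cdot> u = h" using \<open>ft h k\<close> by (rule factors_throughE)
    have "f \<cdot> (k \<cdot> u) = zr (Dom C k) (Cod C f) \<cdot> u" by (rule cmp_reduce[OF k(3)]) (use u k kA f in simp_all)
    then show ?thesis unfolding u(4) using u(1-3) kA f by simp
  qed
  then have "gel (sub_class C k) = {g \<in> Arr C. Cod C g = Dom C f \<and> f \<cdot> g = zr (Dom C g) (Cod C f)}"
    using k ft_Arr[OF _ kA] ft_Cod[OF _ kA] by (auto simp: gel_sub_class)
  then show ?thesis using that sub_class_Sub[OF k(1)] k(2) by metis
qed

text \<open>The inverse image, fixed by its generalised elements. The description is legitimate
  because these determine a subobject, and existence is shown in the next lemma.\<close>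

definition pre :: "'m \<Rightarrow> 'm set \<Rightarrow> 'm set" where
  "pre f S = (THE T. T \<in> carrier (Sub C (Dom C f)) \<and> gel T = {g \<in> Arr C. Cod C g = Dom C f \<and> f \<cdot> g \<in> gel S})"

text \<open>A subobject is the kernel of its cokernel \<open>q\<close>, so its inverse image along
  \<open>f\<close> is the kernel of \<open>q \<cdot> f\<close>.\<close>

lemma pre:
  assumes f: "f \<in> Arr C" and S: "S \<in> carrier (Sub C (Cod C f))"
  shows "pre f S \<in> carrier (Sub C (Dom C f))"
    and gel_pre: "gel (pre f S) = {g \<in> Arr C. Cod C g = Dom C f \<and> f \<cdot> g \<in> gel S}"
proof -
  obtain m where m: "mono m" "m \<in> Arr C" "Cod C m = Cod C f" "\<And>f. f \<in> gel S \<longleftrightarrow> ft f m" using SubE_mono[OF S] by metis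
  obtain q where "is_cokernel C q m" using has_cokernels[OF m(2)] by blast
  note q = cokernelD[OF this]
  have qA: "q \<in> Arr C" using q by simp
  have gS: "h \<in> gel S \<longleftrightarrow> q \<cdot> h = zr (Dom C h) (Cod C q)" if h: "h \<in> Arr C" "Cod C h = Cod C f" for h
  proof
    assume "h \<in> gel S"
    then obtain u where u: "u \<in> Arr C" "Dom C u = Dom C h" "Cod C u = Dom C m" "m \<cdot> u = h"
      unfolding m(4) by (rule factors_throughE)
    have "q \<cdot> (m \<cdot> u) = zr (Dom C m) (Cod C q) \<cdot> u" by (rule cmp_reduce[OF q(4)]) (use u m q(3) qA in simp_all)
    then show "q \<cdot> h = zr (Dom C h) (Cod C q)" unfolding u(4) using u(1-3) m(2) qA by simp
  next
    assume qh: "q \<cdot> h = zr (Dom C h) (Cod C q)"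
    show "h \<in> gel S" unfolding m(4)
    proof (rule mono_factor[OF m(1)])
      fix r assume r: "r \<in> Arr C" "Dom C r = Cod C m" "r \<cdot> m = zr (Dom C m) (Cod C r)"
      then obtain u where u: "u \<in> Arr C" "Dom C u = Cod C q" "Cod C u = Cod C r" "u \<cdot> q = r" using q(5)[of r] by auto
      have "(u \<cdot> q) \<cdot> h = u \<cdot> (q \<cdot> h)" by (rule cmp_assoc) (use u qA h m q(3) in simp_all)
      then show "r \<cdot> h = zr (Dom C h) (Cod C r)" unfolding u(4) qh using u(1-3) h qA by simp
    qed (use h m in simp_all)
  qed
  have qf: "q \<cdot> f \<in> Arr C" "Dom C (q \<cdot> f) = Dom C f" "Cod C (q \<cdot> f) = Cod C q" using qA f q(3) m by simp_all
  obtain T where T: "T \<in> carrier (Sub C (Dom C f))"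
    "gel T = {g \<in> Arr C. Cod C g = Dom C f \<and> (q \<cdot> f) \<cdot> g = zr (Dom C g) (Cod C q)}"
    using sub_kernel[OF qf(1)] unfolding qf(2,3) by auto
  have e: "gel T = {g \<in> Arr C. Cod C g = Dom C f \<and> f \<cdot> g \<in> gel S}"
    unfolding T(2) using gS qA f q(3) m(3) by (auto simp: cmp_assoc)
  have "pre f S = T" unfolding pre_def
  proof (rule the_equality)
    show "T \<in> carrier (Sub C (Dom C f)) \<and> gel T = {g \<in> Arr C. Cod C g = Dom C f \<and> f \<cdot> g \<in> gel S}"
      using T(1) e by (rule conjI)
    fix T' assume "T' \<in> carrier (Sub C (Dom C f)) \<and> gel T' = {g \<in> Arr C. Cod C g = Dom C f \<and> f \<cdot> g \<in> gel S}"
    then show "T' = T" unfolding e[symmetric] using Sub_eqI T(1) by blast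
  qed
  then show "pre f S \<in> carrier (Sub C (Dom C f))" "gel (pre f S) = {g \<in> Arr C. Cod C g = Dom C f \<and> f \<cdot> g \<in> gel S}"
    using T(1) e by auto
qed

text \<open>An element of the image lifts to the domain of \<open>f\<close> only after a cover: the
  epi part of the factorisation is handled by \<open>epi_lift\<close> in one direction and by
  descent in the other.\<close>

lemma image_sub:
  assumes f: "f \<in> Arr C"
  shows image_sub_Sub: "image_sub C f \<in> carrier (Sub C (Cod C f))"
    and gel_image_sub: "gel (image_sub C f) = {g \<in> Arr C. Cod C g = Cod C f \<and>
      (\<exists>e h. epi e \<and> Cod C e = Dom C g \<and> h \<in> Arr C \<and> Dom C h = Dom C e \<and> Cod C h = Dom C f \<and> g \<cdot> e = f \<cdot> h)}"
proof -
  obtain m e where me: "mono m" "epi e" "Dom C e = Dom C f" "Cod C m = Cod C f" "Cod C e = Dom C m" "m \<cdot> e = f"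
    using image_factorisation[OF f] .
  have A: "m \<in> Arr C" "e \<in> Arr C" using me by simp_all
  have fm: "ft f m" using me A by (intro factors_throughI[of e]) simp_all
  have min: "ft m m'" if "mono m'" "Cod C m' = Cod C f" "ft f m'" for m'
    by (rule factors_through_descent[OF me(2) that(1)]) (use that me A in simp_all)
  have "image_sub C f = sub_class C m"
  proof (intro equalityI subsetI)
    fix m' assume "m' \<in> image_sub C f"
    then have m': "mono m'" "Cod C m' = Cod C f" "ft f m'" "ft m' m"
      using me(1,4) fm by (auto simp: image_sub_def)
    then show "m' \<in> sub_class C m" using min me(4) by (auto simp: sub_class_def)
  next
    fix m' assume "m' \<in> sub_class C m"
    then have m': "mono m'" "Cod C m' = Cod C f" "ft m m'" "ft m' m" using me(4) by (auto simp: sub_class_def)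
    have "ft f m'" using ft_trans[OF fm m'(3)] m'(1) by simp
    moreover have "ft m' m''" if "mono m''" "Cod C m'' = Cod C f" "ft f m''" for m''
      using ft_trans[OF m'(4) min[OF that]] that(1) by simp
    ultimately show "m' \<in> image_sub C f" using m' by (auto simp: image_sub_def)
  qed
  then show "image_sub C f \<in> carrier (Sub C (Cod C f))" using sub_class_Sub[OF me(1)] me(4) by simp
  have "ft g m \<longleftrightarrow> g \<in> Arr C \<and> Cod C g = Cod C f \<and>
      (\<exists>e h. epi e \<and> Cod C e = Dom C g \<and> h \<in> Arr C \<and> Dom C h = Dom C e \<and> Cod C h = Dom C f \<and> g \<cdot> e = f \<cdot> h)" for g
  proof
    assume g: "ft g m"
    then obtain u where u: "u \<in> Arr C" "Dom C u = Dom C g" "Cod C u = Dom C m" "m \<cdot> u = g" by (rule factors_throughE)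
    obtain e' h where h: "epi e'" "Cod C e' = Dom C u" "h \<in> Arr C" "Dom C h = Dom C e'" "Cod C h = Dom C e" "e \<cdot> h = u \<cdot> e'"
      using epi_lift[OF me(2) u(1)] u(3) me(5) by auto
    have "f \<cdot> h = m \<cdot> (e \<cdot> h)" using me h(3-5) A cmp_assoc[of m e h] by simp
    also have "\<dots> = g \<cdot> e'" unfolding h(6) by (rule cmp_reduce[OF u(4)]) (use u h(1,2) A in simp_all)
    finally have "g \<cdot> e' = f \<cdot> h" by simp
    then show "g \<in> Arr C \<and> Cod C g = Cod C f \<and>
      (\<exists>e h. epi e \<and> Cod C e = Dom C g \<and> h \<in> Arr C \<and> Dom C h = Dom C e \<and> Cod C h = Dom C f \<and> g \<cdot> e = f \<cdot> h)"
      using ft_Arr[OF g A(1)] ft_Cod[OF g A(1)] h u me by auto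
  next
    assume "g \<in> Arr C \<and> Cod C g = Cod C f \<and>
      (\<exists>e h. epi e \<and> Cod C e = Dom C g \<and> h \<in> Arr C \<and> Dom C h = Dom C e \<and> Cod C h = Dom C f \<and> g \<cdot> e = f \<cdot> h)"
    then obtain e' h where g: "g \<in> Arr C" "Cod C g = Cod C f" and h: "epi e'" "Cod C e' = Dom C g" "h \<in> Arr C"
      "Dom C h = Dom C e'" "Cod C h = Dom C f" "g \<cdot> e' = f \<cdot> h" by blast
    have "ft (g \<cdot> e') m" unfolding h(6) by (rule ft_comp[OF fm A(1)]) (use h in simp_all)
    then show "ft g m" by (rule factors_through_descent[OF h(1) me(1) g(1) h(2)[symmetric] trans[OF g(2) me(4)[symmetric]]])
  qed
  then show "gel (image_sub C f) = {g \<in> Arr C. Cod C g = Cod C f \<and>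
      (\<exists>e h. epi e \<and> Cod C e = Dom C g \<and> h \<in> Arr C \<and> Dom C h = Dom C e \<and> Cod C h = Dom C f \<and> g \<cdot> e = f \<cdot> h)}"
    unfolding \<open>image_sub C f = sub_class C m\<close> gel_sub_class[OF me(1)] by blast
qed

text \<open>The shape matches \<open>pushforward\<close>. All representatives \<open>x\<close> of a
  subobject give the same image, so the union is taken over a single set.\<close>

definition dimg :: "'m \<Rightarrow> 'm set \<Rightarrow> 'm set" where
  "dimg f U = \<Union> ((\<lambda>x. image_sub C (f \<cdot> x)) ` U)"

lemma dimg:
  assumes f: "f \<in> Arr C" and U: "U \<in> carrier (Sub C (Dom C f))"
  shows dimg_Sub: "dimg f U \<in> carrier (Sub C (Cod C f))"
    and gel_dimg: "gel (dimg f U) = {g \<in> Arr C. Cod C g = Cod C f \<and>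
      (\<exists>e a. epi e \<and> Cod C e = Dom C g \<and> a \<in> gel U \<and> Dom C a = Dom C e \<and> g \<cdot> e = f \<cdot> a)}"
    and dimg_rep: "x \<in> U \<Longrightarrow> dimg f U = image_sub C (f \<cdot> x)"
proof -
  let ?G = "{g \<in> Arr C. Cod C g = Cod C f \<and>
      (\<exists>e a. epi e \<and> Cod C e = Dom C g \<and> a \<in> gel U \<and> Dom C a = Dom C e \<and> g \<cdot> e = f \<cdot> a)}"
  have *: "image_sub C (f \<cdot> x) \<in> carrier (Sub C (Cod C f)) \<and> gel (image_sub C (f \<cdot> x)) = ?G" if x: "x \<in> U" for x
  proof -
    note m = Sub_mem[OF U x]
    have fx: "f \<cdot> x \<in> Arr C" "Dom C (f \<cdot> x) = Dom C x" "Cod C (f \<cdot> x) = Cod C f" using m f by simp_all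
    have "(\<exists>e h. epi e \<and> Cod C e = Dom C g \<and> h \<in> Arr C \<and> Dom C h = Dom C e \<and> Cod C h = Dom C x \<and> g \<cdot> e = (f \<cdot> x) \<cdot> h)
      \<longleftrightarrow> (\<exists>e a. epi e \<and> Cod C e = Dom C g \<and> a \<in> gel U \<and> Dom C a = Dom C e \<and> g \<cdot> e = f \<cdot> a)" for g
    proof
      assume "\<exists>e h. epi e \<and> Cod C e = Dom C g \<and> h \<in> Arr C \<and> Dom C h = Dom C e \<and> Cod C h = Dom C x \<and> g \<cdot> e = (f \<cdot> x) \<cdot> h"
      then obtain e h where h: "epi e" "Cod C e = Dom C g" "h \<in> Arr C" "Dom C h = Dom C e" "Cod C h = Dom C x" "g \<cdot> e = (f \<cdot> x) \<cdot> h"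
        by blast
      have "g \<cdot> e = f \<cdot> (x \<cdot> h)" unfolding h(6) using h f m by (intro cmp_assoc) simp_all
      moreover have "x \<cdot> h \<in> gel U" unfolding m(5) using h m by (intro ft_comp ft_refl) simp_all
      ultimately show "\<exists>e a. epi e \<and> Cod C e = Dom C g \<and> a \<in> gel U \<and> Dom C a = Dom C e \<and> g \<cdot> e = f \<cdot> a"
        using h m by (intro exI[of _ e] exI[of _ "x \<cdot> h"]) simp
    next
      assume "\<exists>e a. epi e \<and> Cod C e = Dom C g \<and> a \<in> gel U \<and> Dom C a = Dom C e \<and> g \<cdot> e = f \<cdot> a"
      then obtain e a where a: "epi e" "Cod C e = Dom C g" "ft a x" "Dom C a = Dom C e" "g \<cdot> e = f \<cdot> a" unfolding m(5) by blast
      obtain h where h: "h \<in> Arr C" "Dom C h = Dom C a" "Cod C h = Dom C x" "x \<cdot> h = a" using a(3) by (rule factors_throughE)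
      have "(f \<cdot> x) \<cdot> h = f \<cdot> (x \<cdot> h)" using h f m by (intro cmp_assoc) simp_all
      then show "\<exists>e h. epi e \<and> Cod C e = Dom C g \<and> h \<in> Arr C \<and> Dom C h = Dom C e \<and> Cod C h = Dom C x \<and> g \<cdot> e = (f \<cdot> x) \<cdot> h"
        using a h by (intro exI[of _ e] exI[of _ h]) simp
    qed
    then show ?thesis using image_sub[OF fx(1)] unfolding fx(2,3) by simp
  qed
  have r: "dimg f U = image_sub C (f \<cdot> x)" if x: "x \<in> U" for x
  proof -
    have "image_sub C (f \<cdot> y) = image_sub C (f \<cdot> x)" if "y \<in> U" for y
      by (rule Sub_eqI[OF conjunct1[OF *[OF that]] conjunct1[OF *[OF x]]])
        (simp only: conjunct2[OF *[OF that]] conjunct2[OF *[OF x]])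
    then have "(\<lambda>x. image_sub C (f \<cdot> x)) ` U = {image_sub C (f \<cdot> x)}" using x by blast
    then show ?thesis unfolding dimg_def by simp
  qed
  then show "x \<in> U \<Longrightarrow> dimg f U = image_sub C (f \<cdot> x)" .
  obtain x where "x \<in> U" using SubE[OF U] by metis
  then show "dimg f U \<in> carrier (Sub C (Cod C f))" "gel (dimg f U) = ?G" using r[of x] *[of x] by auto
qed

lemma Sub_full:
  assumes "X \<in> Obj C"
  obtains T where "T \<in> carrier (Sub C X)" "gel T = {g \<in> Arr C. Cod C g = X}"
proof -
  have "ft g (Ide C X)" if "g \<in> Arr C" "Cod C g = X" for g using that by (intro factors_throughI[of g]) auto
  then have "gel (sub_class C (Ide C X)) = {g \<in> Arr C. Cod C g = X}"
    using assms ft_Arr[of _ "Ide C X"] ft_Cod[of _ "Ide C X"] by (auto simp: gel_sub_class)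
  then show ?thesis using that sub_class_Sub[of "Ide C X"] assms by simp
qed

lemma Sub_zero:
  assumes "X \<in> Obj C"
  obtains T where "T \<in> carrier (Sub C X)" "gel T = {zr Y X | Y. Y \<in> Obj C}"
proof -
  obtain T where T: "T \<in> carrier (Sub C X)" "gel T = {g \<in> Arr C. Cod C g = X \<and> Ide C X \<cdot> g = zr (Dom C g) X}"
    using sub_kernel[of "Ide C X"] assms by auto
  have "gel T = {zr Y X | Y. Y \<in> Obj C}"
  proof (intro equalityI subsetI)
    fix g assume "g \<in> gel T"
    then have "g \<in> Arr C" "g = zr (Dom C g) X" unfolding T(2) by auto
    then show "g \<in> {zr Y X | Y. Y \<in> Obj C}" using Dom_in by blast
  qed (use assms in \<open>auto simp: T(2)\<close>)
  then show ?thesis using that T(1) by blast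
qed

text \<open>The intersection is the inverse image of \<open>T\<close> along a representative of
  \<open>S\<close>, composed back into \<open>X\<close>.\<close>

lemma Sub_inter:
  assumes S: "S \<in> carrier (Sub C X)" and T: "T \<in> carrier (Sub C X)"
  obtains U where "U \<in> carrier (Sub C X)" "gel U = gel S \<inter> gel T"
proof -
  obtain m where m: "mono m" "m \<in> Arr C" "Cod C m = X" "\<And>f. f \<in> gel S \<longleftrightarrow> ft f m" using SubE_mono[OF S] by metis
  have T': "T \<in> carrier (Sub C (Cod C m))" using T m by simp
  note p = pre[OF m(2) T']
  obtain k where k: "mono k" "k \<in> Arr C" "Cod C k = Dom C m" "\<And>f. f \<in> gel (pre m T) \<longleftrightarrow> ft f k" using SubE_mono[OF p(1)] by metis
  have mk: "mono (m \<cdot> k)" using m k by (intro mono_comp) auto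
  have "ft f (m \<cdot> k) \<longleftrightarrow> f \<in> gel S \<inter> gel T" for f
  proof
    assume "ft f (m \<cdot> k)"
    then obtain u where "u \<in> Arr C" "Dom C u = Dom C f" "Cod C u = Dom C (m \<cdot> k)" and f: "(m \<cdot> k) \<cdot> u = f" by (rule factors_throughE)
    then have u: "u \<in> Arr C" "Dom C u = Dom C f" "Cod C u = Dom C k" using m k by simp_all
    have f': "f = m \<cdot> (k \<cdot> u)" unfolding f[symmetric] using u m k by (intro cmp_assoc) auto
    have "f \<in> gel S" unfolding m(4) f' using u m k by (intro ft_comp ft_refl) auto
    moreover have "k \<cdot> u \<in> gel (pre m T)" unfolding k(4) using u k by (intro ft_comp ft_refl) auto
    ultimately show "f \<in> gel S \<inter> gel T" using p(2) f' by auto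
  next
    assume f: "f \<in> gel S \<inter> gel T"
    then obtain u where u: "u \<in> Arr C" "Dom C u = Dom C f" "Cod C u = Dom C m" "m \<cdot> u = f"
      using m(4) by (auto elim: factors_throughE)
    then have "u \<in> gel (pre m T)" using f p(2) by auto
    then obtain v where v: "v \<in> Arr C" "Dom C v = Dom C u" "Cod C v = Dom C k" "k \<cdot> v = u" unfolding k(4) by (rule factors_throughE)
    have "(m \<cdot> k) \<cdot> v = m \<cdot> (k \<cdot> v)" using v m k by (intro cmp_assoc) auto
    then show "ft f (m \<cdot> k)" using u v m k by (intro factors_throughI[of v]) simp_all
  qed
  then have "gel (sub_class C (m \<cdot> k)) = gel S \<inter> gel T" unfolding gel_sub_class[OF mk] by blast
  then show ?thesis using that sub_class_Sub[OF mk] m k by simp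
qed

text \<open>The sum is the image of the biproduct of the two sources. The cover \<open>e\<close> in
  the description is there because the map from the biproduct onto its image is epi but in general
  not split.\<close>

lemma Sub_sum:
  assumes S: "S \<in> carrier (Sub C X)" and T: "T \<in> carrier (Sub C X)"
  obtains U where "U \<in> carrier (Sub C X)" "gel U = {g \<in> Arr C. Cod C g = X \<and>
    (\<exists>e a b. epi e \<and> Cod C e = Dom C g \<and> a \<in> gel S \<and> b \<in> gel T \<and> Dom C a = Dom C e \<and> Dom C b = Dom C e \<and> g \<cdot> e = a \<boxplus> b)}"
proof -
  obtain m where m: "mono m" "m \<in> Arr C" "Cod C m = X" "\<And>f. f \<in> gel S \<longleftrightarrow> ft f m" using SubE_mono[OF S] by metis
  obtain n where n: "mono n" "n \<in> Arr C" "Cod C n = X" "\<And>f. f \<in> gel T \<longleftrightarrow> ft f n" using SubE_mono[OF T] by metis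
  obtain P j p where P: "is_biproduct C 2 (\<lambda>i. if i = 0 then Dom C m else Dom C n) P j p"
    using binary_biproduct[of "Dom C m" "Dom C n"] m n by auto
  note b = biproduct2D[OF P]
  define t where "t = m \<cdot> p 0 \<boxplus> n \<cdot> p 1"
  have t: "t \<in> Arr C" "Dom C t = P" "Cod C t = X" using b(1-15) m n by (simp_all add: t_def)
  have th: "t \<cdot> h = m \<cdot> (p 0 \<cdot> h) \<boxplus> n \<cdot> (p 1 \<cdot> h)" if "h \<in> Arr C" "Cod C h = P" for h
    unfolding t_def using b(1-15) m n that by (simp add: cmp_assoc)
  have "(\<exists>e h. epi e \<and> Cod C e = Dom C g \<and> h \<in> Arr C \<and> Dom C h = Dom C e \<and> Cod C h = P \<and> g \<cdot> e = t \<cdot> h) \<longleftrightarrow>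
    (\<exists>e a b. epi e \<and> Cod C e = Dom C g \<and> a \<in> gel S \<and> b \<in> gel T \<and> Dom C a = Dom C e \<and> Dom C b = Dom C e \<and> g \<cdot> e = a \<boxplus> b)" for g
  proof
    assume "\<exists>e h. epi e \<and> Cod C e = Dom C g \<and> h \<in> Arr C \<and> Dom C h = Dom C e \<and> Cod C h = P \<and> g \<cdot> e = t \<cdot> h"
    then obtain e h where h: "epi e" "Cod C e = Dom C g" "h \<in> Arr C" "Dom C h = Dom C e" "Cod C h = P" "g \<cdot> e = t \<cdot> h" by blast
    have "m \<cdot> (p 0 \<cdot> h) \<in> gel S" unfolding m(4) using h m b(1-15) by (intro ft_comp ft_refl) simp_all
    moreover have "n \<cdot> (p 1 \<cdot> h) \<in> gel T" unfolding n(4) using h n b(1-15) by (intro ft_comp ft_refl) simp_all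
    ultimately show "\<exists>e a b. epi e \<and> Cod C e = Dom C g \<and> a \<in> gel S \<and> b \<in> gel T \<and> Dom C a = Dom C e \<and> Dom C b = Dom C e \<and> g \<cdot> e = a \<boxplus> b"
      using h m n b(1-15) th[of h] by (intro exI[of _ e] exI[of _ "m \<cdot> (p 0 \<cdot> h)"] exI[of _ "n \<cdot> (p 1 \<cdot> h)"]) simp
  next
    assume "\<exists>e a b. epi e \<and> Cod C e = Dom C g \<and> a \<in> gel S \<and> b \<in> gel T \<and> Dom C a = Dom C e \<and> Dom C b = Dom C e \<and> g \<cdot> e = a \<boxplus> b"
    then obtain e x y where g: "epi e" "Cod C e = Dom C g" "x \<in> gel S" "y \<in> gel T" "Dom C x = Dom C e" "Dom C y = Dom C e" "g \<cdot> e = x \<boxplus> y"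
      by blast
    obtain u where u: "u \<in> Arr C" "Dom C u = Dom C x" "Cod C u = Dom C m" "m \<cdot> u = x" using g(3) unfolding m(4) by (rule factors_throughE)
    obtain v where v: "v \<in> Arr C" "Dom C v = Dom C y" "Cod C v = Dom C n" "n \<cdot> v = y" using g(4) unfolding n(4) by (rule factors_throughE)
    define h where "h = j 0 \<cdot> u \<boxplus> j 1 \<cdot> v"
    have h: "h \<in> Arr C" "Dom C h = Dom C e" "Cod C h = P" using u v b(1-15) g by (simp_all add: h_def)
    have "p 0 \<cdot> (j 0 \<cdot> u) = Ide C (Dom C m) \<cdot> u" "p 0 \<cdot> (j 1 \<cdot> v) = zr (Dom C n) (Dom C m) \<cdot> v"
      "p 1 \<cdot> (j 0 \<cdot> u) = zr (Dom C m) (Dom C n) \<cdot> u" "p 1 \<cdot> (j 1 \<cdot> v) = Ide C (Dom C n) \<cdot> v"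
      using u v b(1-15) by (intro cmp_reduce b(16-19); simp)+
    then have "p 0 \<cdot> h = u" "p 1 \<cdot> h = v" unfolding h_def using u(1-3) v(1-3) b(1-15) g(5,6) by simp_all
    then have "g \<cdot> e = t \<cdot> h" using th[OF h(1,3)] g(7) u(4) v(4) by simp
    then show "\<exists>e h. epi e \<and> Cod C e = Dom C g \<and> h \<in> Arr C \<and> Dom C h = Dom C e \<and> Cod C h = P \<and> g \<cdot> e = t \<cdot> h" using g(1,2) h by blast
  qed
  then have "gel (image_sub C t) = {g \<in> Arr C. Cod C g = X \<and>
    (\<exists>e a b. epi e \<and> Cod C e = Dom C g \<and> a \<in> gel S \<and> b \<in> gel T \<and> Dom C a = Dom C e \<and> Dom C b = Dom C e \<and> g \<cdot> e = a \<boxplus> b)}"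
    using gel_image_sub[OF t(1)] t by simp
  then show ?thesis using that image_sub_Sub[OF t(1)] t by simp
qed

end

section \<open>Joins, meets and modularity of the subobject lattice\<close>

context abelian_category
begin

definition gsum :: "'o \<Rightarrow> 'm set \<Rightarrow> 'm set \<Rightarrow> 'm set" where
  "gsum X S T = {g \<in> Arr C. Cod C g = X \<and>
    (\<exists>e a b. epi e \<and> Cod C e = Dom C g \<and> a \<in> gel S \<and> b \<in> gel T \<and> Dom C a = Dom C e \<and> Dom C b = Dom C e \<and> g \<cdot> e = a \<boxplus> b)}"

lemma gsumI:
  "g \<in> Arr C \<Longrightarrow> Cod C g = X \<Longrightarrow> epi e \<Longrightarrow> Cod C e = Dom C g \<Longrightarrow> a \<in> gel S \<Longrightarrow> b \<in> gel T \<Longrightarrow> Dom C a = Dom C e \<Longrightarrow>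
     Dom C b = Dom C e \<Longrightarrow> g \<cdot> e = a \<boxplus> b \<Longrightarrow> g \<in> gsum X S T"
  unfolding gsum_def by blast

lemma gsum_sup1: "S \<in> carrier (Sub C X) \<Longrightarrow> T \<in> carrier (Sub C X) \<Longrightarrow> gel S \<subseteq> gsum X S T"
proof
  fix f assume *: "S \<in> carrier (Sub C X)" "T \<in> carrier (Sub C X)" "f \<in> gel S"
  note f = gelD[OF *(3,1)]
  show "f \<in> gsum X S T"
    by (rule gsumI[of f X "Ide C (Dom C f)" f S "zr (Dom C f) X"]) (use f * gel_zr[OF *(2)] in auto)
qed

lemma gsum_sup2: "S \<in> carrier (Sub C X) \<Longrightarrow> T \<in> carrier (Sub C X) \<Longrightarrow> gel T \<subseteq> gsum X S T"
proof
  fix f assume *: "S \<in> carrier (Sub C X)" "T \<in> carrier (Sub C X)" "f \<in> gel T"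
  note f = gelD[OF *(3,2)]
  show "f \<in> gsum X S T"
    by (rule gsumI[of f X "Ide C (Dom C f)" "zr (Dom C f) X" S f]) (use f * gel_zr[OF *(1)] in auto)
qed

lemma gsum_least:
  assumes "V \<in> carrier (Sub C X)" "gel S \<subseteq> gel V" "gel T \<subseteq> gel V"
  shows "gsum X S T \<subseteq> gel V"
proof
  fix g assume "g \<in> gsum X S T"
  then obtain e a b where g: "g \<in> Arr C" "Cod C g = X" "epi e" "Cod C e = Dom C g" "a \<in> gel S" "b \<in> gel T"
    "Dom C a = Dom C e" "Dom C b = Dom C e" "g \<cdot> e = a \<boxplus> b" unfolding gsum_def by blast
  have "g \<cdot> e \<in> gel V" unfolding g(9) by (rule gel_add[OF assms(1)]) (use g assms in auto)
  then show "g \<in> gel V" by (rule gel_descent[OF assms(1)]) (use g in auto)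
qed

lemma Sub_lub:
  assumes "S \<in> carrier (Sub C X)" "T \<in> carrier (Sub C X)" "U \<in> carrier (Sub C X)" "gel U = gsum X S T"
  shows "least (Sub C X) U (Upper (Sub C X) {S, T})"
  unfolding least_def
proof (intro conjI ballI)
  have "S \<sqsubseteq>\<^bsub>Sub C X\<^esub> U" "T \<sqsubseteq>\<^bsub>Sub C X\<^esub> U"
    using gsum_sup1[OF assms(1,2)] gsum_sup2[OF assms(1,2)] assms(4)
    by (simp_all add: Sub_le[OF assms(1,3)] Sub_le[OF assms(2,3)])
  then show "U \<in> Upper (Sub C X) {S, T}" unfolding Upper_def using assms(3) by blast
  fix V assume "V \<in> Upper (Sub C X) {S, T}"
  then have V: "V \<in> carrier (Sub C X)" "S \<sqsubseteq>\<^bsub>Sub C X\<^esub> V" "T \<sqsubseteq>\<^bsub>Sub C X\<^esub> V"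
    using assms(1,2) unfolding Upper_def by blast+
  have "gel S \<subseteq> gel V" "gel T \<subseteq> gel V"
    using V(2,3) Sub_le[OF assms(1) V(1)] Sub_le[OF assms(2) V(1)] by simp_all
  then show "U \<sqsubseteq>\<^bsub>Sub C X\<^esub> V" using gsum_least[OF V(1)] assms(4) by (simp add: Sub_le[OF assms(3) V(1)])
qed auto

lemma Sub_glb:
  assumes "S \<in> carrier (Sub C X)" "T \<in> carrier (Sub C X)" "U \<in> carrier (Sub C X)" "gel U = gel S \<inter> gel T"
  shows "greatest (Sub C X) U (Lower (Sub C X) {S, T})"
  unfolding greatest_def
proof (intro conjI ballI)
  have "U \<sqsubseteq>\<^bsub>Sub C X\<^esub> S" "U \<sqsubseteq>\<^bsub>Sub C X\<^esub> T"
    using assms(4) by (simp_all add: Sub_le[OF assms(3,1)] Sub_le[OF assms(3,2)])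
  then show "U \<in> Lower (Sub C X) {S, T}" unfolding Lower_def using assms(3) by blast
  fix V assume "V \<in> Lower (Sub C X) {S, T}"
  then have V: "V \<in> carrier (Sub C X)" "V \<sqsubseteq>\<^bsub>Sub C X\<^esub> S" "V \<sqsubseteq>\<^bsub>Sub C X\<^esub> T"
    using assms(1,2) unfolding Lower_def by blast+
  have "gel V \<subseteq> gel S" "gel V \<subseteq> gel T"
    using V(2,3) Sub_le[OF V(1) assms(1)] Sub_le[OF V(1) assms(2)] by simp_all
  then show "V \<sqsubseteq>\<^bsub>Sub C X\<^esub> U" using assms(4) by (simp add: Sub_le[OF V(1) assms(3)])
qed auto

lemma lattice_Sub: "lattice (Sub C X)"
proof -
  interpret partial_order "Sub C X" by (rule partial_order_Sub)
  show ?thesis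
  proof
    fix S T assume ST: "S \<in> carrier (Sub C X)" "T \<in> carrier (Sub C X)"
    show "\<exists>U. least (Sub C X) U (Upper (Sub C X) {S, T})"
    proof -
      obtain U where "U \<in> carrier (Sub C X)" "gel U = gsum X S T" using Sub_sum[OF ST] unfolding gsum_def .
      then show ?thesis using Sub_lub[OF ST] by blast
    qed
    show "\<exists>U. greatest (Sub C X) U (Lower (Sub C X) {S, T})"
    proof -
      obtain U where "U \<in> carrier (Sub C X)" "gel U = gel S \<inter> gel T" using Sub_inter[OF ST] .
      then show ?thesis using Sub_glb[OF ST] by blast
    qed
  qed
qed

lemma Sub_meet:
  assumes "S \<in> carrier (Sub C X)" "T \<in> carrier (Sub C X)"
  shows "S \<sqinter>\<^bsub>Sub C X\<^esub> T \<in> carrier (Sub C X)" and gel_meet: "gel (S \<sqinter>\<^bsub>Sub C X\<^esub> T) = gel S \<inter> gel T"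
proof -
  interpret lattice "Sub C X" by (rule lattice_Sub)
  obtain U where U: "U \<in> carrier (Sub C X)" "gel U = gel S \<inter> gel T" using Sub_inter[OF assms] .
  have "greatest (Sub C X) (S \<sqinter>\<^bsub>Sub C X\<^esub> T) (Lower (Sub C X) {S, T})"
    unfolding meet_def by (rule inf_of_two_greatest) (use assms in auto)
  then have "S \<sqinter>\<^bsub>Sub C X\<^esub> T = U" using Sub_glb[OF assms U] by (rule greatest_unique)
  then show "S \<sqinter>\<^bsub>Sub C X\<^esub> T \<in> carrier (Sub C X)" "gel (S \<sqinter>\<^bsub>Sub C X\<^esub> T) = gel S \<inter> gel T" using U by auto
qed

lemma Sub_join:
  assumes "S \<in> carrier (Sub C X)" "T \<in> carrier (Sub C X)"
  shows "S \<squnion>\<^bsub>Sub C X\<^esub> T \<in> carrier (Sub C X)" and gel_join: "gel (S \<squnion>\<^bsub>Sub C X\<^esub> T) = gsum X S T"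
proof -
  interpret lattice "Sub C X" by (rule lattice_Sub)
  obtain U where U: "U \<in> carrier (Sub C X)" "gel U = gsum X S T" using Sub_sum[OF assms] unfolding gsum_def .
  have "least (Sub C X) (S \<squnion>\<^bsub>Sub C X\<^esub> T) (Upper (Sub C X) {S, T})"
    unfolding join_def by (rule sup_of_two_least) (use assms in auto)
  then have "S \<squnion>\<^bsub>Sub C X\<^esub> T = U" using Sub_lub[OF assms U] by (rule least_unique)
  then show "S \<squnion>\<^bsub>Sub C X\<^esub> T \<in> carrier (Sub C X)" "gel (S \<squnion>\<^bsub>Sub C X\<^esub> T) = gsum X S T" using U by auto
qed

lemma gel_joinE:
  assumes "S \<in> carrier (Sub C X)" "T \<in> carrier (Sub C X)" "g \<in> gel (S \<squnion>\<^bsub>Sub C X\<^esub> T)"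
  obtains e a b where "epi e" "Cod C e = Dom C g" "a \<in> gel S" "b \<in> gel T" "a \<in> Arr C" "b \<in> Arr C"
    "Cod C a = X" "Cod C b = X" "Dom C a = Dom C e" "Dom C b = Dom C e" "g \<cdot> e = a \<boxplus> b"
  using assms gelD[of _ S X] gelD[of _ T X] unfolding gel_join[OF assms(1,2)] gsum_def by blast

lemma gel_joinI:
  assumes "S \<in> carrier (Sub C X)" "T \<in> carrier (Sub C X)"
    and "g \<in> Arr C" "Cod C g = X" "epi e" "Cod C e = Dom C g" "a \<in> gel S" "b \<in> gel T" "Dom C a = Dom C e"
     "Dom C b = Dom C e" "g \<cdot> e = a \<boxplus> b"
  shows "g \<in> gel (S \<squnion>\<^bsub>Sub C X\<^esub> T)"
  unfolding gel_join[OF assms(1,2)] using assms(3-) by (rule gsumI)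

lemma modular_lattice_Sub:
  assumes X: "X \<in> Obj C"
  shows "modular_lattice (Sub C X)"
proof -
  interpret lattice "Sub C X" by (rule lattice_Sub)
  show ?thesis
  proof
    obtain B where B: "B \<in> carrier (Sub C X)" "gel B = {zr Y X | Y. Y \<in> Obj C}" using Sub_zero[OF X] .
    obtain T where T: "T \<in> carrier (Sub C X)" "gel T = {g \<in> Arr C. Cod C g = X}" using Sub_full[OF X] .
    show "\<exists>x. least (Sub C X) x (carrier (Sub C X))"
      by (rule exI[of _ B]) (use B gel_zr in \<open>auto simp: least_def Sub_le\<close>)
    show "\<exists>x. greatest (Sub C X) x (carrier (Sub C X))"
      by (rule exI[of _ T]) (use T gelD in \<open>auto simp: greatest_def Sub_le\<close>)
  next
    fix S T U assume c: "S \<in> carrier (Sub C X)" "T \<in> carrier (Sub C X)" "U \<in> carrier (Sub C X)" and le: "S \<sqsubseteq>\<^bsub>Sub C X\<^esub> U"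
    have SU: "gel S \<subseteq> gel U" using le c by (simp add: Sub_le)
    have "gel ((S \<squnion>\<^bsub>Sub C X\<^esub> T) \<sqinter>\<^bsub>Sub C X\<^esub> U) \<subseteq> gel (S \<squnion>\<^bsub>Sub C X\<^esub> (T \<sqinter>\<^bsub>Sub C X\<^esub> U))"
    proof
      fix g assume "g \<in> gel ((S \<squnion>\<^bsub>Sub C X\<^esub> T) \<sqinter>\<^bsub>Sub C X\<^esub> U)"
      then have g: "g \<in> gel (S \<squnion>\<^bsub>Sub C X\<^esub> T)" "g \<in> gel U" using c by (auto simp: gel_meet)
      obtain e a b where eab: "epi e" "Cod C e = Dom C g" "a \<in> gel S" "b \<in> gel T" "a \<in> Arr C" "b \<in> Arr C"
        "Cod C a = X" "Cod C b = X" "Dom C a = Dom C e" "Dom C b = Dom C e" "g \<cdot> e = a \<boxplus> b"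
        using gel_joinE[OF c(1,2) g(1)] .
      \<comment> \<open>The module-theoretic argument after a cover: both \<open>g \<cdot> e\<close>
        and its \<open>S\<close>-part \<open>a\<close> lie in \<open>U\<close>, so the
        \<open>T\<close>-part \<open>b\<close> does too.\<close>
      have "g \<cdot> e \<boxplus> neg a \<in> gel U"
        by (rule gel_diff[OF c(3) gel_comp[OF c(3)]]) (use g eab SU gelD[OF g(2) c(3)] in auto)
      moreover have "g \<cdot> e \<boxplus> neg a = b"
        unfolding eab(11) using eab(5-10) add_neg_cancel(1)[of b a] add_comm[of a b] by simp
      ultimately have "b \<in> gel (T \<sqinter>\<^bsub>Sub C X\<^esub> U)" using eab(4) c by (simp add: gel_meet)
      then show "g \<in> gel (S \<squnion>\<^bsub>Sub C X\<^esub> (T \<sqinter>\<^bsub>Sub C X\<^esub> U))"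
        by (rule gel_joinI[OF c(1) Sub_meet(1)[OF c(2,3)] gelD(1)[OF g(2) c(3)] gelD(2)[OF g(2) c(3)] eab(1,2,3) _ eab(9,10,11)])
    qed
    then show "(S \<squnion>\<^bsub>Sub C X\<^esub> T) \<sqinter>\<^bsub>Sub C X\<^esub> U \<sqsubseteq>\<^bsub>Sub C X\<^esub> S \<squnion>\<^bsub>Sub C X\<^esub> (T \<sqinter>\<^bsub>Sub C X\<^esub> U)"
      using c by (simp add: Sub_le)
  qed
qed

lemma Sub_bottom:
  assumes X: "X \<in> Obj C"
  shows "\<bottom>\<^bsub>Sub C X\<^esub> \<in> carrier (Sub C X)" and gel_bottom: "g \<in> gel \<bottom>\<^bsub>Sub C X\<^esub> \<longleftrightarrow> g \<in> Arr C \<and> g = zr (Dom C g) X"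
proof -
  interpret modular_lattice "Sub C X" by (rule modular_lattice_Sub[OF X])
  show "\<bottom>\<^bsub>Sub C X\<^esub> \<in> carrier (Sub C X)" by simp
  obtain B where B: "B \<in> carrier (Sub C X)" "gel B = {zr Y X | Y. Y \<in> Obj C}" using Sub_zero[OF X] .
  have "B \<sqsubseteq>\<^bsub>Sub C X\<^esub> \<bottom>\<^bsub>Sub C X\<^esub>" using B gel_zr by (auto simp: Sub_le)
  then have "B = \<bottom>\<^bsub>Sub C X\<^esub>" using le_bot_eq B by blast
  moreover have "g \<in> gel B \<longleftrightarrow> g \<in> Arr C \<and> g = zr (Dom C g) X"
    unfolding B(2) using X Dom_in[of g] by auto
  ultimately show "g \<in> gel \<bottom>\<^bsub>Sub C X\<^esub> \<longleftrightarrow> g \<in> Arr C \<and> g = zr (Dom C g) X" by simp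
qed

lemma gel_top:
  assumes X: "X \<in> Obj C"
  shows "gel \<top>\<^bsub>Sub C X\<^esub> = {g \<in> Arr C. Cod C g = X}"
proof -
  interpret modular_lattice "Sub C X" by (rule modular_lattice_Sub[OF X])
  obtain T where T: "T \<in> carrier (Sub C X)" "gel T = {g \<in> Arr C. Cod C g = X}" using Sub_full[OF X] .
  have "gel T \<subseteq> gel \<top>\<^bsub>Sub C X\<^esub>" using T Sub_le[OF T(1) top_closed] top_higher by auto
  then show ?thesis using T(2) gelD[OF _ top_closed] by auto
qed

section \<open>Transport of cubes\<close>

lemma pre_meet:
  assumes "f \<in> Arr C" "S \<in> carrier (Sub C (Cod C f))" "T \<in> carrier (Sub C (Cod C f))"
  shows "pre f (S \<sqinter>\<^bsub>Sub C (Cod C f)\<^esub> T) = pre f S \<sqinter>\<^bsub>Sub C (Dom C f)\<^esub> pre f T"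
  by (rule Sub_eqI[OF pre(1) Sub_meet(1)]) (use assms in \<open>auto simp: pre gel_pre gel_meet Sub_meet\<close>)

lemma pre_join_le:
  assumes f: "f \<in> Arr C" and S: "S \<in> carrier (Sub C (Cod C f))" and T: "T \<in> carrier (Sub C (Cod C f))"
  shows "gel (pre f S \<squnion>\<^bsub>Sub C (Dom C f)\<^esub> pre f T) \<subseteq> gel (pre f (S \<squnion>\<^bsub>Sub C (Cod C f)\<^esub> T))"
proof -
  interpret L: lattice "Sub C (Cod C f)" by (rule lattice_Sub)
  have le: "gel S \<subseteq> gel (S \<squnion>\<^bsub>Sub C (Cod C f)\<^esub> T)" "gel T \<subseteq> gel (S \<squnion>\<^bsub>Sub C (Cod C f)\<^esub> T)"
    using gsum_sup1[OF S T] gsum_sup2[OF S T] by (simp_all add: gel_join[OF S T])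
  show ?thesis unfolding gel_join[OF pre(1)[OF f S] pre(1)[OF f T]]
    by (rule gsum_least[OF pre(1)[OF f Sub_join(1)[OF S T]]])
      (use le in \<open>auto simp: gel_pre[OF f S] gel_pre[OF f T] gel_pre[OF f Sub_join(1)[OF S T]]\<close>)
qed

text \<open>Inverse images always respect meets; joins need \<open>f\<close> to be epi. The
  \<open>S\<close>-part of \<open>f \<cdot> g\<close> is lifted through \<open>f\<close>, and what
  remains of \<open>g\<close> maps into \<open>T\<close>.\<close>

lemma pre_join_epi:
  assumes f: "epi f" and S: "S \<in> carrier (Sub C (Cod C f))" and T: "T \<in> carrier (Sub C (Cod C f))"
  shows "pre f (S \<squnion>\<^bsub>Sub C (Cod C f)\<^esub> T) = pre f S \<squnion>\<^bsub>Sub C (Dom C f)\<^esub> pre f T"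
proof (rule Sub_eqI[OF pre(1)[OF epi_Arr[OF f] Sub_join(1)[OF S T]] Sub_join(1)[OF pre(1)[OF epi_Arr[OF f] S] pre(1)[OF epi_Arr[OF f] T]]], intro equalityI subsetI)
  have fA: "f \<in> Arr C" using f by simp
  fix g assume g: "g \<in> gel (pre f (S \<squnion>\<^bsub>Sub C (Cod C f)\<^esub> T))"
  then have gA: "g \<in> Arr C" "Cod C g = Dom C f" and "f \<cdot> g \<in> gel (S \<squnion>\<^bsub>Sub C (Cod C f)\<^esub> T)"
    using gel_pre[OF fA Sub_join(1)[OF S T]] by auto
  then obtain e a b where eab: "epi e" "Cod C e = Dom C (f \<cdot> g)" "a \<in> gel S" "b \<in> gel T" "a \<in> Arr C" "b \<in> Arr C"
        "Cod C a = Cod C f" "Cod C b = Cod C f" "Dom C a = Dom C e" "Dom C b = Dom C e" "(f \<cdot> g) \<cdot> e = a \<boxplus> b"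
    using gel_joinE[OF S T] by blast
  have eg: "Cod C e = Dom C g" using eab(2) gA fA by simp
  obtain e' h where h: "epi e'" "Cod C e' = Dom C a" "h \<in> Arr C" "Dom C h = Dom C e'" "Cod C h = Dom C f" "f \<cdot> h = a \<cdot> e'"
    using epi_lift[OF f eab(5,7)] .
  have A: "e \<in> Arr C" "e' \<in> Arr C" using eab h by auto
  have ee: "epi (e \<cdot> e')" using eab h by (intro epi_comp) auto
  have "h \<in> gel (pre f S)" using h gel_comp[OF S eab(3), of e'] A by (simp add: gel_pre[OF fA S])
  moreover
  \<comment> \<open>The remainder of \<open>g\<close> after subtracting the lift \<open>h\<close> of
    the \<open>S\<close>-part; its image under \<open>f\<close> is the \<open>T\<close>-part
    \<open>b \<cdot> e'\<close>.\<close>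
  define k where "k = g \<cdot> (e \<cdot> e') \<boxplus> neg h"
  have k: "k \<in> Arr C" "Dom C k = Dom C e'" "Cod C k = Dom C f" using gA eg A h eab(9) by (simp_all add: k_def)
  have fge: "f \<cdot> (g \<cdot> (e \<cdot> e')) = a \<cdot> e' \<boxplus> b \<cdot> e'"
  proof -
    have "f \<cdot> (g \<cdot> (e \<cdot> e')) = ((f \<cdot> g) \<cdot> e) \<cdot> e'" using fA gA eg A h(2) eab(9) by (simp add: cmp_assoc)
    then show ?thesis unfolding eab(11) using eab(5-10) A h(2) by simp
  qed
  have "f \<cdot> k = (b \<cdot> e' \<boxplus> a \<cdot> e') \<boxplus> neg (a \<cdot> e')"
    unfolding k_def using fge gA eg A h(2-6) eab(5-10) fA add_comm[of "a \<cdot> e'" "b \<cdot> e'"] by simp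
  then have "f \<cdot> k = b \<cdot> e'" using add_neg_cancel(1)[of "b \<cdot> e'" "a \<cdot> e'"] A h(2) eab(5-10) by simp
  then have "k \<in> gel (pre f T)" using k gel_comp[OF T eab(4), of e'] A h(2) eab(9,10) by (simp add: gel_pre[OF fA T])
  moreover have "g \<cdot> (e \<cdot> e') = h \<boxplus> k"
    unfolding k_def using gA eg A h(2-5) eab(9) add_comm[of h "g \<cdot> (e \<cdot> e') \<boxplus> neg h"] add_neg_cancel(2)[of "g \<cdot> (e \<cdot> e')" h]
    by simp
  ultimately show "g \<in> gel (pre f S \<squnion>\<^bsub>Sub C (Dom C f)\<^esub> pre f T)"
    by (intro gel_joinI[OF pre(1)[OF fA S] pre(1)[OF fA T] gA ee]) (use gA eg A h k eab(9) in simp_all)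
qed (use pre_join_le[OF epi_Arr[OF f] S T] in blast)

lemma pre_inj_epi:
  assumes f: "epi f" and S: "S \<in> carrier (Sub C (Cod C f))" and T: "T \<in> carrier (Sub C (Cod C f))" and e: "pre f S = pre f T"
  shows "S = T"
proof -
  have fA: "f \<in> Arr C" using f by simp
  have *: "gel S \<subseteq> gel T" if S: "S \<in> carrier (Sub C (Cod C f))" and T: "T \<in> carrier (Sub C (Cod C f))" and e: "pre f S = pre f T" for S T
  proof
    fix g assume g: "g \<in> gel S"
    note gA = gelD[OF g S]
    obtain e' h where h: "epi e'" "Cod C e' = Dom C g" "h \<in> Arr C" "Dom C h = Dom C e'" "Cod C h = Dom C f" "f \<cdot> h = g \<cdot> e'"
      using epi_lift[OF f gA] .
    have "h \<in> gel (pre f S)" using h gel_comp[OF S g, of e'] by (simp add: gel_pre[OF fA S])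
    then have "g \<cdot> e' \<in> gel T" unfolding e h(6)[symmetric] by (simp add: gel_pre[OF fA T])
    then show "g \<in> gel T" by (rule gel_descent[OF T]) (use gA h in auto)
  qed
  show ?thesis by (rule Sub_eqI[OF S T equalityI[OF *[OF S T e] *[OF T S e[symmetric]]]])
qed

lemma cube_carrier: "strict_cube L n f \<Longrightarrow> S \<subseteq> {1..n} \<Longrightarrow> f S \<in> carrier L"
  unfolding strict_cube_def by blast

text \<open>Along an epimorphism the inverse image is an injective lattice homomorphism, so
  quotients cannot have larger reduced rank. The base of the cube moves, which is harmless since
  reduced rank allows any base.\<close>

lemma cube_pre_epi:
  assumes e: "epi e" and f: "strict_cube (Sub C (Cod C e)) n f"
  shows "strict_cube (Sub C (Dom C e)) n (pre e \<circ> f)"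
  by (rule strict_cube_map[OF f])
    (use e cube_carrier[OF f] pre(1) pre_meet pre_join_epi[OF e] pre_inj_epi[OF e] in auto)

text \<open>For a monomorphism, joins are respected only among subobjects below \<open>m\<close>,
  where the summands of a decomposition again factor through \<open>m\<close>.\<close>

lemma pre_join_mono:
  assumes m: "mono m" and S: "S \<in> carrier (Sub C (Cod C m))" and T: "T \<in> carrier (Sub C (Cod C m))"
    and le: "gel S \<subseteq> {f. ft f m}" "gel T \<subseteq> {f. ft f m}"
  shows "pre m (S \<squnion>\<^bsub>Sub C (Cod C m)\<^esub> T) = pre m S \<squnion>\<^bsub>Sub C (Dom C m)\<^esub> pre m T"
proof (rule Sub_eqI[OF pre(1)[OF mono_Arr[OF m] Sub_join(1)[OF S T]] Sub_join(1)[OF pre(1)[OF mono_Arr[OF m] S] pre(1)[OF mono_Arr[OF m] T]]], intro equalityI subsetI)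
  have mA: "m \<in> Arr C" using m by simp
  fix g assume g: "g \<in> gel (pre m (S \<squnion>\<^bsub>Sub C (Cod C m)\<^esub> T))"
  then have gA: "g \<in> Arr C" "Cod C g = Dom C m" and "m \<cdot> g \<in> gel (S \<squnion>\<^bsub>Sub C (Cod C m)\<^esub> T)"
    using gel_pre[OF mA Sub_join(1)[OF S T]] by auto
  then obtain e a b where eab: "epi e" "Cod C e = Dom C (m \<cdot> g)" "a \<in> gel S" "b \<in> gel T" "a \<in> Arr C" "b \<in> Arr C"
        "Cod C a = Cod C m" "Cod C b = Cod C m" "Dom C a = Dom C e" "Dom C b = Dom C e" "(m \<cdot> g) \<cdot> e = a \<boxplus> b"
    using gel_joinE[OF S T] by blast
  have eg: "Cod C e = Dom C g" "e \<in> Arr C" using eab(1,2) gA mA by simp_all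
  have "ft a m" "ft b m" using le eab by auto
  then obtain u v where u: "u \<in> Arr C" "Dom C u = Dom C a" "Cod C u = Dom C m" "m \<cdot> u = a"
    and v: "v \<in> Arr C" "Dom C v = Dom C b" "Cod C v = Dom C m" "m \<cdot> v = b" by (auto elim!: factors_throughE)
  have "m \<cdot> (g \<cdot> e) = m \<cdot> (u \<boxplus> v)"
    using eab(11) u v gA eg mA eab(9,10) by (simp add: cmp_assoc)
  then have "g \<cdot> e = u \<boxplus> v" using mono_cancel[OF m, of "g \<cdot> e" "u \<boxplus> v"] u(1-3) v(1-3) gA eg eab(9,10) by simp
  moreover have "u \<in> gel (pre m S)" "v \<in> gel (pre m T)" using u v eab by (simp_all add: gel_pre[OF mA S] gel_pre[OF mA T])
  ultimately show "g \<in> gel (pre m S \<squnion>\<^bsub>Sub C (Dom C m)\<^esub> pre m T)"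
    by (intro gel_joinI[OF pre(1)[OF mA S] pre(1)[OF mA T] gA eab(1) eg(1)]) (use u v eab in simp_all)
qed (use pre_join_le[OF mono_Arr[OF m] S T] in blast)

lemma pre_inj_mono:
  assumes m: "mono m" and S: "S \<in> carrier (Sub C (Cod C m))" and T: "T \<in> carrier (Sub C (Cod C m))"
    and le: "gel S \<subseteq> {f. ft f m}" "gel T \<subseteq> {f. ft f m}" and e: "pre m S = pre m T"
  shows "S = T"
proof -
  have mA: "m \<in> Arr C" using m by simp
  have *: "gel S \<subseteq> gel T" if S: "S \<in> carrier (Sub C (Cod C m))" and T: "T \<in> carrier (Sub C (Cod C m))"
    and le: "gel S \<subseteq> {f. ft f m}" and e: "pre m S = pre m T" for S T
  proof
    fix g assume g: "g \<in> gel S"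
    then obtain u where u: "u \<in> Arr C" "Dom C u = Dom C g" "Cod C u = Dom C m" "m \<cdot> u = g"
      using le by (auto elim!: factors_throughE)
    then have "u \<in> gel (pre m S)" using g by (simp add: gel_pre[OF mA S])
    then show "g \<in> gel T" unfolding e using u by (simp add: gel_pre[OF mA T])
  qed
  show ?thesis by (rule Sub_eqI[OF S T equalityI[OF *[OF S T le(1) e] *[OF T S le(2) e[symmetric]]]])
qed

lemma cube_pre_mono:
  assumes m: "mono m" and f: "strict_cube (Sub C (Cod C m)) n f"
    and le: "\<And>S. S \<subseteq> {1..n} \<Longrightarrow> gel (f S) \<subseteq> {f. ft f m}"
  shows "strict_cube (Sub C (Dom C m)) n (pre m \<circ> f)"
proof (rule strict_cube_map[OF f])
  note c = cube_carrier[OF f]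
  fix S T assume ST: "S \<subseteq> {1..n}" "T \<subseteq> {1..n}"
  show "f S = f T" if "pre m (f S) = pre m (f T)"
    by (rule pre_inj_mono[OF m c[OF ST(1)] c[OF ST(2)] le[OF ST(1)] le[OF ST(2)] that])
  show "pre m (f S \<squnion>\<^bsub>Sub C (Cod C m)\<^esub> f T) = pre m (f S) \<squnion>\<^bsub>Sub C (Dom C m)\<^esub> pre m (f T)"
    by (rule pre_join_mono[OF m c[OF ST(1)] c[OF ST(2)] le[OF ST(1)] le[OF ST(2)]])
  show "pre m (f S \<sqinter>\<^bsub>Sub C (Cod C m)\<^esub> f T) = pre m (f S) \<sqinter>\<^bsub>Sub C (Dom C m)\<^esub> pre m (f T)"
    by (rule pre_meet[OF mono_Arr[OF m] c[OF ST(1)] c[OF ST(2)]])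
qed (use pre(1)[OF mono_Arr[OF m]] cube_carrier[OF f] in blast)

lemma gel_dimgE:
  assumes "f \<in> Arr C" "U \<in> carrier (Sub C (Dom C f))" "g \<in> gel (dimg f U)"
  obtains e a where "g \<in> Arr C" "Cod C g = Cod C f" "epi e" "e \<in> Arr C" "Cod C e = Dom C g" "a \<in> gel U" "a \<in> Arr C"
    "Cod C a = Dom C f" "Dom C a = Dom C e" "g \<cdot> e = f \<cdot> a"
proof -
  obtain e a where *: "g \<in> Arr C" "Cod C g = Cod C f" "epi e" "Cod C e = Dom C g" "a \<in> gel U" "Dom C a = Dom C e" "g \<cdot> e = f \<cdot> a"
    using assms(3) unfolding gel_dimg[OF assms(1,2)] by blast
  then show ?thesis using that gelD[OF *(5) assms(2)] by simp
qed

lemma gel_dimgI: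
  assumes "f \<in> Arr C" "U \<in> carrier (Sub C (Dom C f))"
    and "g \<in> Arr C" "Cod C g = Cod C f" "epi e" "Cod C e = Dom C g" "a \<in> gel U" "Dom C a = Dom C e" "g \<cdot> e = f \<cdot> a"
  shows "g \<in> gel (dimg f U)"
  using assms unfolding gel_dimg[OF assms(1,2)] by blast

lemma gel_dimg_comp: "f \<in> Arr C \<Longrightarrow> U \<in> carrier (Sub C (Dom C f)) \<Longrightarrow> a \<in> gel U \<Longrightarrow> f \<cdot> a \<in> gel (dimg f U)"
  by (rule gel_dimgI[of f U _ "Ide C (Dom C a)" a]) (auto simp: gelD)

lemma dimg_least:
  assumes "f \<in> Arr C" "U \<in> carrier (Sub C (Dom C f))" "V \<in> carrier (Sub C (Cod C f))"
    and "\<And>a. a \<in> gel U \<Longrightarrow> f \<cdot> a \<in> gel V"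
  shows "gel (dimg f U) \<subseteq> gel V"
proof
  fix g assume "g \<in> gel (dimg f U)"
  then obtain e a where g: "g \<in> Arr C" "Cod C g = Cod C f" "epi e" "e \<in> Arr C" "Cod C e = Dom C g" "a \<in> gel U" "a \<in> Arr C"
    "Cod C a = Dom C f" "Dom C a = Dom C e" "g \<cdot> e = f \<cdot> a" using gel_dimgE[OF assms(1,2)] by metis
  then have "g \<cdot> e \<in> gel V" using assms(4) by simp
  then show "g \<in> gel V" by (rule gel_descent[OF assms(3)]) (use g in auto)
qed

lemma dimg_mono:
  assumes "f \<in> Arr C" "U \<in> carrier (Sub C (Dom C f))" "V \<in> carrier (Sub C (Dom C f))" "gel U \<subseteq> gel V"
  shows "gel (dimg f U) \<subseteq> gel (dimg f V)"
  by (rule dimg_least[OF assms(1,2) dimg_Sub[OF assms(1,3)]]) (use assms gel_dimg_comp in blast)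

lemma dimg_join:
  assumes f: "f \<in> Arr C" and S: "S \<in> carrier (Sub C (Dom C f))" and T: "T \<in> carrier (Sub C (Dom C f))"
  shows "dimg f (S \<squnion>\<^bsub>Sub C (Dom C f)\<^esub> T) = dimg f S \<squnion>\<^bsub>Sub C (Cod C f)\<^esub> dimg f T"
proof (rule Sub_eqI)
  note J = Sub_join(1)[OF S T] note DJ = Sub_join(1)[OF dimg_Sub[OF f S] dimg_Sub[OF f T]]
  show "dimg f (S \<squnion>\<^bsub>Sub C (Dom C f)\<^esub> T) \<in> carrier (Sub C (Cod C f))" by (rule dimg_Sub[OF f J])
  show "dimg f S \<squnion>\<^bsub>Sub C (Cod C f)\<^esub> dimg f T \<in> carrier (Sub C (Cod C f))" by (rule DJ)
  show "gel (dimg f (S \<squnion>\<^bsub>Sub C (Dom C f)\<^esub> T)) = gel (dimg f S \<squnion>\<^bsub>Sub C (Cod C f)\<^esub> dimg f T)"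
  proof
    show "gel (dimg f (S \<squnion>\<^bsub>Sub C (Dom C f)\<^esub> T)) \<subseteq> gel (dimg f S \<squnion>\<^bsub>Sub C (Cod C f)\<^esub> dimg f T)"
    proof (rule dimg_least[OF f J DJ])
      fix g assume g: "g \<in> gel (S \<squnion>\<^bsub>Sub C (Dom C f)\<^esub> T)"
      obtain e a b where eab: "epi e" "Cod C e = Dom C g" "a \<in> gel S" "b \<in> gel T" "a \<in> Arr C" "b \<in> Arr C"
        "Cod C a = Dom C f" "Cod C b = Dom C f" "Dom C a = Dom C e" "Dom C b = Dom C e" "g \<cdot> e = a \<boxplus> b"
        using gel_joinE[OF S T g] .
      note gA = gelD[OF g J]
      have "(f \<cdot> g) \<cdot> e = f \<cdot> a \<boxplus> f \<cdot> b" using f gA eab by (simp add: cmp_assoc)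
      then show "f \<cdot> g \<in> gel (dimg f S \<squnion>\<^bsub>Sub C (Cod C f)\<^esub> dimg f T)"
        by (intro gel_joinI[OF dimg_Sub[OF f S] dimg_Sub[OF f T] _ _ eab(1) _ gel_dimg_comp[OF f S eab(3)] gel_dimg_comp[OF f T eab(4)]])
          (use f gA eab in simp_all)
    qed
    show "gel (dimg f S \<squnion>\<^bsub>Sub C (Cod C f)\<^esub> dimg f T) \<subseteq> gel (dimg f (S \<squnion>\<^bsub>Sub C (Dom C f)\<^esub> T))"
      unfolding gel_join[OF dimg_Sub[OF f S] dimg_Sub[OF f T]]
      by (intro gsum_least[OF dimg_Sub[OF f J]] dimg_mono[OF f _ J] S T)
        (use gsum_sup1[OF S T] gsum_sup2[OF S T] in \<open>simp_all add: gel_join[OF S T]\<close>)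
  qed
qed

text \<open>This is the correspondence between subobjects above the kernel and their images: two
  lifts of the same element differ by an element of the kernel, which lies in
  \<open>S\<close>.\<close>

lemma dimg_gel_iff:
  assumes f: "f \<in> Arr C" and S: "S \<in> carrier (Sub C (Dom C f))"
    and ker: "\<And>g. g \<in> Arr C \<Longrightarrow> Cod C g = Dom C f \<Longrightarrow> f \<cdot> g = zr (Dom C g) (Cod C f) \<Longrightarrow> g \<in> gel S"
    and a: "a \<in> Arr C" "Cod C a = Dom C f"
  shows "f \<cdot> a \<in> gel (dimg f S) \<longleftrightarrow> a \<in> gel S"
proof
  assume "f \<cdot> a \<in> gel (dimg f S)"
  then obtain e b where h: "f \<cdot> a \<in> Arr C" "epi e" "e \<in> Arr C" "Cod C e = Dom C (f \<cdot> a)" "b \<in> gel S" "b \<in> Arr C"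
    "Cod C b = Dom C f" "Dom C b = Dom C e" "(f \<cdot> a) \<cdot> e = f \<cdot> b" using gel_dimgE[OF f S] by metis
  have e: "Cod C e = Dom C a" using h f a by simp
  have "f \<cdot> (a \<cdot> e) = f \<cdot> b" using h(9) f a e h(3) by (simp add: cmp_assoc)
  then have "f \<cdot> (a \<cdot> e \<boxplus> neg b) = zr (Dom C e) (Cod C f)" using f a e h(3,6-8) by simp
  then have "a \<cdot> e \<boxplus> neg b \<in> gel S" using ker[of "a \<cdot> e \<boxplus> neg b"] a e h(3,6-8) by simp
  then have "(a \<cdot> e \<boxplus> neg b) \<boxplus> b \<in> gel S" by (rule gel_add[OF S _ h(5)]) (use a e h in simp)
  then have "a \<cdot> e \<in> gel S" using add_neg_cancel(2)[of "a \<cdot> e" b] a e h(3,6-8) by simp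
  then show "a \<in> gel S" by (rule gel_descent[OF S _ h(2)]) (use a e in auto)
qed (rule gel_dimg_comp[OF f S])

text \<open>If the base contains the kernel of \<open>f\<close>, so does every vertex, and direct
  image is injective and respects meets on such subobjects. Joins are respected without this
  condition.\<close>

lemma cube_dimg:
  assumes f: "f \<in> Arr C" and c: "strict_cube (Sub C (Dom C f)) n c"
    and ker: "\<And>g. g \<in> Arr C \<Longrightarrow> Cod C g = Dom C f \<Longrightarrow> f \<cdot> g = zr (Dom C g) (Cod C f) \<Longrightarrow> g \<in> gel (c {})"
  shows "strict_cube (Sub C (Cod C f)) n (dimg f \<circ> c)"
proof (rule strict_cube_map[OF c])
  have X: "Dom C f \<in> Obj C" using f by simp
  interpret L: modular_lattice "Sub C (Dom C f)" by (rule modular_lattice_Sub[OF X])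
  note cc = cube_carrier[OF c]
  have kerS: "g \<in> gel (c S)" if "S \<subseteq> {1..n}" "g \<in> Arr C" "Cod C g = Dom C f" "f \<cdot> g = zr (Dom C g) (Cod C f)" for g S
    using ker[OF that(2-4)] L.cube_mono[OF c _ that(1), of "{}"] that(1) cc by (auto simp: Sub_le)
  fix S T assume ST: "S \<subseteq> {1..n}" "T \<subseteq> {1..n}"
  have iff: "f \<cdot> a \<in> gel (dimg f (c S)) \<longleftrightarrow> a \<in> gel (c S)" if "S \<subseteq> {1..n}" "a \<in> Arr C" "Cod C a = Dom C f" for S a
    by (rule dimg_gel_iff[OF f cc[OF that(1)] kerS[OF that(1)] that(2,3)])
  show "c S = c T" if "dimg f (c S) = dimg f (c T)"
  proof (rule Sub_eqI[OF cc[OF ST(1)] cc[OF ST(2)]], intro equalityI subsetI)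
    fix a assume a: "a \<in> gel (c S)"
    note aA = gelD[OF a cc[OF ST(1)]]
    show "a \<in> gel (c T)" using a iff[OF ST(1) aA] iff[OF ST(2) aA] that by simp
  next
    fix a assume a: "a \<in> gel (c T)"
    note aA = gelD[OF a cc[OF ST(2)]]
    show "a \<in> gel (c S)" using a iff[OF ST(1) aA] iff[OF ST(2) aA] that by simp
  qed
  show "dimg f (c S \<squnion>\<^bsub>Sub C (Dom C f)\<^esub> c T) = dimg f (c S) \<squnion>\<^bsub>Sub C (Cod C f)\<^esub> dimg f (c T)"
    by (rule dimg_join[OF f cc[OF ST(1)] cc[OF ST(2)]])
  note M = Sub_meet(1)[OF cc[OF ST(1)] cc[OF ST(2)]]
  note d = dimg_Sub[OF f cc[OF ST(1)]] dimg_Sub[OF f cc[OF ST(2)]]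
  show "dimg f (c S \<sqinter>\<^bsub>Sub C (Dom C f)\<^esub> c T) = dimg f (c S) \<sqinter>\<^bsub>Sub C (Cod C f)\<^esub> dimg f (c T)"
  proof (rule Sub_eqI[OF dimg_Sub[OF f M] Sub_meet(1)[OF d]], intro equalityI subsetI)
    fix g assume "g \<in> gel (dimg f (c S \<sqinter>\<^bsub>Sub C (Dom C f)\<^esub> c T))"
    then show "g \<in> gel (dimg f (c S) \<sqinter>\<^bsub>Sub C (Cod C f)\<^esub> dimg f (c T))"
      using dimg_mono[OF f M cc[OF ST(1)]] dimg_mono[OF f M cc[OF ST(2)]]
      unfolding gel_meet[OF cc[OF ST(1)] cc[OF ST(2)]] gel_meet[OF d] by blast
  next
    fix g assume "g \<in> gel (dimg f (c S) \<sqinter>\<^bsub>Sub C (Cod C f)\<^esub> dimg f (c T))"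
    then have g: "g \<in> gel (dimg f (c S))" "g \<in> gel (dimg f (c T))" using gel_meet[OF d] by auto
    obtain e a where ea: "g \<in> Arr C" "Cod C g = Cod C f" "epi e" "e \<in> Arr C" "Cod C e = Dom C g" "a \<in> gel (c S)" "a \<in> Arr C"
      "Cod C a = Dom C f" "Dom C a = Dom C e" "g \<cdot> e = f \<cdot> a" using gel_dimgE[OF f cc[OF ST(1)] g(1)] .
    have "f \<cdot> a \<in> gel (dimg f (c T))" unfolding ea(10)[symmetric] by (rule gel_comp[OF d(2) g(2)]) (use ea in auto)
    then have "a \<in> gel (c T)" using iff[OF ST(2) ea(7,8)] by simp
    then have "a \<in> gel (c S \<sqinter>\<^bsub>Sub C (Dom C f)\<^esub> c T)" using ea(6) gel_meet[OF cc[OF ST(1)] cc[OF ST(2)]] by simp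
    then show "g \<in> gel (dimg f (c S \<sqinter>\<^bsub>Sub C (Dom C f)\<^esub> c T))"
      by (rule gel_dimgI[OF f M ea(1,2,3,5) _ ea(9,10)])
  qed
qed (use dimg_Sub[OF f] cube_carrier[OF c] in blast)

end

section \<open>Bounds on the reduced rank\<close>

context abelian_category
begin

text \<open>A one-sided form of reduced rank with values in \<open>nat\<close>: only upper bounds
  are transported through quotients, subobjects and powers.\<close>

definition cube_bound :: "'o \<Rightarrow> nat \<Rightarrow> bool" where
  "cube_bound X d \<longleftrightarrow> (\<forall>n f. strict_cube (Sub C X) n f \<longrightarrow> n \<le> d)"

lemma cube_boundD: "cube_bound X d \<Longrightarrow> strict_cube (Sub C X) n f \<Longrightarrow> n \<le> d"
  unfolding cube_bound_def by blast

lemma cube_bound_rk0: "rk0 (Sub C X) = enat d \<Longrightarrow> cube_bound X d"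
  unfolding cube_bound_def using rk0_ge by (metis enat_ord_simps(1))

lemma cube_bound_epi: "epi e \<Longrightarrow> cube_bound (Dom C e) d \<Longrightarrow> cube_bound (Cod C e) d"
  unfolding cube_bound_def using cube_pre_epi by blast

lemma cube_bound_ind:
  assumes "cube_bound X d" "X \<in> Obj C" "indep_list (Sub C X) b as"
  shows "length as \<le> d"
proof -
  interpret modular_lattice "Sub C X" by (rule modular_lattice_Sub) fact
  show ?thesis using ind_cube[OF assms(3)] assms(1) cube_boundD by blast
qed

text \<open>The cube spanned by \<open>as\<close> stays under the join of \<open>as\<close>, hence
  under \<open>m\<close>, and can be restricted to the domain of \<open>m\<close>, where the bound
  applies.\<close>

lemma cube_bound_ind_mono:
  assumes m: "mono m" and b: "cube_bound (Dom C m) d" and as: "indep_list (Sub C (Cod C m)) b as"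
    and le: "gel (list_join (Sub C (Cod C m)) b as) \<subseteq> {f. ft f m}"
  shows "length as \<le> d"
proof -
  have X: "Cod C m \<in> Obj C" using m by simp
  interpret modular_lattice "Sub C (Cod C m)" by (rule modular_lattice_Sub[OF X])
  obtain f where f: "strict_cube (Sub C (Cod C m)) (length as) f"
    "\<And>S. S \<subseteq> {1..length as} \<Longrightarrow> f S \<sqsubseteq>\<^bsub>Sub C (Cod C m)\<^esub> jn b as"
    using ind_cube[OF as] by blast
  have "gel (f S) \<subseteq> {f. ft f m}" if "S \<subseteq> {1..length as}" for S
    using f(2)[OF that] le Sub_le[OF cube_carrier[OF f(1) that] ind_jn_closed[OF as]] by blast
  from cube_pre_mono[OF m f(1) this] show ?thesis using b cube_boundD by blast
qed

text \<open>This is the subadditivity of ranks along short exact sequences.\<close>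

lemma cube_exact_split:
  assumes q: "q \<in> Arr C" and y: "y \<in> carrier (Sub C (Dom C q))"
    and ker: "\<And>g. g \<in> Arr C \<Longrightarrow> Cod C g = Dom C q \<Longrightarrow> q \<cdot> g = zr (Dom C g) (Cod C q) \<Longrightarrow> g \<in> gel y"
    and b: "cube_bound (Cod C q) d" and f: "strict_cube (Sub C (Dom C q)) n f"
  obtains as where "indep_list (Sub C (Dom C q)) (f {} \<sqinter>\<^bsub>Sub C (Dom C q)\<^esub> y) as"
    "list_join (Sub C (Dom C q)) (f {} \<sqinter>\<^bsub>Sub C (Dom C q)\<^esub> y) as \<sqsubseteq>\<^bsub>Sub C (Dom C q)\<^esub> y" "n \<le> length as + d"
proof -
  have X: "Dom C q \<in> Obj C" using q by simp
  interpret modular_lattice "Sub C (Dom C q)" by (rule modular_lattice_Sub[OF X])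
  obtain as bs where as: "ind (f {} \<sqinter>\<^bsub>Sub C (Dom C q)\<^esub> y) as" "jn (f {} \<sqinter>\<^bsub>Sub C (Dom C q)\<^esub> y) as \<sqsubseteq>\<^bsub>Sub C (Dom C q)\<^esub> y"
    and bs: "ind (f {} \<squnion>\<^bsub>Sub C (Dom C q)\<^esub> y) bs" and len: "length as + length bs = n"
    using cube_split[OF f y] by blast
  obtain g where g: "strict_cube (Sub C (Dom C q)) (length bs) g" "g {} = f {} \<squnion>\<^bsub>Sub C (Dom C q)\<^esub> y"
    using ind_cube[OF bs] by blast
  have "f {} \<in> carrier (Sub C (Dom C q))" using cube_carrier[OF f] by simp
  then have "y \<sqsubseteq>\<^bsub>Sub C (Dom C q)\<^esub> g {}" unfolding g(2) using y by (intro join_right)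
  then have "gel y \<subseteq> gel (g {})" using Sub_le[OF y cube_carrier[OF g(1)]] by simp
  \<comment> \<open>The base of \<open>g\<close> contains \<open>y\<close> and hence the kernel of
    \<open>q\<close>, so the whole cube survives in the target of \<open>q\<close>.\<close>
  then have "strict_cube (Sub C (Cod C q)) (length bs) (dimg q \<circ> g)"
    using ker by (intro cube_dimg[OF q g(1)]) blast
  then have "length bs \<le> d" using b cube_boundD by blast
  then show ?thesis using that[OF as] len by simp
qed

lemma biproduct_0_cube_bound:
  assumes "is_biproduct C 0 S P j p"
  shows "cube_bound P 0"
  unfolding cube_bound_def
proof (intro allI impI)
  fix n f assume f: "strict_cube (Sub C P) n f"
  note b = biproductD[OF assms]
  have I: "Ide C P = zr P P" using b(1,11) by simp
  have z: "g = zr (Dom C g) P" if "g \<in> Arr C" "Cod C g = P" for g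
  proof -
    have "g = Ide C P \<cdot> g" using that by simp
    then show ?thesis unfolding I using that b(1) by simp
  qed
  have "gel S = gel T" if "S \<in> carrier (Sub C P)" "T \<in> carrier (Sub C P)" for S T
  proof -
    have "gel S \<subseteq> gel T" if "S \<in> carrier (Sub C P)" "T \<in> carrier (Sub C P)" for S T
    proof
      fix g assume "g \<in> gel S"
      note gA = gelD[OF this that(1)]
      show "g \<in> gel T" using gel_zr[OF that(2), of "Dom C g"] z[OF gA] gA by simp
    qed
    then show ?thesis using that by blast
  qed
  then have "f {} = f {1..n}"
    using Sub_eqI[OF cube_carrier[OF f] cube_carrier[OF f], of "{}" "{1..n}"] cube_carrier[OF f] by auto
  moreover have "inj_on f (Pow {1..n})" using f by (simp add: strict_cube_def)
  ultimately have "{1..n} = {}" using inj_onD[of f "Pow {1..n}" "{}" "{1..n}"] by blast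
  then show "n \<le> 0" by simp
qed

text \<open>The biproduct \<open>P\<close> is arbitrary and not built by recursion, so an induction
  on the number of summands has to peel one off: the kernel of the last projection is a biproduct of
  the others, with restricted projections.\<close>

lemma biproduct_kernel_last:
  assumes P: "is_biproduct C (Suc k) S P j p"
  obtains m i r where "mono m" "Cod C m = P" "is_biproduct C k S (Dom C m) i r"
    "\<And>g. ft g m \<longleftrightarrow> g \<in> Arr C \<and> Cod C g = P \<and> p k \<cdot> g = zr (Dom C g) (S k)"
proof -
  note b = biproductD[OF P]
  have pk: "p k \<in> Arr C" "Dom C (p k) = P" "Cod C (p k) = S k" using b by auto
  obtain m where m: "mono m" "Cod C m = P" "p k \<cdot> m = zr (Dom C m) (S k)"
    "\<And>h. h \<in> Arr C \<Longrightarrow> Cod C h = P \<Longrightarrow> p k \<cdot> h = zr (Dom C h) (S k) \<Longrightarrow> ft h m"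
    using kernel_exists[OF pk(1)] unfolding pk(2,3) by metis
  have mA: "m \<in> Arr C" using m by simp
  have "\<exists>u. u \<in> Arr C \<and> Dom C u = S i \<and> Cod C u = Dom C m \<and> m \<cdot> u = j i" if "i < k" for i
  proof -
    have "ft (j i) m" by (rule m(4)) (use that b(3-5)[of i] b(10)[of k i] in auto)
    then show ?thesis using that b(3-5)[of i] by (auto elim!: factors_throughE)
  qed
  then obtain j' where j': "\<And>i. i < k \<Longrightarrow> j' i \<in> Arr C" "\<And>i. i < k \<Longrightarrow> Dom C (j' i) = S i"
    "\<And>i. i < k \<Longrightarrow> Cod C (j' i) = Dom C m" "\<And>i. i < k \<Longrightarrow> m \<cdot> j' i = j i" by metis
  have "is_biproduct C k S (Dom C m) j' (\<lambda>i. p i \<cdot> m)"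
  proof (rule biproduct_extI)
    fix i l assume il: "i < k" "l < k"
    have "(p i \<cdot> m) \<cdot> j' l = p i \<cdot> (m \<cdot> j' l)" using il b(6-8)[of i] j'(1-3) m(2) mA by (intro cmp_assoc) auto
    then show "(p i \<cdot> m) \<cdot> j' l = (if i = l then Ide C (S i) else zr (S l) (S i))"
      unfolding j'(4)[OF il(2)] using il b(9)[of i] b(10)[of i l] by auto
  next
    fix f g assume fg: "f \<in> Hom C (Dom C m) (Dom C m)" "g \<in> Hom C (Dom C m) (Dom C m)"
      and e: "\<And>i. i < k \<Longrightarrow> (p i \<cdot> m) \<cdot> f = (p i \<cdot> m) \<cdot> g"
    have z: "p k \<cdot> (m \<cdot> h) = zr (Dom C m) (S k)" if "h \<in> Hom C (Dom C m) (Dom C m)" for h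
    proof -
      have "p k \<cdot> (m \<cdot> h) = zr (Dom C m) (S k) \<cdot> h" by (rule cmp_reduce[OF m(3)]) (use that pk m(2) mA in simp_all)
      then show ?thesis using that pk Cod_in[OF pk(1)] by simp
    qed
    have "m \<cdot> f = m \<cdot> g"
    proof (rule biproduct_ext[OF P])
      fix i assume "i < Suc k"
      then show "p i \<cdot> (m \<cdot> f) = p i \<cdot> (m \<cdot> g)"
      proof (cases "i = k")
        case False
        then have i: "i < k" using \<open>i < Suc k\<close> by simp
        then show ?thesis using e[OF i] fg b(6-8)[of i] m(2) mA by (simp add: cmp_assoc)
      qed (use z[OF fg(1)] z[OF fg(2)] in simp)
    qed (use fg m(2) mA in simp_all)
    then show "f = g" using mono_cancel[OF m(1), of f g] fg by simp
  qed (use b j' m(2) mA in auto)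
  moreover have "ft g m \<longleftrightarrow> g \<in> Arr C \<and> Cod C g = P \<and> p k \<cdot> g = zr (Dom C g) (S k)" for g
  proof
    assume g: "ft g m"
    then obtain u where u: "u \<in> Arr C" "Dom C u = Dom C g" "Cod C u = Dom C m" "m \<cdot> u = g" by (rule factors_throughE)
    have "p k \<cdot> (m \<cdot> u) = zr (Dom C m) (S k) \<cdot> u" by (rule cmp_reduce[OF m(3)]) (use u(1-3) pk m(2) mA in simp_all)
    then have "p k \<cdot> g = zr (Dom C g) (S k)" unfolding u(4) using u(1-3) Cod_in[OF pk(1)] pk(3) by simp
    then show "g \<in> Arr C \<and> Cod C g = P \<and> p k \<cdot> g = zr (Dom C g) (S k)" using ft_Arr[OF g mA] ft_Cod[OF g mA] m(2) by simp
  qed (use m(4) in blast)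
  ultimately show ?thesis using that m(1,2) by blast
qed

text \<open>Subadditivity along the kernel of the last projection: this kernel contributes at most
  \<open>k * d\<close> directions, and the target \<open>X\<close> at most \<open>d\<close>
  more.\<close>

lemma cube_bound_biproduct:
  assumes X: "cube_bound X d"
  shows "is_biproduct C k (\<lambda>_. X) P j p \<Longrightarrow> cube_bound P (k * d)"
proof (induction k arbitrary: P j p)
  case 0
  then show ?case using biproduct_0_cube_bound by simp
next
  case (Suc k)
  note b = biproductD[OF Suc.prems]
  have pk: "p k \<in> Arr C" "Dom C (p k) = P" "Cod C (p k) = X" using b by auto
  obtain m i r where m: "mono m" "Cod C m = P" "is_biproduct C k (\<lambda>_. X) (Dom C m) i r"
    "\<And>g. ft g m \<longleftrightarrow> g \<in> Arr C \<and> Cod C g = P \<and> p k \<cdot> g = zr (Dom C g) X"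
    using biproduct_kernel_last[OF Suc.prems] by metis
  have bm: "cube_bound (Dom C m) (k * d)" by (rule Suc.IH[OF m(3)])
  have y: "sub_class C m \<in> carrier (Sub C (Dom C (p k)))" using sub_class_Sub[OF m(1)] m(2) pk by simp
  show ?case unfolding cube_bound_def
  proof (intro allI impI)
    fix n f assume f: "strict_cube (Sub C P) n f"
    have ker: "g \<in> gel (sub_class C m)" if "g \<in> Arr C" "Cod C g = Dom C (p k)" "p k \<cdot> g = zr (Dom C g) (Cod C (p k))" for g
      using that m(4)[of g] pk by (simp add: gel_sub_class[OF m(1)])
    have X': "cube_bound (Cod C (p k)) d" and f': "strict_cube (Sub C (Dom C (p k))) n f" using X f pk by simp_all
    obtain as where as: "indep_list (Sub C P) (f {} \<sqinter>\<^bsub>Sub C P\<^esub> sub_class C m) as"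
      "list_join (Sub C P) (f {} \<sqinter>\<^bsub>Sub C P\<^esub> sub_class C m) as \<sqsubseteq>\<^bsub>Sub C P\<^esub> sub_class C m" "n \<le> length as + d"
      by (rule cube_exact_split[OF pk(1) y ker X' f', unfolded pk(2)])
    interpret modular_lattice "Sub C P" by (rule modular_lattice_Sub) (rule b(1))
    have "gel (list_join (Sub C P) (f {} \<sqinter>\<^bsub>Sub C P\<^esub> sub_class C m) as) \<subseteq> {f. ft f m}"
      using as(2) Sub_le[OF ind_jn_closed[OF as(1)], of "sub_class C m"] y pk gel_sub_class[OF m(1)] by simp
    then have "length as \<le> k * d" using cube_bound_ind_mono[OF m(1) bm] as(1) unfolding m(2) by blast
    then show "n \<le> Suc k * d" using as(3) by simp
  qed
qed

text \<open>Each coordinate inclusion is mono and carries the cube spanned by \<open>as\<close> to a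
  cube over \<open>\<bottom>\<close> in its own summand; blocks from different summands are
  independent. This provides the lower bound opposite to
  \<open>cube_bound_biproduct\<close>.\<close>

lemma biproduct_ind:
  assumes P: "is_biproduct C n (\<lambda>_. Y) P j p" and as: "indep_list (Sub C Y) \<bottom>\<^bsub>Sub C Y\<^esub> as" and Y: "Y \<in> Obj C"
  shows "\<exists>bs. indep_list (Sub C P) \<bottom>\<^bsub>Sub C P\<^esub> bs \<and> length bs = n * length as"
proof -
  note b = biproductD[OF P]
  interpret P: modular_lattice "Sub C P" by (rule modular_lattice_Sub) (rule b(1))
  interpret Y: modular_lattice "Sub C Y" by (rule modular_lattice_Sub) (rule Y)
  let ?d = "length as"
  obtain f where f: "strict_cube (Sub C Y) ?d f" "f {} = \<bottom>\<^bsub>Sub C Y\<^esub>" using Y.ind_cube[OF as] by blast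
  \<comment> \<open>The last conjunct says that the join found so far lives in the coordinates below
    \<open>k\<close>. The next block lives in coordinate \<open>k\<close> alone and therefore meets
    it only in \<open>\<bottom>\<close>.\<close>
  have "k \<le> n \<Longrightarrow> \<exists>bs. P.ind \<bottom>\<^bsub>Sub C P\<^esub> bs \<and> length bs = k * ?d \<and>
     (\<forall>g\<in>gel (P.jn \<bottom>\<^bsub>Sub C P\<^esub> bs). \<forall>i. k \<le> i \<and> i < n \<longrightarrow> p i \<cdot> g = zr (Dom C g) Y)" for k
  proof (induction k)
    case 0
    have "p i \<cdot> g = zr (Dom C g) Y" if "g \<in> gel \<bottom>\<^bsub>Sub C P\<^esub>" "i < n" for g i
    proof -
      have g: "g \<in> Arr C" "g = zr (Dom C g) P" using that(1) gel_bottom[OF b(1)] by auto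
      have "p i \<cdot> zr (Dom C g) P = zr (Dom C g) Y" using b(6-8)[OF that(2)] g(1) by simp
      then show ?thesis using g(2) by simp
    qed
    then show ?case by (intro exI[of _ "[]"]) simp
  next
    case (Suc k)
    then obtain bs where bs: "P.ind \<bottom>\<^bsub>Sub C P\<^esub> bs" "length bs = k * ?d"
      "\<And>g i. g \<in> gel (P.jn \<bottom>\<^bsub>Sub C P\<^esub> bs) \<Longrightarrow> k \<le> i \<Longrightarrow> i < n \<Longrightarrow> p i \<cdot> g = zr (Dom C g) Y" by auto
    have k: "k < n" using Suc.prems by simp
    note jk = b(3-5)[OF k]
    have pjk: "p k \<cdot> j k = Ide C Y" using b(9)[OF k] .
    have jm: "mono (j k)" using b(6-8)[OF k] jk pjk by (intro split_mono[of _ "p k"]) auto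
    have fc: "f S \<in> carrier (Sub C (Dom C (j k)))" if "S \<subseteq> {1..?d}" for S using cube_carrier[OF f(1) that] jk by simp
    have "g \<in> gel (f {})" if "g \<in> Arr C" "Cod C g = Dom C (j k)" "j k \<cdot> g = zr (Dom C g) (Cod C (j k))" for g
    proof -
      have "g = zr (Dom C g) Y" using mono_zr[OF jm that] jk by simp
      then show ?thesis unfolding f(2) using gel_bottom[OF Y] that by simp
    qed
    then have "strict_cube (Sub C (Cod C (j k))) ?d (dimg (j k) \<circ> f)"
      using f(1) jk by (intro cube_dimg) auto
    then have c: "strict_cube (Sub C P) ?d (dimg (j k) \<circ> f)" using jk by simp
    have gel_c: "p i \<cdot> g = zr (Dom C g) Y" if S: "S \<subseteq> {1..?d}" and g: "g \<in> gel (dimg (j k) (f S))" and i: "i < n" "i \<noteq> k" for S g i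
    proof -
      obtain e a where ea: "g \<in> Arr C" "Cod C g = Cod C (j k)" "epi e" "e \<in> Arr C" "Cod C e = Dom C g" "a \<in> gel (f S)" "a \<in> Arr C"
        "Cod C a = Dom C (j k)" "Dom C a = Dom C e" "g \<cdot> e = j k \<cdot> a" using gel_dimgE[OF jk(1) fc[OF S] g] .
      note pi = b(6-8)[OF i(1)]
      have "(p i \<cdot> g) \<cdot> e = p i \<cdot> (j k \<cdot> a)" using ea pi jk by (simp add: cmp_assoc)
      also have "\<dots> = zr Y Y \<cdot> a" by (rule cmp_reduce[OF b(10)[OF i(1) k i(2)]]) (use ea(7,8) pi jk in auto)
      also have "\<dots> = zr (Dom C e) Y" using ea(7-9) jk Y by simp
      finally show ?thesis using epi_zr[OF ea(3), of "p i \<cdot> g"] ea(1,2,5) pi jk by simp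
    qed
    have base: "(dimg (j k) \<circ> f) {} = \<bottom>\<^bsub>Sub C P\<^esub>"
    proof -
      have "gel (dimg (j k) (f {})) \<subseteq> gel \<bottom>\<^bsub>Sub C P\<^esub>"
      proof (rule dimg_least[OF jk(1) fc, unfolded jk(3)])
        fix a assume "a \<in> gel (f {})"
        then have a: "a \<in> Arr C" "a = zr (Dom C a) Y" unfolding f(2) using gel_bottom[OF Y] by auto
        have "j k \<cdot> zr (Dom C a) Y = zr (Dom C a) P" using jk a(1) by simp
        then have "j k \<cdot> a = zr (Dom C a) P" using a(2) by simp
        then show "j k \<cdot> a \<in> gel \<bottom>\<^bsub>Sub C P\<^esub>" using gel_zr[of "\<bottom>\<^bsub>Sub C P\<^esub>" P "Dom C a"] a(1) by simp
      qed auto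
      moreover have "dimg (j k) (f {}) \<in> carrier (Sub C P)" using dimg_Sub[OF jk(1) fc, of "{}"] jk by simp
      ultimately show ?thesis using P.le_bot_eq Sub_le[of "dimg (j k) (f {})" P "\<bottom>\<^bsub>Sub C P\<^esub>"] by simp
    qed
    define cs where "cs = map (\<lambda>i. (dimg (j k) \<circ> f) {i}) [1..<Suc ?d]"
    have set: "set [1..<Suc ?d] = {1..?d}" by auto
    have cs: "P.ind \<bottom>\<^bsub>Sub C P\<^esub> cs" "P.jn \<bottom>\<^bsub>Sub C P\<^esub> cs \<sqsubseteq>\<^bsub>Sub C P\<^esub> dimg (j k) (f {1..?d})" "length cs = ?d"
    proof -
      have "set [1..<Suc ?d] \<subseteq> {1..?d}" unfolding set by simp
      from P.cube_ind[OF c distinct_upt this]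
      show "P.ind \<bottom>\<^bsub>Sub C P\<^esub> cs" "P.jn \<bottom>\<^bsub>Sub C P\<^esub> cs \<sqsubseteq>\<^bsub>Sub C P\<^esub> dimg (j k) (f {1..?d})" "length cs = ?d"
        unfolding base set cs_def by (simp_all del: upt_Suc)
    qed
    have dc: "dimg (j k) (f {1..?d}) \<in> carrier (Sub C P)" using cube_carrier[OF c, of "{1..?d}"] by simp
    have gcs: "p i \<cdot> g = zr (Dom C g) Y" if "g \<in> gel (P.jn \<bottom>\<^bsub>Sub C P\<^esub> cs)" "i < n" "i \<noteq> k" for g i
      using gel_c[of "{1..?d}" g i] that cs(2) Sub_le[OF P.ind_jn_closed[OF cs(1)] dc] by auto
    note Jc = P.ind_jn_closed[OF bs(1)] P.ind_jn_closed[OF cs(1)]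
    have "P.jn \<bottom>\<^bsub>Sub C P\<^esub> bs \<sqinter>\<^bsub>Sub C P\<^esub> P.jn \<bottom>\<^bsub>Sub C P\<^esub> cs \<sqsubseteq>\<^bsub>Sub C P\<^esub> \<bottom>\<^bsub>Sub C P\<^esub>"
      unfolding Sub_le[OF Sub_meet(1)[OF Jc] P.bottom_closed] gel_meet[OF Jc]
    proof
      fix g assume g: "g \<in> gel (P.jn \<bottom>\<^bsub>Sub C P\<^esub> bs) \<inter> gel (P.jn \<bottom>\<^bsub>Sub C P\<^esub> cs)"
      then have gA: "g \<in> Arr C" "Cod C g = P" using gelD[OF _ Jc(1)] by auto
      have "g = zr (Dom C g) P"
      proof (rule biproduct_ext[OF P])
        fix i assume i: "i < n"
        have "p i \<cdot> g = zr (Dom C g) Y" using g bs(3)[of g i] gcs[of g i] i by (cases "i = k") auto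
        then show "p i \<cdot> g = p i \<cdot> zr (Dom C g) P" using b(6-8)[OF i] gA by simp
      qed (use gA b(1) in simp_all)
      then show "g \<in> gel \<bottom>\<^bsub>Sub C P\<^esub>" using gel_bottom[OF b(1)] gA by simp
    qed
    then have "P.jn \<bottom>\<^bsub>Sub C P\<^esub> bs \<sqinter>\<^bsub>Sub C P\<^esub> P.jn \<bottom>\<^bsub>Sub C P\<^esub> cs = \<bottom>\<^bsub>Sub C P\<^esub>"
      using P.le_bot_eq Sub_meet(1)[OF Jc] by blast
    then have i: "P.ind \<bottom>\<^bsub>Sub C P\<^esub> (bs @ cs)" by (rule P.ind_append[OF bs(1) cs(1)])
    have "p i \<cdot> g = zr (Dom C g) Y" if g: "g \<in> gel (P.jn \<bottom>\<^bsub>Sub C P\<^esub> (bs @ cs))" and i: "Suc k \<le> i" "i < n" for g i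
    proof -
      have "P.jn \<bottom>\<^bsub>Sub C P\<^esub> (bs @ cs) = P.jn \<bottom>\<^bsub>Sub C P\<^esub> bs \<squnion>\<^bsub>Sub C P\<^esub> P.jn \<bottom>\<^bsub>Sub C P\<^esub> cs"
        using P.indD[OF bs(1)] P.indD[OF cs(1)] by (intro P.jn_append) auto
      then have g': "g \<in> gel (P.jn \<bottom>\<^bsub>Sub C P\<^esub> bs \<squnion>\<^bsub>Sub C P\<^esub> P.jn \<bottom>\<^bsub>Sub C P\<^esub> cs)" using g by simp
      obtain e x y where exy: "epi e" "Cod C e = Dom C g" "x \<in> gel (P.jn \<bottom>\<^bsub>Sub C P\<^esub> bs)" "y \<in> gel (P.jn \<bottom>\<^bsub>Sub C P\<^esub> cs)" "x \<in> Arr C" "y \<in> Arr C"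
        "Cod C x = P" "Cod C y = P" "Dom C x = Dom C e" "Dom C y = Dom C e" "g \<cdot> e = x \<boxplus> y"
        using gel_joinE[OF Jc g'] .
      have gA: "g \<in> Arr C" "Cod C g = P" using gelD[OF g P.ind_jn_closed[OF \<open>P.ind \<bottom>\<^bsub>Sub C P\<^esub> (bs @ cs)\<close>]] by auto
      note pi = b(6-8)[OF i(2)]
      have "p i \<cdot> x = zr (Dom C e) Y" "p i \<cdot> y = zr (Dom C e) Y"
        using bs(3)[OF exy(3)] gcs[OF exy(4)] i exy(9,10) by auto
      then have "(p i \<cdot> g) \<cdot> e = zr (Dom C e) Y" using exy pi gA Y by (simp add: cmp_assoc)
      then show ?thesis using epi_zr[OF exy(1), of "p i \<cdot> g"] exy(2) gA pi by simp
    qed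
    then show ?case using i bs(2) cs(3) by (intro exI[of _ "bs @ cs"]) auto
  qed
  then show ?thesis by blast
qed

section \<open>Finite powers\<close>

lemma zero_obj_ide: "zero_obj C Z \<Longrightarrow> Ide C Z = zr Z Z"
proof -
  assume Z: "zero_obj C Z"
  then have "\<exists>!f. f \<in> Hom C Z Z" "Z \<in> Obj C" by (auto simp: zero_obj_def)
  moreover from this have "Ide C Z \<in> Hom C Z Z" "zr Z Z \<in> Hom C Z Z" by auto
  ultimately show ?thesis by blast
qed

lemma zero_objI: "Z \<in> Obj C \<Longrightarrow> Ide C Z = zr Z Z \<Longrightarrow> zero_obj C Z"
proof -
  assume Z: "Z \<in> Obj C" "Ide C Z = zr Z Z"
  have "f = zr X Z" if "f \<in> Arr C" "Dom C f = X" "Cod C f = Z" for f X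
  proof -
    have "f = Ide C Z \<cdot> f" using that by simp
    then show ?thesis unfolding Z(2) using that Z(1) by simp
  qed
  moreover have "f = zr Z X" if "f \<in> Arr C" "Dom C f = Z" "Cod C f = X" for f X
  proof -
    have "f = f \<cdot> Ide C Z" using that by simp
    then show ?thesis unfolding Z(2) using that Z(1) by simp
  qed
  ultimately show ?thesis unfolding zero_obj_def
  proof (intro conjI ballI)
    assume u: "\<And>f X. f \<in> Arr C \<Longrightarrow> Dom C f = X \<Longrightarrow> Cod C f = Z \<Longrightarrow> f = zr X Z"
      "\<And>f X. f \<in> Arr C \<Longrightarrow> Dom C f = Z \<Longrightarrow> Cod C f = X \<Longrightarrow> f = zr Z X"
    fix X assume "X \<in> Obj C"
    then show "\<exists>!f. f \<in> Hom C Z X" "\<exists>!f. f \<in> Hom C X Z"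
      using Z(1) u by (intro ex1I[of _ "zr Z X"] ex1I[of _ "zr X Z"]; simp)+
  qed (rule Z(1))
qed

lemma biproduct_0: "zero_obj C Z \<Longrightarrow> is_biproduct C 0 S Z j p"
  unfolding is_biproduct_def using zero_obj_ide[of Z] by (auto simp: zero_obj_def)

lemma power_exists: "X \<in> Obj C \<Longrightarrow> \<exists>P j p. is_biproduct C n (\<lambda>_. X) P j p"
proof (induction n)
  case 0
  then show ?case using has_zero biproduct_0 by blast
next
  case (Suc n)
  then obtain P j p where P: "is_biproduct C n (\<lambda>_. X) P j p" by blast
  obtain Q a b where "is_biproduct C 2 (\<lambda>i. if i = 0 then P else X) Q a b"
    using binary_biproduct[of P X] biproductD(1)[OF P] Suc.prems by metis
  from biproduct_Suc[OF P this] show ?case by blast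
qed

text \<open>Existence of powers justifies the choice made in \<open>pow_diagram\<close>.\<close>

lemma pow_biproduct: "X \<in> Obj C \<Longrightarrow> is_biproduct C n (\<lambda>_. X) (pow_obj C X n) (pow_inj C X n) (pow_proj C X n)"
proof -
  assume "X \<in> Obj C"
  then obtain P j p where "is_biproduct C n (\<lambda>_. X) P j p" using power_exists by blast
  then have "\<exists>t. is_biproduct C n (\<lambda>_. X) (fst t) (fst (snd t)) (snd (snd t))"
    by (intro exI[of _ "(P, j, p)"]) simp
  from someI_ex[OF this] show ?thesis
    unfolding pow_obj_def pow_inj_def pow_proj_def pow_diagram_def .
qed

section \<open>Semisimple objects\<close>

lemma biproduct_cong:
  assumes "is_biproduct C n S P j p" "\<And>i. i < n \<Longrightarrow> S i = S' i"
  shows "is_biproduct C n S' P j p"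
  using assms unfolding is_biproduct_def by simp

lemma biproduct_iso:
  assumes P: "is_biproduct C n S P j p" and m: "m \<in> Arr C" "Dom C m = P" "Cod C m = X"
    and u: "u \<in> Arr C" "Dom C u = X" "Cod C u = P" and mu: "m \<cdot> u = Ide C X" "u \<cdot> m = Ide C P"
  shows "is_biproduct C n S X (\<lambda>i. m \<cdot> j i) (\<lambda>i. p i \<cdot> u)"
proof (rule biproduct_extI)
  note b = biproductD[OF P]
  fix i l assume il: "i < n" "l < n"
  have "u \<cdot> (m \<cdot> j l) = Ide C P \<cdot> j l" by (rule cmp_reduce[OF mu(2)]) (use u m il b in auto)
  then have "(p i \<cdot> u) \<cdot> (m \<cdot> j l) = p i \<cdot> j l" using u m il b(3-8) by (simp add: cmp_assoc)
  then show "(p i \<cdot> u) \<cdot> (m \<cdot> j l) = (if i = l then Ide C (S i) else zr (S l) (S i))"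
    using il b(9,10) by auto
next
  note b = biproductD[OF P]
  fix f g assume fg: "f \<in> Hom C X X" "g \<in> Hom C X X" and e: "\<And>i. i < n \<Longrightarrow> (p i \<cdot> u) \<cdot> f = (p i \<cdot> u) \<cdot> g"
  have "u \<cdot> f = u \<cdot> g"
    by (rule biproduct_ext[OF P]) (use fg u e b(6-8) in \<open>simp_all add: cmp_assoc\<close>)
  then have "m \<cdot> (u \<cdot> f) = m \<cdot> (u \<cdot> g)" by simp
  moreover have "m \<cdot> (u \<cdot> f) = Ide C X \<cdot> f" "m \<cdot> (u \<cdot> g) = Ide C X \<cdot> g"
    by (rule cmp_reduce[OF mu(1)]; use fg u m in simp)+
  ultimately show "f = g" using fg by simp
qed (use biproductD[OF P] m u Cod_in[OF m(1)] in auto)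

text \<open>An independent list is an internal direct sum: the sum map from the biproduct of
  representatives is mono, and its image is the join. The summands are recorded as sources of
  representatives so that they can later be recognised as simple.\<close>

lemma ind_biproduct:
  assumes X: "X \<in> Obj C"
  shows "indep_list (Sub C X) \<bottom>\<^bsub>Sub C X\<^esub> ss \<Longrightarrow> \<exists>P j p m S. is_biproduct C (length ss) S P j p \<and> mono m \<and> Dom C m = P \<and> Cod C m = X \<and>
    (\<forall>g. g \<in> gel (list_join (Sub C X) \<bottom>\<^bsub>Sub C X\<^esub> ss) \<longleftrightarrow> ft g m) \<and> (\<forall>i<length ss. \<exists>s\<in>set ss. \<exists>n\<in>s. Dom C n = S i)"
proof (induction ss)
  case Nil
  obtain Z where Z: "zero_obj C Z" using has_zero by blast
  then have ZO: "Z \<in> Obj C" by (simp add: zero_obj_def)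
  have uz: "f = zr (Dom C f) Z" if "f \<in> Arr C" "Cod C f = Z" for f
  proof -
    have "f = Ide C Z \<cdot> f" using that by simp
    then show ?thesis unfolding zero_obj_ide[OF Z] using that ZO by simp
  qed
  have m: "mono (zr Z X)" by (rule monoI) (use uz X ZO in auto)
  have "g \<in> gel \<bottom>\<^bsub>Sub C X\<^esub> \<longleftrightarrow> ft g (zr Z X)" for g
  proof
    assume "g \<in> gel \<bottom>\<^bsub>Sub C X\<^esub>"
    then have g: "g \<in> Arr C" "g = zr (Dom C g) X" using gel_bottom[OF X] by auto
    have "zr Z X \<cdot> zr (Dom C g) Z = zr (Dom C g) X" using g(1) X ZO by simp
    then show "ft g (zr Z X)" using g X ZO by (intro factors_throughI[of "zr (Dom C g) Z"]) auto
  next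
    assume "ft g (zr Z X)"
    then obtain u where u: "u \<in> Arr C" "Dom C u = Dom C g" "Cod C u = Dom C (zr Z X)" "zr Z X \<cdot> u = g"
      by (rule factors_throughE)
    then have "g = zr (Dom C g) X" using X ZO by simp
    then show "g \<in> gel \<bottom>\<^bsub>Sub C X\<^esub>"
      using gel_bottom[OF X] ft_Arr[OF \<open>ft g (zr Z X)\<close>] X ZO by simp
  qed
  then show ?case using biproduct_0[OF Z] m X ZO
    by - (rule exI[of _ Z], rule exI[of _ undefined], rule exI[of _ undefined], rule exI[of _ "zr Z X"],
        rule exI[of _ undefined], simp)
next
  case (Cons s ss)
  interpret L: modular_lattice "Sub C X" by (rule modular_lattice_Sub[OF X])
  define J where "J = L.jn \<bottom>\<^bsub>Sub C X\<^esub> ss"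
  have s: "s \<in> carrier (Sub C X)" "J \<in> carrier (Sub C X)" "s \<sqinter>\<^bsub>Sub C X\<^esub> J = \<bottom>\<^bsub>Sub C X\<^esub>" using Cons.prems by (auto simp: J_def)
  obtain P j p m S where P: "is_biproduct C (length ss) S P j p" and m: "mono m" "Dom C m = P" "Cod C m = X"
    "\<And>g. g \<in> gel J \<longleftrightarrow> ft g m" and S: "\<forall>i<length ss. \<exists>s\<in>set ss. \<exists>n\<in>s. Dom C n = S i"
  proof -
    have "indep_list (Sub C X) \<bottom>\<^bsub>Sub C X\<^esub> ss" using Cons.prems by simp
    from Cons.IH[OF this, folded J_def] show thesis using that by blast
  qed
  obtain n where ns: "n \<in> s" using SubE[OF s(1)] by metis
  note n = Sub_mem[OF s(1) ns]
  have mA: "m \<in> Arr C" using m by simp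
  define S' where "S' i = (if i < length ss then S i else Dom C n)" for i
  have P': "is_biproduct C (length ss) S' P j p" by (rule biproduct_cong[OF P]) (simp add: S'_def)
  obtain Q a b where Q: "is_biproduct C 2 (\<lambda>i. if i = 0 then P else Dom C n) Q a b"
    using binary_biproduct[of P "Dom C n"] biproductD(1)[OF P] n(2) by auto
  have S'n: "S' (length ss) = Dom C n" by (simp add: S'_def)
  have Q': "is_biproduct C 2 (\<lambda>i. if i = 0 then P else S' (length ss)) Q a b" unfolding S'n by (rule Q)
  note q = biproduct2D[OF Q]
  define t where "t = n \<cdot> b 1 \<boxplus> m \<cdot> b 0"
  have t: "t \<in> Arr C" "Dom C t = Q" "Cod C t = X" using q(1-15) m n mA by (simp_all add: t_def)
  have th: "t \<cdot> h = n \<cdot> (b 1 \<cdot> h) \<boxplus> m \<cdot> (b 0 \<cdot> h)" if "h \<in> Arr C" "Cod C h = Q" for h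
    unfolding t_def using q(1-15) m(2,3) mA n(2,3) that by (simp add: cmp_assoc)
  have inS: "n \<cdot> h \<in> gel s" if "h \<in> Arr C" "Cod C h = Dom C n" for h
    unfolding n(5) using that n(2) by (intro ft_comp ft_refl) auto
  have inJ: "m \<cdot> h \<in> gel J" if "h \<in> Arr C" "Cod C h = P" for h
    unfolding m(4) using that m(2) mA by (intro ft_comp ft_refl) auto
  have tm: "mono t"
  proof (rule monoI[OF t(1)])
    fix f assume f: "f \<in> Arr C" "Cod C f = Dom C t" "t \<cdot> f = zr (Dom C f) (Cod C t)"
    define x where "x = n \<cdot> (b 1 \<cdot> f)"
    define y where "y = m \<cdot> (b 0 \<cdot> f)"
    have xy: "x \<in> Arr C" "y \<in> Arr C" "Dom C x = Dom C f" "Dom C y = Dom C f" "Cod C x = X" "Cod C y = X"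
      using f(1,2) t(2) q(1-15) m(2,3) mA n(2,3) by (simp_all add: x_def y_def)
    \<comment> \<open>If the sum map kills \<open>f\<close>, its two components are negatives of
      each other, hence both lie in \<open>s \<sqinter> J = \<bottom>\<close>.\<close>
    have z: "x \<boxplus> y = zr (Dom C f) X" using th[of f] f t by (simp add: x_def y_def)
    have sJ: "x \<in> gel s" "y \<in> gel J" unfolding x_def y_def
      using inS[of "b 1 \<cdot> f"] inJ[of "b 0 \<cdot> f"] f(1,2) t(2) q(1-15) by simp_all
    have "x = zr (Dom C f) X \<boxplus> neg y" using add_neg_cancel(1)[of x y] xy z by simp
    then have "x = neg y" using xy Cod_in[OF xy(1)] by simp
    then have "x \<in> gel (s \<sqinter>\<^bsub>Sub C X\<^esub> J)" using sJ gel_neg[OF s(2) sJ(2)] by (simp add: gel_meet[OF s(1,2)])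
    then have x0: "x = zr (Dom C f) X" unfolding s(3) using gel_bottom[OF X] xy by simp
    then have y0: "y = zr (Dom C f) X" using z xy by simp
    have "b 1 \<cdot> f = zr (Dom C f) (Dom C n)" using mono_zr[OF n(1), of "b 1 \<cdot> f"] x0 f(1,2) t(2) q(1-15) n(3) by (simp add: x_def)
    moreover have "b 0 \<cdot> f = zr (Dom C f) P" using mono_zr[OF m(1), of "b 0 \<cdot> f"] y0 f(1,2) t(2) q(1-15) m(2,3) by (simp add: y_def)
    ultimately show "f = zr (Dom C f) (Cod C f)"
      using f(1,2) t(2) q(1-15) by - (rule biproduct_2_ext[OF Q], simp_all)
  qed
  have "g \<in> gel (s \<squnion>\<^bsub>Sub C X\<^esub> J) \<longleftrightarrow> ft g t" for g
  proof
    assume g: "g \<in> gel (s \<squnion>\<^bsub>Sub C X\<^esub> J)"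
    note gA = gelD[OF g Sub_join(1)[OF s(1,2)]]
    obtain e x y where exy: "epi e" "Cod C e = Dom C g" "x \<in> gel s" "y \<in> gel J" "x \<in> Arr C" "y \<in> Arr C"
      "Cod C x = X" "Cod C y = X" "Dom C x = Dom C e" "Dom C y = Dom C e" "g \<cdot> e = x \<boxplus> y"
      using gel_joinE[OF s(1,2) g] .
    have "ft x n" "ft y m" using exy n(5) m(4) by auto
    then obtain u v where u: "u \<in> Arr C" "Dom C u = Dom C x" "Cod C u = Dom C n" "n \<cdot> u = x"
      and v: "v \<in> Arr C" "Dom C v = Dom C y" "Cod C v = Dom C m" "m \<cdot> v = y" by (auto elim!: factors_throughE)
    define h where "h = a 0 \<cdot> v \<boxplus> a 1 \<cdot> u"
    have h: "h \<in> Arr C" "Dom C h = Dom C e" "Cod C h = Q" using u v q(1-15) exy m(2) by (simp_all add: h_def)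
    have "b 0 \<cdot> (a 0 \<cdot> v) = Ide C P \<cdot> v" "b 0 \<cdot> (a 1 \<cdot> u) = zr (Dom C n) P \<cdot> u"
      "b 1 \<cdot> (a 0 \<cdot> v) = zr P (Dom C n) \<cdot> v" "b 1 \<cdot> (a 1 \<cdot> u) = Ide C (Dom C n) \<cdot> u"
      using u v q(1-15) m(2) by (intro cmp_reduce q(16-19); simp)+
    then have "b 0 \<cdot> h = v" "b 1 \<cdot> h = u" unfolding h_def using u(1-3) v(1-3) q(1-15) exy(9,10) m(2) by simp_all
    then have "t \<cdot> h = g \<cdot> e" using th[OF h(1,3)] exy(11) u(4) v(4) by simp
    then have "ft (g \<cdot> e) t" using h t gA exy(1,2) by (intro factors_throughI[of h]) auto
    then show "ft g t" using factors_through_descent[OF exy(1) tm gA(1)] exy(2) gA t by simp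
  next
    assume g: "ft g t"
    then obtain h where h: "h \<in> Arr C" "Dom C h = Dom C g" "Cod C h = Dom C t" "t \<cdot> h = g" by (rule factors_throughE)
    have gA: "g \<in> Arr C" "Cod C g = X" using ft_Arr[OF g t(1)] ft_Cod[OF g t(1)] t by auto
    have e: "g \<cdot> Ide C (Dom C g) = n \<cdot> (b 1 \<cdot> h) \<boxplus> m \<cdot> (b 0 \<cdot> h)" using th[of h] h t gA by simp
    have hQ: "Cod C h = Q" using h t by simp
    have i: "n \<cdot> (b 1 \<cdot> h) \<in> gel s" "m \<cdot> (b 0 \<cdot> h) \<in> gel J"
      using inS[of "b 1 \<cdot> h"] inJ[of "b 0 \<cdot> h"] h(1) hQ q(1-15) by simp_all
    show "g \<in> gel (s \<squnion>\<^bsub>Sub C X\<^esub> J)"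
      by (rule gel_joinI[OF s(1,2) gA _ _ i _ _ e]) (use gA h(1,2) hQ q(1-15) m(2,3) mA n(2,3) in simp_all)
  qed
  moreover have "\<forall>i<length (s # ss). \<exists>s\<in>set (s # ss). \<exists>n\<in>s. Dom C n = S' i"
    using S ns by (auto simp: S'_def)
  ultimately show ?case using biproduct_Suc[OF P' Q'] tm t
    unfolding list_join.simps J_def[symmetric] list.size add_0_right add_Suc_right by blast
qed

text \<open>Composition with \<open>n\<close> sends a subobject of its source to one of
  \<open>X\<close> below \<open>s\<close>. If the result is \<open>\<bottom>\<close>, the given
  subobject has zero source; if it is \<open>s\<close>, the mono is invertible.\<close>

lemma atom_simple:
  assumes X: "X \<in> Obj C" and s: "s \<in> carrier (Sub C X)" "s \<noteq> \<bottom>\<^bsub>Sub C X\<^esub>" and n: "n \<in> s"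
    and atom: "\<And>t. t \<in> carrier (Sub C X) \<Longrightarrow> t \<sqsubseteq>\<^bsub>Sub C X\<^esub> s \<Longrightarrow> t = \<bottom>\<^bsub>Sub C X\<^esub> \<or> t = s"
  shows "simple_obj C (Dom C n)"
  unfolding simple_obj_def
proof (intro conjI allI impI)
  note n = Sub_mem[OF s(1) n]
  show "Dom C n \<in> Obj C" using n by simp
  show "\<not> zero_obj C (Dom C n)"
  proof
    assume z: "zero_obj C (Dom C n)"
    have "n = n \<cdot> Ide C (Dom C n)" using n by simp
    then have n0: "n = zr (Dom C n) X" unfolding zero_obj_ide[OF z] using n(2,3) by simp
    have "gel s \<subseteq> gel \<bottom>\<^bsub>Sub C X\<^esub>"
    proof
      fix g assume "g \<in> gel s"
      then obtain u where u: "u \<in> Arr C" "Dom C u = Dom C g" "Cod C u = Dom C n" "n \<cdot> u = g" unfolding n(5) by (rule factors_throughE)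
      have "zr (Dom C n) X \<cdot> u = zr (Dom C g) X" using u X by simp
      then have "g = zr (Dom C g) X" using u(4) n0 by simp
      then show "g \<in> gel \<bottom>\<^bsub>Sub C X\<^esub>" using gel_bottom[OF X] gelD[OF \<open>g \<in> gel s\<close> s(1)] by simp
    qed
    moreover have "gel \<bottom>\<^bsub>Sub C X\<^esub> \<subseteq> gel s"
    proof
      fix g assume "g \<in> gel \<bottom>\<^bsub>Sub C X\<^esub>"
      then have "g \<in> Arr C" "g = zr (Dom C g) X" using gel_bottom[OF X] by auto
      then show "g \<in> gel s" using gel_zr[OF s(1), of "Dom C g"] by simp
    qed
    ultimately show False using s Sub_eqI[OF s(1) Sub_bottom(1)[OF X]] by blast
  qed
  fix k assume k: "mono k \<and> Cod C k = Dom C n"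
  then have nk: "mono (n \<cdot> k)" using n by (intro mono_comp) auto
  have kA: "k \<in> Arr C" "Cod C k = Dom C n" using k by auto
  define t where "t = sub_class C (n \<cdot> k)"
  have t: "t \<in> carrier (Sub C X)" "\<And>g. g \<in> gel t \<longleftrightarrow> ft g (n \<cdot> k)"
    using sub_class_Sub[OF nk] n kA gel_sub_class[OF nk] by (auto simp: t_def)
  have nkn: "ft (n \<cdot> k) n" using n kA by (intro ft_comp ft_refl) auto
  have "gel t \<subseteq> gel s" using t(2) n(5) ft_trans[OF _ nkn n(2)] by blast
  then consider "t = \<bottom>\<^bsub>Sub C X\<^esub>" | "t = s" using atom[OF t(1)] Sub_le[OF t(1) s(1)] by blast
  then show "zero_obj C (Dom C k) \<or> iso_arr C k"
  proof cases
    case 1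
    have "n \<cdot> k \<in> gel t" unfolding t(2) using nk by (intro ft_refl) simp
    then have "n \<cdot> k = zr (Dom C k) X" unfolding 1 using gel_bottom[OF X] n kA by simp
    then have "k = zr (Dom C k) (Dom C n)" using mono_zr[OF n(1), of k] kA n by simp
    then have "k \<cdot> Ide C (Dom C k) = k \<cdot> zr (Dom C k) (Dom C k)" using kA by simp
    then have "Ide C (Dom C k) = zr (Dom C k) (Dom C k)"
      using mono_cancel[of k "Ide C (Dom C k)" "zr (Dom C k) (Dom C k)"] k kA by simp
    then show ?thesis using zero_objI kA by simp
  next
    case 2
    have "n \<in> gel t" unfolding 2 n(5) using n by (intro ft_refl) simp
    then obtain v where v: "v \<in> Arr C" "Dom C v = Dom C n" "Cod C v = Dom C (n \<cdot> k)" "(n \<cdot> k) \<cdot> v = n"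
      unfolding t(2) by (rule factors_throughE)
    have v': "Cod C v = Dom C k" using v(3) n kA by simp
    have "n \<cdot> (k \<cdot> v) = n \<cdot> Ide C (Dom C n)" using v v' n kA by (simp add: cmp_assoc)
    then have kv: "k \<cdot> v = Ide C (Dom C n)" using mono_cancel[OF n(1), of "k \<cdot> v" "Ide C (Dom C n)"] v(1,2) v' kA n by simp
    have "k \<cdot> (v \<cdot> k) = Ide C (Dom C n) \<cdot> k" by (rule cmp_reduce[OF kv]) (use v(1,2) v' kA in simp_all)
    then have "k \<cdot> (v \<cdot> k) = k \<cdot> Ide C (Dom C k)" using kA by simp
    then have "v \<cdot> k = Ide C (Dom C k)" using mono_cancel[of k "v \<cdot> k" "Ide C (Dom C k)"] k v(1,2) v' kA by simp
    then show ?thesis unfolding iso_arr_def using kv kA v(1,2) v' by auto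
  qed
qed

text \<open>When the number of independent elements equals the length, their join is
  \<open>\<top>\<close>, so the sum map is an isomorphism onto \<open>X\<close>, and every entry is
  an atom, so the summands are simple.\<close>

lemma semisimple_of_ind:
  assumes X: "X \<in> Obj C" and len: "poset_length (Sub C X) = enat d"
    and ss: "indep_list (Sub C X) \<bottom>\<^bsub>Sub C X\<^esub> ss" "length ss = d"
  shows "semisimple_obj C X"
proof -
  interpret L: modular_lattice "Sub C X" by (rule modular_lattice_Sub[OF X])
  obtain P j p m S where P: "is_biproduct C (length ss) S P j p" and m: "mono m" "Dom C m = P" "Cod C m = X"
    "\<And>g. g \<in> gel (L.jn \<bottom>\<^bsub>Sub C X\<^esub> ss) \<longleftrightarrow> ft g m" and S: "\<forall>i<length ss. \<exists>s\<in>set ss. \<exists>n\<in>s. Dom C n = S i"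
    using ind_biproduct[OF X ss(1)] by auto
  have mA: "m \<in> Arr C" using m by simp
  have "ft (Ide C X) m" unfolding m(4)[symmetric] L.ind_length_top[OF len ss] gel_top[OF X] using X by simp
  then obtain u where "u \<in> Arr C" "Dom C u = Dom C (Ide C X)" "Cod C u = Dom C m" and mu: "m \<cdot> u = Ide C X" by (rule factors_throughE)
  then have u: "u \<in> Arr C" "Dom C u = X" "Cod C u = P" using X m by auto
  have "m \<cdot> (u \<cdot> m) = Ide C X \<cdot> m" by (rule cmp_reduce[OF mu]) (use u m mA in simp_all)
  then have "m \<cdot> (u \<cdot> m) = m \<cdot> Ide C P" using m mA by simp
  then have um: "u \<cdot> m = Ide C P" using mono_cancel[OF m(1), of "u \<cdot> m" "Ide C P"] u m mA Dom_in[OF mA] by simp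
  have "is_biproduct C (length ss) S X (\<lambda>i. m \<cdot> j i) (\<lambda>i. p i \<cdot> u)"
    by (rule biproduct_iso[OF P mA m(2,3) u mu um])
  moreover have "simple_obj C (S i)" if i: "i < length ss" for i
  proof -
    obtain s n where s: "s \<in> set ss" "n \<in> s" "Dom C n = S i" using S i by blast
    have "s \<in> carrier (Sub C X)" "s \<noteq> \<bottom>\<^bsub>Sub C X\<^esub>" using L.indD[OF ss(1)] s by auto
    from atom_simple[OF X this s(2)] show ?thesis
      using L.ind_length_atom[OF len ss s(1)] s(3) by auto
  qed
  ultimately show ?thesis unfolding semisimple_obj_def by blast
qed

lemma Sub_iso:
  assumes m: "m \<in> Arr C" "Dom C m = P" "Cod C m = X" and u: "u \<in> Arr C" "Dom C u = X" "Cod C u = P"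
    and mu: "m \<cdot> u = Ide C X" "u \<cdot> m = Ide C P"
  shows "poset_iso (Sub C P) (Sub C X) (dimg m)"
proof -
  have inv: "dimg v (dimg w S) = S" if w: "w \<in> Arr C" "Dom C w = Y" "Cod C w = Z" and v: "v \<in> Arr C" "Dom C v = Z" "Cod C v = Y"
    and vw: "v \<cdot> w = Ide C Y" and S: "S \<in> carrier (Sub C Y)" for v w Y Z S
  proof -
    have S': "S \<in> carrier (Sub C (Dom C w))" using S w by simp
    have D: "dimg w S \<in> carrier (Sub C (Dom C v))" using dimg_Sub[OF w(1) S'] v w by simp
    have r: "v \<cdot> (w \<cdot> a) = a" if "a \<in> Arr C" "Cod C a = Y" for a
      using cmp_reduce[OF vw, of a] v w that by simp
    have "gel (dimg v (dimg w S)) \<subseteq> gel S"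
    proof (rule dimg_least[OF v(1) D])
      show "S \<in> carrier (Sub C (Cod C v))" using S v by simp
      fix a assume "a \<in> gel (dimg w S)"
      then obtain e b where ea: "a \<in> Arr C" "Cod C a = Cod C w" "epi e" "e \<in> Arr C" "Cod C e = Dom C a" "b \<in> gel S" "b \<in> Arr C"
        "Cod C b = Dom C w" "Dom C b = Dom C e" "a \<cdot> e = w \<cdot> b" using gel_dimgE[OF w(1) S'] by metis
      have "(v \<cdot> a) \<cdot> e = b" using ea v w r[of b] by (simp add: cmp_assoc)
      then show "v \<cdot> a \<in> gel S" using gel_descent[OF S, of "v \<cdot> a" e] ea v w by simp
    qed
    moreover have "gel S \<subseteq> gel (dimg v (dimg w S))"
    proof
      fix a assume a: "a \<in> gel S"
      have "v \<cdot> (w \<cdot> a) \<in> gel (dimg v (dimg w S))" by (rule gel_dimg_comp[OF v(1) D gel_dimg_comp[OF w(1) S' a]])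
      then show "a \<in> gel (dimg v (dimg w S))" using r[OF gelD[OF a S]] by simp
    qed
    ultimately have "gel (dimg v (dimg w S)) = gel S" by (rule equalityI)
    moreover have "dimg v (dimg w S) \<in> carrier (Sub C Y)" using dimg_Sub[OF v(1) D] v by simp
    ultimately show ?thesis using Sub_eqI S by blast
  qed
  have cm: "dimg m S \<in> carrier (Sub C X)" if "S \<in> carrier (Sub C P)" for S using dimg_Sub[OF m(1)] that m by simp
  have cu: "dimg u S \<in> carrier (Sub C P)" if "S \<in> carrier (Sub C X)" for S using dimg_Sub[OF u(1)] that u by simp
  note im = inv[OF m u mu(2)] and iu = inv[OF u m mu(1)]
  have "dimg m \<in> carrier (Sub C P) \<rightarrow> carrier (Sub C X)" "dimg u \<in> carrier (Sub C X) \<rightarrow> carrier (Sub C P)"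
    using cm cu by blast+
  from bij_betwI[OF this im iu] have "bij_betw (dimg m) (carrier (Sub C P)) (carrier (Sub C X))" by blast
  moreover have "dimg m S \<sqsubseteq>\<^bsub>Sub C X\<^esub> dimg m T \<longleftrightarrow> S \<sqsubseteq>\<^bsub>Sub C P\<^esub> T" if "S \<in> carrier (Sub C P)" "T \<in> carrier (Sub C P)" for S T
  proof -
    have "gel S \<subseteq> gel T \<Longrightarrow> gel (dimg m S) \<subseteq> gel (dimg m T)" using dimg_mono[OF m(1)] that m by simp
    moreover have "gel (dimg m S) \<subseteq> gel (dimg m T) \<Longrightarrow> gel (dimg u (dimg m S)) \<subseteq> gel (dimg u (dimg m T))"
      using dimg_mono[OF u(1)] cm that u by simp
    ultimately show ?thesis
      unfolding Sub_le[OF that] Sub_le[OF cm[OF that(1)] cm[OF that(2)]] im[OF that(1)] im[OF that(2)] by blast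
  qed
  ultimately show ?thesis
    using partial_order_Sub[of P] partial_order_Sub[of X] unfolding poset_iso_def order_emb_def
    by (simp add: partial_order_def)
qed

end

section \<open>Directories\<close>

context abelian_category
begin

lemma image_sub_mono: "mono m \<Longrightarrow> image_sub C m = sub_class C m"
proof -
  assume m: "mono m"
  have "gel (image_sub C m) = gel (sub_class C m)"
  proof (intro equalityI subsetI)
    fix g assume "g \<in> gel (image_sub C m)"
    then obtain e h where g: "g \<in> Arr C" "Cod C g = Cod C m" "epi e" "Cod C e = Dom C g" "h \<in> Arr C" "Dom C h = Dom C e"
      "Cod C h = Dom C m" "g \<cdot> e = m \<cdot> h" unfolding gel_image_sub[OF mono_Arr[OF m]] by blast
    then have "g \<cdot> e \<in> gel (sub_class C m)" unfolding gel_sub_class[OF m] using m by (auto intro: factors_throughI[of h])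
    then show "g \<in> gel (sub_class C m)" by (rule gel_descent[OF sub_class_Sub[OF m]]) (use g in auto)
  next
    fix g assume "g \<in> gel (sub_class C m)"
    then have g: "ft g m" by (simp add: gel_sub_class[OF m])
    then obtain h where h: "h \<in> Arr C" "Dom C h = Dom C g" "Cod C h = Dom C m" "m \<cdot> h = g" by (rule factors_throughE)
    have gA: "g \<in> Arr C" "Cod C g = Cod C m" using ft_Arr[OF g] ft_Cod[OF g] m by auto
    then have "epi (Ide C (Dom C g)) \<and> Cod C (Ide C (Dom C g)) = Dom C g \<and> h \<in> Arr C \<and> Dom C h = Dom C (Ide C (Dom C g)) \<and>
      Cod C h = Dom C m \<and> g \<cdot> Ide C (Dom C g) = m \<cdot> h" using h by simp
    then show "g \<in> gel (image_sub C m)" unfolding gel_image_sub[OF mono_Arr[OF m]] using gA by blast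
  qed
  then show ?thesis using Sub_eqI[OF image_sub_Sub[OF mono_Arr[OF m]] sub_class_Sub[OF m]] by blast
qed

text \<open>Here the inverse is named, whereas \<open>iso_arr\<close> hides it behind an
  existential; the cancellation laws can then be used for rewriting.\<close>

definition inverse_arrs :: "'m \<Rightarrow> 'm \<Rightarrow> bool" where
  "inverse_arrs a b \<longleftrightarrow> a \<in> Arr C \<and> b \<in> Arr C \<and> Dom C b = Cod C a \<and> Cod C b = Dom C a \<and>
     b \<cdot> a = Ide C (Dom C a) \<and> a \<cdot> b = Ide C (Cod C a)"

lemma inverse_arrsD:
  assumes "inverse_arrs a b"
  shows "a \<in> Arr C" "b \<in> Arr C" "Dom C b = Cod C a" "Cod C b = Dom C a" "b \<cdot> a = Ide C (Dom C a)" "a \<cdot> b = Ide C (Cod C a)"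
    "x \<in> Arr C \<Longrightarrow> Cod C x = Dom C a \<Longrightarrow> b \<cdot> (a \<cdot> x) = x" "x \<in> Arr C \<Longrightarrow> Cod C x = Cod C a \<Longrightarrow> a \<cdot> (b \<cdot> x) = x"
proof -
  show *: "a \<in> Arr C" "b \<in> Arr C" "Dom C b = Cod C a" "Cod C b = Dom C a" "b \<cdot> a = Ide C (Dom C a)" "a \<cdot> b = Ide C (Cod C a)"
    using assms by (auto simp: inverse_arrs_def)
  show "x \<in> Arr C \<Longrightarrow> Cod C x = Dom C a \<Longrightarrow> b \<cdot> (a \<cdot> x) = x" using cmp_reduce[OF *(5), of x] * by simp
  show "x \<in> Arr C \<Longrightarrow> Cod C x = Cod C a \<Longrightarrow> a \<cdot> (b \<cdot> x) = x" using cmp_reduce[OF *(6), of x] * by simp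
qed

lemma inverse_arrs_mono: "inverse_arrs a b \<Longrightarrow> mono a" and inverse_arrs_epi: "inverse_arrs a b \<Longrightarrow> epi a"
  using split_mono[of a b] split_epi[of a b] inverse_arrsD by metis+

lemma ft_comp_left: "ft f m \<Longrightarrow> m \<in> Arr C \<Longrightarrow> a \<in> Arr C \<Longrightarrow> Dom C a = Cod C m \<Longrightarrow> ft (a \<cdot> f) (a \<cdot> m)"
proof -
  assume *: "ft f m" "m \<in> Arr C" "a \<in> Arr C" "Dom C a = Cod C m"
  obtain u where u: "u \<in> Arr C" "Dom C u = Dom C f" "Cod C u = Dom C m" "m \<cdot> u = f" using *(1) by (rule factors_throughE)
  have "(a \<cdot> m) \<cdot> u = a \<cdot> (m \<cdot> u)" by (rule cmp_assoc) (use u(1-3) * in simp_all)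
  then show ?thesis using u * ft_Arr[OF *(1,2)] ft_Cod[OF *(1,2)] by (intro factors_throughI[of u]) simp_all
qed

text \<open>The action in \<open>Dir\<close> is a literal image of an equivalence class. An
  isomorphism maps a class onto a whole class, since its inverse brings every member back, so the
  action is a direct image.\<close>

lemma image_iso_dimg:
  assumes ab: "inverse_arrs a b" and U: "U \<in> carrier (Sub C (Dom C a))"
  shows "(\<lambda>x. a \<cdot> x) ` U = dimg a U"
proof -
  note i = inverse_arrsD[OF ab]
  obtain x where x: "x \<in> U" using SubE[OF U] by metis
  note m = Sub_mem[OF U x]
  have ax: "mono (a \<cdot> x)" using inverse_arrs_mono[OF ab] m i by (intro mono_comp) auto
  have D: "dimg a U = sub_class C (a \<cdot> x)" unfolding dimg_rep[OF i(1) U x] by (rule image_sub_mono[OF ax])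
  have "(\<lambda>x. a \<cdot> x) ` U \<subseteq> sub_class C (a \<cdot> x)"
  proof clarify
    fix y assume y: "y \<in> U"
    note n = Sub_mem[OF U y]
    have "ft y x" "ft x y" using m n ft_refl by blast+
    then have "ft (a \<cdot> y) (a \<cdot> x)" "ft (a \<cdot> x) (a \<cdot> y)" using m(2,3) n(2,3) i(1) by (auto intro: ft_comp_left)
    moreover have "mono (a \<cdot> y)" using inverse_arrs_mono[OF ab] n i by (intro mono_comp) auto
    ultimately show "a \<cdot> y \<in> sub_class C (a \<cdot> x)" using m(2,3) n(2,3) i(1) by (simp add: sub_class_def)
  qed
  moreover have "sub_class C (a \<cdot> x) \<subseteq> (\<lambda>x. a \<cdot> x) ` U"
  proof
    fix z assume "z \<in> sub_class C (a \<cdot> x)"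
    then have z: "mono z" "Cod C z = Cod C a" "ft z (a \<cdot> x)" "ft (a \<cdot> x) z" using m(2,3) i(1) by (auto simp: sub_class_def)
    have zA: "z \<in> Arr C" using z by simp
    have "mono b" using ab inverse_arrs_mono[of b a] by (auto simp: inverse_arrs_def)
    then have bz: "mono (b \<cdot> z)" using z i by (intro mono_comp) auto
    have "ft (b \<cdot> z) (b \<cdot> (a \<cdot> x))" by (rule ft_comp_left[OF z(3)]) (use m(2,3) i in simp_all)
    moreover have "ft (b \<cdot> (a \<cdot> x)) (b \<cdot> z)" by (rule ft_comp_left[OF z(4)]) (use zA z(2) i in simp_all)
    moreover have "b \<cdot> (a \<cdot> x) = x" using i(7)[of x] m(2,3) by simp
    ultimately have "b \<cdot> z \<in> U" unfolding m(4) using bz zA z(2) i m(3) by (simp add: sub_class_def)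
    moreover have "z = a \<cdot> (b \<cdot> z)" using i(8)[of z] zA z(2) by simp
    ultimately show "z \<in> (\<lambda>x. a \<cdot> x) ` U" by blast
  qed
  ultimately show ?thesis unfolding D by blast
qed

lemma dimg_dimg:
  assumes f: "f \<in> Arr C" and g: "g \<in> Arr C" "Dom C g = Cod C f" and U: "U \<in> carrier (Sub C (Dom C f))"
  shows "dimg g (dimg f U) = dimg (g \<cdot> f) U"
proof -
  have D: "dimg f U \<in> carrier (Sub C (Dom C g))" using dimg_Sub[OF f U] g by simp
  have gf: "g \<cdot> f \<in> Arr C" "Dom C (g \<cdot> f) = Dom C f" "Cod C (g \<cdot> f) = Cod C g" using f g by simp_all
  have U': "U \<in> carrier (Sub C (Dom C (g \<cdot> f)))" using U gf by simp
  have E: "dimg (g \<cdot> f) U \<in> carrier (Sub C (Cod C g))" using dimg_Sub[OF gf(1) U'] gf by simp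
  have "gel (dimg g (dimg f U)) \<subseteq> gel (dimg (g \<cdot> f) U)"
  proof (rule dimg_least[OF g(1) D E])
    fix a assume "a \<in> gel (dimg f U)"
    then obtain e b where a: "a \<in> Arr C" "Cod C a = Cod C f" "epi e" "e \<in> Arr C" "Cod C e = Dom C a" "b \<in> gel U" "b \<in> Arr C"
      "Cod C b = Dom C f" "Dom C b = Dom C e" "a \<cdot> e = f \<cdot> b" using gel_dimgE[OF f U] by metis
    have "(g \<cdot> a) \<cdot> e = (g \<cdot> f) \<cdot> b" using a f g by (simp add: cmp_assoc)
    then show "g \<cdot> a \<in> gel (dimg (g \<cdot> f) U)"
      by (intro gel_dimgI[OF gf(1) U' _ _ a(3) _ a(6,9)]) (use a f g in simp_all)
  qed
  moreover have "gel (dimg (g \<cdot> f) U) \<subseteq> gel (dimg g (dimg f U))"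
  proof (rule dimg_least[OF gf(1) U'])
    show "dimg g (dimg f U) \<in> carrier (Sub C (Cod C (g \<cdot> f)))" using dimg_Sub[OF g(1) D] gf by simp
    fix a assume a: "a \<in> gel U"
    have "g \<cdot> (f \<cdot> a) \<in> gel (dimg g (dimg f U))" by (rule gel_dimg_comp[OF g(1) D gel_dimg_comp[OF f U a]])
    then show "(g \<cdot> f) \<cdot> a \<in> gel (dimg g (dimg f U))" using f g gelD[OF a U] by (simp add: cmp_assoc)
  qed
  ultimately show ?thesis using Sub_eqI[OF dimg_Sub[OF g(1) D] E] by blast
qed

lemma pushforward_dimg: "pushforward C f n U = dimg (pow_arr C f n) U"
  by (simp add: pushforward_def dimg_def)

subsection \<open>Morphisms between finite powers\<close>

lemma pow_simps [simp]:
  assumes "X \<in> Obj C"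
  shows "pow_obj C X n \<in> Obj C" "i < n \<Longrightarrow> pow_inj C X n i \<in> Arr C" "i < n \<Longrightarrow> Dom C (pow_inj C X n i) = X"
    "i < n \<Longrightarrow> Cod C (pow_inj C X n i) = pow_obj C X n" "i < n \<Longrightarrow> pow_proj C X n i \<in> Arr C"
    "i < n \<Longrightarrow> Dom C (pow_proj C X n i) = pow_obj C X n" "i < n \<Longrightarrow> Cod C (pow_proj C X n i) = X"
  using biproductD(1-8)[OF pow_biproduct[OF assms, of n]] by simp_all

lemma pow_ext:
  assumes "X \<in> Obj C" "f \<in> Arr C" "g \<in> Arr C" "Cod C f = pow_obj C X n" "Cod C g = pow_obj C X n" "Dom C f = Dom C g"
    and "\<And>i. i < n \<Longrightarrow> pow_proj C X n i \<cdot> f = pow_proj C X n i \<cdot> g"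
  shows "f = g"
  by (rule biproduct_ext[OF pow_biproduct[OF assms(1)]]) (use assms in auto)

lemma pow_arr:
  assumes f: "f \<in> Arr C"
  shows "pow_arr C f n \<in> Arr C" "Dom C (pow_arr C f n) = pow_obj C (Dom C f) n" "Cod C (pow_arr C f n) = pow_obj C (Cod C f) n"
    and "i < n \<Longrightarrow> pow_proj C (Cod C f) n i \<cdot> pow_arr C f n = f \<cdot> pow_proj C (Dom C f) n i"
  using biproduct_tuple[OF pow_biproduct[OF Cod_in[OF f]], of "pow_obj C (Dom C f) n" n "\<lambda>i. f \<cdot> pow_proj C (Dom C f) n i"] f
  unfolding pow_arr_def by auto

lemma pow_arr_comp:
  assumes f: "f \<in> Arr C" and x: "x \<in> Arr C" "Cod C x = pow_obj C (Dom C f) n" and i: "i < n"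
  shows "pow_proj C (Cod C f) n i \<cdot> (pow_arr C f n \<cdot> x) = f \<cdot> (pow_proj C (Dom C f) n i \<cdot> x)"
  using cmp_reduce[OF pow_arr(4)[OF f i], of x] pow_arr(1-3)[OF f, of n] f x i by (simp add: cmp_assoc)

lemma pow_shift:
  assumes X: "X \<in> Obj C" and N: "s + n \<le> N"
  shows "pow_shift C X n N s \<in> Arr C" "Dom C (pow_shift C X n N s) = pow_obj C X n" "Cod C (pow_shift C X n N s) = pow_obj C X N"
    and "i < N \<Longrightarrow> pow_proj C X N i \<cdot> pow_shift C X n N s =
       (if s \<le> i \<and> i < s + n then pow_proj C X n (i - s) else zr (pow_obj C X n) X)"
proof -
  note b = biproductD[OF pow_biproduct[OF X, of N]]
  show A: "pow_shift C X n N s \<in> Arr C" "Dom C (pow_shift C X n N s) = pow_obj C X n" "Cod C (pow_shift C X n N s) = pow_obj C X N"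
    unfolding pow_shift_def using X N by auto
  assume i: "i < N"
  have "pow_proj C X N i \<cdot> pow_shift C X n N s =
      hsum (pow_obj C X n) X (\<lambda>l. pow_proj C X N i \<cdot> (pow_inj C X N (s + l) \<cdot> pow_proj C X n l)) {..<n}"
    unfolding pow_shift_def using X N i by (intro cmp_hsum) auto
  also have "\<dots> = (if s \<le> i \<and> i < s + n then pow_proj C X n (i - s) else zr (pow_obj C X n) X)"
  proof -
    have t: "pow_proj C X N i \<cdot> (pow_inj C X N (s + l) \<cdot> pow_proj C X n l) =
        (if i = s + l then pow_proj C X n l else zr (pow_obj C X n) X)" if l: "l < n" for l
    proof (cases "i = s + l")
      case True
      have "pow_proj C X N i \<cdot> (pow_inj C X N i \<cdot> pow_proj C X n l) = Ide C X \<cdot> pow_proj C X n l"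
        by (rule cmp_reduce[OF b(9)[OF i]]) (use X N l i in simp_all)
      then show ?thesis using True X l by simp
    next
      case False
      have "pow_proj C X N i \<cdot> (pow_inj C X N (s + l) \<cdot> pow_proj C X n l) = zr X X \<cdot> pow_proj C X n l"
        by (rule cmp_reduce[OF b(10)[OF i _ False]]) (use X N l i in simp_all)
      then show ?thesis using False X l by simp
    qed
    show ?thesis
    proof (cases "s \<le> i \<and> i < s + n")
      case True
      have "hsum (pow_obj C X n) X (\<lambda>l. pow_proj C X N i \<cdot> (pow_inj C X N (s + l) \<cdot> pow_proj C X n l)) {..<n} =
         pow_proj C X N i \<cdot> (pow_inj C X N (s + (i - s)) \<cdot> pow_proj C X n (i - s))"
        by (rule hsum_single[where i = "i - s"]) (use True t X N i in auto)
      then show ?thesis using True t[of "i - s"] by auto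
    next
      case False
      have "hsum (pow_obj C X n) X (\<lambda>l. pow_proj C X N i \<cdot> (pow_inj C X N (s + l) \<cdot> pow_proj C X n l)) {..<n} = zr (pow_obj C X n) X"
        by (rule hsum_zr) (use False t X in auto)
      then show ?thesis unfolding if_not_P[OF False] .
    qed
  qed
  finally show "pow_proj C X N i \<cdot> pow_shift C X n N s =
       (if s \<le> i \<and> i < s + n then pow_proj C X n (i - s) else zr (pow_obj C X n) X)" .
qed

lemma pow_shift_comp:
  assumes X: "X \<in> Obj C" and N: "s + n \<le> N" and x: "x \<in> Arr C" "Cod C x = pow_obj C X n" and i: "i < N"
  shows "pow_proj C X N i \<cdot> (pow_shift C X n N s \<cdot> x) =
       (if s \<le> i \<and> i < s + n then pow_proj C X n (i - s) \<cdot> x else zr (Dom C x) X)"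
proof -
  note ps = pow_shift[OF X N]
  have "pow_proj C X N i \<cdot> (pow_shift C X n N s \<cdot> x) =
      (if s \<le> i \<and> i < s + n then pow_proj C X n (i - s) else zr (pow_obj C X n) X) \<cdot> x"
    by (rule cmp_reduce[OF ps(4)[OF i]]) (use ps(1-3) X x i in simp_all)
  then show ?thesis using x X by auto
qed

lemma pow_arr_shift:
  assumes f: "f \<in> Arr C" and N: "s + n \<le> N"
  shows "pow_arr C f N \<cdot> pow_shift C (Dom C f) n N s = pow_shift C (Cod C f) n N s \<cdot> pow_arr C f n"
proof -
  have XY: "Dom C f \<in> Obj C" "Cod C f \<in> Obj C" using f by auto
  note sX = pow_shift[OF XY(1) N] and sY = pow_shift[OF XY(2) N]
  note a = pow_arr(1-3)[OF f]
  show ?thesis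
  proof (rule pow_ext[OF XY(2), where n = N])
    fix i assume i: "i < N"
    have "pow_proj C (Cod C f) N i \<cdot> (pow_arr C f N \<cdot> pow_shift C (Dom C f) n N s) =
        f \<cdot> (if s \<le> i \<and> i < s + n then pow_proj C (Dom C f) n (i - s) else zr (pow_obj C (Dom C f) n) (Dom C f))"
      using pow_arr_comp[OF f sX(1) sX(3) i] sX(4)[OF i] by simp
    also have "\<dots> = pow_proj C (Cod C f) N i \<cdot> (pow_shift C (Cod C f) n N s \<cdot> pow_arr C f n)"
      using pow_shift_comp[OF XY(2) N a(1) a(3) i] pow_arr(4)[OF f, of "i - s" n] f XY a by auto
    finally show "pow_proj C (Cod C f) N i \<cdot> (pow_arr C f N \<cdot> pow_shift C (Dom C f) n N s) =
       pow_proj C (Cod C f) N i \<cdot> (pow_shift C (Cod C f) n N s \<cdot> pow_arr C f n)" .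
  qed (use sX(1-3) sY(1-3) a in simp_all)
qed

lemma hsum_scl:
  assumes "f \<in> Arr C" "Dom C f = X" "Cod C f = Y" "finite A"
  shows "hsum X Y (\<lambda>k. Scl C (c k) f) A = Scl C (\<Sum>k\<in>A. c k) f"
  using assms(4)
proof (induction A rule: finite_induct)
  case empty
  then show ?case using assms scl_arith(4)[OF assms(1)] by auto
next
  case (insert a A)
  have "hsum X Y (\<lambda>k. Scl C (c k) f) (insert a A) = Scl C (c a) f \<boxplus> hsum X Y (\<lambda>k. Scl C (c k) f) A"
    by (rule hsum_insert) (use insert assms in auto)
  then show ?case using insert scl_arith(3)[OF assms(1)] by simp
qed

lemma pow_mat:
  assumes X: "X \<in> Obj C"
  shows "pow_mat C X n g \<in> Arr C" "Dom C (pow_mat C X n g) = pow_obj C X n" "Cod C (pow_mat C X n g) = pow_obj C X n"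
    and "i < n \<Longrightarrow> l < n \<Longrightarrow> pow_proj C X n i \<cdot> (pow_mat C X n g \<cdot> pow_inj C X n l) = Scl C (g $$ (i, l)) (Ide C X)"
proof -
  let ?F = "\<lambda>(i, l). Scl C (g $$ (i, l)) (pow_inj C X n i \<cdot> pow_proj C X n l)"
  note b = biproductD[OF pow_biproduct[OF X, of n]]
  have FH: "?F a \<in> Hom C (pow_obj C X n) (pow_obj C X n)" if "a \<in> {..<n} \<times> {..<n}" for a
    using that X by (cases a) simp
  have O: "pow_obj C X n \<in> Obj C" using X by simp
  show A: "pow_mat C X n g \<in> Arr C" "Dom C (pow_mat C X n g) = pow_obj C X n" "Cod C (pow_mat C X n g) = pow_obj C X n"
    unfolding pow_mat_def using hsum_Hom[OF O O, of "{..<n} \<times> {..<n}" ?F] FH by blast+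
  assume il: "i < n" "l < n"
  have "pow_mat C X n g \<cdot> pow_inj C X n l = hsum X (pow_obj C X n) (\<lambda>a. ?F a \<cdot> pow_inj C X n l) ({..<n} \<times> {..<n})"
    unfolding pow_mat_def by (rule hsum_cmp) (use FH O X il in auto)
  then have "pow_proj C X n i \<cdot> (pow_mat C X n g \<cdot> pow_inj C X n l) =
     pow_proj C X n i \<cdot> hsum X (pow_obj C X n) (\<lambda>a. ?F a \<cdot> pow_inj C X n l) ({..<n} \<times> {..<n})" by simp
  also have "\<dots> = hsum X X (\<lambda>a. pow_proj C X n i \<cdot> (?F a \<cdot> pow_inj C X n l)) ({..<n} \<times> {..<n})"
    by (rule cmp_hsum) (use FH O X il in auto)
  also have "\<dots> = pow_proj C X n i \<cdot> (?F (i, l) \<cdot> pow_inj C X n l)"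
  proof (rule hsum_single)
    fix a assume a: "a \<in> {..<n} \<times> {..<n}" "a \<noteq> (i, l)"
    obtain r s where rs: "a = (r, s)" "r < n" "s < n" using a(1) by auto
    have "?F a \<cdot> pow_inj C X n l = Scl C (g $$ (r, s)) (pow_inj C X n r \<cdot> (pow_proj C X n s \<cdot> pow_inj C X n l))"
      using rs X il by (simp add: cmp_assoc)
    then have "pow_proj C X n i \<cdot> (?F a \<cdot> pow_inj C X n l) =
       Scl C (g $$ (r, s)) (pow_proj C X n i \<cdot> (pow_inj C X n r \<cdot> (pow_proj C X n s \<cdot> pow_inj C X n l)))"
      using rs X il by simp
    also have "pow_proj C X n i \<cdot> (pow_inj C X n r \<cdot> (pow_proj C X n s \<cdot> pow_inj C X n l)) = zr X X"
    proof (cases "s = l")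
      case True
      then have ir: "i \<noteq> r" using a rs by auto
      have "pow_proj C X n i \<cdot> (pow_inj C X n r \<cdot> Ide C X) = zr X X" using b(10)[OF il(1) rs(2) ir] X rs il by simp
      then show ?thesis using True b(9)[OF il(2)] by simp
    next
      case False
      then show ?thesis using b(10)[OF rs(3) il(2) False] X rs il by simp
    qed
    finally show "pow_proj C X n i \<cdot> (?F a \<cdot> pow_inj C X n l) = zr X X"
      using scl_arith(2)[of "zr X X" "g $$ (r, s)" 0] scl_arith(4)[of "zr X X"] X by simp
  qed (use FH O X il in auto)
  also have "\<dots> = Scl C (g $$ (i, l)) (pow_proj C X n i \<cdot> (pow_inj C X n i \<cdot> (pow_proj C X n l \<cdot> pow_inj C X n l)))"
    using X il by (simp add: cmp_assoc)
  also have "\<dots> = Scl C (g $$ (i, l)) (Ide C X)" using b(9)[OF il(1)] b(9)[OF il(2)] X il by simp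
  finally show "pow_proj C X n i \<cdot> (pow_mat C X n g \<cdot> pow_inj C X n l) = Scl C (g $$ (i, l)) (Ide C X)" .
qed

lemma pow_entry_ext:
  assumes X: "X \<in> Obj C" and "f \<in> Hom C (pow_obj C X n) (pow_obj C X n)" "g \<in> Hom C (pow_obj C X n) (pow_obj C X n)"
    and e: "\<And>i l. i < n \<Longrightarrow> l < n \<Longrightarrow> pow_proj C X n i \<cdot> (f \<cdot> pow_inj C X n l) = pow_proj C X n i \<cdot> (g \<cdot> pow_inj C X n l)"
  shows "f = g"
proof (rule biproduct_ext'[OF pow_biproduct[OF X, of n]])
  fix l assume l: "l < n"
  show "f \<cdot> pow_inj C X n l = g \<cdot> pow_inj C X n l"
    by (rule pow_ext[OF X, where n = n]) (use assms(2,3) e[OF _ l] X l in auto)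
qed (use assms(2,3) in auto)

lemma pow_mat_one: "X \<in> Obj C \<Longrightarrow> pow_mat C X n (1\<^sub>m n) = Ide C (pow_obj C X n)"
proof (rule pow_entry_ext[of X _ n])
  fix i l assume X: "X \<in> Obj C" and il: "i < n" "l < n"
  note b = biproductD[OF pow_biproduct[OF X, of n]]
  show "pow_proj C X n i \<cdot> (pow_mat C X n (1\<^sub>m n) \<cdot> pow_inj C X n l) = pow_proj C X n i \<cdot> (Ide C (pow_obj C X n) \<cdot> pow_inj C X n l)"
    unfolding pow_mat(4)[OF X il] using b(9)[OF il(1)] b(10)[OF il] scl_arith(1,4)[of "Ide C X"] X il by auto
qed (use pow_mat(1-3) in auto)

lemma pow_mat_mult:
  assumes X: "X \<in> Obj C" and gh: "g \<in> carrier_mat n n" "h \<in> carrier_mat n n"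
  shows "pow_mat C X n g \<cdot> pow_mat C X n h = pow_mat C X n (g * h)"
proof (rule pow_entry_ext[OF X])
  note mg = pow_mat[OF X, where n = n and g = g] and mh = pow_mat[OF X, where n = n and g = h]
  have O: "pow_obj C X n \<in> Obj C" using X by simp
  fix i l assume il: "i < n" "l < n"
  let ?f = "pow_mat C X n h \<cdot> pow_inj C X n l"
  have f: "?f \<in> Arr C" "Dom C ?f = X" "Cod C ?f = pow_obj C X n" using mh X il by simp_all
  have "?f = hsum X (pow_obj C X n) (\<lambda>k. pow_inj C X n k \<cdot> (pow_proj C X n k \<cdot> ?f)) {..<n}"
    using biproduct_decomp[OF pow_biproduct[OF X, of n] f(1,3)] f(2) by simp
  also have "\<dots> = hsum X (pow_obj C X n) (\<lambda>k. Scl C (h $$ (k, l)) (pow_inj C X n k)) {..<n}"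
    by (rule hsum_cong) (use mh(4) X O il in auto)
  finally have fe: "?f = hsum X (pow_obj C X n) (\<lambda>k. Scl C (h $$ (k, l)) (pow_inj C X n k)) {..<n}" .
  have "(pow_mat C X n g \<cdot> pow_mat C X n h) \<cdot> pow_inj C X n l = pow_mat C X n g \<cdot> ?f"
    using mg(1-3) mh(1-3) X il by (intro cmp_assoc) auto
  also have "\<dots> = hsum X (pow_obj C X n) (\<lambda>k. pow_mat C X n g \<cdot> Scl C (h $$ (k, l)) (pow_inj C X n k)) {..<n}"
    unfolding fe by (rule cmp_hsum) (use mg(1-3) X O in auto)
  finally have "pow_proj C X n i \<cdot> ((pow_mat C X n g \<cdot> pow_mat C X n h) \<cdot> pow_inj C X n l) =
    pow_proj C X n i \<cdot> hsum X (pow_obj C X n) (\<lambda>k. pow_mat C X n g \<cdot> Scl C (h $$ (k, l)) (pow_inj C X n k)) {..<n}" by simp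
  also have "\<dots> = hsum X X (\<lambda>k. pow_proj C X n i \<cdot> (pow_mat C X n g \<cdot> Scl C (h $$ (k, l)) (pow_inj C X n k))) {..<n}"
    by (rule cmp_hsum) (use mg(1-3) X O il in auto)
  also have "\<dots> = hsum X X (\<lambda>k. Scl C (h $$ (k, l) * g $$ (i, k)) (Ide C X)) {..<n}"
    by (rule hsum_cong) (use mg X il scl_arith(2)[of "Ide C X"] in auto)
  also have "\<dots> = Scl C (\<Sum>k<n. h $$ (k, l) * g $$ (i, k)) (Ide C X)"
    by (rule hsum_scl) (use X in auto)
  \<comment> \<open>The scalars leave the composite with the entry of \<open>h\<close> first;
    commutativity of the field restores the order of the matrix product.\<close>
  also have "(\<Sum>k<n. h $$ (k, l) * g $$ (i, k)) = (g * h) $$ (i, l)"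
    using gh il by (simp add: scalar_prod_def lessThan_atLeast0 mult.commute)
  also have "Scl C ((g * h) $$ (i, l)) (Ide C X) = pow_proj C X n i \<cdot> (pow_mat C X n (g * h) \<cdot> pow_inj C X n l)"
    by (rule pow_mat(4)[OF X il, symmetric])
  finally show "pow_proj C X n i \<cdot> ((pow_mat C X n g \<cdot> pow_mat C X n h) \<cdot> pow_inj C X n l) =
     pow_proj C X n i \<cdot> (pow_mat C X n (g * h) \<cdot> pow_inj C X n l)" .
qed (use pow_mat(1-3)[OF X] in auto)

lemma GL_inverse:
  assumes "g \<in> GL n"
  obtains h where "h \<in> carrier_mat n n" "g \<in> carrier_mat n n" "g * h = 1\<^sub>m n" "h * g = 1\<^sub>m n"
proof -
  have g: "g \<in> carrier_mat n n" "invertible_mat g" using assms by (auto simp: GL_def)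
  then obtain h where h: "inverts_mat g h" "inverts_mat h g" unfolding invertible_mat_def by blast
  have "g * h = 1\<^sub>m n" "h * g = 1\<^sub>m (dim_row h)" using h g by (auto simp: inverts_mat_def)
  moreover have "dim_row h = n"
    using arg_cong[OF \<open>h * g = 1\<^sub>m (dim_row h)\<close>, of dim_col] g by simp
  moreover have "dim_col h = n" using arg_cong[OF \<open>g * h = 1\<^sub>m n\<close>, of dim_col] by simp
  ultimately show ?thesis using that g by auto
qed

lemma pow_mat_inverse:
  assumes X: "X \<in> Obj C" and g: "g \<in> GL n"
  obtains b where "inverse_arrs (pow_mat C X n g) b"
proof -
  obtain h where h: "h \<in> carrier_mat n n" "g \<in> carrier_mat n n" "g * h = 1\<^sub>m n" "h * g = 1\<^sub>m n" using GL_inverse[OF g] .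
  have "inverse_arrs (pow_mat C X n g) (pow_mat C X n h)"
    unfolding inverse_arrs_def using pow_mat(1-3)[OF X] pow_mat_mult[OF X h(2,1)] pow_mat_mult[OF X h(1,2)] pow_mat_one[OF X]
    by (simp add: h(3,4))
  then show ?thesis using that by blast
qed

text \<open>Scalars of the base field commute with every morphism, so the two composites have the
  same components. This gives the equivariance of pushforward.\<close>

lemma pow_arr_mat:
  assumes f: "f \<in> Arr C"
  shows "pow_arr C f n \<cdot> pow_mat C (Dom C f) n g = pow_mat C (Cod C f) n g \<cdot> pow_arr C f n"
proof -
  have XY: "Dom C f \<in> Obj C" "Cod C f \<in> Obj C" using f by auto
  note a0 = pow_arr(1-3)[OF f, of n]
  note mX = pow_mat[OF XY(1), where n = n and g = g] and mY = pow_mat[OF XY(2), where n = n and g = g]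
  note bX = biproductD[OF pow_biproduct[OF XY(1), of n]] and bY = biproductD[OF pow_biproduct[OF XY(2), of n]]
  have inj: "pow_arr C f n \<cdot> pow_inj C (Dom C f) n l = pow_inj C (Cod C f) n l \<cdot> f" if l: "l < n" for l
  proof (rule pow_ext[OF XY(2), where n = n])
    fix i assume i: "i < n"
    have "pow_proj C (Cod C f) n i \<cdot> (pow_arr C f n \<cdot> pow_inj C (Dom C f) n l) = f \<cdot> (pow_proj C (Dom C f) n i \<cdot> pow_inj C (Dom C f) n l)"
      by (rule pow_arr_comp[OF f _ _ i]) (use XY l in auto)
    also have "\<dots> = (pow_proj C (Cod C f) n i \<cdot> pow_inj C (Cod C f) n l) \<cdot> f"
      using bX(9)[OF i] bY(9)[OF i] bX(10)[OF i l] bY(10)[OF i l] f XY by (cases "i = l") auto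
    also have "\<dots> = pow_proj C (Cod C f) n i \<cdot> (pow_inj C (Cod C f) n l \<cdot> f)"
      by (rule cmp_assoc) (use f XY l i in auto)
    finally show "pow_proj C (Cod C f) n i \<cdot> (pow_arr C f n \<cdot> pow_inj C (Dom C f) n l) =
      pow_proj C (Cod C f) n i \<cdot> (pow_inj C (Cod C f) n l \<cdot> f)" .
  qed (use a0 f XY l in auto)
  show ?thesis
  proof (rule biproduct_ext'[OF pow_biproduct[OF XY(1), of n]])
    fix l assume l: "l < n"
    show "(pow_arr C f n \<cdot> pow_mat C (Dom C f) n g) \<cdot> pow_inj C (Dom C f) n l =
       (pow_mat C (Cod C f) n g \<cdot> pow_arr C f n) \<cdot> pow_inj C (Dom C f) n l"
    proof (rule pow_ext[OF XY(2), where n = n])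
      fix i assume i: "i < n"
      have x: "pow_mat C (Dom C f) n g \<cdot> pow_inj C (Dom C f) n l \<in> Arr C"
        "Cod C (pow_mat C (Dom C f) n g \<cdot> pow_inj C (Dom C f) n l) = pow_obj C (Dom C f) n" using mX(1-3) XY l by simp_all
      have "pow_proj C (Cod C f) n i \<cdot> ((pow_arr C f n \<cdot> pow_mat C (Dom C f) n g) \<cdot> pow_inj C (Dom C f) n l) =
         pow_proj C (Cod C f) n i \<cdot> (pow_arr C f n \<cdot> (pow_mat C (Dom C f) n g \<cdot> pow_inj C (Dom C f) n l))"
        using a0 mX(1-3) XY l by (simp add: cmp_assoc)
      also have "\<dots> = f \<cdot> Scl C (g $$ (i, l)) (Ide C (Dom C f))" unfolding pow_arr_comp[OF f x i] mX(4)[OF i l] ..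
      also have "\<dots> = Scl C (g $$ (i, l)) (Ide C (Cod C f)) \<cdot> f" using f XY by simp
      also have "\<dots> = (pow_proj C (Cod C f) n i \<cdot> (pow_mat C (Cod C f) n g \<cdot> pow_inj C (Cod C f) n l)) \<cdot> f" unfolding mY(4)[OF i l] ..
      also have "\<dots> = pow_proj C (Cod C f) n i \<cdot> (pow_mat C (Cod C f) n g \<cdot> (pow_inj C (Cod C f) n l \<cdot> f))"
        using mY(1-3) XY f i l by (simp add: cmp_assoc)
      also have "\<dots> = pow_proj C (Cod C f) n i \<cdot> ((pow_mat C (Cod C f) n g \<cdot> pow_arr C f n) \<cdot> pow_inj C (Dom C f) n l)"
        using mY(1-3) XY f a0 l inj[OF l] by (simp add: cmp_assoc)
      finally show "pow_proj C (Cod C f) n i \<cdot> ((pow_arr C f n \<cdot> pow_mat C (Dom C f) n g) \<cdot> pow_inj C (Dom C f) n l) =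
         pow_proj C (Cod C f) n i \<cdot> ((pow_mat C (Cod C f) n g \<cdot> pow_arr C f n) \<cdot> pow_inj C (Dom C f) n l)" .
    qed (use a0 mX(1-3) mY(1-3) XY l in simp_all)
  qed (use a0 mX(1-3) mY(1-3) XY in simp_all)
qed

end

context abelian_category
begin

subsection \<open>Direct sums of subobjects\<close>

abbreviation dsum_arr :: "'o \<Rightarrow> nat \<Rightarrow> nat \<Rightarrow> 'm \<Rightarrow> 'm \<Rightarrow> 'm" where
  "dsum_arr X n m u w \<equiv> pow_shift C X n (n + m) 0 \<cdot> u \<boxplus> pow_shift C X m (n + m) n \<cdot> w"

lemma dsum_arr:
  assumes X: "X \<in> Obj C" and u: "u \<in> Arr C" "Cod C u = pow_obj C X n" and w: "w \<in> Arr C" "Cod C w = pow_obj C X m"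
    and uw: "Dom C u = Dom C w"
  shows "dsum_arr X n m u w \<in> Arr C" "Dom C (dsum_arr X n m u w) = Dom C w" "Cod C (dsum_arr X n m u w) = pow_obj C X (n + m)"
    and "i < n + m \<Longrightarrow> pow_proj C X (n + m) i \<cdot> dsum_arr X n m u w =
      (if i < n then pow_proj C X n i \<cdot> u else pow_proj C X m (i - n) \<cdot> w)"
    and "h \<in> Arr C \<Longrightarrow> Cod C h = Dom C w \<Longrightarrow> dsum_arr X n m u w \<cdot> h = dsum_arr X n m (u \<cdot> h) (w \<cdot> h)"
proof -
  have N: "0 + n \<le> n + m" "n + m \<le> n + m" by simp_all
  note s0 = pow_shift[OF X N(1)] and s1 = pow_shift[OF X N(2)]
  show "dsum_arr X n m u w \<in> Arr C" "Dom C (dsum_arr X n m u w) = Dom C w" "Cod C (dsum_arr X n m u w) = pow_obj C X (n + m)"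
    using s0(1-3) s1(1-3) u w uw by simp_all
  show "h \<in> Arr C \<Longrightarrow> Cod C h = Dom C w \<Longrightarrow> dsum_arr X n m u w \<cdot> h = dsum_arr X n m (u \<cdot> h) (w \<cdot> h)"
    using s0(1-3) s1(1-3) u w uw by (simp add: cmp_assoc)
  assume i: "i < n + m"
  have "pow_proj C X (n + m) i \<cdot> dsum_arr X n m u w =
    pow_proj C X (n + m) i \<cdot> (pow_shift C X n (n + m) 0 \<cdot> u) \<boxplus> pow_proj C X (n + m) i \<cdot> (pow_shift C X m (n + m) n \<cdot> w)"
    using s0(1-3) s1(1-3) u w uw X i by simp
  also have "\<dots> = (if i < n then pow_proj C X n i \<cdot> u else zr (Dom C u) X) \<boxplus> (if n \<le> i then pow_proj C X m (i - n) \<cdot> w else zr (Dom C w) X)"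
    using pow_shift_comp[OF X N(1) u i] pow_shift_comp[OF X N(2) w i] i by simp
  also have "\<dots> = (if i < n then pow_proj C X n i \<cdot> u else pow_proj C X m (i - n) \<cdot> w)"
    using u w uw X i by auto
  finally show "pow_proj C X (n + m) i \<cdot> dsum_arr X n m u w =
      (if i < n then pow_proj C X n i \<cdot> u else pow_proj C X m (i - n) \<cdot> w)" .
qed

lemma dsum_arr_inj:
  assumes X: "X \<in> Obj C" and u: "u \<in> Arr C" "Cod C u = pow_obj C X n" "u' \<in> Arr C" "Cod C u' = pow_obj C X n"
    and w: "w \<in> Arr C" "Cod C w = pow_obj C X m" "w' \<in> Arr C" "Cod C w' = pow_obj C X m"
    and d: "Dom C u = Dom C w" "Dom C u' = Dom C w'" "Dom C w = Dom C w'"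
    and e: "dsum_arr X n m u w = dsum_arr X n m u' w'"
  shows "u = u'" "w = w'"
proof -
  note p = dsum_arr(4)[OF X u(1,2) w(1,2) d(1)] and p' = dsum_arr(4)[OF X u(3,4) w(3,4) d(2)]
  have e': "pow_proj C X (n + m) i \<cdot> dsum_arr X n m u w = pow_proj C X (n + m) i \<cdot> dsum_arr X n m u' w'" for i
    using e by simp
  show "u = u'"
  proof (rule pow_ext[OF X u(1,3,2,4)])
    fix i assume "i < n"
    then show "pow_proj C X n i \<cdot> u = pow_proj C X n i \<cdot> u'" using e'[of i] p[of i] p'[of i] by simp
  qed (use d in simp)
  show "w = w'"
  proof (rule pow_ext[OF X w(1,3,2,4)])
    fix i assume "i < m"
    then show "pow_proj C X m i \<cdot> w = pow_proj C X m i \<cdot> w'" using e'[of "n + i"] p[of "n + i"] p'[of "n + i"] by simp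
  qed (use d in simp)
qed

definition gdsum :: "'o \<Rightarrow> nat \<Rightarrow> nat \<Rightarrow> 'm set \<Rightarrow> 'm set \<Rightarrow> 'm set" where
  "gdsum X n m U W = {g. \<exists>u\<in>gel U. \<exists>w\<in>gel W. Dom C u = Dom C w \<and> g = dsum_arr X n m u w}"

text \<open>The coordinates of a block sum determine both blocks, so injectivity reduces to that of
  \<open>x\<close> and \<open>y\<close>. The resulting generalised elements do not mention the
  chosen representatives or the biproduct.\<close>

lemma dsum_mono:
  assumes X: "X \<in> Obj C" and U: "U \<in> carrier (Sub C (pow_obj C X n))" and W: "W \<in> carrier (Sub C (pow_obj C X m))"
    and x: "x \<in> U" and y: "y \<in> W" and Q: "is_biproduct C 2 (\<lambda>i. if i = 0 then Dom C x else Dom C y) Q j p"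
    and z: "z = dsum_arr X n m (x \<cdot> p 0) (y \<cdot> p 1)"
  shows "mono z" "Dom C z = Q" "Cod C z = pow_obj C X (n + m)" "gel (sub_class C z) = gdsum X n m U W"
proof -
  note xm = Sub_mem[OF U x] and ym = Sub_mem[OF W y] and q = biproduct2D[OF Q]
  have xp: "x \<cdot> p 0 \<in> Arr C" "Cod C (x \<cdot> p 0) = pow_obj C X n" "Dom C (x \<cdot> p 0) = Q" using xm q(1-15) by simp_all
  have yp: "y \<cdot> p 1 \<in> Arr C" "Cod C (y \<cdot> p 1) = pow_obj C X m" "Dom C (y \<cdot> p 1) = Q" using ym q(1-15) by simp_all
  have d: "Dom C (x \<cdot> p 0) = Dom C (y \<cdot> p 1)" using xp yp by simp
  note da = dsum_arr[OF X xp(1,2) yp(1,2) d]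
  have zA: "z \<in> Arr C" and zD: "Dom C z = Q" and zC: "Cod C z = pow_obj C X (n + m)"
    unfolding z using da(1-3) yp(3) by simp_all
  then show "Dom C z = Q" "Cod C z = pow_obj C X (n + m)" by simp_all
  have zh: "z \<cdot> h = dsum_arr X n m (x \<cdot> (p 0 \<cdot> h)) (y \<cdot> (p 1 \<cdot> h))" if h: "h \<in> Arr C" "Cod C h = Q" for h
    unfolding z using da(5)[of h] h yp(3) xm(2,3) ym(2,3) q(1-15) by (simp add: cmp_assoc)
  show zm: "mono z" unfolding mono_arr_def
  proof (intro conjI allI ballI impI zA)
    fix Y f g assume fg: "f \<in> Hom C Y (Dom C z)" "g \<in> Hom C Y (Dom C z)" and e: "z \<cdot> f = z \<cdot> g"
    have fA: "f \<in> Arr C" "Cod C f = Q" "Dom C f = Y" and gA: "g \<in> Arr C" "Cod C g = Q" "Dom C g = Y" using fg zD by auto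
    have e': "dsum_arr X n m (x \<cdot> (p 0 \<cdot> f)) (y \<cdot> (p 1 \<cdot> f)) = dsum_arr X n m (x \<cdot> (p 0 \<cdot> g)) (y \<cdot> (p 1 \<cdot> g))"
      using e zh[OF fA(1,2)] zh[OF gA(1,2)] by simp
    have "x \<cdot> (p 0 \<cdot> f) = x \<cdot> (p 0 \<cdot> g)" "y \<cdot> (p 1 \<cdot> f) = y \<cdot> (p 1 \<cdot> g)"
      by (rule dsum_arr_inj[OF X _ _ _ _ _ _ _ _ _ _ _ e']; use fA gA xm(2,3) ym(2,3) q(1-15) in simp)+
    then have "p 0 \<cdot> f = p 0 \<cdot> g" "p 1 \<cdot> f = p 1 \<cdot> g"
      using mono_cancel[OF xm(1), of "p 0 \<cdot> f" "p 0 \<cdot> g"] mono_cancel[OF ym(1), of "p 1 \<cdot> f" "p 1 \<cdot> g"] fA gA q(1-15) by simp_all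
    then show "f = g" using fA gA by - (rule biproduct_2_ext[OF Q], simp_all)
  qed
  show "gel (sub_class C z) = gdsum X n m U W"
    unfolding gel_sub_class[OF zm]
  proof (intro equalityI subsetI)
    fix g assume "g \<in> {f. ft f z}"
    then obtain h where h: "h \<in> Arr C" "Dom C h = Dom C g" "Cod C h = Dom C z" "z \<cdot> h = g" by (auto elim: factors_throughE)
    have hQ: "Cod C h = Q" using h zD by simp
    have "x \<cdot> (p 0 \<cdot> h) \<in> gel U" unfolding xm(5) using xm(2) h hQ q(1-15) by (intro ft_comp ft_refl) simp_all
    moreover have "y \<cdot> (p 1 \<cdot> h) \<in> gel W" unfolding ym(5) using ym(2) h hQ q(1-15) by (intro ft_comp ft_refl) simp_all
    moreover have "Dom C (x \<cdot> (p 0 \<cdot> h)) = Dom C (y \<cdot> (p 1 \<cdot> h))" using xm(2) ym(2) h(1) hQ q(1-15) by simp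
    ultimately show "g \<in> gdsum X n m U W" unfolding gdsum_def h(4)[symmetric] zh[OF h(1) hQ] by blast
  next
    fix g assume "g \<in> gdsum X n m U W"
    then obtain u w where uw: "u \<in> gel U" "w \<in> gel W" "Dom C u = Dom C w" "g = dsum_arr X n m u w" unfolding gdsum_def by blast
    obtain a where a: "a \<in> Arr C" "Dom C a = Dom C u" "Cod C a = Dom C x" "x \<cdot> a = u" using uw(1) unfolding xm(5) by (rule factors_throughE)
    obtain b where b: "b \<in> Arr C" "Dom C b = Dom C w" "Cod C b = Dom C y" "y \<cdot> b = w" using uw(2) unfolding ym(5) by (rule factors_throughE)
    define h where "h = j 0 \<cdot> a \<boxplus> j 1 \<cdot> b"
    have h: "h \<in> Arr C" "Dom C h = Dom C w" "Cod C h = Q" using a b q(1-15) uw(3) by (simp_all add: h_def)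
    have "p 0 \<cdot> (j 0 \<cdot> a) = Ide C (Dom C x) \<cdot> a" "p 0 \<cdot> (j 1 \<cdot> b) = zr (Dom C y) (Dom C x) \<cdot> b"
      "p 1 \<cdot> (j 0 \<cdot> a) = zr (Dom C x) (Dom C y) \<cdot> a" "p 1 \<cdot> (j 1 \<cdot> b) = Ide C (Dom C y) \<cdot> b"
      using a b q(1-15) by (intro cmp_reduce q(16-19); simp)+
    then have "p 0 \<cdot> h = a" "p 1 \<cdot> h = b" unfolding h_def using a(1-3) b(1-3) q(1-15) uw(3) by simp_all
    then have "z \<cdot> h = g" unfolding zh[OF h(1,3)] uw(4) using a(4) b(4) by simp
    moreover have "Dom C g = Dom C w"
      unfolding uw(4) by (rule dsum_arr(2)[OF X _ _ _ _ uw(3)]) (use gelD[OF uw(1) U] gelD[OF uw(2) W] in simp_all)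
    ultimately show "g \<in> {f. ft f z}" using h zD by (auto intro!: factors_throughI[of h])
  qed
qed

text \<open>Sums formed from any representatives and any biproduct have the same generalised
  elements, hence lie in one class. Conversely, every monomorphism equivalent to such a sum is again
  one, so the defining set is the whole class.\<close>

lemma sub_dsum:
  assumes X: "X \<in> Obj C" and U: "U \<in> carrier (Sub C (pow_obj C X n))" and W: "W \<in> carrier (Sub C (pow_obj C X m))"
  shows sub_dsum_Sub: "sub_dsum C X n m U W \<in> carrier (Sub C (pow_obj C X (n + m)))"
    and gel_sub_dsum: "gel (sub_dsum C X n m U W) = gdsum X n m U W"
proof -
  obtain x where x: "x \<in> U" using SubE[OF U] by metis
  obtain y where y: "y \<in> W" using SubE[OF W] by metis
  note xm = Sub_mem[OF U x] and ym = Sub_mem[OF W y]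
  obtain Q j p where Q: "is_biproduct C 2 (\<lambda>i. if i = 0 then Dom C x else Dom C y) Q j p"
    using binary_biproduct[of "Dom C x" "Dom C y"] xm(2) ym(2) by auto
  note q = biproduct2D[OF Q]
  define z where "z = dsum_arr X n m (x \<cdot> p 0) (y \<cdot> p 1)"
  note zz = dsum_mono[OF X U W x y Q z_def]
  have zA: "z \<in> Arr C" using zz by simp
  have "sub_dsum C X n m U W = sub_class C z"
  proof (intro equalityI subsetI)
    fix z' assume "z' \<in> sub_dsum C X n m U W"
    then obtain x' y' j' p' where *: "x' \<in> U" "y' \<in> W" "is_biproduct C 2 (\<lambda>i. if i = 0 then Dom C x' else Dom C y') (Dom C z') j' p'"
      "z' = dsum_arr X n m (x' \<cdot> p' 0) (y' \<cdot> p' 1)" unfolding sub_dsum_def by blast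
    note zz' = dsum_mono[OF X U W *]
    have "sub_class C z' = sub_class C z"
      by (rule Sub_eqI[of _ "pow_obj C X (n + m)"]) (use sub_class_Sub[OF zz'(1)] sub_class_Sub[OF zz(1)] zz'(3,4) zz(3,4) in simp_all)
    then show "z' \<in> sub_class C z" using sub_class_self[OF zz'(1)] by simp
  next
    fix z' assume "z' \<in> sub_class C z"
    then have z': "mono z'" "Cod C z' = Cod C z" "ft z' z" "ft z z'" by (auto simp: sub_class_def)
    have z'A: "z' \<in> Arr C" using z' by simp
    obtain u where u: "u \<in> Arr C" "Dom C u = Dom C z'" "Cod C u = Dom C z" "z \<cdot> u = z'" using z'(3) by (rule factors_throughE)
    obtain v where v: "v \<in> Arr C" "Dom C v = Dom C z" "Cod C v = Dom C z'" "z' \<cdot> v = z" using z'(4) by (rule factors_throughE)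
    have "z \<cdot> (u \<cdot> v) = z' \<cdot> v" by (rule cmp_reduce[OF u(4)]) (use u v zA in simp_all)
    then have "z \<cdot> (u \<cdot> v) = z \<cdot> Ide C (Dom C z)" using v(4) zA by simp
    then have uv: "u \<cdot> v = Ide C (Dom C z)" using mono_cancel[OF zz(1), of "u \<cdot> v" "Ide C (Dom C z)"] u(1-3) v(1-3) Dom_in[OF zA] by simp
    have "z' \<cdot> (v \<cdot> u) = z \<cdot> u" by (rule cmp_reduce[OF v(4)]) (use u v z'A in simp_all)
    then have "z' \<cdot> (v \<cdot> u) = z' \<cdot> Ide C (Dom C z')" using u(4) z'A by simp
    then have vu: "v \<cdot> u = Ide C (Dom C z')" using mono_cancel[OF z'(1), of "v \<cdot> u" "Ide C (Dom C z')"] u(1-3) v(1-3) Dom_in[OF z'A] by simp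
    have dz: "Dom C z = Q" by (rule zz(2))
    \<comment> \<open>The biproduct structure is transported along the isomorphism between the
      sources, which gives \<open>z'\<close> itself the required shape.\<close>
    have Q': "is_biproduct C 2 (\<lambda>i. if i = 0 then Dom C x else Dom C y) (Dom C z') (\<lambda>i. v \<cdot> j i) (\<lambda>i. p i \<cdot> u)"
      by (rule biproduct_iso[OF Q v(1) _ v(3) u(1,2) _ vu]) (use u v uv dz in simp_all)
    have xp: "x \<cdot> p 0 \<in> Arr C" "Cod C (x \<cdot> p 0) = pow_obj C X n" "Dom C (x \<cdot> p 0) = Q" using xm q(1-15) by simp_all
    have yp: "y \<cdot> p 1 \<in> Arr C" "Cod C (y \<cdot> p 1) = pow_obj C X m" "Dom C (y \<cdot> p 1) = Q" using ym q(1-15) by simp_all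
    have "z' = dsum_arr X n m ((x \<cdot> p 0) \<cdot> u) ((y \<cdot> p 1) \<cdot> u)"
      unfolding u(4)[symmetric] z_def by (rule dsum_arr(5)[OF X xp(1,2) yp(1,2)]) (use xp yp u dz in simp_all)
    also have "(x \<cdot> p 0) \<cdot> u = x \<cdot> (p 0 \<cdot> u)" by (rule cmp_assoc) (use xm q(1-15) u dz in simp_all)
    also have "(y \<cdot> p 1) \<cdot> u = y \<cdot> (p 1 \<cdot> u)" by (rule cmp_assoc) (use ym q(1-15) u dz in simp_all)
    finally show "z' \<in> sub_dsum C X n m U W" unfolding sub_dsum_def using z'(1) x y Q' by blast
  qed
  then show "sub_dsum C X n m U W \<in> carrier (Sub C (pow_obj C X (n + m)))" "gel (sub_dsum C X n m U W) = gdsum X n m U W"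
    using sub_class_Sub[OF zz(1)] zz(3,4) by simp_all
qed

lemma sub_dsum_class:
  assumes X: "X \<in> Obj C" and x: "mono x" "Cod C x = pow_obj C X n" and y: "mono y" "Cod C y = pow_obj C X m"
    and Q: "is_biproduct C 2 (\<lambda>i. if i = 0 then Dom C x else Dom C y) Q j p"
    and z: "z = dsum_arr X n m (x \<cdot> p 0) (y \<cdot> p 1)"
  shows "sub_dsum C X n m (sub_class C x) (sub_class C y) = sub_class C z"
proof -
  have U: "sub_class C x \<in> carrier (Sub C (pow_obj C X n))" and W: "sub_class C y \<in> carrier (Sub C (pow_obj C X m))"
    using sub_class_Sub[OF x(1)] sub_class_Sub[OF y(1)] x y by auto
  note zz = dsum_mono[OF X U W sub_class_self[OF x(1)] sub_class_self[OF y(1)] Q z]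
  show ?thesis
    by (rule Sub_eqI[OF sub_dsum_Sub[OF X U W]]) (use sub_class_Sub[OF zz(1)] zz(3,4) gel_sub_dsum[OF X U W] in simp_all)
qed

subsection \<open>Pushforward of directories\<close>

text \<open>Powers of \<open>f\<close> commute with the coordinate shifts, so blocks are mapped to
  blocks.\<close>

lemma pushforward_dsum:
  assumes f: "f \<in> Arr C" and U: "U \<in> carrier (Sub C (pow_obj C (Dom C f) n))" and W: "W \<in> carrier (Sub C (pow_obj C (Dom C f) m))"
  shows "dimg (pow_arr C f (n + m)) (sub_dsum C (Dom C f) n m U W) =
    sub_dsum C (Cod C f) n m (dimg (pow_arr C f n) U) (dimg (pow_arr C f m) W)"
proof -
  have XY: "Dom C f \<in> Obj C" "Cod C f \<in> Obj C" using f by auto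
  let ?N = "n + m"
  have N: "0 + n \<le> n + m" "n + m \<le> n + m" by simp_all
  note aN = pow_arr(1-3)[OF f, of ?N] and an = pow_arr(1-3)[OF f, of n] and am = pow_arr(1-3)[OF f, of m]
  have U': "U \<in> carrier (Sub C (Dom C (pow_arr C f n)))" and W': "W \<in> carrier (Sub C (Dom C (pow_arr C f m)))"
    using U W an am by simp_all
  have S: "sub_dsum C (Dom C f) n m U W \<in> carrier (Sub C (Dom C (pow_arr C f ?N)))"
    using sub_dsum_Sub[OF XY(1) U W] aN by simp
  have DU: "dimg (pow_arr C f n) U \<in> carrier (Sub C (pow_obj C (Cod C f) n))" using dimg_Sub[OF an(1) U'] an by simp
  have DW: "dimg (pow_arr C f m) W \<in> carrier (Sub C (pow_obj C (Cod C f) m))" using dimg_Sub[OF am(1) W'] am by simp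
  have DS: "dimg (pow_arr C f ?N) (sub_dsum C (Dom C f) n m U W) \<in> carrier (Sub C (pow_obj C (Cod C f) ?N))"
    using dimg_Sub[OF aN(1) S] aN by simp
  note SD = sub_dsum_Sub[OF XY(2) DU DW]
  have comm: "pow_arr C f ?N \<cdot> dsum_arr (Dom C f) n m u w = dsum_arr (Cod C f) n m (pow_arr C f n \<cdot> u) (pow_arr C f m \<cdot> w)"
    if u: "u \<in> Arr C" "Cod C u = pow_obj C (Dom C f) n" and w: "w \<in> Arr C" "Cod C w = pow_obj C (Dom C f) m" and d: "Dom C u = Dom C w" for u w
  proof -
    note s0 = pow_shift(1-3)[OF XY(1) N(1)] and s1 = pow_shift(1-3)[OF XY(1) N(2)]
      and t0 = pow_shift(1-3)[OF XY(2) N(1)] and t1 = pow_shift(1-3)[OF XY(2) N(2)]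
    have "pow_arr C f ?N \<cdot> (pow_shift C (Dom C f) n ?N 0 \<cdot> u) = (pow_shift C (Cod C f) n ?N 0 \<cdot> pow_arr C f n) \<cdot> u"
      by (rule cmp_reduce[OF pow_arr_shift[OF f N(1)]]) (use s0 aN u in simp_all)
    also have "\<dots> = pow_shift C (Cod C f) n ?N 0 \<cdot> (pow_arr C f n \<cdot> u)" by (rule cmp_assoc) (use t0 an u in simp_all)
    finally have 1: "pow_arr C f ?N \<cdot> (pow_shift C (Dom C f) n ?N 0 \<cdot> u) = pow_shift C (Cod C f) n ?N 0 \<cdot> (pow_arr C f n \<cdot> u)" .
    have "pow_arr C f ?N \<cdot> (pow_shift C (Dom C f) m ?N n \<cdot> w) = (pow_shift C (Cod C f) m ?N n \<cdot> pow_arr C f m) \<cdot> w"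
      by (rule cmp_reduce[OF pow_arr_shift[OF f N(2)]]) (use s1 aN w in simp_all)
    also have "\<dots> = pow_shift C (Cod C f) m ?N n \<cdot> (pow_arr C f m \<cdot> w)" by (rule cmp_assoc) (use t1 am w in simp_all)
    finally have 2: "pow_arr C f ?N \<cdot> (pow_shift C (Dom C f) m ?N n \<cdot> w) = pow_shift C (Cod C f) m ?N n \<cdot> (pow_arr C f m \<cdot> w)" .
    have "pow_arr C f ?N \<cdot> dsum_arr (Dom C f) n m u w =
      pow_arr C f ?N \<cdot> (pow_shift C (Dom C f) n ?N 0 \<cdot> u) \<boxplus> pow_arr C f ?N \<cdot> (pow_shift C (Dom C f) m ?N n \<cdot> w)"
      using s0 s1 aN u w d by (intro cmp_add) simp_all
    then show ?thesis unfolding 1 2 .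
  qed
  have "gel (dimg (pow_arr C f ?N) (sub_dsum C (Dom C f) n m U W)) \<subseteq> gel (sub_dsum C (Cod C f) n m (dimg (pow_arr C f n) U) (dimg (pow_arr C f m) W))"
  proof (rule dimg_least[OF aN(1) S])
    show "sub_dsum C (Cod C f) n m (dimg (pow_arr C f n) U) (dimg (pow_arr C f m) W) \<in> carrier (Sub C (Cod C (pow_arr C f ?N)))"
      using SD aN by simp
    fix g assume "g \<in> gel (sub_dsum C (Dom C f) n m U W)"
    then obtain u w where uw: "u \<in> gel U" "w \<in> gel W" "Dom C u = Dom C w" "g = dsum_arr (Dom C f) n m u w"
      unfolding gel_sub_dsum[OF XY(1) U W] gdsum_def by blast
    note u = gelD[OF uw(1) U] and w = gelD[OF uw(2) W]
    have "pow_arr C f n \<cdot> u \<in> gel (dimg (pow_arr C f n) U)" "pow_arr C f m \<cdot> w \<in> gel (dimg (pow_arr C f m) W)"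
      by (rule gel_dimg_comp[OF an(1) U' uw(1)], rule gel_dimg_comp[OF am(1) W' uw(2)])
    moreover have "Dom C (pow_arr C f n \<cdot> u) = Dom C (pow_arr C f m \<cdot> w)" using an am u w uw(3) by simp
    ultimately show "pow_arr C f ?N \<cdot> g \<in> gel (sub_dsum C (Cod C f) n m (dimg (pow_arr C f n) U) (dimg (pow_arr C f m) W))"
      unfolding gel_sub_dsum[OF XY(2) DU DW] gdsum_def uw(4) comm[OF u w uw(3)] by blast
  qed
  moreover have "gel (sub_dsum C (Cod C f) n m (dimg (pow_arr C f n) U) (dimg (pow_arr C f m) W)) \<subseteq> gel (dimg (pow_arr C f ?N) (sub_dsum C (Dom C f) n m U W))"
  proof
    fix g assume "g \<in> gel (sub_dsum C (Cod C f) n m (dimg (pow_arr C f n) U) (dimg (pow_arr C f m) W))"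
    then obtain u' w' where uw': "u' \<in> gel (dimg (pow_arr C f n) U)" "w' \<in> gel (dimg (pow_arr C f m) W)" "Dom C u' = Dom C w'"
      "g = dsum_arr (Cod C f) n m u' w'" unfolding gel_sub_dsum[OF XY(2) DU DW] gdsum_def by blast
    note u' = gelD[OF uw'(1) DU] and w' = gelD[OF uw'(2) DW]
    obtain e u where u: "epi e" "e \<in> Arr C" "Cod C e = Dom C u'" "u \<in> gel U" "u \<in> Arr C" "Cod C u = Dom C (pow_arr C f n)" "Dom C u = Dom C e"
      "u' \<cdot> e = pow_arr C f n \<cdot> u" using gel_dimgE[OF an(1) U' uw'(1)] by metis
    obtain e' w where w: "epi e'" "e' \<in> Arr C" "Cod C e' = Dom C w'" "w \<in> gel W" "w \<in> Arr C" "Cod C w = Dom C (pow_arr C f m)" "Dom C w = Dom C e'"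
      "w' \<cdot> e' = pow_arr C f m \<cdot> w" using gel_dimgE[OF am(1) W' uw'(2)] by metis
    \<comment> \<open>The two components have been lifted along different covers; a common
      refinement is needed before the lifts can be combined into one block element.\<close>
    have "Cod C e = Cod C e'" using u(3) w(3) uw'(3) by simp
    then obtain a b where ab: "a \<in> Arr C" "b \<in> Arr C" "Cod C a = Dom C e" "Cod C b = Dom C e'" "Dom C a = Dom C b" "epi (e \<cdot> a)" "e \<cdot> a = e' \<cdot> b"
      using epi_refine2[OF u(1) w(1)] by metis
    have ua: "u \<cdot> a \<in> gel U" "w \<cdot> b \<in> gel W" using gel_comp[OF U u(4) ab(1)] gel_comp[OF W w(4) ab(2)] ab u w by simp_all
    have dd: "Dom C (u \<cdot> a) = Dom C (w \<cdot> b)" using u w ab by simp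
    have uaC: "u \<cdot> a \<in> Arr C" "Cod C (u \<cdot> a) = pow_obj C (Dom C f) n" "w \<cdot> b \<in> Arr C" "Cod C (w \<cdot> b) = pow_obj C (Dom C f) m"
      using u w ab an am by simp_all
    have h: "dsum_arr (Dom C f) n m (u \<cdot> a) (w \<cdot> b) \<in> gel (sub_dsum C (Dom C f) n m U W)"
      unfolding gel_sub_dsum[OF XY(1) U W] gdsum_def using ua dd by blast
    have "g \<cdot> (e \<cdot> a) = dsum_arr (Cod C f) n m (u' \<cdot> (e \<cdot> a)) (w' \<cdot> (e \<cdot> a))"
      unfolding uw'(4) by (rule dsum_arr(5)[OF XY(2) u' w' uw'(3)]) (use u(2,3) ab(1,3) uw'(3) in simp_all)
    also have "u' \<cdot> (e \<cdot> a) = pow_arr C f n \<cdot> (u \<cdot> a)"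
      using cmp_reduce[OF u(8), of a] u' u(2,3) ab(1,3) cmp_assoc[of "pow_arr C f n" u a] an u(5-7) by simp
    also have "w' \<cdot> (e \<cdot> a) = pow_arr C f m \<cdot> (w \<cdot> b)"
      unfolding ab(7) using cmp_reduce[OF w(8), of b] w' w(2,3) ab(2,4) cmp_assoc[of "pow_arr C f m" w b] am w(5-7) by simp
    also have "dsum_arr (Cod C f) n m (pow_arr C f n \<cdot> (u \<cdot> a)) (pow_arr C f m \<cdot> (w \<cdot> b)) =
       pow_arr C f ?N \<cdot> dsum_arr (Dom C f) n m (u \<cdot> a) (w \<cdot> b)" by (rule comm[OF uaC dd, symmetric])
    finally have ge: "g \<cdot> (e \<cdot> a) = pow_arr C f ?N \<cdot> dsum_arr (Dom C f) n m (u \<cdot> a) (w \<cdot> b)" .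
    note gA = dsum_arr(1-3)[OF XY(2) u' w' uw'(3), folded uw'(4)]
    show "g \<in> gel (dimg (pow_arr C f ?N) (sub_dsum C (Dom C f) n m U W))"
      by (rule gel_dimgI[OF aN(1) S gA(1) _ ab(6) _ h _ ge])
        (use gA aN u(2,3) ab(1,3,5) w(5,7) ab(2,4) uw'(3) dsum_arr(2)[OF XY(1) uaC dd] in simp_all)
  qed
  ultimately show ?thesis using Sub_eqI[OF DS SD] by blast
qed

lemma Dir_simps [simp]:
  "Srt (Dir C X) n = Sub C (pow_obj C X n)" "Dsum (Dir C X) = sub_dsum C X"
  "Act (Dir C X) n g U = (\<lambda>x. pow_mat C X n g \<cdot> x) ` U"
  by (simp_all add: Dir_def)

lemma Dir_Act:
  assumes "X \<in> Obj C" "g \<in> GL n" "U \<in> carrier (Sub C (pow_obj C X n))"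
  shows "Act (Dir C X) n g U = dimg (pow_mat C X n g) U"
proof -
  obtain b where "inverse_arrs (pow_mat C X n g) b" using pow_mat_inverse[OF assms(1,2)] .
  then show ?thesis using image_iso_dimg[of "pow_mat C X n g" b U] pow_mat(1-3)[OF assms(1)] assms(3) by simp
qed

lemma weak_partial_order_Sub: "weak_partial_order (Sub C X)"
  using partial_order_Sub partial_order.axioms(1) by blast

lemma pushforward_morphism:
  assumes f: "f \<in> Arr C"
  shows "dir_morphism (Dir C (Dom C f)) (Dir C (Cod C f)) (pushforward C f)"
  unfolding dir_morphism_def pushforward_dimg
proof (intro conjI allI impI ballI)
  have XY: "Dom C f \<in> Obj C" "Cod C f \<in> Obj C" using f by auto
  fix n :: nat
  note an = pow_arr(1-3)[OF f, of n]
  have c: "dimg (pow_arr C f n) U \<in> carrier (Sub C (pow_obj C (Cod C f) n))" if "U \<in> carrier (Sub C (pow_obj C (Dom C f) n))" for U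
    using dimg_Sub[OF an(1), of U] that an by simp
  then show "dimg (pow_arr C f n) \<in> carrier (Srt (Dir C (Dom C f)) n) \<rightarrow> carrier (Srt (Dir C (Cod C f)) n)" by auto
  show "isotone (Srt (Dir C (Dom C f)) n) (Srt (Dir C (Cod C f)) n) (dimg (pow_arr C f n))"
  proof (rule isotoneI)
    fix U V assume UV: "U \<in> carrier (Srt (Dir C (Dom C f)) n)" "V \<in> carrier (Srt (Dir C (Dom C f)) n)" "U \<sqsubseteq>\<^bsub>Srt (Dir C (Dom C f)) n\<^esub> V"
    then have "gel U \<subseteq> gel V" by (simp add: Sub_le)
    then have "gel (dimg (pow_arr C f n) U) \<subseteq> gel (dimg (pow_arr C f n) V)" using dimg_mono[OF an(1)] UV an by simp
    then show "dimg (pow_arr C f n) U \<sqsubseteq>\<^bsub>Srt (Dir C (Cod C f)) n\<^esub> dimg (pow_arr C f n) V" using UV c by (simp add: Sub_le)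
  qed (simp_all add: weak_partial_order_Sub)
  {
    fix g :: "'k mat" and U assume g: "g \<in> GL n" and U: "U \<in> carrier (Srt (Dir C (Dom C f)) n)"
    then have U': "U \<in> carrier (Sub C (pow_obj C (Dom C f) n))" by simp
    note mX = pow_mat(1-3)[OF XY(1), of n g] and mY = pow_mat(1-3)[OF XY(2), of n g]
    have "dimg (pow_arr C f n) (dimg (pow_mat C (Dom C f) n g) U) = dimg (pow_arr C f n \<cdot> pow_mat C (Dom C f) n g) U"
      by (rule dimg_dimg) (use mX an U' in simp_all)
    also have "\<dots> = dimg (pow_mat C (Cod C f) n g \<cdot> pow_arr C f n) U" unfolding pow_arr_mat[OF f] ..
    also have "\<dots> = dimg (pow_mat C (Cod C f) n g) (dimg (pow_arr C f n) U)"
      by (rule dimg_dimg[symmetric]) (use mY an U' in simp_all)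
    finally show "dimg (pow_arr C f n) (Act (Dir C (Dom C f)) n g U) = Act (Dir C (Cod C f)) n g (dimg (pow_arr C f n) U)"
      unfolding Dir_Act[OF XY(1) g U'] Dir_Act[OF XY(2) g c[OF U']] .
  }
  fix m U W assume "U \<in> carrier (Srt (Dir C (Dom C f)) n)" "W \<in> carrier (Srt (Dir C (Dom C f)) m)"
  then show "dimg (pow_arr C f (n + m)) (Dsum (Dir C (Dom C f)) n m U W) =
    Dsum (Dir C (Cod C f)) n m (dimg (pow_arr C f n) U) (dimg (pow_arr C f m) W)"
    using pushforward_dsum[OF f] by simp
qed

end

section \<open>Composition of directory morphisms\<close>

lemma dir_morphismD:
  fixes D :: "('s, 'k::field) dir" and E :: "('t, 'k) dir"
  assumes "dir_morphism D E f" "n \<ge> 1"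
  shows "f n \<in> carrier (Srt D n) \<rightarrow> carrier (Srt E n)" "isotone (Srt D n) (Srt E n) (f n)"
    and "g \<in> GL n \<Longrightarrow> x \<in> carrier (Srt D n) \<Longrightarrow> f n (Act D n g x) = Act E n g (f n x)"
    and "m \<ge> 1 \<Longrightarrow> x \<in> carrier (Srt D n) \<Longrightarrow> y \<in> carrier (Srt D m) \<Longrightarrow>
      f (n + m) (Dsum D n m x y) = Dsum E n m (f n x) (f m y)"
  using assms unfolding dir_morphism_def by simp_all

lemma dir_morphism_comp:
  fixes D :: "('s, 'k::field) dir" and E :: "('t, 'k) dir" and F :: "('u, 'k) dir"
  assumes f: "dir_morphism D E f" and g: "dir_morphism E F g"
  shows "dir_morphism D F (dir_comp g f)"
  unfolding dir_morphism_def dir_comp_def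
proof (intro conjI allI impI ballI)
  fix n :: nat assume n: "n \<ge> 1"
  note fD = dir_morphismD[OF f n] and gD = dir_morphismD[OF g n]
  show "g n \<circ> f n \<in> carrier (Srt D n) \<rightarrow> carrier (Srt F n)" using fD(1) gD(1) by (auto simp: Pi_iff)
  show "isotone (Srt D n) (Srt F n) (g n \<circ> f n)" by (rule iso_compose[OF fD(1,2) gD(1,2)])
  fix h :: "'k mat" and x assume h: "h \<in> GL n" and x: "x \<in> carrier (Srt D n)"
  have "f n x \<in> carrier (Srt E n)" using fD(1) x by (rule funcset_mem)
  then show "(g n \<circ> f n) (Act D n h x) = Act F n h ((g n \<circ> f n) x)" using fD(3)[OF h x] gD(3)[OF h] by simp
next
  fix n m :: nat and x y assume n: "n \<ge> 1" and m: "m \<ge> 1" and x: "x \<in> carrier (Srt D n)" and y: "y \<in> carrier (Srt D m)"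
  have "f n x \<in> carrier (Srt E n)" "f m y \<in> carrier (Srt E m)"
    using funcset_mem[OF dir_morphismD(1)[OF f n] x] funcset_mem[OF dir_morphismD(1)[OF f m] y] by auto
  then show "(g (n + m) \<circ> f (n + m)) (Dsum D n m x y) = Dsum F n m ((g n \<circ> f n) x) ((g m \<circ> f m) y)"
    using dir_morphismD(4)[OF f n m x y] dir_morphismD(4)[OF g n m] by simp
qed

section \<open>Subspaces of \<open>K\<^sup>n\<close> and matrices\<close>

abbreviation Ksubspace :: "nat \<Rightarrow> 'a::field vec set \<Rightarrow> bool" where
  "Ksubspace n U \<equiv> subspace class_ring U (Kn n)"

lemma Ksubspace_iff:
  fixes U :: "'a::field vec set"
  shows "Ksubspace n U \<longleftrightarrow> U \<subseteq> carrier_vec n \<and> 0\<^sub>v n \<in> U \<and> (\<forall>v\<in>U. \<forall>w\<in>U. v + w \<in> U) \<and> (\<forall>c. \<forall>v\<in>U. c \<cdot>\<^sub>v v \<in> U)"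
proof -
  interpret vec_space "TYPE('a)" n .
  show ?thesis unfolding subspace_def submodule_def using vec_vs vec_module
    by (auto simp: module_vec_simps)
qed

lemma mat_of_cols_padded:
  assumes ws: "set ws \<subseteq> carrier_vec n" "length ws = n" and k: "k \<le> n" and x: "x \<in> carrier_vec n" "\<And>i. k \<le> i \<Longrightarrow> i < n \<Longrightarrow> x $ i = (0::'a::field)"
  shows "mat_of_cols n ws *\<^sub>v x = mat_of_cols n (take k ws) *\<^sub>v vec k (\<lambda>i. x $ i)"
proof (rule eq_vecI)
  fix r assume "r < dim_vec (mat_of_cols n (take k ws) *\<^sub>v vec k (\<lambda>i. x $ i))"
  then have r: "r < n" by simp
  have "(mat_of_cols n ws *\<^sub>v x) $ r = (\<Sum>i\<in>{0..<n}. ws ! i $ r * x $ i)"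
    using r x ws by (simp add: scalar_prod_def mat_of_cols_index)
  also have "\<dots> = (\<Sum>i\<in>{0..<k}. ws ! i $ r * x $ i)"
    by (rule sum.mono_neutral_right) (use k x(2) in auto)
  also have "\<dots> = (mat_of_cols n (take k ws) *\<^sub>v vec k (\<lambda>i. x $ i)) $ r"
    using r k ws by (simp add: scalar_prod_def mat_of_cols_index)
  finally show "(mat_of_cols n ws *\<^sub>v x) $ r = (mat_of_cols n (take k ws) *\<^sub>v vec k (\<lambda>i. x $ i)) $ r" .
qed simp

text \<open>The dimension of the ambient space bounds the independent subsets of \<open>U\<close>,
  so a maximal one exists. It is a basis, and this also shows that \<open>U\<close> is
  finite-dimensional.\<close>

lemma (in vec_space) subspace_basis:
  assumes U: "subspace class_ring U V"
  obtains B where "finite B" "B \<subseteq> U" "lin_indpt B" "span B = U" "vectorspace.fin_dim class_ring (vs U)"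
    "vectorspace.dim class_ring (vs U) = card B"
proof -
  interpret W: vectorspace class_ring "vs U" by (rule subspace_is_vs[OF U])
  have sm: "submodule class_ring U V" using U by (simp add: subspace_def)
  have sub: "U \<subseteq> carrier V" using sm by (auto simp: submodule_def)
  have cW: "carrier (vs U) = U" by simp
  have li: "lin_indpt S" if "S \<subseteq> U" "\<not> LinearCombinations.module.lin_dep class_ring (vs U) S" for S
    using span_li_not_depend(2)[OF that(1) sm] that(2) by simp
  have "\<exists>B. finite B \<and> maximal B (\<lambda>S. S \<subseteq> carrier (vs U) \<and> \<not> LinearCombinations.module.lin_dep class_ring (vs U) S)"
  proof (rule maximal_exists[where N = dim and B = "{}"])
    fix A assume "A \<subseteq> carrier (vs U) \<and> \<not> LinearCombinations.module.lin_dep class_ring (vs U) A"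
    then have A: "A \<subseteq> U" "\<not> LinearCombinations.module.lin_dep class_ring (vs U) A" unfolding cW by simp_all
    have Ac: "A \<subseteq> carrier_vec n" using A(1) sub by auto
    show "finite A \<and> card A \<le> dim"
      by (rule conjI[OF fin_dim_li_fin[OF fin_dim li[OF A] Ac] li_le_dim(2)[OF fin_dim Ac li[OF A]]])
  next
    show "{} \<subseteq> carrier (vs U) \<and> \<not> LinearCombinations.module.lin_dep class_ring (vs U) {}" by (auto simp: W.lin_dep_def)
  qed
  then obtain B where fB: "finite B" and m: "maximal B (\<lambda>S. S \<subseteq> carrier (vs U) \<and> \<not> LinearCombinations.module.lin_dep class_ring (vs U) S)"
    by blast
  have bas: "vectorspace.basis class_ring (vs U) B" by (rule W.max_li_is_basis[OF m])
  have B: "B \<subseteq> U" "\<not> LinearCombinations.module.lin_dep class_ring (vs U) B" "LinearCombinations.module.span class_ring (vs U) B = U"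
    using bas unfolding W.basis_def cW by auto
  have "vectorspace.fin_dim class_ring (vs U)" unfolding W.fin_dim_def using fB B by auto
  then show thesis using that[of B] fB B li[OF B(1,2)] span_li_not_depend(1)[OF B(1) sm] W.dim_basis[OF fB bas] by metis
qed

text \<open>By the replacement theorem a basis of \<open>U\<close> extends to a spanning family of
  at most \<open>n\<close> vectors. The square matrix \<open>P\<close> with these columns has a
  right inverse because they span, hence a two-sided one, and \<open>U\<close> is where the trailing
  coordinates vanish.\<close>

lemma (in vec_space) subspace_coordinates:
  assumes U: "subspace class_ring U V"
  obtains P Q where "P \<in> carrier_mat n n" "Q \<in> carrier_mat n n" "P * Q = 1\<^sub>m n" "Q * P = 1\<^sub>m n"
    "vectorspace.fin_dim class_ring (vs U)" "vectorspace.dim class_ring (vs U) \<le> n"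
    "U = {v \<in> carrier_vec n. \<forall>i. vectorspace.dim class_ring (vs U) \<le> i \<and> i < n \<longrightarrow> (Q *\<^sub>v v) $ i = 0}"
proof -
  obtain B where B: "finite B" "B \<subseteq> U" "lin_indpt B" "span B = U" "vectorspace.fin_dim class_ring (vs U)"
    "vectorspace.dim class_ring (vs U) = card B" using subspace_basis[OF U] .
  let ?k = "vectorspace.dim class_ring (vs U)"
  have Uc: "U \<subseteq> carrier_vec n" using U unfolding Ksubspace_iff by blast
  have Bu: "B \<subseteq> span (set (unit_vecs n))" using B(2) Uc span_unit_vecs_is_carrier by blast
  have uc: "set (unit_vecs n) \<subseteq> (carrier_vec n :: 'a vec set)" by (rule unit_vecs_carrier)
  note rep = replacement[OF B(1) finite_set _ B(3) Bu, unfolded module_vec_simps, OF uc]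
  obtain C where C: "finite C" "C \<subseteq> carrier_vec n" "int (card C) \<le> int (card (set (unit_vecs n :: 'a vec list))) - int (card B)"
    "span (B \<union> C) = span (set (unit_vecs n))"
    using rep by blast
  have cu: "card (set (unit_vecs n :: 'a vec list)) = n" using distinct_card[OF unit_vecs_distinct] by simp
  obtain bs where bs: "set bs = B" "distinct bs" using finite_distinct_list[OF B(1)] by blast
  obtain cs where cs: "set cs = C" "distinct cs" using finite_distinct_list[OF C(1)] by blast
  have lb: "length bs = ?k" using bs B(6) distinct_card by metis
  have lc: "length cs \<le> n - ?k" "?k \<le> n" using C(3) cs bs distinct_card[OF cs(2)] B(6) cu by auto
  \<comment> \<open>The basis of \<open>U\<close> comes first. Since only an upper bound on
    \<open>length cs\<close> is at hand, zero vectors fill the list up to exactly \<open>n\<close>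
    columns; invertibility will come from spanning, not from independence.\<close>
  define ws where "ws = bs @ cs @ replicate (n - (length bs + length cs)) (0\<^sub>v n)"
  have lw: "length ws = n" using lc lb by (simp add: ws_def)
  have wc: "set ws \<subseteq> carrier_vec n" using bs cs B(2) C(2) Uc by (auto simp: ws_def)
  have tw: "take ?k ws = bs" using lb by (simp add: ws_def)
  have "span (B \<union> C) \<subseteq> span (set ws)" by (rule span_is_monotone) (use bs cs in \<open>auto simp: ws_def\<close>)
  then have full: "carrier_vec n \<subseteq> span_list ws" unfolding C(4) span_unit_vecs_is_carrier span_list_as_span[OF wc] .
  define P where "P = mat_of_cols n ws"
  have P: "P \<in> carrier_mat n n" unfolding P_def using mat_of_cols_carrier(1)[of n ws] lw by simp
  have dimw: "\<forall>w\<in>set ws. dim_vec w = n" using wc by auto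
  have "\<exists>c. unit_vec n i = P *\<^sub>v vec n c" for i
  proof -
    have "unit_vec n i \<in> span_list ws" using full by auto
    then show ?thesis using lincomb_list_as_mat_mult[OF dimw] unfolding P_def lw by (auto elim!: in_span_listE)
  qed
  then obtain c where c: "\<And>i. unit_vec n i = P *\<^sub>v vec n (c i)" by metis
  define Q where "Q = mat n n (\<lambda>(l, i). c i l)"
  have Q: "Q \<in> carrier_mat n n" by (simp add: Q_def)
  have cQ: "col Q i = vec n (c i)" if "i < n" for i using that by (auto simp: Q_def)
  have PQ: "P * Q = 1\<^sub>m n"
  proof (rule eq_matI)
    fix l i assume "l < dim_row (1\<^sub>m n)" "i < dim_col (1\<^sub>m n)"
    then have li: "l < n" "i < n" by simp_all
    have "(P * Q) $$ (l, i) = (P *\<^sub>v col Q i) $ l" using li P Q by simp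
    also have "\<dots> = unit_vec n i $ l" unfolding cQ[OF li(2)] c[of i, symmetric] ..
    also have "\<dots> = 1\<^sub>m n $$ (l, i)" using li by simp
    finally show "(P * Q) $$ (l, i) = 1\<^sub>m n $$ (l, i)" .
  qed (use P Q in simp_all)
  have QP: "Q * P = 1\<^sub>m n" by (rule mat_mult_left_right_inverse[OF P Q PQ])
  have bU: "set bs \<subseteq> carrier_vec n" and dimb: "\<forall>w\<in>set bs. dim_vec w = n" using bs B(2) Uc by auto
  have Ub: "U = span_list bs" unfolding span_list_as_span[OF bU] bs(1) B(4) ..
  have Ub': "v \<in> U \<longleftrightarrow> (\<exists>x. v = mat_of_cols n bs *\<^sub>v vec ?k x)" for v
  proof -
    have "v \<in> U \<longleftrightarrow> v \<in> span_list bs" using Ub by simp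
    then show ?thesis unfolding span_list_def using lincomb_list_as_mat_mult[OF dimb] lb by simp
  qed
  have pad: "P *\<^sub>v x = mat_of_cols n bs *\<^sub>v vec ?k (\<lambda>i. x $ i)"
    if "x \<in> carrier_vec n" "\<And>i. ?k \<le> i \<Longrightarrow> i < n \<Longrightarrow> x $ i = 0" for x
    using mat_of_cols_padded[OF wc lw lc(2) that] unfolding P_def tw .
  have "U = {v \<in> carrier_vec n. \<forall>i. ?k \<le> i \<and> i < n \<longrightarrow> (Q *\<^sub>v v) $ i = 0}"
  proof (intro equalityI subsetI)
    fix v assume v: "v \<in> U"
    then obtain x where x: "v = mat_of_cols n bs *\<^sub>v vec ?k x" using Ub' by blast
    define x' where "x' = vec n (\<lambda>i. if i < ?k then x i else 0)"
    have x': "x' \<in> carrier_vec n" "\<And>i. ?k \<le> i \<Longrightarrow> i < n \<Longrightarrow> x' $ i = 0" by (simp_all add: x'_def)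
    have "vec ?k x = vec ?k (\<lambda>i. x' $ i)" using lc(2) by (auto simp: x'_def)
    then have "v = P *\<^sub>v x'" using pad[OF x'] x by simp
    then have "Q *\<^sub>v v = x'" using assoc_mult_mat_vec[OF Q P x'(1)] QP x'(1) by simp
    then show "v \<in> {v \<in> carrier_vec n. \<forall>i. ?k \<le> i \<and> i < n \<longrightarrow> (Q *\<^sub>v v) $ i = 0}" using x'(2) v Uc by auto
  next
    fix v assume "v \<in> {v \<in> carrier_vec n. \<forall>i. ?k \<le> i \<and> i < n \<longrightarrow> (Q *\<^sub>v v) $ i = 0}"
    then have v: "v \<in> carrier_vec n" "\<And>i. ?k \<le> i \<Longrightarrow> i < n \<Longrightarrow> (Q *\<^sub>v v) $ i = 0" by auto
    have "v = P *\<^sub>v (Q *\<^sub>v v)" using assoc_mult_mat_vec[OF P Q v(1)] PQ v(1) by simp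
    also have "\<dots> = mat_of_cols n bs *\<^sub>v vec ?k (\<lambda>i. (Q *\<^sub>v v) $ i)" by (rule pad) (use Q v in auto)
    finally show "v \<in> U" using Ub' by blast
  qed
  then show thesis using that[OF P Q PQ QP B(5) lc(2)] by blast
qed

lemma Ksubspace_UNIV: "Ksubspace n (carrier_vec n :: 'a::field vec set)"
  unfolding Ksubspace_iff by auto

lemma Ksubspace_coordinates:
  fixes U :: "'a::field vec set"
  assumes U: "Ksubspace n U"
  obtains P Q where "P \<in> carrier_mat n n" "Q \<in> carrier_mat n n" "P * Q = 1\<^sub>m n" "Q * P = 1\<^sub>m n"
    "vectorspace.dim class_ring (Ksub n U) \<le> n"
    "U = {v \<in> carrier_vec n. \<forall>i. vectorspace.dim class_ring (Ksub n U) \<le> i \<and> i < n \<longrightarrow> (Q *\<^sub>v v) $ i = 0}"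
proof -
  interpret vec_space "TYPE('a)" n .
  show thesis by (rule subspace_coordinates[OF U, folded Ksub_def]) (rule that)
qed

lemma Ksub_vectorspace:
  fixes U :: "'a::field vec set"
  assumes U: "Ksubspace n U"
  shows "vectorspace class_ring (Ksub n U)" "vectorspace.fin_dim class_ring (Ksub n U)"
proof -
  interpret vec_space "TYPE('a)" n .
  show "vectorspace class_ring (Ksub n U)" unfolding Ksub_def by (rule subspace_is_vs[OF U])
  show "vectorspace.fin_dim class_ring (Ksub n U)" by (rule subspace_coordinates[OF U, folded Ksub_def])
qed

text \<open>With the full spaces in the form \<open>Ksub\<close>, all objects that occur have one
  shape and a single family of arrows suffices.\<close>

lemma Kn_Ksub: "Kn n = Ksub n (carrier_vec n)"
  by (simp add: Ksub_def module_vec_def)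

lemma Ksub_simps [simp]:
  "carrier (Ksub n U) = U" "add (Ksub n U) = (+)" "smult (Ksub n U) = (\<cdot>\<^sub>v)" "zero (Ksub n U) = 0\<^sub>v n"
  by (simp_all add: Ksub_def module_vec_simps)

section \<open>Linear maps between subspaces, represented by matrices\<close>

definition Karr :: "nat \<Rightarrow> 'a::field vec set \<Rightarrow> nat \<Rightarrow> 'a vec set \<Rightarrow> 'a mat \<Rightarrow> 'a vmap" where
  "Karr n U m W M = (Ksub n U, Ksub m W, \<lambda>v\<in>U. M *\<^sub>v v)"

text \<open>The matrices belong to the ambient spaces, so equations between morphisms become
  matrix-vector identities checked on \<open>U\<close> only. One map may have several matrices;
  \<open>Karr_cong\<close> identifies the corresponding arrows.\<close>

definition Kmaps :: "nat \<Rightarrow> 'a::field vec set \<Rightarrow> nat \<Rightarrow> 'a vec set \<Rightarrow> 'a mat \<Rightarrow> bool" where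
  "Kmaps n U m W M \<longleftrightarrow> Ksubspace n U \<and> Ksubspace m W \<and> M \<in> carrier_mat m n \<and> (\<forall>v\<in>U. M *\<^sub>v v \<in> W)"

lemma KmapsD:
  assumes "Kmaps n U m W M"
  shows "Ksubspace n U" "Ksubspace m W" "M \<in> carrier_mat m n" "v \<in> U \<Longrightarrow> M *\<^sub>v v \<in> W" "v \<in> U \<Longrightarrow> v \<in> carrier_vec n"
    "w \<in> W \<Longrightarrow> w \<in> carrier_vec m"
  using assms unfolding Kmaps_def Ksubspace_iff by auto

lemma Kmaps_comp: "Kmaps n U m W M \<Longrightarrow> Kmaps m W k Z N \<Longrightarrow> Kmaps n U k Z (N * M)"
  using KmapsD(5)[of n U m W M] unfolding Kmaps_def by (auto simp: assoc_mult_mat_vec[of N k m M n])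

lemma Kmaps_one: "Ksubspace n U \<Longrightarrow> Ksubspace n W \<Longrightarrow> U \<subseteq> W \<Longrightarrow> Kmaps n U n W (1\<^sub>m n)"
  unfolding Kmaps_def Ksubspace_iff by (auto simp: subset_iff)

lemma Kmaps_UNIV: "Ksubspace n U \<Longrightarrow> M \<in> carrier_mat m n \<Longrightarrow> Kmaps n U m (carrier_vec m) M"
  unfolding Kmaps_def using Ksubspace_UNIV Ksubspace_iff[of U n] by (auto simp: mult_mat_vec_carrier subset_iff)

lemma smult_mat_mult_vec: "M \<in> carrier_mat m n \<Longrightarrow> v \<in> carrier_vec n \<Longrightarrow> (c \<cdot>\<^sub>m M) *\<^sub>v v = (c::'a::field) \<cdot>\<^sub>v (M *\<^sub>v v)"
  by (intro eq_vecI) auto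

lemma Karr_Hom:
  assumes "Kmaps n U m W M"
  shows "Karr n U m W M \<in> Hom (KVectf \<iota>) (Ksub n U) (Ksub m W)"
proof -
  note k = KmapsD[OF assms]
  have "(\<lambda>v\<in>U. M *\<^sub>v v) \<in> module_hom class_ring (Ksub n U) (Ksub m W)"
    unfolding module_hom_def using k(1,4,5) mult_add_distrib_mat_vec[OF k(3)] mult_mat_vec[OF k(3)]
    by (auto simp: Ksubspace_iff)
  then show ?thesis using Ksub_vectorspace[OF k(1)] Ksub_vectorspace[OF k(2)]
    by (simp add: Hom_def KVectf_def Karr_def)
qed

lemma Karr_cong: "(\<And>v. v \<in> U \<Longrightarrow> M *\<^sub>v v = N *\<^sub>v v) \<Longrightarrow> Karr n U m W M = Karr n U m W N"
  unfolding Karr_def by (simp add: restrict_def fun_eq_iff)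

lemma Karr_Cmp:
  assumes "Kmaps n U m W M" "Kmaps m W k Z N"
  shows "Cmp (KVectf \<iota>) (Karr m W k Z N) (Karr n U m W M) = Karr n U k Z (N * M)"
  using KmapsD(3-5)[OF assms(1)] KmapsD(3)[OF assms(2)]
  by (auto simp: KVectf_def Karr_def compose_def restrict_def fun_eq_iff assoc_mult_mat_vec[of N k m M n])

lemma Karr_Ide: "Ksubspace n U \<Longrightarrow> Ide (KVectf \<iota>) (Ksub n U) = Karr n U n U (1\<^sub>m n)"
  by (auto simp: KVectf_def Karr_def restrict_def fun_eq_iff Ksubspace_iff subset_iff)

lemma Karr_Add:
  assumes "Kmaps n U m W M" "Kmaps n U m W N"
  shows "Add (KVectf \<iota>) (Karr n U m W M) (Karr n U m W N) = Karr n U m W (M + N)"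
  using KmapsD(5)[OF assms(1)] KmapsD(3)[OF assms(1)] KmapsD(3)[OF assms(2)]
  by (auto simp: KVectf_def Karr_def restrict_def fun_eq_iff add_mult_distrib_mat_vec[of M m n N])

lemma Karr_Scl:
  assumes "Kmaps n U m W M"
  shows "Scl (KVectf \<iota>) c (Karr n U m W M) = Karr n U m W (\<iota> c \<cdot>\<^sub>m M)"
  using KmapsD(5)[OF assms] KmapsD(3)[OF assms]
  by (auto simp: KVectf_def Karr_def restrict_def fun_eq_iff smult_mat_mult_vec[of M m n])

lemma Kincl_Karr:
  assumes "Ksubspace n U"
  shows "Kincl n U = Karr n U n (carrier_vec n) (1\<^sub>m n)"
proof -
  have "U \<subseteq> carrier_vec n" using assms unfolding Ksubspace_iff by blast
  then show ?thesis by (auto simp: Kincl_def Karr_def Kn_Ksub restrict_def fun_eq_iff)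
qed

definition row_mat :: "nat \<Rightarrow> nat \<Rightarrow> 'a::field mat" where
  "row_mat n i = mat 1 n (\<lambda>(_, l). if l = i then 1 else 0)"

definition col_mat :: "nat \<Rightarrow> nat \<Rightarrow> 'a::field mat" where
  "col_mat n i = mat n 1 (\<lambda>(l, _). if l = i then 1 else 0)"

lemma row_mat [simp]: "row_mat n i \<in> carrier_mat 1 n" and col_mat [simp]: "col_mat n i \<in> carrier_mat n 1"
  by (simp_all add: row_mat_def col_mat_def)

lemma delta_mult: "(if l = i then 1 else 0) * x = (if l = i then x else (0::'a::field))"
  by simp

lemma row_mat_mult_vec: "i < n \<Longrightarrow> v \<in> carrier_vec n \<Longrightarrow> row_mat n i *\<^sub>v v = vec 1 (\<lambda>_. v $ i)"
proof (rule eq_vecI)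
  fix r assume i: "i < n" and v: "v \<in> carrier_vec n" and r: "r < dim_vec (vec 1 (\<lambda>_. v $ i))"
  show "(row_mat n i *\<^sub>v v) $ r = vec 1 (\<lambda>_. v $ i) $ r"
    using i r v by (simp add: row_mat_def scalar_prod_def delta_mult)
qed (simp_all add: row_mat_def)

lemma Kproj_Karr: "i < n \<Longrightarrow> Kproj n i = Karr n (carrier_vec n) 1 (carrier_vec 1) (row_mat n i)"
  by (auto simp: Kproj_def Karr_def Kn_Ksub restrict_def fun_eq_iff row_mat_mult_vec)

declare index_mult_mat_vec [simp del] One_nat_def [simp del] Ksubspace_UNIV [simp]

lemma mult_mat_zero_vec: "Q \<in> carrier_mat m n \<Longrightarrow> Q *\<^sub>v 0\<^sub>v n = 0\<^sub>v m"
  by (rule eq_vecI) (auto simp: index_mult_mat_vec)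

lemma triple_mult_carrier: "A \<in> carrier_mat a b \<Longrightarrow> B \<in> carrier_mat b c \<Longrightarrow> D \<in> carrier_mat c e \<Longrightarrow> A * B * D \<in> carrier_mat a e"
  by (intro mult_carrier_mat)

definition coord_mat :: "nat \<Rightarrow> nat set \<Rightarrow> 'a::field mat" where
  "coord_mat n S = mat n n (\<lambda>(a, b). if a = b \<and> a \<in> S then 1 else 0)"

lemma coord_mat [simp]: "coord_mat n S \<in> carrier_mat n n" "dim_row (coord_mat n S) = n" "dim_col (coord_mat n S) = n"
  by (simp_all add: coord_mat_def)

lemma coord_mat_mult_vec: "v \<in> carrier_vec n \<Longrightarrow> coord_mat n S *\<^sub>v v = vec n (\<lambda>i. if i \<in> S then v $ i else 0)"
proof (rule eq_vecI)
  fix i assume v: "v \<in> carrier_vec n" and i: "i < dim_vec (vec n (\<lambda>i. if i \<in> S then v $ i else 0))"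
  have "(if i = l \<and> i \<in> S then 1 else 0) * v $ l = (if l = i then if i \<in> S then v $ i else 0 else 0)" for l by auto
  then show "(coord_mat n S *\<^sub>v v) $ i = vec n (\<lambda>i. if i \<in> S then v $ i else 0) $ i"
    using i v by (simp add: index_mult_mat_vec coord_mat_def scalar_prod_def)
qed (simp add: coord_mat_def)

lemma col_mat_mult_vec: "w \<in> carrier_vec 1 \<Longrightarrow> col_mat n l *\<^sub>v w = vec n (\<lambda>i. if i = l then w $ 0 else (0::'a::field))"
  by (intro eq_vecI) (simp_all add: index_mult_mat_vec col_mat_def scalar_prod_def One_nat_def)

text \<open>With \<open>Q\<close> as a coordinate change, \<open>S\<close> lists the coordinates
  that may be nonzero. A subspace and a complement are then given by one \<open>Q\<close> and
  complementary index sets, and the same lemmas serve both.\<close>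

definition coord_space :: "nat \<Rightarrow> 'a::field mat \<Rightarrow> nat set \<Rightarrow> 'a vec set" where
  "coord_space n Q S = {v \<in> carrier_vec n. \<forall>i<n. i \<notin> S \<longrightarrow> (Q *\<^sub>v v) $ i = 0}"

definition inverse_mats :: "nat \<Rightarrow> 'a::field mat \<Rightarrow> 'a mat \<Rightarrow> bool" where
  "inverse_mats n P Q \<longleftrightarrow> P \<in> carrier_mat n n \<and> Q \<in> carrier_mat n n \<and> P * Q = 1\<^sub>m n \<and> Q * P = 1\<^sub>m n"

lemma inverse_matsD:
  assumes "inverse_mats n P Q"
  shows "P \<in> carrier_mat n n" "Q \<in> carrier_mat n n" "v \<in> carrier_vec n \<Longrightarrow> P *\<^sub>v (Q *\<^sub>v v) = v" "v \<in> carrier_vec n \<Longrightarrow> Q *\<^sub>v (P *\<^sub>v v) = v"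
    "v \<in> carrier_vec n \<Longrightarrow> P *\<^sub>v v \<in> carrier_vec n" "v \<in> carrier_vec n \<Longrightarrow> Q *\<^sub>v v \<in> carrier_vec n"
proof -
  show P: "P \<in> carrier_mat n n" and Q: "Q \<in> carrier_mat n n" using assms by (simp_all add: inverse_mats_def)
  show "v \<in> carrier_vec n \<Longrightarrow> P *\<^sub>v v \<in> carrier_vec n" "v \<in> carrier_vec n \<Longrightarrow> Q *\<^sub>v v \<in> carrier_vec n" using P Q by auto
  assume v: "v \<in> carrier_vec n"
  show "P *\<^sub>v (Q *\<^sub>v v) = v" "Q *\<^sub>v (P *\<^sub>v v) = v"
    using assoc_mult_mat_vec[OF P Q v] assoc_mult_mat_vec[OF Q P v] v assms by (simp_all add: inverse_mats_def)
qed

lemma Ksubspace_coord_space: "Q \<in> carrier_mat n n \<Longrightarrow> Ksubspace n (coord_space n Q S)"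
  unfolding Ksubspace_iff coord_space_def by (auto simp: mult_add_distrib_mat_vec[of Q n n] mult_mat_vec[of Q n n] mult_mat_zero_vec[of Q n n] index_add_vec(1)[of _ "Q *\<^sub>v _"])

lemma coord_space_UNIV: "{..<n} \<subseteq> S \<Longrightarrow> coord_space n Q S = carrier_vec n"
  by (auto simp: coord_space_def)

lemma Ksubspace_coord:
  assumes "Ksubspace n U"
  obtains P Q where "inverse_mats n P Q" "vectorspace.dim class_ring (Ksub n U) \<le> n"
    "U = coord_space n Q {0..<vectorspace.dim class_ring (Ksub n U)}"
proof -
  obtain P Q where PQ: "P \<in> carrier_mat n n" "Q \<in> carrier_mat n n" "P * Q = 1\<^sub>m n" "Q * P = 1\<^sub>m n"
    "vectorspace.dim class_ring (Ksub n U) \<le> n"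
    and U: "U = {v \<in> carrier_vec n. \<forall>i. vectorspace.dim class_ring (Ksub n U) \<le> i \<and> i < n \<longrightarrow> (Q *\<^sub>v v) $ i = 0}"
    using Ksubspace_coordinates[OF assms] .
  have "U = coord_space n Q {0..<vectorspace.dim class_ring (Ksub n U)}"
    using U unfolding coord_space_def by (auto simp: not_less)
  then show thesis using that PQ unfolding inverse_mats_def by blast
qed

text \<open>The two offsets let one definition cover the block projections (\<open>s\<close> is the
  start of the block) and the block inclusions (\<open>t\<close> is the start of the block).\<close>

definition shift_mat :: "nat \<Rightarrow> nat \<Rightarrow> nat \<Rightarrow> nat \<Rightarrow> 'a::field mat" where
  "shift_mat a b s t = mat a b (\<lambda>(i, l). if i + s = l + t then 1 else 0)"

lemma shift_mat [simp]: "shift_mat a b s t \<in> carrier_mat a b"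
  by (simp add: shift_mat_def)

lemma shift_mat_mult_vec:
  assumes x: "x \<in> carrier_vec b"
  shows "shift_mat a b s t *\<^sub>v x = vec a (\<lambda>i. if t \<le> i + s \<and> i + s - t < b then x $ (i + s - t) else 0)"
proof (rule eq_vecI)
  fix i assume i: "i < dim_vec (vec a (\<lambda>i. if t \<le> i + s \<and> i + s - t < b then x $ (i + s - t) else 0))"
  have "(if i + s = l + t then 1 else 0) * x $ l = (if l = i + s - t then if t \<le> i + s then x $ (i + s - t) else 0 else 0)" for l
    by auto
  then show "(shift_mat a b s t *\<^sub>v x) $ i = vec a (\<lambda>i. if t \<le> i + s \<and> i + s - t < b then x $ (i + s - t) else 0) $ i"
    using i x by (simp add: index_mult_mat_vec shift_mat_def scalar_prod_def)
qed (simp add: shift_mat_def)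

section \<open>Functors on finite-dimensional vector spaces\<close>

locale functor_from_vect = abelian_category C + linear_functor "KVectf \<iota>" C FO FA
  for \<iota> :: "'k::field \<Rightarrow> 'K::field" and C :: "('o, 'm, 'k) lincat" and FO :: "'K vspace \<Rightarrow> 'o" and FA :: "'K vmap \<Rightarrow> 'm"
begin

abbreviation FS :: "nat \<Rightarrow> 'K vec set \<Rightarrow> 'o" where "FS n U \<equiv> FO (Ksub n U)"
abbreviation FM :: "nat \<Rightarrow> 'K vec set \<Rightarrow> nat \<Rightarrow> 'K vec set \<Rightarrow> 'K mat \<Rightarrow> 'm" where "FM n U m W M \<equiv> FA (Karr n U m W M)"
abbreviation X where "X \<equiv> FS 1 (carrier_vec 1)"

lemma FO_Kn: "FO (Kn n) = FS n (carrier_vec n)"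
  using Kn_Ksub by metis

lemma FS_Obj [simp]: "Ksubspace n U \<Longrightarrow> FS n U \<in> Obj C"
  using Ksub_vectorspace[where n = n and U = U] by (intro FO_Obj) (simp add: KVectf_def)

lemma FM: "Kmaps n U m W M \<Longrightarrow> FM n U m W M \<in> Arr C" "Kmaps n U m W M \<Longrightarrow> Dom C (FM n U m W M) = FS n U"
  "Kmaps n U m W M \<Longrightarrow> Cod C (FM n U m W M) = FS m W"
  using FA_Hom[OF Karr_Hom] by auto

lemma FM_cong: "(\<And>v. v \<in> U \<Longrightarrow> M *\<^sub>v v = N *\<^sub>v v) \<Longrightarrow> FM n U m W M = FM n U m W N"
  using Karr_cong by metis

lemma FM_comp: "Kmaps n U m W M \<Longrightarrow> Kmaps m W k Z N \<Longrightarrow> FM m W k Z N \<cdot> FM n U m W M = FM n U k Z (N * M)"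
  using FA_Cmp[OF Karr_Hom Karr_Hom] Karr_Cmp by metis

lemma FM_comp_eq:
  assumes M: "Kmaps n U m W M" and N: "Kmaps m W k Z N" and e: "\<And>v. v \<in> U \<Longrightarrow> N *\<^sub>v (M *\<^sub>v v) = L *\<^sub>v v"
  shows "FM m W k Z N \<cdot> FM n U m W M = FM n U k Z L"
  unfolding FM_comp[OF M N]
  by (rule FM_cong) (use e KmapsD[OF M] KmapsD(3)[OF N] in \<open>simp add: assoc_mult_mat_vec[of N k m M n]\<close>)

lemma FM_Ide: "Ksubspace n U \<Longrightarrow> (\<And>v. v \<in> U \<Longrightarrow> M *\<^sub>v v = v) \<Longrightarrow> FM n U n U M = Ide C (FS n U)"
proof -
  assume U: "Ksubspace n U" and M: "\<And>v. v \<in> U \<Longrightarrow> M *\<^sub>v v = v"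
  have "U \<subseteq> carrier_vec n" using U unfolding Ksubspace_iff by blast
  then have "FM n U n U M = FM n U n U (1\<^sub>m n)" using M by (intro FM_cong) auto
  also have "\<dots> = FA (Ide (KVectf \<iota>) (Ksub n U))" using Karr_Ide[OF U, of \<iota>] by simp
  also have "\<dots> = Ide C (FS n U)" using Ksub_vectorspace[OF U] by (intro FA_Ide) (simp add: KVectf_def)
  finally show ?thesis .
qed

lemma FM_Add: "Kmaps n U m W M \<Longrightarrow> Kmaps n U m W N \<Longrightarrow> FM n U m W M \<boxplus> FM n U m W N = FM n U m W (M + N)"
  using FA_Add[OF Karr_Hom Karr_Hom] Karr_Add by metis

lemma FM_Scl: "Kmaps n U m W M \<Longrightarrow> Scl C c (FM n U m W M) = FM n U m W (\<iota> c \<cdot>\<^sub>m M)"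
  using FA_Scl[OF Karr_Hom] Karr_Scl by metis

text \<open>A map vanishing on \<open>U\<close> agrees there with a scaled copy of itself, which
  \<open>F\<close> turns into the multiple by the scalar 0.\<close>

lemma FM_zr:
  assumes M: "Kmaps n U m W M" and z: "\<And>v. v \<in> U \<Longrightarrow> M *\<^sub>v v = 0\<^sub>v m"
  shows "FM n U m W M = zr (FS n U) (FS m W)"
proof -
  have "(\<iota> 0 \<cdot>\<^sub>m M) *\<^sub>v v = M *\<^sub>v v" if "v \<in> U" for v
    using z[OF that] KmapsD(3)[OF M] KmapsD(5)[OF M that] by (auto simp: smult_mat_mult_vec[of M m n])
  then have "FM n U m W M = FM n U m W (\<iota> 0 \<cdot>\<^sub>m M)" by (intro FM_cong) simp
  also have "\<dots> = Scl C 0 (FM n U m W M)" by (rule FM_Scl[OF M, symmetric])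
  also have "\<dots> = zr (FS n U) (FS m W)" using FM[OF M] scl_arith(4) by simp
  finally show ?thesis .
qed

text \<open>In the coordinates given by \<open>Q\<close>, the matrix
  \<open>P * coord_mat n T * Q\<close> is the projection that keeps the coordinates in
  \<open>T\<close>.\<close>

lemma Kmaps_coord:
  assumes PQ: "inverse_mats n P Q" and U: "Ksubspace n U" and T: "T \<subseteq> S"
  shows "Kmaps n U n (coord_space n Q S) (P * coord_mat n T * Q)"
    and "v \<in> carrier_vec n \<Longrightarrow> (P * coord_mat n T * Q) *\<^sub>v v = P *\<^sub>v vec n (\<lambda>i. if i \<in> T then (Q *\<^sub>v v) $ i else 0)"
proof -
  note i = inverse_matsD[OF PQ]
  show e: "(P * coord_mat n T * Q) *\<^sub>v v = P *\<^sub>v vec n (\<lambda>i. if i \<in> T then (Q *\<^sub>v v) $ i else 0)" if v: "v \<in> carrier_vec n" for v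
    using assoc_mult_mat_vec[of "P * coord_mat n T" n n Q n v] assoc_mult_mat_vec[of P n n "coord_mat n T" n "Q *\<^sub>v v"] i v
    by (simp add: coord_mat_mult_vec)
  show "Kmaps n U n (coord_space n Q S) (P * coord_mat n T * Q)"
    unfolding Kmaps_def
  proof (intro conjI ballI)
    fix v assume "v \<in> U"
    then have v: "v \<in> carrier_vec n" using U unfolding Ksubspace_iff by blast
    show "(P * coord_mat n T * Q) *\<^sub>v v \<in> coord_space n Q S"
      unfolding e[OF v] coord_space_def using T i(1) i(4,5) by auto
  qed (use U Ksubspace_coord_space[OF i(2)] triple_mult_carrier[OF i(1) coord_mat(1) i(2)] in simp_all)
qed

text \<open>An additive functor preserves the decomposition of a coordinate space into lines. The
  offset \<open>s\<close> is free so that a subspace (\<open>s = 0\<close>) and its complement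
  (\<open>s\<close> equal to the dimension) are both covered.\<close>

lemma FS_biproduct:
  assumes PQ: "inverse_mats n P Q" and sk: "s + k \<le> n" and U: "U = coord_space n Q {s..<s + k}"
  shows "is_biproduct C k (\<lambda>_. X) (FS n U) (\<lambda>i. FM 1 (carrier_vec 1) n U (P * col_mat n (s + i)))
    (\<lambda>i. FM n U 1 (carrier_vec 1) (row_mat n (s + i) * Q))"
proof (rule biproductI)
  note i = inverse_matsD[OF PQ]
  have S: "Ksubspace n U" unfolding U by (rule Ksubspace_coord_space[OF i(2)])
  have Uc: "v \<in> carrier_vec n" if "v \<in> U" for v using that unfolding U coord_space_def by simp
  show "FS n U \<in> Obj C" "X \<in> Obj C" using S Ksubspace_UNIV by simp_all
  have pv: "(row_mat n l * Q) *\<^sub>v v = vec 1 (\<lambda>_. (Q *\<^sub>v v) $ l)" if "v \<in> carrier_vec n" "l < n" for v l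
    using that i assoc_mult_mat_vec[of "row_mat n l" 1 n Q n v] by (simp add: row_mat_mult_vec)
  have jv: "(P * col_mat n l) *\<^sub>v w = P *\<^sub>v vec n (\<lambda>i. if i = l then w $ 0 else 0)" if "w \<in> carrier_vec 1" for w l
    using that i assoc_mult_mat_vec[of P n n "col_mat n l" 1 w] by (simp add: col_mat_mult_vec)
  have jK: "Kmaps 1 (carrier_vec 1) n U (P * col_mat n (s + l))" if "l < k" for l
    unfolding Kmaps_def
  proof (intro conjI ballI)
    fix w :: "'K vec" assume w: "w \<in> carrier_vec 1"
    show "(P * col_mat n (s + l)) *\<^sub>v w \<in> U" unfolding jv[OF w] U coord_space_def using i(1) i(4,5) that by auto
  qed (use S mult_carrier_mat[OF i(1) col_mat] in simp_all)
  have pK: "Kmaps n U 1 (carrier_vec 1) (row_mat n (s + l) * Q)" for l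
    by (rule Kmaps_UNIV[OF S mult_carrier_mat[OF row_mat i(2)]])
  show "FM 1 (carrier_vec 1) n U (P * col_mat n (s + l)) \<in> Hom C X (FS n U)" if "l < k" for l using FM[OF jK[OF that]] by simp
  show "FM n U 1 (carrier_vec 1) (row_mat n (s + l) * Q) \<in> Hom C (FS n U) X" for l using FM[OF pK] by simp
  show "FM n U 1 (carrier_vec 1) (row_mat n (s + r) * Q) \<cdot> FM 1 (carrier_vec 1) n U (P * col_mat n (s + l)) =
     (if r = l then Ide C X else zr X X)" if r: "r < k" and l: "l < k" for r l
  proof -
    let ?M = "(row_mat n (s + r) * Q) * (P * col_mat n (s + l))"
    have M: "?M *\<^sub>v w = (if r = l then w else 0\<^sub>v 1)" if w: "w \<in> carrier_vec 1" for w
    proof -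
      have "?M *\<^sub>v w = (row_mat n (s + r) * Q) *\<^sub>v ((P * col_mat n (s + l)) *\<^sub>v w)"
        by (rule assoc_mult_mat_vec[OF mult_carrier_mat[OF row_mat i(2)] mult_carrier_mat[OF i(1) col_mat] w])
      also have "\<dots> = vec 1 (\<lambda>_. if s + r = s + l then w $ 0 else 0)"
        unfolding jv[OF w] using pv[of "P *\<^sub>v vec n (\<lambda>i. if i = s + l then w $ 0 else 0)" "s + r"] i sk r by simp
      also have "\<dots> = (if r = l then w else 0\<^sub>v 1)" using w by auto
      finally show ?thesis .
    qed
    show ?thesis unfolding FM_comp[OF jK[OF l] pK] using FM_Ide[OF Ksubspace_UNIV, of 1 ?M] FM_zr[OF Kmaps_comp[OF jK[OF l] pK]] M by auto
  qed
  let ?J = "\<lambda>m. P * coord_mat n {s..<s + m} * Q"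
  have JK: "Kmaps n U n U (?J m)" if "m \<le> k" for m unfolding U using S U that by (intro Kmaps_coord(1)[OF PQ]) auto
  note Jv = Kmaps_coord(2)[OF PQ S order.refl]
  \<comment> \<open>The partial sums are the images under \<open>F\<close> of the projections onto
    the first \<open>m\<close> lines; for \<open>m = k\<close> this projection is the identity on
    \<open>U\<close>.\<close>
  have "m \<le> k \<Longrightarrow> hsum (FS n U) (FS n U) (\<lambda>i. FM 1 (carrier_vec 1) n U (P * col_mat n (s + i)) \<cdot> FM n U 1 (carrier_vec 1) (row_mat n (s + i) * Q)) {..<m} =
      FM n U n U (?J m)" for m
  proof (induction m)
    case 0
    have "FM n U n U (?J 0) = zr (FS n U) (FS n U)"
    proof (rule FM_zr)
      fix v assume v: "v \<in> U"
      have "vec n (\<lambda>_. 0 :: 'K) = 0\<^sub>v n" by auto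
      then show "?J 0 *\<^sub>v v = 0\<^sub>v n" unfolding Jv[OF Uc[OF v]] using mult_mat_zero_vec[OF i(1)] by simp
    qed (rule JK, simp)
    then show ?case using S by simp
  next
    case (Suc m)
    have m: "m < k" "m \<le> k" using Suc.prems by simp_all
    let ?E = "(P * col_mat n (s + m)) * (row_mat n (s + m) * Q)"
    have EK: "Kmaps n U n U ?E" by (rule Kmaps_comp[OF pK jK[OF m(1)]])
    have "hsum (FS n U) (FS n U) (\<lambda>i. FM 1 (carrier_vec 1) n U (P * col_mat n (s + i)) \<cdot> FM n U 1 (carrier_vec 1) (row_mat n (s + i) * Q)) {..<Suc m} =
       FM 1 (carrier_vec 1) n U (P * col_mat n (s + m)) \<cdot> FM n U 1 (carrier_vec 1) (row_mat n (s + m) * Q) \<boxplus> FM n U n U (?J m)"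
      unfolding Suc.IH[OF m(2), symmetric] using Suc.prems FM[OF jK] FM[OF pK] by (intro hsum_lessThan_Suc) simp
    also have "\<dots> = FM n U n U (?E + ?J m)" unfolding FM_comp[OF pK jK[OF m(1)]] by (rule FM_Add[OF EK JK[OF m(2)]])
    also have "\<dots> = FM n U n U (?J (Suc m))"
    proof (rule FM_cong)
      fix v assume "v \<in> U"
      then have v: "v \<in> carrier_vec n" by (rule Uc)
      have "(?E + ?J m) *\<^sub>v v = ?E *\<^sub>v v + ?J m *\<^sub>v v"
        by (rule add_mult_distrib_mat_vec[OF KmapsD(3)[OF EK] KmapsD(3)[OF JK[OF m(2)]] v])
      also have "?E *\<^sub>v v = (P * col_mat n (s + m)) *\<^sub>v ((row_mat n (s + m) * Q) *\<^sub>v v)"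
        by (rule assoc_mult_mat_vec[OF mult_carrier_mat[OF i(1) col_mat] mult_carrier_mat[OF row_mat i(2)] v])
      also have "\<dots> = P *\<^sub>v vec n (\<lambda>i. if i = s + m then (Q *\<^sub>v v) $ (s + m) else 0)"
      proof -
        have "vec 1 (\<lambda>_. (Q *\<^sub>v v) $ (s + m)) $ 0 = (Q *\<^sub>v v) $ (s + m)" by simp
        then show ?thesis using pv[OF v, of "s + m"] m sk jv[of "vec 1 (\<lambda>_. (Q *\<^sub>v v) $ (s + m))" "s + m"] by (simp cong: if_cong)
      qed
      also have "\<dots> + ?J m *\<^sub>v v = P *\<^sub>v (vec n (\<lambda>i. if i = s + m then (Q *\<^sub>v v) $ (s + m) else 0) + vec n (\<lambda>i. if i \<in> {s..<s + m} then (Q *\<^sub>v v) $ i else 0))"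
        unfolding Jv[OF v] using i(1) by (intro mult_add_distrib_mat_vec[symmetric, of _ n n]) auto
      also have "\<dots> = P *\<^sub>v vec n (\<lambda>i. if i \<in> {s..<s + Suc m} then (Q *\<^sub>v v) $ i else 0)"
        by (rule arg_cong[of _ _ "\<lambda>x. P *\<^sub>v x"]) (auto intro!: eq_vecI)
      also have "\<dots> = ?J (Suc m) *\<^sub>v v" unfolding Jv[OF v] ..
      finally show "(?E + ?J m) *\<^sub>v v = ?J (Suc m) *\<^sub>v v" .
    qed
    finally show ?case .
  qed
  from this[of k] have "hsum (FS n U) (FS n U) (\<lambda>i. FM 1 (carrier_vec 1) n U (P * col_mat n (s + i)) \<cdot> FM n U 1 (carrier_vec 1) (row_mat n (s + i) * Q)) {..<k} =
      FM n U n U (?J k)" by simp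
  also have "\<dots> = Ide C (FS n U)"
  proof (rule FM_Ide[OF S])
    fix v assume v: "v \<in> U"
    have "vec n (\<lambda>i. if i \<in> {s..<s + k} then (Q *\<^sub>v v) $ i else 0) = Q *\<^sub>v v"
      using v i unfolding U coord_space_def by (intro eq_vecI) auto
    then show "?J k *\<^sub>v v = v" unfolding Jv[OF Uc[OF v]] using i Uc[OF v] by simp
  qed
  finally show "hsum (FS n U) (FS n U) (\<lambda>i. FM 1 (carrier_vec 1) n U (P * col_mat n (s + i)) \<cdot> FM n U 1 (carrier_vec 1) (row_mat n (s + i) * Q)) {..<k} = Ide C (FS n U)" .
qed

lemma inverse_mats_one: "inverse_mats n (1\<^sub>m n) (1\<^sub>m n)"
  by (simp add: inverse_mats_def)

lemma FS_Kn_biproduct: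
  "is_biproduct C n (\<lambda>_. X) (FS n (carrier_vec n)) (\<lambda>i. FM 1 (carrier_vec 1) n (carrier_vec n) (col_mat n i))
    (\<lambda>i. FM n (carrier_vec n) 1 (carrier_vec 1) (row_mat n i))"
proof -
  have U: "carrier_vec n = coord_space n (1\<^sub>m n :: 'K mat) {0..<0 + n}" by (rule coord_space_UNIV[symmetric]) auto
  have "1\<^sub>m n * col_mat n i = (col_mat n i :: 'K mat)" "row_mat n i * 1\<^sub>m n = (row_mat n i :: 'K mat)" for i
    using left_mult_one_mat[OF col_mat] right_mult_one_mat[OF row_mat] by metis+
  then show ?thesis using FS_biproduct[OF inverse_mats_one, where s = 0 and k = n and n = n and U = "carrier_vec n"] U by simp
qed

lemma X_Obj: "X \<in> Obj C"
  by simp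

abbreviation \<theta> where "\<theta> \<equiv> functor_pow_iso C FO FA"

lemma functor_pow_iso:
  shows "\<theta> n \<in> Arr C" "Dom C (\<theta> n) = FS n (carrier_vec n)" "Cod C (\<theta> n) = pow_obj C X n"
    and "i < n \<Longrightarrow> pow_proj C X n i \<cdot> \<theta> n = FM n (carrier_vec n) 1 (carrier_vec 1) (row_mat n i)"
proof -
  let ?h = "\<lambda>i. FM n (carrier_vec n) 1 (carrier_vec 1) (row_mat n i)"
  have K: "Kmaps n (carrier_vec n) 1 (carrier_vec 1) (row_mat n i)" for i by (rule Kmaps_UNIV) simp_all
  have h: "?h i \<in> Hom C (FS n (carrier_vec n)) X" for i using FM[OF K] by simp
  have e: "\<theta> n = hsum (FS n (carrier_vec n)) (pow_obj C X n) (\<lambda>i. pow_inj C X n i \<cdot> ?h i) {..<n}"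
    unfolding functor_pow_iso_def FO_Kn using h X_Obj by (intro hsum_cong) (auto simp: Kproj_Karr)
  have O: "FS n (carrier_vec n) \<in> Obj C" by simp
  have "\<theta> n \<in> Hom C (FS n (carrier_vec n)) (pow_obj C X n)"
    unfolding e by (rule biproduct_tuple(1)[OF pow_biproduct[OF X_Obj] O]) (rule h)
  then show "\<theta> n \<in> Arr C" "Dom C (\<theta> n) = FS n (carrier_vec n)" "Cod C (\<theta> n) = pow_obj C X n" by simp_all
  show "i < n \<Longrightarrow> pow_proj C X n i \<cdot> \<theta> n = ?h i"
    unfolding e by (rule biproduct_tuple(2)[OF pow_biproduct[OF X_Obj] O]) (rule h)
qed

text \<open>Both \<open>F(K^n)\<close> and the chosen power are \<open>n\<close>-fold biproducts of
  \<open>X\<close>, so the inverse is the tuple map with the two roles exchanged. Its columns are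
  recorded for the comparison of matrix actions.\<close>

lemma functor_pow_iso_inverse:
  obtains \<psi> where "inverse_arrs (\<theta> n) \<psi>" "\<And>i. i < n \<Longrightarrow> \<psi> \<cdot> pow_inj C X n i = FM 1 (carrier_vec 1) n (carrier_vec n) (col_mat n i)"
proof -
  note B = FS_Kn_biproduct[of n] and t = functor_pow_iso[where n = n] and P = pow_biproduct[OF X_Obj, of n]
  note b = biproductD[OF B] and q = biproductD[OF P]
  let ?\<psi> = "hsum (pow_obj C X n) (FS n (carrier_vec n)) (\<lambda>i. FM 1 (carrier_vec 1) n (carrier_vec n) (col_mat n i) \<cdot> pow_proj C X n i) {..<n}"
  have pH: "pow_proj C X n i \<in> Hom C (pow_obj C X n) X" if "i < n" for i using q that by simp
  have O: "pow_obj C X n \<in> Obj C" using X_Obj by simp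
  have "?\<psi> \<in> Hom C (pow_obj C X n) (FS n (carrier_vec n))" by (rule biproduct_tuple(1)[OF B O]) (rule pH)
  then have uA: "?\<psi> \<in> Arr C" "Dom C ?\<psi> = pow_obj C X n" "Cod C ?\<psi> = FS n (carrier_vec n)" by auto
  have u: "FM n (carrier_vec n) 1 (carrier_vec 1) (row_mat n i) \<cdot> ?\<psi> = pow_proj C X n i" if "i < n" for i
    by (rule biproduct_tuple(2)[OF B O]) (rule pH, simp, rule that)
  have 1: "?\<psi> \<cdot> \<theta> n = Ide C (FS n (carrier_vec n))"
  proof (rule biproduct_ext[OF B])
    fix i assume i: "i < n"
    have "FM n (carrier_vec n) 1 (carrier_vec 1) (row_mat n i) \<cdot> (?\<psi> \<cdot> \<theta> n) = pow_proj C X n i \<cdot> \<theta> n"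
      by (rule cmp_reduce[OF u[OF i]]) (use b(6-8)[OF i] uA t(1-3) in simp_all)
    then show "FM n (carrier_vec n) 1 (carrier_vec 1) (row_mat n i) \<cdot> (?\<psi> \<cdot> \<theta> n) =
      FM n (carrier_vec n) 1 (carrier_vec 1) (row_mat n i) \<cdot> Ide C (FS n (carrier_vec n))" using t(4)[OF i] b(6-8)[OF i] by simp
  qed (use uA t(1-3) in simp_all)
  have 2: "\<theta> n \<cdot> ?\<psi> = Ide C (pow_obj C X n)"
  proof (rule biproduct_ext[OF P])
    fix i assume i: "i < n"
    have "pow_proj C X n i \<cdot> (\<theta> n \<cdot> ?\<psi>) = FM n (carrier_vec n) 1 (carrier_vec 1) (row_mat n i) \<cdot> ?\<psi>"
      by (rule cmp_reduce[OF t(4)[OF i]]) (use q(6-8)[OF i] uA t(1-3) in simp_all)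
    then show "pow_proj C X n i \<cdot> (\<theta> n \<cdot> ?\<psi>) = pow_proj C X n i \<cdot> Ide C (pow_obj C X n)" using u[OF i] q(6-8)[OF i] by simp
  qed (use uA t(1-3) X_Obj in simp_all)
  have inv: "inverse_arrs (\<theta> n) ?\<psi>" unfolding inverse_arrs_def using 1 2 uA t(1-3) by simp
  have "?\<psi> \<cdot> pow_inj C X n l = FM 1 (carrier_vec 1) n (carrier_vec n) (col_mat n l)" if l: "l < n" for l
  proof (rule biproduct_ext[OF B])
    fix i assume i: "i < n"
    have "FM n (carrier_vec n) 1 (carrier_vec 1) (row_mat n i) \<cdot> (?\<psi> \<cdot> pow_inj C X n l) = pow_proj C X n i \<cdot> pow_inj C X n l"
      by (rule cmp_reduce[OF u[OF i]]) (use b(6-8)[OF i] uA q(3-5)[OF l] in simp_all)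
    then show "FM n (carrier_vec n) 1 (carrier_vec 1) (row_mat n i) \<cdot> (?\<psi> \<cdot> pow_inj C X n l) =
      FM n (carrier_vec n) 1 (carrier_vec 1) (row_mat n i) \<cdot> FM 1 (carrier_vec 1) n (carrier_vec n) (col_mat n l)"
      using b(9)[OF i] b(10)[OF i l] q(9)[OF i] q(10)[OF i l] by (cases "i = l") simp_all
  qed (use uA q(3-5)[OF l] b(3-5)[OF l] in simp_all)
  then show thesis using that[OF inv] by blast
qed

definition incl :: "nat \<Rightarrow> 'K vec set \<Rightarrow> 'm" where
  "incl n U = FM n U n (carrier_vec n) (1\<^sub>m n)"

definition fsub :: "nat \<Rightarrow> 'K vec set \<Rightarrow> 'm" where
  "fsub n U = \<theta> n \<cdot> incl n U"

lemma Kmaps_incl: "Ksubspace n U \<Longrightarrow> Kmaps n U n (carrier_vec n) (1\<^sub>m n)"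
  by (rule Kmaps_UNIV) simp_all

lemma incl:
  assumes "Ksubspace n U"
  shows "incl n U \<in> Arr C" "Dom C (incl n U) = FS n U" "Cod C (incl n U) = FS n (carrier_vec n)"
  using FM[OF Kmaps_incl[OF assms]] by (simp_all add: incl_def)

lemma fsub:
  assumes U: "Ksubspace n U"
  shows "fsub n U \<in> Arr C" "Dom C (fsub n U) = FS n U" "Cod C (fsub n U) = pow_obj C X n"
    and "i < n \<Longrightarrow> pow_proj C X n i \<cdot> fsub n U = FM n U 1 (carrier_vec 1) (row_mat n i)"
proof -
  note t = functor_pow_iso[where n = n] and c = incl[OF U]
  show "fsub n U \<in> Arr C" "Dom C (fsub n U) = FS n U" "Cod C (fsub n U) = pow_obj C X n"
    unfolding fsub_def using t(1-3) c by simp_all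
  assume i: "i < n"
  have "pow_proj C X n i \<cdot> fsub n U = FM n (carrier_vec n) 1 (carrier_vec 1) (row_mat n i) \<cdot> incl n U"
    unfolding fsub_def by (rule cmp_reduce[OF t(4)[OF i]]) (use t(1-3) c X_Obj i in simp_all)
  also have "\<dots> = FM n U 1 (carrier_vec 1) (row_mat n i)"
    unfolding incl_def by (rule FM_comp_eq[OF Kmaps_incl[OF U] Kmaps_UNIV]) (use KmapsD(5)[OF Kmaps_incl[OF U]] in simp_all)
  finally show "pow_proj C X n i \<cdot> fsub n U = FM n U 1 (carrier_vec 1) (row_mat n i)" .
qed

text \<open>Coordinate projections give a retraction onto \<open>F(V)\<close> and, with the
  complement, a decomposition of the identity of \<open>F(K^n)\<close>. The retraction makes
  inclusions mono; the decomposition controls the cokernel later.\<close>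

lemma incl_split:
  assumes PQ: "inverse_mats n P Q" and ST: "S \<union> T = {..<n}" "S \<inter> T = {}"
  obtains r r' where "r \<in> Hom C (FS n (carrier_vec n)) (FS n (coord_space n Q S))" "r' \<in> Hom C (FS n (carrier_vec n)) (FS n (coord_space n Q T))"
    "r \<cdot> incl n (coord_space n Q S) = Ide C (FS n (coord_space n Q S))"
    "incl n (coord_space n Q S) \<cdot> r \<boxplus> incl n (coord_space n Q T) \<cdot> r' = Ide C (FS n (carrier_vec n))"
proof -
  note i = inverse_matsD[OF PQ]
  let ?r = "\<lambda>S. P * coord_mat n S * Q"
  have U: "Ksubspace n (coord_space n Q S)" for S by (rule Ksubspace_coord_space[OF i(2)])
  have rK: "Kmaps n (carrier_vec n) n (coord_space n Q S) (?r S)" for S by (rule Kmaps_coord(1)[OF PQ]) simp_all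
  note rv = Kmaps_coord(2)[OF PQ Ksubspace_UNIV order.refl]
  have rK': "Kmaps n (carrier_vec n) n (carrier_vec n) (?r S)" for S by (rule Kmaps_UNIV) (simp_all add: KmapsD(3)[OF rK])
  have ir: "incl n (coord_space n Q S) \<cdot> FM n (carrier_vec n) n (coord_space n Q S) (?r S) = FM n (carrier_vec n) n (carrier_vec n) (?r S)" for S
    unfolding incl_def by (rule FM_comp_eq[OF rK Kmaps_incl[OF U]]) (use KmapsD(6)[OF rK'] KmapsD(4)[OF rK'] in simp)
  show thesis
  proof (rule that[of "FM n (carrier_vec n) n (coord_space n Q S) (?r S)" "FM n (carrier_vec n) n (coord_space n Q T) (?r T)"])
    have "FM n (carrier_vec n) n (coord_space n Q S) (?r S) \<cdot> incl n (coord_space n Q S) = FM n (coord_space n Q S) n (coord_space n Q S) (1\<^sub>m n)"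
      unfolding incl_def
    proof (rule FM_comp_eq[OF Kmaps_incl[OF U] rK])
      fix v assume v: "v \<in> coord_space n Q S"
      then have vc: "v \<in> carrier_vec n" by (simp add: coord_space_def)
      have "vec n (\<lambda>i. if i \<in> S then (Q *\<^sub>v v) $ i else 0) = Q *\<^sub>v v"
        using v i(2) unfolding coord_space_def by (intro eq_vecI) auto
      then show "?r S *\<^sub>v (1\<^sub>m n *\<^sub>v v) = 1\<^sub>m n *\<^sub>v v" using rv[OF vc] i(3)[OF vc] vc by simp
    qed
    also have "\<dots> = Ide C (FS n (coord_space n Q S))" by (rule FM_Ide[OF U]) (simp add: coord_space_def)
    finally show "FM n (carrier_vec n) n (coord_space n Q S) (?r S) \<cdot> incl n (coord_space n Q S) = Ide C (FS n (coord_space n Q S))" .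
    have "FM n (carrier_vec n) n (carrier_vec n) (?r S) \<boxplus> FM n (carrier_vec n) n (carrier_vec n) (?r T) = FM n (carrier_vec n) n (carrier_vec n) (?r S + ?r T)"
      by (rule FM_Add[OF rK' rK'])
    also have "\<dots> = Ide C (FS n (carrier_vec n))"
    proof (rule FM_Ide[OF Ksubspace_UNIV])
      fix v :: "'K vec" assume v: "v \<in> carrier_vec n"
      let ?c = "\<lambda>S. vec n (\<lambda>i. if i \<in> S then (Q *\<^sub>v v) $ i else 0)"
      have "(?r S + ?r T) *\<^sub>v v = ?r S *\<^sub>v v + ?r T *\<^sub>v v"
        by (rule add_mult_distrib_mat_vec[OF KmapsD(3)[OF rK] KmapsD(3)[OF rK] v])
      also have "\<dots> = P *\<^sub>v (?c S + ?c T)" unfolding rv[OF v] by (rule mult_add_distrib_mat_vec[OF i(1), symmetric]) auto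
      also have "?c S + ?c T = Q *\<^sub>v v"
        using ST i(2) by (intro eq_vecI) (auto simp: set_eq_iff)
      finally show "(?r S + ?r T) *\<^sub>v v = v" using i(3)[OF v] by simp
    qed
    finally show "incl n (coord_space n Q S) \<cdot> FM n (carrier_vec n) n (coord_space n Q S) (?r S) \<boxplus>
       incl n (coord_space n Q T) \<cdot> FM n (carrier_vec n) n (coord_space n Q T) (?r T) = Ide C (FS n (carrier_vec n))" unfolding ir .
  qed (use FM[OF rK] in simp_all)
qed

text \<open>Every subspace is a coordinate space for suitable coordinates, hence a retract, and
  functors preserve retracts.\<close>

lemma fsub_mono:
  assumes U: "Ksubspace n U"
  shows "mono (fsub n U)"
proof -
  obtain P Q where PQ: "inverse_mats n P Q" and k: "vectorspace.dim class_ring (Ksub n U) \<le> n"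
    and e: "U = coord_space n Q {0..<vectorspace.dim class_ring (Ksub n U)}"
    using Ksubspace_coord[OF U] .
  define k where "k = vectorspace.dim class_ring (Ksub n U)"
  have ST: "{0..<k} \<union> {k..<n} = {..<n}" "{0..<k} \<inter> {k..<n} = {}" using k unfolding k_def by auto
  obtain r where r: "r \<in> Hom C (FS n (carrier_vec n)) (FS n U)" "r \<cdot> incl n U = Ide C (FS n U)"
    using incl_split[OF PQ ST] e[folded k_def] by metis
  have "mono (incl n U)" by (rule split_mono[of _ r]) (use r incl[OF U] in auto)
  moreover obtain \<psi> where "inverse_arrs (\<theta> n) \<psi>" using functor_pow_iso_inverse .
  ultimately show ?thesis unfolding fsub_def
    using inverse_arrs_mono functor_pow_iso(1-3)[of n] incl[OF U] by (intro mono_comp) auto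
qed

lemma functor_dir_map: "Ksubspace n U \<Longrightarrow> functor_dir_map C FO FA n U = sub_class C (fsub n U)"
  unfolding functor_dir_map_def fsub_def incl_def using Kincl_Karr by metis

lemma fsub_factor:
  assumes U: "Ksubspace n U" and W: "Ksubspace n W" and UW: "U \<subseteq> W"
  shows "fsub n U = fsub n W \<cdot> FM n U n W (1\<^sub>m n)"
proof -
  note K = Kmaps_one[OF U W UW]
  show ?thesis
  proof (rule pow_ext[OF X_Obj])
    fix i assume i: "i < n"
    have "pow_proj C X n i \<cdot> (fsub n W \<cdot> FM n U n W (1\<^sub>m n)) = FM n W 1 (carrier_vec 1) (row_mat n i) \<cdot> FM n U n W (1\<^sub>m n)"
      by (rule cmp_reduce[OF fsub(4)[OF W i]]) (use fsub(1-3)[OF W] FM[OF K] i X_Obj in simp_all)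
    also have "\<dots> = FM n U 1 (carrier_vec 1) (row_mat n i)"
      by (rule FM_comp_eq[OF K Kmaps_UNIV[OF W row_mat]]) (use KmapsD(5)[OF K] in simp)
    finally show "pow_proj C X n i \<cdot> fsub n U = pow_proj C X n i \<cdot> (fsub n W \<cdot> FM n U n W (1\<^sub>m n))" unfolding fsub(4)[OF U i] ..
  qed (use fsub(1-3)[OF U] fsub(1-3)[OF W] FM[OF K] in simp_all)
qed

end

section \<open>The map induced by \<open>F\<close> as a morphism of directories\<close>

lemma mult_delta: "x * (if l = i then c else 0) = (if l = i then x * c else (0::'a::field))"
  by simp

lemma shift_mat_append:
  assumes v: "v \<in> carrier_vec n" and w: "w \<in> carrier_vec m"
  shows "shift_mat n (n + m) 0 0 *\<^sub>v (v @\<^sub>v w) = v" "shift_mat m (n + m) n 0 *\<^sub>v (v @\<^sub>v w) = w"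
    and "shift_mat (n + m) n 0 0 *\<^sub>v v = v @\<^sub>v 0\<^sub>v m" "shift_mat (n + m) m 0 n *\<^sub>v w = 0\<^sub>v n @\<^sub>v w"
proof -
  have vw: "v @\<^sub>v w \<in> carrier_vec (n + m)" using v w by simp
  show "shift_mat n (n + m) 0 0 *\<^sub>v (v @\<^sub>v w) = v" "shift_mat m (n + m) n 0 *\<^sub>v (v @\<^sub>v w) = w"
    unfolding shift_mat_mult_vec[OF vw] using v w by (auto intro!: eq_vecI)
  show "shift_mat (n + m) n 0 0 *\<^sub>v v = v @\<^sub>v 0\<^sub>v m" "shift_mat (n + m) m 0 n *\<^sub>v w = 0\<^sub>v n @\<^sub>v w"
    unfolding shift_mat_mult_vec[OF v] shift_mat_mult_vec[OF w] using v w by (auto intro!: eq_vecI)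
qed

lemma Ksubspace_append:
  assumes "Ksubspace n V" "Ksubspace m W"
  shows "Ksubspace (n + m) {v @\<^sub>v w | v w. v \<in> V \<and> w \<in> W}"
proof -
  have z: "0\<^sub>v (n + m) = 0\<^sub>v n @\<^sub>v (0\<^sub>v m :: 'a vec)" by (auto intro!: eq_vecI)
  have a: "(v @\<^sub>v w) + (v' @\<^sub>v w') = (v + v') @\<^sub>v (w + w')"
    if "v \<in> carrier_vec n" "v' \<in> carrier_vec n" "w \<in> carrier_vec m" "w' \<in> carrier_vec m" for v v' w w' :: "'a vec"
    using that by (intro eq_vecI) auto
  have s: "c \<cdot>\<^sub>v (v @\<^sub>v w) = (c \<cdot>\<^sub>v v) @\<^sub>v (c \<cdot>\<^sub>v w)" for c and v w :: "'a vec" by (auto intro!: eq_vecI)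
  note V = assms(1)[unfolded Ksubspace_iff] and W = assms(2)[unfolded Ksubspace_iff]
  show ?thesis unfolding Ksubspace_iff
  proof (intro conjI ballI allI)
    show "{v @\<^sub>v w | v w. v \<in> V \<and> w \<in> W} \<subseteq> carrier_vec (n + m)" using V W by auto
    show "0\<^sub>v (n + m) \<in> {v @\<^sub>v w | v w. v \<in> V \<and> w \<in> W}" unfolding z using V W by blast
    fix x assume "x \<in> {v @\<^sub>v w | v w. v \<in> V \<and> w \<in> W}"
    then obtain v w where x: "x = v @\<^sub>v w" "v \<in> V" "w \<in> W" by blast
    show "c \<cdot>\<^sub>v x \<in> {v @\<^sub>v w | v w. v \<in> V \<and> w \<in> W}" for c unfolding x(1) s using V W x by blast
    fix y assume "y \<in> {v @\<^sub>v w | v w. v \<in> V \<and> w \<in> W}"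
    then obtain v' w' where y: "y = v' @\<^sub>v w'" "v' \<in> V" "w' \<in> W" by blast
    have "x + y = (v + v') @\<^sub>v (w + w')" unfolding x(1) y(1) by (rule a) (use x y V W in auto)
    then show "x + y \<in> {v @\<^sub>v w | v w. v \<in> V \<and> w \<in> W}" using V W x y by blast
  qed
qed

lemma Ksubspace_image:
  assumes "Ksubspace n V" and N: "N \<in> carrier_mat m n"
  shows "Ksubspace m ((\<lambda>v. N *\<^sub>v v) ` V)"
proof -
  note V = assms(1)[unfolded Ksubspace_iff]
  have Vc: "v \<in> V \<Longrightarrow> v \<in> carrier_vec n" for v using V by blast
  show ?thesis unfolding Ksubspace_iff
  proof (intro conjI ballI allI)
    show "(\<lambda>v. N *\<^sub>v v) ` V \<subseteq> carrier_vec m" using Vc N by auto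
    show "0\<^sub>v m \<in> (\<lambda>v. N *\<^sub>v v) ` V" by (rule image_eqI[of _ _ "0\<^sub>v n"]) (use V mult_mat_zero_vec[OF N] in auto)
    fix x assume "x \<in> (\<lambda>v. N *\<^sub>v v) ` V"
    then obtain v where v: "x = N *\<^sub>v v" "v \<in> V" by blast
    show "c \<cdot>\<^sub>v x \<in> (\<lambda>v. N *\<^sub>v v) ` V" for c
      by (rule image_eqI[of _ _ "c \<cdot>\<^sub>v v"]) (use v V mult_mat_vec[OF N Vc[OF v(2)]] in auto)
    fix y assume "y \<in> (\<lambda>v. N *\<^sub>v v) ` V"
    then obtain v' where v': "y = N *\<^sub>v v'" "v' \<in> V" by blast
    show "x + y \<in> (\<lambda>v. N *\<^sub>v v) ` V"
      by (rule image_eqI[of _ _ "v + v'"]) (use v v' V mult_add_distrib_mat_vec[OF N Vc[OF v(2)] Vc[OF v'(2)]] in auto)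
  qed
qed

context functor_from_vect
begin

lemma FM_comp_zr:
  assumes M: "Kmaps n U m W M" and N: "Kmaps m W k Z N" and e: "\<And>v. v \<in> U \<Longrightarrow> N *\<^sub>v (M *\<^sub>v v) = 0\<^sub>v k"
  shows "FM m W k Z N \<cdot> FM n U m W M = zr (FS n U) (FS k Z)"
  unfolding FM_comp[OF M N]
  by (rule FM_zr[OF Kmaps_comp[OF M N]]) (use e assoc_mult_mat_vec[OF KmapsD(3)[OF N] KmapsD(3)[OF M]] KmapsD(5)[OF M] in simp)

lemma FM_comp_Ide:
  assumes M: "Kmaps n U m W M" and N: "Kmaps m W n U N" and e: "\<And>v. v \<in> U \<Longrightarrow> N *\<^sub>v (M *\<^sub>v v) = v"
  shows "FM m W n U N \<cdot> FM n U m W M = Ide C (FS n U)"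
  unfolding FM_comp[OF M N]
  by (rule FM_Ide[OF KmapsD(1)[OF M]]) (use e assoc_mult_mat_vec[OF KmapsD(3)[OF N] KmapsD(3)[OF M]] KmapsD(5)[OF M] in simp)

lemma sub_class_iso:
  assumes b: "mono b" and u: "inverse_arrs u v" and ub: "Cod C u = Dom C b"
  shows "sub_class C (b \<cdot> u) = sub_class C b"
proof -
  note i = inverse_arrsD[OF u]
  have bA: "b \<in> Arr C" using b by simp
  show ?thesis
  proof (rule sub_class_eqI)
    show "mono (b \<cdot> u)" using b inverse_arrs_mono[OF u] ub by (intro mono_comp) auto
    show "ft (b \<cdot> u) b" by (rule factors_throughI[of u]) (use i(1-4) bA ub in simp_all)
    have "(b \<cdot> u) \<cdot> v = b \<cdot> (u \<cdot> v)" by (rule cmp_assoc) (use i(1-4) bA ub in simp_all)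
    then have "(b \<cdot> u) \<cdot> v = b" using i(6) bA ub by simp
    then show "ft b (b \<cdot> u)" by (intro factors_throughI[of v]) (use i(1-4) bA ub in simp_all)
  qed (use b i(1-4) bA ub in simp_all)
qed

text \<open>The canonical isomorphism intertwines the matrix action on the power with
  \<open>F\<close> of the matrix. After conjugation with the inverse, both sides are endomorphisms
  of the power and can be compared entry by entry.\<close>

lemma pow_mat_functor_pow_iso:
  "pow_mat C X n g \<cdot> \<theta> n = \<theta> n \<cdot> FM n (carrier_vec n) n (carrier_vec n) (mat n n (\<lambda>(i, l). \<iota> (g $$ (i, l))))"
proof -
  let ?N = "mat n n (\<lambda>(i, l). \<iota> (g $$ (i, l)))" and ?U = "carrier_vec n :: 'K vec set"
  let ?F = "FM n ?U n ?U ?N"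
  obtain \<psi> where \<psi>: "inverse_arrs (\<theta> n) \<psi>" and \<psi>j: "\<And>i. i < n \<Longrightarrow> \<psi> \<cdot> pow_inj C X n i = FM 1 (carrier_vec 1) n ?U (col_mat n i)"
    using functor_pow_iso_inverse[of n] by metis
  note t = functor_pow_iso[where n = n] and i = inverse_arrsD[OF \<psi>]
  have N: "?N \<in> carrier_mat n n" by simp
  have NK: "Kmaps n ?U n ?U ?N" by (rule Kmaps_UNIV) simp_all
  note F = FM[OF NK]
  have rK: "Kmaps n ?U 1 (carrier_vec 1) (row_mat n l)" for l by (rule Kmaps_UNIV) simp_all
  have cK: "Kmaps 1 (carrier_vec 1) n ?U (col_mat n l)" for l by (rule Kmaps_UNIV) simp_all
  have Nc: "Kmaps 1 (carrier_vec 1) n ?U (?N * col_mat n l)" for l by (rule Kmaps_comp[OF cK NK])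
  have "\<theta> n \<cdot> (?F \<cdot> \<psi>) = pow_mat C X n g"
  proof (rule pow_entry_ext[OF X_Obj, where n = n])
    fix r l assume rl: "r < n" "l < n"
    have "(\<theta> n \<cdot> (?F \<cdot> \<psi>)) \<cdot> pow_inj C X n l = \<theta> n \<cdot> (?F \<cdot> (\<psi> \<cdot> pow_inj C X n l))"
      using t(1-3) i(1-4) F rl X_Obj by (simp add: cmp_assoc)
    also have "\<dots> = \<theta> n \<cdot> FM 1 (carrier_vec 1) n ?U (?N * col_mat n l)" unfolding \<psi>j[OF rl(2)] FM_comp[OF cK NK] ..
    finally have "pow_proj C X n r \<cdot> ((\<theta> n \<cdot> (?F \<cdot> \<psi>)) \<cdot> pow_inj C X n l) =
        pow_proj C X n r \<cdot> (\<theta> n \<cdot> FM 1 (carrier_vec 1) n ?U (?N * col_mat n l))" by simp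
    also have "\<dots> = FM n ?U 1 (carrier_vec 1) (row_mat n r) \<cdot> FM 1 (carrier_vec 1) n ?U (?N * col_mat n l)"
      by (rule cmp_reduce[OF t(4)[OF rl(1)]]) (use t(1-3) FM[OF Nc] rl X_Obj in simp_all)
    also have "\<dots> = FM 1 (carrier_vec 1) 1 (carrier_vec 1) (\<iota> (g $$ (r, l)) \<cdot>\<^sub>m 1\<^sub>m 1)"
    proof (rule FM_comp_eq[OF Nc rK])
      fix w :: "'K vec" assume w: "w \<in> carrier_vec 1"
      have "(?N * col_mat n l) *\<^sub>v w = ?N *\<^sub>v vec n (\<lambda>i. if i = l then w $ 0 else 0)"
        using assoc_mult_mat_vec[OF N col_mat w] col_mat_mult_vec[OF w] by simp
      also have "\<dots> = vec n (\<lambda>i. \<iota> (g $$ (i, l)) * w $ 0)"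
        using rl by (intro eq_vecI) (simp_all add: index_mult_mat_vec scalar_prod_def mult_delta)
      finally show "row_mat n r *\<^sub>v ((?N * col_mat n l) *\<^sub>v w) = (\<iota> (g $$ (r, l)) \<cdot>\<^sub>m 1\<^sub>m 1) *\<^sub>v w"
        using rl w by (auto simp: row_mat_mult_vec smult_mat_mult_vec[of "1\<^sub>m 1" 1 1] intro!: eq_vecI)
    qed
    \<comment> \<open>Linearity of \<open>F\<close> over the base field turns multiplication by
      \<open>\<iota> (g $$ (r, l))\<close> on the line into the scalar acting on
      \<open>X\<close>.\<close>
    also have "\<dots> = Scl C (g $$ (r, l)) (Ide C X)"
      using FM_Scl[OF Kmaps_one[OF Ksubspace_UNIV Ksubspace_UNIV order.refl, of 1], of "g $$ (r, l)"] FM_Ide[OF Ksubspace_UNIV, of 1 "1\<^sub>m 1"] by simp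
    finally show "pow_proj C X n r \<cdot> ((\<theta> n \<cdot> (?F \<cdot> \<psi>)) \<cdot> pow_inj C X n l) = pow_proj C X n r \<cdot> (pow_mat C X n g \<cdot> pow_inj C X n l)"
      unfolding pow_mat(4)[OF X_Obj rl] .
  qed (use t(1-3) i(1-4) F pow_mat(1-3)[OF X_Obj] in simp_all)
  then have "pow_mat C X n g \<cdot> \<theta> n = (\<theta> n \<cdot> (?F \<cdot> \<psi>)) \<cdot> \<theta> n" by simp
  also have "\<dots> = \<theta> n \<cdot> (?F \<cdot> (\<psi> \<cdot> \<theta> n))" using t(1-3) i(1-4) F by (simp add: cmp_assoc)
  also have "\<dots> = \<theta> n \<cdot> ?F" using i(5) t(2) F by simp
  finally show ?thesis .
qed

lemma functor_dir_map_Act: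
  assumes hom: "field_hom \<iota>" and g: "g \<in> GL n" and V: "Ksubspace n V"
  shows "functor_dir_map C FO FA n ((\<lambda>v. map_mat \<iota> g *\<^sub>v v) ` V) = Act (Dir C X) n g (functor_dir_map C FO FA n V)"
proof -
  interpret h: field_hom \<iota> by (rule hom)
  obtain g' where g': "g' \<in> carrier_mat n n" "g * g' = 1\<^sub>m n" "g' * g = 1\<^sub>m n" using GL_inverse[OF g] by metis
  have gc: "g \<in> carrier_mat n n" using g by (simp add: GL_def)
  let ?N = "map_mat \<iota> g" and ?N' = "map_mat \<iota> g'" and ?W = "(\<lambda>v. map_mat \<iota> g *\<^sub>v v) ` V"
  \<comment> \<open>A field homomorphism carries the inverse of \<open>g\<close> to an inverse of
    the image matrix, so \<open>V\<close> and its image are isomorphic and the induced arrow on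
    \<open>F(V)\<close> is invertible.\<close>
  have i: "inverse_mats n ?N ?N'"
    unfolding inverse_mats_def using gc g' h.mat_hom_mult[OF gc g'(1)] h.mat_hom_mult[OF g'(1) gc] h.mat_hom_one by auto
  note iD = inverse_matsD[OF i]
  have Vc: "v \<in> carrier_vec n" if "v \<in> V" for v using V that unfolding Ksubspace_iff by blast
  have W: "Ksubspace n ?W" by (rule Ksubspace_image[OF V iD(1)])
  have a: "Kmaps n V n ?W ?N" unfolding Kmaps_def using V W iD(1) by simp
  have b: "Kmaps n ?W n V ?N'" unfolding Kmaps_def using V W iD(2) iD(4)[OF Vc] by auto
  have ba: "FM n V n ?W ?N \<cdot> FM n ?W n V ?N' = Ide C (FS n ?W)"
    by (rule FM_comp_Ide[OF b a]) (use iD(4)[OF Vc] in auto)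
  have inv: "inverse_arrs (FM n V n ?W ?N) (FM n ?W n V ?N')"
    unfolding inverse_arrs_def using FM[OF a] FM[OF b] FM_comp_Ide[OF a b iD(4)[OF Vc]] ba by simp
  have NK: "Kmaps n (carrier_vec n) n (carrier_vec n) ?N" by (rule Kmaps_UNIV[OF Ksubspace_UNIV iD(1)])
  have e: "mat n n (\<lambda>(i, l). \<iota> (g $$ (i, l))) = ?N" using gc by (intro eq_matI) auto
  note t = functor_pow_iso(1-3)[where n = n] and m = pow_mat(1-3)[OF X_Obj, of n g]
  have "FM n (carrier_vec n) n (carrier_vec n) ?N \<cdot> incl n V = FM n V n (carrier_vec n) ?N"
    unfolding incl_def by (rule FM_comp_eq[OF Kmaps_incl[OF V] NK]) (use Vc in simp)
  moreover have "incl n ?W \<cdot> FM n V n ?W ?N = FM n V n (carrier_vec n) ?N"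
    unfolding incl_def by (rule FM_comp_eq[OF a Kmaps_incl[OF W]]) (use Vc iD in simp)
  ultimately have c: "FM n (carrier_vec n) n (carrier_vec n) ?N \<cdot> incl n V = incl n ?W \<cdot> FM n V n ?W ?N" by simp
  have "pow_mat C X n g \<cdot> fsub n V = (\<theta> n \<cdot> FM n (carrier_vec n) n (carrier_vec n) ?N) \<cdot> incl n V"
    unfolding fsub_def by (rule cmp_reduce[OF pow_mat_functor_pow_iso[of n g, unfolded e]]) (use t m incl[OF V] in simp_all)
  also have "\<dots> = \<theta> n \<cdot> (FM n (carrier_vec n) n (carrier_vec n) ?N \<cdot> incl n V)"
    by (rule cmp_assoc) (use t FM[OF NK] incl[OF V] in simp_all)
  also have "\<dots> = fsub n ?W \<cdot> FM n V n ?W ?N"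
    unfolding c fsub_def by (rule cmp_assoc[symmetric]) (use t FM[OF a] incl[OF W] in simp_all)
  finally have eq: "pow_mat C X n g \<cdot> fsub n V = fsub n ?W \<cdot> FM n V n ?W ?N" .
  have S: "sub_class C (fsub n V) \<in> carrier (Sub C (pow_obj C X n))"
    using sub_class_Sub[OF fsub_mono[OF V]] fsub(3)[OF V] by simp
  have A: "Act (Dir C X) n g (sub_class C (fsub n V)) \<in> carrier (Sub C (pow_obj C X n))"
    unfolding Dir_Act[OF X_Obj g S] using dimg_Sub[of "pow_mat C X n g"] m S by simp
  moreover have "pow_mat C X n g \<cdot> fsub n V \<in> Act (Dir C X) n g (sub_class C (fsub n V))"
    using sub_class_self[OF fsub_mono[OF V]] by simp
  ultimately have "Act (Dir C X) n g (sub_class C (fsub n V)) = sub_class C (pow_mat C X n g \<cdot> fsub n V)" by (rule Sub_mem(4))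
  also have "\<dots> = sub_class C (fsub n ?W)"
    unfolding eq by (rule sub_class_iso[OF fsub_mono[OF W] inv]) (use FM[OF a] fsub(2)[OF W] in simp)
  finally show ?thesis unfolding functor_dir_map[OF V] functor_dir_map[OF W] by simp
qed

text \<open>The concatenated subspace is a biproduct of \<open>V\<close> and \<open>W\<close> via
  block matrices, and \<open>F\<close> preserves this. Comparing coordinates shows that its
  embedding into the power has exactly the shape demanded by \<open>sub_dsum\<close>.\<close>

lemma functor_dir_map_Dsum:
  assumes V: "Ksubspace n V" and W: "Ksubspace m W"
  shows "functor_dir_map C FO FA (n + m) {v @\<^sub>v w | v w. v \<in> V \<and> w \<in> W} =
    sub_dsum C X n m (functor_dir_map C FO FA n V) (functor_dir_map C FO FA m W)"
proof -
  let ?N = "n + m" and ?S = "{v @\<^sub>v w | v w. v \<in> V \<and> w \<in> W}"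
  have Vc: "v \<in> carrier_vec n" if "v \<in> V" for v using V that unfolding Ksubspace_iff by blast
  have Wc: "w \<in> carrier_vec m" if "w \<in> W" for w using W that unfolding Ksubspace_iff by blast
  have z: "0\<^sub>v n \<in> V" "0\<^sub>v m \<in> W" using V W unfolding Ksubspace_iff by blast+
  have S: "Ksubspace ?N ?S" by (rule Ksubspace_append[OF V W])
  note sh = shift_mat_append[OF Vc Wc]
  have P0: "Kmaps ?N ?S n V (shift_mat n ?N 0 0)" unfolding Kmaps_def using S V sh(1) by auto
  have P1: "Kmaps ?N ?S m W (shift_mat m ?N n 0)" unfolding Kmaps_def using S W sh(2) by auto
  have J0: "Kmaps n V ?N ?S (shift_mat ?N n 0 0)" unfolding Kmaps_def using S V sh(3)[OF _ z(2)] z by auto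
  have J1: "Kmaps m W ?N ?S (shift_mat ?N m 0 n)" unfolding Kmaps_def using S W sh(4)[OF z(1)] z by auto
  define j where "j = (\<lambda>i::nat. if i = 0 then FM n V ?N ?S (shift_mat ?N n 0 0) else FM m W ?N ?S (shift_mat ?N m 0 n))"
  define p where "p = (\<lambda>i::nat. if i = 0 then FM ?N ?S n V (shift_mat n ?N 0 0) else FM ?N ?S m W (shift_mat m ?N n 0))"
  have Q: "is_biproduct C 2 (\<lambda>i. if i = 0 then FS n V else FS m W) (FS ?N ?S) j p"
  proof (rule biproductI)
    show "FS ?N ?S \<in> Obj C" "(if i = 0 then FS n V else FS m W) \<in> Obj C" for i :: nat using S V W by simp_all
    show "j i \<in> Hom C (if i = 0 then FS n V else FS m W) (FS ?N ?S)" for i using FM[OF J0] FM[OF J1] by (simp add: j_def)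
    show "p i \<in> Hom C (FS ?N ?S) (if i = 0 then FS n V else FS m W)" for i using FM[OF P0] FM[OF P1] by (simp add: p_def)
    have "FM ?N ?S n V (shift_mat n ?N 0 0) \<cdot> FM n V ?N ?S (shift_mat ?N n 0 0) = Ide C (FS n V)"
      by (rule FM_comp_Ide[OF J0 P0]) (use sh(1)[OF _ z(2)] sh(3)[OF _ z(2)] in simp)
    moreover have "FM ?N ?S m W (shift_mat m ?N n 0) \<cdot> FM m W ?N ?S (shift_mat ?N m 0 n) = Ide C (FS m W)"
      by (rule FM_comp_Ide[OF J1 P1]) (use sh(2)[OF z(1)] sh(4)[OF z(1)] in simp)
    moreover have "FM ?N ?S n V (shift_mat n ?N 0 0) \<cdot> FM m W ?N ?S (shift_mat ?N m 0 n) = zr (FS m W) (FS n V)"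
      by (rule FM_comp_zr[OF J1 P0]) (use sh(1)[OF z(1)] sh(4)[OF z(1)] in simp)
    moreover have "FM ?N ?S m W (shift_mat m ?N n 0) \<cdot> FM n V ?N ?S (shift_mat ?N n 0 0) = zr (FS n V) (FS m W)"
      by (rule FM_comp_zr[OF J0 P1]) (use sh(2)[OF _ z(2)] sh(3)[OF _ z(2)] in simp)
    ultimately show "p i \<cdot> j l = (if i = l then Ide C (if i = 0 then FS n V else FS m W)
        else zr (if l = 0 then FS n V else FS m W) (if i = 0 then FS n V else FS m W))" if "i < 2" "l < 2" for i l
      using that unfolding p_def j_def by (auto simp: less_2_cases_iff)
    note K1 = Kmaps_comp[OF P1 J1] and K0 = Kmaps_comp[OF P0 J0]
    have "hsum (FS ?N ?S) (FS ?N ?S) (\<lambda>i. j i \<cdot> p i) {..<2} = j 1 \<cdot> p 1 \<boxplus> j 0 \<cdot> p 0"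
      by (rule hsum_2) (use FM[OF J0] FM[OF J1] FM[OF P0] FM[OF P1] in \<open>simp_all add: j_def p_def\<close>)
    also have "\<dots> = FM ?N ?S ?N ?S (shift_mat ?N m 0 n * shift_mat m ?N n 0 + shift_mat ?N n 0 0 * shift_mat n ?N 0 0)"
      unfolding FM_Add[OF K1 K0, symmetric] FM_comp[OF P1 J1, symmetric] FM_comp[OF P0 J0, symmetric] by (simp add: j_def p_def)
    also have "\<dots> = Ide C (FS ?N ?S)"
    proof (rule FM_Ide[OF S])
      fix x assume xS: "x \<in> ?S"
      then obtain v w where x: "x = v @\<^sub>v w" "v \<in> V" "w \<in> W" by blast
      have xc: "x \<in> carrier_vec ?N" using x Vc Wc by simp
      have "(shift_mat ?N m 0 n * shift_mat m ?N n 0 + shift_mat ?N n 0 0 * shift_mat n ?N 0 0) *\<^sub>v x =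
        (shift_mat ?N m 0 n * shift_mat m ?N n 0) *\<^sub>v x + (shift_mat ?N n 0 0 * shift_mat n ?N 0 0) *\<^sub>v x"
        by (rule add_mult_distrib_mat_vec[OF KmapsD(3)[OF K1] KmapsD(3)[OF K0] xc])
      also have "\<dots> = (0\<^sub>v n @\<^sub>v w) + (v @\<^sub>v 0\<^sub>v m)"
        unfolding assoc_mult_mat_vec[OF shift_mat shift_mat xc] using sh[OF x(2,3)] x(1) by simp
      also have "\<dots> = x" unfolding x(1) using Vc[OF x(2)] Wc[OF x(3)] by (auto intro!: eq_vecI)
      finally show "(shift_mat ?N m 0 n * shift_mat m ?N n 0 + shift_mat ?N n 0 0 * shift_mat n ?N 0 0) *\<^sub>v x = x" .
    qed
    finally show "hsum (FS ?N ?S) (FS ?N ?S) (\<lambda>i. j i \<cdot> p i) {..<2} = Ide C (FS ?N ?S)" .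
  qed
  note v = fsub[OF V] and w = fsub[OF W] and s = fsub[OF S]
  note q = biproduct2D[OF Q]
  have p0: "p 0 \<in> Arr C" "Dom C (p 0) = FS ?N ?S" "Cod C (p 0) = FS n V" and p1: "p 1 \<in> Arr C" "Dom C (p 1) = FS ?N ?S" "Cod C (p 1) = FS m W"
    using FM[OF P0] FM[OF P1] by (simp_all add: p_def)
  have vp: "fsub n V \<cdot> p 0 \<in> Arr C" "Cod C (fsub n V \<cdot> p 0) = pow_obj C X n" and wp: "fsub m W \<cdot> p 1 \<in> Arr C" "Cod C (fsub m W \<cdot> p 1) = pow_obj C X m"
    and d: "Dom C (fsub n V \<cdot> p 0) = Dom C (fsub m W \<cdot> p 1)" and d': "Dom C (fsub m W \<cdot> p 1) = FS ?N ?S"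
    using v(1-3) w(1-3) p0 p1 by simp_all
  note da = dsum_arr[OF X_Obj vp wp d]
  have fs: "fsub ?N ?S = dsum_arr X n m (fsub n V \<cdot> p 0) (fsub m W \<cdot> p 1)"
  proof (rule pow_ext[OF X_Obj, where n = ?N])
    fix i assume i: "i < ?N"
    have ap: "(v @\<^sub>v w) $ i = (if i < n then v $ i else w $ (i - n))" if "v \<in> V" "w \<in> W" for v w
      using i index_append_vec(1)[of i v w] carrier_vecD[OF Vc[OF that(1)]] carrier_vecD[OF Wc[OF that(2)]] by simp
    have "pow_proj C X ?N i \<cdot> dsum_arr X n m (fsub n V \<cdot> p 0) (fsub m W \<cdot> p 1) = FM ?N ?S 1 (carrier_vec 1) (row_mat ?N i)"
    proof (cases "i < n")
      case True
      have "pow_proj C X n i \<cdot> (fsub n V \<cdot> p 0) = FM n V 1 (carrier_vec 1) (row_mat n i) \<cdot> p 0"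
        by (rule cmp_reduce[OF v(4)[OF True]]) (use v(1-3) p0 True X_Obj in simp_all)
      also have "\<dots> = FM ?N ?S 1 (carrier_vec 1) (row_mat ?N i)"
        unfolding p_def if_P[OF refl]
        by (rule FM_comp_eq[OF P0 Kmaps_UNIV[OF V row_mat]]) (use True i sh(1) Vc Wc ap in \<open>auto simp: row_mat_mult_vec\<close>)
      finally show ?thesis using da(4)[OF i] True by simp
    next
      case False
      then have i': "i - n < m" using i by simp
      have "pow_proj C X m (i - n) \<cdot> (fsub m W \<cdot> p 1) = FM m W 1 (carrier_vec 1) (row_mat m (i - n)) \<cdot> p 1"
        by (rule cmp_reduce[OF w(4)[OF i']]) (use w(1-3) p1 i' X_Obj in simp_all)
      also have "\<dots> = FM ?N ?S 1 (carrier_vec 1) (row_mat ?N i)"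
        unfolding p_def if_not_P[OF one_neq_zero]
        by (rule FM_comp_eq[OF P1 Kmaps_UNIV[OF W row_mat]]) (use False i i' sh(2) Vc Wc ap in \<open>auto simp: row_mat_mult_vec\<close>)
      finally show ?thesis using da(4)[OF i] False by simp
    qed
    then show "pow_proj C X ?N i \<cdot> fsub ?N ?S = pow_proj C X ?N i \<cdot> dsum_arr X n m (fsub n V \<cdot> p 0) (fsub m W \<cdot> p 1)"
      unfolding s(4)[OF i] by simp
  qed (use s(1-3) da(1-3) d' in simp_all)
  have Q': "is_biproduct C 2 (\<lambda>i. if i = 0 then Dom C (fsub n V) else Dom C (fsub m W)) (FS ?N ?S) j p"
    unfolding v(2) w(2) by (rule Q)
  show ?thesis unfolding functor_dir_map[OF V] functor_dir_map[OF W] functor_dir_map[OF S]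
    by (rule sub_dsum_class[OF X_Obj fsub_mono[OF V] v(3) fsub_mono[OF W] w(3) Q' fs, symmetric])
qed

lemma functor_dir_map_morphism:
  assumes "field_hom \<iota>"
  shows "dir_morphism (DirK \<iota>) (Dir C X) (functor_dir_map C FO FA)"
  unfolding dir_morphism_def
proof (intro conjI allI impI ballI)
  fix n :: nat
  have c: "functor_dir_map C FO FA n V \<in> carrier (Sub C (pow_obj C X n))" if V: "Ksubspace n V" for V
    unfolding functor_dir_map[OF V] using sub_class_Sub[OF fsub_mono[OF V]] fsub(3)[OF V] by simp
  then show "functor_dir_map C FO FA n \<in> carrier (Srt (DirK \<iota>) n) \<rightarrow> carrier (Srt (Dir C X) n)" by (auto simp: DirK_def)
  show "isotone (Srt (DirK \<iota>) n) (Srt (Dir C X) n) (functor_dir_map C FO FA n)"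
  proof (rule isotoneI)
    show "weak_partial_order (Srt (DirK \<iota>) n)" by unfold_locales (auto simp: DirK_def)
    show "weak_partial_order (Srt (Dir C X) n)" using weak_partial_order_Sub by simp
    fix V W assume "V \<in> carrier (Srt (DirK \<iota>) n)" "W \<in> carrier (Srt (DirK \<iota>) n)" "V \<sqsubseteq>\<^bsub>Srt (DirK \<iota>) n\<^esub> W"
    then have VW: "Ksubspace n V" "Ksubspace n W" "V \<subseteq> W" by (auto simp: DirK_def)
    note K = Kmaps_one[OF VW]
    have "ft (fsub n V) (fsub n W)"
      by (rule factors_throughI[of "FM n V n W (1\<^sub>m n)"]) (use FM[OF K] fsub[OF VW(1)] fsub[OF VW(2)] fsub_factor[OF VW] in simp_all)
    then show "functor_dir_map C FO FA n V \<sqsubseteq>\<^bsub>Srt (Dir C X) n\<^esub> functor_dir_map C FO FA n W"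
      unfolding functor_dir_map[OF VW(1)] functor_dir_map[OF VW(2)]
      using sub_class_self[OF fsub_mono[OF VW(1)]] sub_class_self[OF fsub_mono[OF VW(2)]] by (auto simp: Sub_def)
  qed
  fix g :: "'k mat" and V assume g: "g \<in> GL n" and "V \<in> carrier (Srt (DirK \<iota>) n)"
  then have V: "Ksubspace n V" by (simp add: DirK_def)
  then show "functor_dir_map C FO FA n (Act (DirK \<iota>) n g V) = Act (Dir C X) n g (functor_dir_map C FO FA n V)"
    using functor_dir_map_Act[OF assms g V] by (simp add: DirK_def)
next
  fix n m :: nat and V W assume "V \<in> carrier (Srt (DirK \<iota>) n)" "W \<in> carrier (Srt (DirK \<iota>) m)"
  then have "Ksubspace n V" "Ksubspace m W" by (simp_all add: DirK_def)
  from functor_dir_map_Dsum[OF this]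
  show "functor_dir_map C FO FA (n + m) (Dsum (DirK \<iota>) n m V W) =
     Dsum (Dir C X) n m (functor_dir_map C FO FA n V) (functor_dir_map C FO FA m W)" by (simp add: DirK_def)
qed

end

section \<open>Semisimplicity of the flattening and lengths of images\<close>

context abelian_category
begin

lemma epi_of_comp:
  assumes e: "epi (u \<cdot> w)" and u: "u \<in> Arr C" and w: "w \<in> Arr C" "Cod C w = Dom C u"
  shows "epi u"
proof (rule epiI[OF u])
  fix f assume f: "f \<in> Arr C" "Dom C f = Cod C u" "f \<cdot> u = zr (Dom C u) (Cod C f)"
  have "f \<cdot> (u \<cdot> w) = zr (Dom C u) (Cod C f) \<cdot> w" by (rule cmp_reduce[OF f(3)]) (use f u w in simp_all)
  then have "f \<cdot> (u \<cdot> w) = zr (Dom C f) (Cod C f) \<cdot> (u \<cdot> w)" using f u w by simp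
  then show "f = zr (Dom C f) (Cod C f)" using epi_cancel[OF e, of f "zr (Dom C f) (Cod C f)"] f u w by simp
qed

lemma pow_arr_inj:
  assumes f: "f \<in> Arr C" and l: "l < n"
  shows "pow_arr C f n \<cdot> pow_inj C (Dom C f) n l = pow_inj C (Cod C f) n l \<cdot> f"
proof (rule pow_ext[OF Cod_in[OF f], where n = n])
  note bX = biproductD[OF pow_biproduct[OF Dom_in[OF f], of n]] and bY = biproductD[OF pow_biproduct[OF Cod_in[OF f], of n]]
  note a = pow_arr(1-3)[OF f, of n]
  fix i assume i: "i < n"
  have "pow_proj C (Cod C f) n i \<cdot> (pow_arr C f n \<cdot> pow_inj C (Dom C f) n l) = f \<cdot> (pow_proj C (Dom C f) n i \<cdot> pow_inj C (Dom C f) n l)"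
    by (rule pow_arr_comp[OF f bX(3,5)[OF l] i])
  also have "\<dots> = pow_proj C (Cod C f) n i \<cdot> (pow_inj C (Cod C f) n l \<cdot> f)"
  proof (cases "i = l")
    case True
    have "pow_proj C (Cod C f) n l \<cdot> (pow_inj C (Cod C f) n l \<cdot> f) = Ide C (Cod C f) \<cdot> f"
      by (rule cmp_reduce[OF bY(9)[OF l]]) (use bY(3-8)[OF l] f in simp_all)
    then show ?thesis using True bX(9)[OF l] f by simp
  next
    case False
    have "pow_proj C (Cod C f) n i \<cdot> (pow_inj C (Cod C f) n l \<cdot> f) = zr (Cod C f) (Cod C f) \<cdot> f"
      by (rule cmp_reduce[OF bY(10)[OF i l False]]) (use bY(3-8)[OF l] bY(3-8)[OF i] f in simp_all)
    then show ?thesis using bX(10)[OF i l False] f by simp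
  qed
  finally show "pow_proj C (Cod C f) n i \<cdot> (pow_arr C f n \<cdot> pow_inj C (Dom C f) n l) =
    pow_proj C (Cod C f) n i \<cdot> (pow_inj C (Cod C f) n l \<cdot> f)" .
qed (use pow_arr(1-3)[OF f, of n] f l in simp_all)

text \<open>Equality of maps out of a power can be tested on the coordinate inclusions, where the
  power of \<open>q\<close> acts as \<open>q\<close>.\<close>

lemma pow_arr_epi:
  assumes q: "epi q"
  shows "epi (pow_arr C q n)"
proof (rule epiI)
  have f: "q \<in> Arr C" using q by simp
  note a = pow_arr(1-3)[OF f, of n] and bY = biproductD[OF pow_biproduct[OF Cod_in[OF f], of n]]
    and bX = biproductD[OF pow_biproduct[OF Dom_in[OF f], of n]]
  show "pow_arr C q n \<in> Arr C" by (rule a(1))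
  fix g assume g: "g \<in> Arr C" "Dom C g = Cod C (pow_arr C q n)" "g \<cdot> pow_arr C q n = zr (Dom C (pow_arr C q n)) (Cod C g)"
  show "g = zr (Dom C g) (Cod C g)"
  proof (rule biproduct_ext'[OF pow_biproduct[OF Cod_in[OF f], of n]])
    fix l assume l: "l < n"
    have "(g \<cdot> pow_inj C (Cod C q) n l) \<cdot> q = g \<cdot> (pow_arr C q n \<cdot> pow_inj C (Dom C q) n l)"
      unfolding pow_arr_inj[OF f l] by (rule cmp_assoc) (use g a bY(3-5)[OF l] f in simp_all)
    also have "\<dots> = zr (Dom C (pow_arr C q n)) (Cod C g) \<cdot> pow_inj C (Dom C q) n l"
      by (rule cmp_reduce[OF g(3)]) (use g a bX(3-5)[OF l] in simp_all)
    also have "\<dots> = zr (Cod C q) (Cod C g) \<cdot> q" using g a bX(3-5)[OF l] f by simp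
    finally have "g \<cdot> pow_inj C (Cod C q) n l = zr (Cod C q) (Cod C g)"
      using epi_cancel[OF q, of "g \<cdot> pow_inj C (Cod C q) n l" "zr (Cod C q) (Cod C g)"] g a bY(3-5)[OF l] f by simp
    then show "g \<cdot> pow_inj C (Cod C q) n l = zr (Dom C g) (Cod C g) \<cdot> pow_inj C (Cod C q) n l"
      using g a bY(3-5)[OF l] by simp
  qed (use g a f in simp_all)
qed

text \<open>Sort 1 of a directory is the subobject lattice of a chosen first power, which is
  isomorphic to \<open>B\<close> but need not be equal to it; hence the detour through
  \<open>Sub_iso\<close>. A maximal independent list then produces as many independent subobjects of
  \<open>B\<close> as its length allows.\<close>

lemma semisimple_of_flat_iso:
  assumes B: "B \<in> Obj C" and L: "modular_lattice L" and h: "poset_iso (flat_lattice L) (Sub C (pow_obj C B 1)) h"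
    and as: "indep_list L \<bottom>\<^bsub>L\<^esub> as" and max: "\<And>bs. indep_list L \<bottom>\<^bsub>L\<^esub> bs \<Longrightarrow> length bs \<le> length as"
  shows "semisimple_obj C B" "obj_length C B = enat (length as)"
proof -
  interpret L: modular_lattice L by (rule L)
  note b = biproductD[OF pow_biproduct[OF B, of 1]]
  have "pow_inj C B 1 0 \<cdot> pow_proj C B 1 0 = Ide C (pow_obj C B 1)"
    using b(11) hsum_single[of "{..<1}" 0 "\<lambda>i. pow_inj C B 1 i \<cdot> pow_proj C B 1 i" "pow_obj C B 1" "pow_obj C B 1"] b(3-8)[of 0] by simp
  then have "poset_iso (Sub C (pow_obj C B 1)) (Sub C B) (dimg (pow_proj C B 1 0))"
    by (intro Sub_iso[of _ _ _ "pow_inj C B 1 0"]) (use b(3-9)[of 0] in simp_all)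
  with h have h': "poset_iso (flat_lattice L) (Sub C B) (dimg (pow_proj C B 1 0) \<circ> h)" by (rule poset_iso_comp)
  let ?h = "dimg (pow_proj C B 1 0) \<circ> h"
  show len: "obj_length C B = enat (length as)"
    unfolding obj_length_def using poset_iso_length[OF h'] L.flat_length[OF as max] by simp
  have qa: "set as \<subseteq> quasi_atoms L"
    by (rule L.maximal_ind_quasi_atoms[OF as L.top_higher L.top_closed]) (use as max in auto)
  have "indep_list (Sub C B) \<bottom>\<^bsub>Sub C B\<^esub> (map (\<lambda>q. ?h (flat_V L q)) as)"
    using flat_ind_image[OF L modular_lattice_Sub[OF B] h' as qa] by blast
  then show "semisimple_obj C B" by (rule semisimple_of_ind[OF B len[unfolded obj_length_def]]) simp
qed

end

context functor_from_vect
begin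

text \<open>The number \<open>d\<close> enters twice: as a bound on all cubes in \<open>X\<close>,
  which passes to powers and quotients, and as a number of independent elements in the quotient. The
  first bounds the length from above, the second from below.\<close>

lemma pushforward_length:
  assumes q: "epi q" "Dom C q = X" and cb: "cube_bound X d"
    and as: "indep_list (Sub C (Cod C q)) \<bottom>\<^bsub>Sub C (Cod C q)\<^esub> as" "length as = d" and V: "Ksubspace n V"
  shows "elt_length (flat_lattice (Sub C (pow_obj C (Cod C q) n)))
    (flat_V (Sub C (pow_obj C (Cod C q) n)) (dimg (pow_arr C q n) (sub_class C (fsub n V)))) =
    enat (d * vectorspace.dim class_ring (Ksub n V))"
proof -
  have qA: "q \<in> Arr C" using q by simp
  define k where "k = vectorspace.dim class_ring (Ksub n V)"
  obtain P Q where PQ: "inverse_mats n P Q" and k: "k \<le> n" and Ve: "V = coord_space n Q {0..<k}"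
    using Ksubspace_coord[OF V] unfolding k_def by metis
  have Ve0: "V = coord_space n Q {0..<0 + k}" using Ve by simp
  define V' where "V' = coord_space n Q {k..<n}"
  have Ve1: "V' = coord_space n Q {k..<k + (n - k)}" using k by (simp add: V'_def)
  have V': "Ksubspace n V'" unfolding V'_def by (rule Ksubspace_coord_space[OF inverse_matsD(2)[OF PQ]])
  have ST: "{0..<k} \<union> {k..<n} = {..<n}" "{0..<k} \<inter> {k..<n} = {}" using k by auto
  obtain r r' where r: "r \<in> Hom C (FS n (carrier_vec n)) (FS n V)" "r' \<in> Hom C (FS n (carrier_vec n)) (FS n V')"
    and rr: "incl n V \<cdot> r \<boxplus> incl n V' \<cdot> r' = Ide C (FS n (carrier_vec n))"
    using incl_split[OF PQ ST] unfolding Ve V'_def by metis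
  have cV: "cube_bound (FS n V) (k * d)"
    by (rule cube_bound_biproduct[OF cb FS_biproduct[OF PQ _ Ve0]]) (use k in simp)
  have cV': "cube_bound (FS n V') ((n - k) * d)"
    by (rule cube_bound_biproduct[OF cb FS_biproduct[OF PQ _ Ve1]]) (use k in simp)
  let ?Y = "Cod C q" and ?e = "pow_arr C q n"
  have Y: "?Y \<in> Obj C" using qA by simp
  note e = pow_arr(1-3)[OF qA, of n, unfolded q(2)] and f = fsub[OF V] and f' = fsub[OF V'] and t = functor_pow_iso(1-3)[where n = n]
    and i = incl[OF V] and i' = incl[OF V']
  have PY: "pow_obj C ?Y n \<in> Obj C" using Y by simp
  interpret L: modular_lattice "Sub C (pow_obj C ?Y n)" by (rule modular_lattice_Sub[OF PY])
  let ?L = "Sub C (pow_obj C ?Y n)"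
  define y where "y = dimg ?e (sub_class C (fsub n V))"
  have U: "sub_class C (fsub n V) \<in> carrier (Sub C (Dom C ?e))" using sub_class_Sub[OF fsub_mono[OF V]] f(3) e by simp
  have y: "y \<in> carrier ?L" unfolding y_def using dimg_Sub[OF e(1) U] e by simp
  have gU: "a \<in> gel (sub_class C (fsub n V)) \<longleftrightarrow> ft a (fsub n V)" for a using gel_sub_class[OF fsub_mono[OF V]] by simp
  obtain m where m: "mono m" "m \<in> Arr C" "Cod C m = pow_obj C ?Y n" "\<And>a. a \<in> gel y \<longleftrightarrow> ft a m" using SubE[OF y] by metis
  have "ft (?e \<cdot> fsub n V) m"
    using gel_dimg_comp[OF e(1) U, of "fsub n V"] gU ft_refl[of "fsub n V"] f(1) m(4) unfolding y_def by simp
  then obtain u where u: "u \<in> Arr C" "Dom C u = FS n V" "Cod C u = Dom C m" "m \<cdot> u = ?e \<cdot> fsub n V"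
    using f(1-3) e by (auto elim!: factors_throughE)
  have "m \<in> gel (dimg ?e (sub_class C (fsub n V)))" using m(4)[of m] ft_refl[of m] m(2) unfolding y_def by simp
  then obtain e0 a where e0: "epi e0" "e0 \<in> Arr C" "Cod C e0 = Dom C m" "a \<in> gel (sub_class C (fsub n V))" "a \<in> Arr C" "Dom C a = Dom C e0"
    "m \<cdot> e0 = ?e \<cdot> a" using gel_dimgE[OF e(1) U] by metis
  obtain w where w: "w \<in> Arr C" "Dom C w = Dom C a" "Cod C w = FS n V" "fsub n V \<cdot> w = a"
    using e0(4) gU f(2) by (auto elim!: factors_throughE)
  \<comment> \<open>The cover \<open>e0\<close> factors through \<open>u\<close>, so
    \<open>u\<close> is epi and the source of \<open>m\<close> is a quotient of
    \<open>F(V)\<close>.\<close>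
  have "m \<cdot> (u \<cdot> w) = (?e \<cdot> fsub n V) \<cdot> w" by (rule cmp_reduce[OF u(4)]) (use u w m in simp_all)
  also have "\<dots> = m \<cdot> e0" unfolding e0(7) w(4)[symmetric] by (rule cmp_assoc) (use e f w in simp_all)
  finally have "u \<cdot> w = e0" using mono_cancel[OF m(1), of "u \<cdot> w" e0] u w e0 by simp
  then have ue: "epi u" using epi_of_comp[of u w] e0(1) u w by simp
  have cm: "cube_bound (Dom C m) (k * d)" using cube_bound_epi[OF ue] u cV by simp
  have upper: "length bs \<le> k * d" if bs: "indep_list ?L \<bottom>\<^bsub>?L\<^esub> bs" "list_join ?L \<bottom>\<^bsub>?L\<^esub> bs \<sqsubseteq>\<^bsub>?L\<^esub> y" for bs
  proof -
    have "gel (list_join ?L \<bottom>\<^bsub>?L\<^esub> bs) \<subseteq> {a. ft a m}"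
      using bs(2) Sub_le[OF L.ind_jn_closed[OF bs(1)] y] m(4) by auto
    then show ?thesis using cube_bound_ind_mono[OF m(1) cm] bs(1) m(3) by simp
  qed
  obtain c where c: "is_cokernel C c m" using has_cokernels[OF m(2)] by blast
  note cD = cokernelD[OF c]
  have cA: "c \<in> Arr C" and cDom: "Dom C c = pow_obj C ?Y n" using cD m by simp_all
  \<comment> \<open>The quotient by \<open>y\<close> is covered by \<open>F(K^n)\<close>. The
    summand \<open>F(V)\<close> dies in it by the choice of \<open>c\<close>, so this cover factors
    through \<open>r'\<close> and already \<open>F(V')\<close> maps onto the quotient.\<close>
  have "epi (c \<cdot> (?e \<cdot> \<theta> n))"
  proof (intro epi_comp cD(2) pow_arr_epi q(1))
    obtain \<psi> where "inverse_arrs (\<theta> n) \<psi>" using functor_pow_iso_inverse .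
    then show "epi (\<theta> n)" by (rule inverse_arrs_epi)
  qed (use e t cDom in simp_all)
  moreover have "c \<cdot> (?e \<cdot> \<theta> n) = (c \<cdot> (?e \<cdot> fsub n V')) \<cdot> r'"
  proof -
    have z: "c \<cdot> (?e \<cdot> fsub n V) = zr (FS n V) (Cod C c)"
      unfolding u(4)[symmetric] using cmp_reduce[OF cD(4), of u] cA cDom m u by simp
    have A: "c \<cdot> (?e \<cdot> (\<theta> n \<cdot> (incl n V \<cdot> r))) = zr (FS n (carrier_vec n)) (Cod C c)"
    proof -
      have "c \<cdot> (?e \<cdot> (\<theta> n \<cdot> (incl n V \<cdot> r))) = (c \<cdot> (?e \<cdot> fsub n V)) \<cdot> r"
        unfolding fsub_def using cA cDom e t i r by (simp add: cmp_assoc)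
      then show ?thesis unfolding z using r cA V by simp
    qed
    have B: "c \<cdot> (?e \<cdot> (\<theta> n \<cdot> (incl n V' \<cdot> r'))) = (c \<cdot> (?e \<cdot> fsub n V')) \<cdot> r'"
      unfolding fsub_def using cA cDom e t i' r by (simp add: cmp_assoc)
    have "c \<cdot> (?e \<cdot> \<theta> n) = c \<cdot> (?e \<cdot> (\<theta> n \<cdot> (incl n V \<cdot> r \<boxplus> incl n V' \<cdot> r')))" unfolding rr using t by simp
    also have "\<dots> = c \<cdot> (?e \<cdot> (\<theta> n \<cdot> (incl n V \<cdot> r))) \<boxplus> c \<cdot> (?e \<cdot> (\<theta> n \<cdot> (incl n V' \<cdot> r')))"
      using cA cDom e t i i' r by simp
    also have "\<dots> = (c \<cdot> (?e \<cdot> fsub n V')) \<cdot> r'" unfolding A B using cA cDom e f' r by simp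
    finally show ?thesis .
  qed
  ultimately have "epi (c \<cdot> (?e \<cdot> fsub n V'))"
    using epi_of_comp[of "c \<cdot> (?e \<cdot> fsub n V')" r'] cA cDom e f' r by simp
  from cube_bound_epi[OF this] have cc: "cube_bound (Cod C c) ((n - k) * d)" using cV' cA cDom e f' by simp
  obtain bs where bs: "indep_list ?L \<bottom>\<^bsub>?L\<^esub> bs" "length bs = n * d"
    using biproduct_ind[OF pow_biproduct[OF Y, of n] as(1) Y] as(2) by metis
  obtain g where g: "strict_cube ?L (n * d) g" "g {} = \<bottom>\<^bsub>?L\<^esub>" using L.ind_cube[OF bs(1)] bs(2) by metis
  \<comment> \<open>In an abelian category the mono \<open>m\<close> contains the kernel of its
    cokernel \<open>c\<close>, as \<open>cube_exact_split\<close> requires.\<close>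
  have ker: "h \<in> gel y" if h: "h \<in> Arr C" "Cod C h = Dom C c" "c \<cdot> h = zr (Dom C h) (Cod C c)" for h
    unfolding m(4)
  proof (rule mono_factor[OF m(1) h(1)])
    fix p assume p: "p \<in> Arr C" "Dom C p = Cod C m" "p \<cdot> m = zr (Dom C m) (Cod C p)"
    obtain v where v: "v \<in> Hom C (Cod C c) (Cod C p)" "v \<cdot> c = p" using cD(5)[OF p] by blast
    have "p \<cdot> h = v \<cdot> (c \<cdot> h)" unfolding v(2)[symmetric] by (rule cmp_assoc) (use v cA h in simp_all)
    then show "p \<cdot> h = zr (Dom C h) (Cod C p)" unfolding h(3) using v h by simp
  qed (use h cD m in simp)
  obtain cs where cs: "indep_list ?L (g {} \<sqinter>\<^bsub>?L\<^esub> y) cs" "list_join ?L (g {} \<sqinter>\<^bsub>?L\<^esub> y) cs \<sqsubseteq>\<^bsub>?L\<^esub> y" "n * d \<le> length cs + (n - k) * d"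
    by (rule cube_exact_split[OF cA _ _ cc, unfolded cDom, OF y _ g(1)])
      (rule ker, assumption, simp add: cDom, assumption, rule that, assumption+)
  have "g {} \<sqinter>\<^bsub>?L\<^esub> y = \<bottom>\<^bsub>?L\<^esub>" using g(2) y by simp
  with cs have cs': "indep_list ?L \<bottom>\<^bsub>?L\<^esub> cs" "list_join ?L \<bottom>\<^bsub>?L\<^esub> cs \<sqsubseteq>\<^bsub>?L\<^esub> y" by simp_all
  \<comment> \<open>The split leaves at least \<open>k * d\<close> independent elements below
    \<open>y\<close>, and \<open>upper\<close> allows no more.\<close>
  have "n * d = k * d + (n - k) * d" using k by (metis add_mult_distrib le_add_diff_inverse)
  then have "length cs = k * d" using cs(3) upper[OF cs'] by simp
  from L.flat_elt_length[OF y cs' this upper] show ?thesis unfolding y_def k_def by (simp add: mult.commute)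
qed

end

text \<open>The flattening enters as any directory \<open>D\<close> with a flattening map
  \<open>\<phi>\<close>, in accordance with its uniqueness up to isomorphism. The types
  \<open>'p\<close> and \<open>'q\<close> belong to a category realising \<open>D\<close>, which may
  differ from \<open>C\<close>.\<close>

theorem theorem8p5:
  fixes \<iota> :: "'k::field \<Rightarrow> 'K::field"
    and C :: "('o, 'm, 'k) lincat"
    and FO :: "'K vspace \<Rightarrow> 'o" and FA :: "'K vmap \<Rightarrow> 'm"
    and d :: nat and A :: "'m set"
    and D :: "('s, 'k) dir" and \<phi> :: "nat \<Rightarrow> 'm set \<Rightarrow> 's"
  assumes "infinite (UNIV :: 'k set)"
    and "field_hom \<iota>"
    and "abelian_category C"
    and "linear_functor (KVectf \<iota>) C FO FA"
    and "\<not> zero_obj C (FO (Kn 1))"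
    and "cube_bounded C (FO (Kn 1))"
    and "enat d = rk0 (Sub C (FO (Kn 1)))"
    and "pedestal C (FO (Kn 1)) A"
    and "directory TYPE('p \<times> 'q) D"
    and "dir_flattening (Dir C (quot_obj C A)) D \<phi>"
  shows "inflator TYPE('p \<times> 'q) \<iota> d D
    (dir_comp \<phi> (dir_comp (pushforward C (quot_map C A)) (functor_dir_map C FO FA)))"
proof -
  interpret abelian_category C by fact
  interpret linear_functor "KVectf \<iota>" C FO FA by fact
  interpret functor_from_vect \<iota> C FO FA by unfold_locales
  note [simp] = FO_Kn
  let ?q = "quot_map C A" and ?Y = "quot_obj C A"
  have A: "A \<in> carrier (Sub C X)" and rk: "rk_bot (Sub C ?Y) = enat d"
    using assms(7,8) by (simp_all add: pedestal_def)
  have cb: "cube_bound X d" using assms(7) by (intro cube_bound_rk0) simp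
  obtain a where a: "a \<in> A" "a \<in> Arr C" using SubE[OF A] by metis
  have "\<exists>q. \<exists>a\<in>A. is_cokernel C q a" using has_cokernels[OF a(2)] a(1) by blast
  then have "\<exists>a\<in>A. is_cokernel C ?q a" unfolding quot_map_def by (rule someI_ex)
  then obtain b where b: "b \<in> A" "is_cokernel C ?q b" by blast
  have q: "epi ?q" "Dom C ?q = X" "Cod C ?q = ?Y" and qA: "?q \<in> Arr C"
    using cokernelD[OF b(2)] Sub_mem[OF A b(1)] by (simp_all add: quot_obj_def)
  have Y: "?Y \<in> Obj C" using q(3) qA by (metis Cod_in)
  interpret LY: modular_lattice "Sub C ?Y" by (rule modular_lattice_Sub[OF Y])
  obtain as where as: "indep_list (Sub C ?Y) \<bottom>\<^bsub>Sub C ?Y\<^esub> as" "length as = d"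
    using LY.rk_bot_attained[OF rk] by metis
  have \<phi>: "dir_morphism (Dir C ?Y) D \<phi>" and fl: "flattening_map (Sub C (pow_obj C ?Y n)) (Srt D n) (\<phi> n)" if "n \<ge> 1" for n
    using assms(10) that unfolding dir_flattening_def by auto
  have "dir_morphism (Dir C X) (Dir C ?Y) (pushforward C ?q)" using pushforward_morphism[OF qA] unfolding q .
  then have mor: "dir_morphism (DirK \<iota>) D (dir_comp \<phi> (dir_comp (pushforward C ?q) (functor_dir_map C FO FA)))"
    using dir_morphism_comp[OF dir_morphism_comp[OF functor_dir_map_morphism[OF assms(2)]] \<phi>[OF order.refl]] by blast
  have len: "elt_length (Srt D n) (dir_comp \<phi> (dir_comp (pushforward C ?q) (functor_dir_map C FO FA)) n V) =
      enat (d * vectorspace.dim class_ring (Ksub n V))" if n: "n \<ge> 1" and V: "Ksubspace n V" for n V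
  proof -
    let ?y = "dimg (pow_arr C ?q n) (sub_class C (fsub n V))" and ?L = "Sub C (pow_obj C ?Y n)"
    have e: "pow_arr C ?q n \<in> Arr C" "Dom C (pow_arr C ?q n) = pow_obj C X n" "Cod C (pow_arr C ?q n) = pow_obj C ?Y n"
      using pow_arr(1-3)[OF qA, of n] unfolding q .
    have y: "?y \<in> carrier ?L"
      using dimg_Sub[OF e(1)] sub_class_Sub[OF fsub_mono[OF V]] fsub(3)[OF V] e by simp
    obtain g where g: "poset_iso (flat_lattice ?L) (Srt D n) g" "\<And>x. x \<in> carrier ?L \<Longrightarrow> \<phi> n x = g (flat_V ?L x)"
      using fl[OF n] unfolding flattening_map_def by blast
    interpret Ln: modular_lattice ?L by (rule modular_lattice_Sub) (use Y in simp)
    have "dir_comp \<phi> (dir_comp (pushforward C ?q) (functor_dir_map C FO FA)) n V = g (flat_V ?L ?y)"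
      using g(2)[OF y] by (simp add: dir_comp_def pushforward_dimg functor_dir_map[OF V])
    then show ?thesis
      using poset_iso_elt_length[OF g(1) Ln.flat_V_closed[OF y]] pushforward_length[OF q(1,2) cb _ as(2) V, unfolded q(3), OF as(1)] by simp
  qed
  \<comment> \<open>Some object \<open>B\<close> of some category realises \<open>D\<close>. In sort
    1 its subobject lattice is isomorphic to the flattening for the first power of the quotient,
    where the longest independent lists have length \<open>d\<close>.\<close>
  have "semisimple_directory TYPE('p \<times> 'q) d D"
  proof -
    obtain C' :: "('p, 'q, 'k) lincat" and B f where D: "abelian_category C'" "B \<in> Obj C'" "dir_iso D (Dir C' B) f"
      using assms(9) unfolding directory_def by blast
    let ?L = "Sub C (pow_obj C ?Y 1)"
    obtain g where g: "poset_iso (flat_lattice ?L) (Srt D 1) g" using fl[of 1] unfolding flattening_map_def by blast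
    have "poset_iso (Srt D 1) (Sub C' (pow_obj C' B 1)) (f 1)" using D(3) by (simp add: dir_iso_def Dir_def)
    with g have h: "poset_iso (flat_lattice ?L) (Sub C' (pow_obj C' B 1)) (f 1 \<circ> g)" by (rule poset_iso_comp)
    have P: "pow_obj C ?Y 1 \<in> Obj C" using Y by simp
    have cY: "cube_bound (pow_obj C ?Y 1) d"
      using cube_bound_biproduct[OF _ pow_biproduct[OF Y, of 1], of d] cube_bound_epi[OF q(1)] cb unfolding q by simp
    obtain bs where bs: "indep_list ?L \<bottom>\<^bsub>?L\<^esub> bs" "length bs = d"
      using biproduct_ind[OF pow_biproduct[OF Y, of 1] as(1) Y] as(2) by auto
    note s = abelian_category.semisimple_of_flat_iso[OF D(1,2) modular_lattice_Sub[OF P] h bs(1), unfolded bs(2)]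
    have "semisimple_obj C' B" by (rule s(1)) (rule cube_bound_ind[OF cY P])
    moreover have "obj_length C' B = enat d" by (rule s(2)) (rule cube_bound_ind[OF cY P])
    ultimately show ?thesis unfolding semisimple_directory_def using D by blast
  qed
  then show ?thesis unfolding inflator_def using mor len by (simp add: DirK_def)
qed

end
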